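(* Let $\mu$ be a shift-invariant Markov random field on $\mathbb Z^d$ with topological support $X\subseteq A^{\mathbb Z^d}$. Suppose that $\mu$ satisfies exponential strong spatial mixing, and let $v\in C(X)$ be $(d-1)$-regular with $\mathbb E_\mu[v]=0$. Then the series $\sigma_v^2=\sum_{i\in\mathbb Z^d}\mathbb E_\mu[v\,(v\circ T^i)]$ converges and is non-negative. Moreover, if $\sigma_v^2>0$, then, as $n\to\infty$, $$|\Gamma_n|^{-1/2}\sum_{i\in\Gamma_n}v\circ T^i\longrightarrow_d\mathcal N(0,\sigma_v^2)$$ for any Følner sequence $\{\Gamma_n\}_{n\ge1}$ for $\mathbb Z^d$, and $$n^{-d/2}W_n(v)\longrightarrow_w\sigma_vW,$$ where $W$ is a standard Brownian sheet on $[0,1]^d$, $\sigma_v=\sqrt{\sigma_v^2}$, $\longrightarrow_d$ is convergence in distribution, and $\longrightarrow_w$ is weak convergence of probability measures on $\mathcal C([0,1]^d)$ with the supremum norm.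
   Context: $A$ is a finite alphabet, $d$ a positive integer, $A^{\mathbb Z^d}$ carries the prodiscrete topology, and $(T^ix)_j=x_{i+j}$ for $i,j\in\mathbb Z^d$ are the shifts. $C(X)$ is the space of continuous functions $X\to\mathbb R$ and $\mathbb E_\mu$ is expectation with respect to $\mu$. For $k\ge0$, $B_k=[-k,k]^d\cap\mathbb Z^d$. For bounded $v\colon X\to\mathbb R$, $\delta_k(v)=\sup\{|v(x)-v(x')|: x,x'\in X,\ x|_{B_k}=x'|_{B_k}\}$. For $p\ge0$, $v\in C(X)$ is $p$-regular if $\sum_{k=1}^\infty k^p\delta_k(v)<\infty$. For finite $V,W\subseteq\mathbb Z^d$, $\operatorname{dist}(V,W)$ is the graph distance in the canonical Cayley graph of $\mathbb Z^d$ (nearest-neighbour graph), with $\operatorname{dist}(U,\varnothing)=+\infty$; $\partial V$ is the set of points at distance $1$ from $V$. $\mu$ is a Markov random field if, for every finite $V$, conditionally on the configuration on $\partial V$, the configuration on $V$ is independent of the configuration on $\mathbb Z^d\setminus(V\cup\partial V)$. Let $X_{\partial V}=\{x|_{\partial V}:x\in X\}$. For $\tau\in X_{\partial V}$ and $\eta\in A^V$, $P_V^\tau(\eta)=\mu(\{x\in X:x|_V=\eta\}\mid\{x\in X:x|_{\partial V}=\tau\})$; for $U\subseteq V$, $P^\tau_{V,U}$ is the marginal of $P_V^\tau$ on $A^U$. For $\tau,\tau'\in X_{\partial V}$ let $\Sigma_V(\tau,\tau')=\{i\in\partial V:\tau_i\ne\tau'_i\}$. $\mu$ satisfies exponential strong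 spatial mixing if there are constants $C,c>0$ such that $$\|P^{\tau}_{V,U}-P^{\tau'}_{V,U}\|_{\rm TV}\le C|U|\exp\big(-c\operatorname{dist}(U,\Sigma_V(\tau,\tau'))\big)$$ for every finite $V\subseteq\mathbb Z^d$, every $U\subseteq V$, and every $\tau,\tau'\in X_{\partial V}$, where $\|\cdot\|_{\rm TV}$ is total variation. A sequence $\{\Gamma_n\}$ of finite subsets of $\mathbb Z^d$ is Følner if $\lim_{n\to\infty}|\Gamma_n\cap(\Gamma_n-j)|/|\Gamma_n|=1$ for each $j\in\mathbb Z^d$. For $t\in[0,1]^d$ let $A_t=\prod_{i=1}^d[0,t_i]$; let $Q_i=(i_1-1,i_1]\times\cdots\times(i_d-1,i_d]$ and let $\lambda$ be Lebesgue measure on $\mathbb R^d$. $W_n(v)=\{W_{n,t}(v)\}_{t\in[0,1]^d}$ is the process on $(X,\mu)$ given by $W_{n,t}(v)=\sum_{i\in\{1,\dots,n\}^d}\lambda(nA_t\cap Q_i)\,(v\circ T^i)$. A standard Brownian sheet is a zero-mean Gaussian random field $W=\{W_t\}_{t\in[0,1]^d}$ with covariance $\mathbb E[W_sW_t]=\prod_{i=1}^d\min(s_i,t_i)$. Both are viewed as random elements of $\mathcal C([0,1]^d)$, the space of continuous functions with the supremum norm. *)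

theory Defs
  imports "HOL-Probability.Probability"
begin

section \<open>Configurations on the lattice\<close>

text \<open>The alphabet is an arbitrary type \<open>'a\<close> of class \<open>finite\<close>; its copy \<open>'a discrete\<close> carries the
  discrete topology, so that the type class topology on configurations is the prodiscrete one.\<close>

type_synonym 'd site = "int ^ 'd"

type_synonym ('d, 'a) config = "'d site \<Rightarrow> 'a discrete"

definition lattice_shift :: "'d::finite site \<Rightarrow> ('d, 'a) config \<Rightarrow> ('d, 'a) config" where
  "lattice_shift i x = (\<lambda>j. x (i + j))"

definition shift_invariant :: "('d::finite, 'a) config measure \<Rightarrow> bool" where
  "shift_invariant \<mu> \<longleftrightarrow> (\<forall>i. distr \<mu> \<mu> (lattice_shift i) = \<mu>)"

definition topological_support :: "'b::topological_space measure \<Rightarrow> 'b set" where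
  "topological_support \<mu> = {x. \<forall>U. open U \<longrightarrow> x \<in> U \<longrightarrow> 0 < emeasure \<mu> U}"

text \<open>Observables are only meaningful on the support \<open>X\<close>; they are random variables on the
  probability space \<open>(X, \<mu>)\<close>.\<close>

definition support_space :: "'b::topological_space measure \<Rightarrow> 'b measure" where
  "support_space \<mu> = restrict_space \<mu> (topological_support \<mu>)"


section \<open>Regularity of observables\<close>

definition centered_box :: "nat \<Rightarrow> 'd::finite site set" where
  "centered_box k = {i. \<forall>m. \<bar>i $ m\<bar> \<le> int k}"

definition oscillation ::
    "('d::finite, 'a) config set \<Rightarrow> (('d, 'a) config \<Rightarrow> real) \<Rightarrow> nat \<Rightarrow> real" where
  "oscillation X v k =
     Sup {\<bar>v x - v x'\<bar> | x x'. x \<in> X \<and> x' \<in> X \<and> (\<forall>i\<in>centered_box k. x i = x' i)}"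

text \<open>The series starts at \<open>k = 1\<close>.\<close>

definition regular_on ::
    "('d::finite, 'a) config set \<Rightarrow> real \<Rightarrow> (('d, 'a) config \<Rightarrow> real) \<Rightarrow> bool" where
  "regular_on X p v \<longleftrightarrow> continuous_on X v \<and>
     summable (\<lambda>k. real (Suc k) powr p * oscillation X v (Suc k))"


section \<open>The nearest-neighbour graph\<close>

definition nn_edges :: "('d::finite site \<times> 'd site) set" where
  "nn_edges = {(i, j). \<exists>k. j - i = axis k 1 \<or> i - j = axis k 1}"

text \<open>The infimum of the empty set is \<open>\<infinity>\<close>, so the distance to the empty set is \<open>\<infinity>\<close>.\<close>

definition graph_dist :: "'d::finite site set \<Rightarrow> 'd site set \<Rightarrow> enat" where
  "graph_dist V W = Inf {enat n | n. \<exists>i\<in>V. \<exists>j\<in>W. (i, j) \<in> nn_edges ^^ n}"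

definition outer_boundary :: "'d::finite site set \<Rightarrow> 'd site set" where
  "outer_boundary V = {j. graph_dist {j} V = 1}"


section \<open>Markov random fields and strong spatial mixing\<close>

text \<open>Partial configurations on \<open>V\<close> are extensional functions, obtained by \<^const>\<open>restrict\<close>.
  Since \<open>outer_boundary V\<close> is finite for finite \<open>V\<close> and the alphabet is finite, conditioning on the
  configuration on the boundary is elementary conditioning on each event of positive probability.\<close>

definition cylinder :: "'d::finite site set \<Rightarrow> ('d, 'a) config \<Rightarrow> ('d, 'a) config set" where
  "cylinder V \<tau> = {x. restrict x V = \<tau>}"

definition markov_random_field :: "('d::finite, 'a::finite) config measure \<Rightarrow> bool" where
  "markov_random_field \<mu> \<longleftrightarrow>
     (\<forall>V \<tau>. finite V \<and> 0 < emeasure \<mu> (cylinder (outer_boundary V) \<tau>) \<longrightarrow>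
        (let W = - (V \<union> outer_boundary V) in
           prob_space.indep_var (uniform_measure \<mu> (cylinder (outer_boundary V) \<tau>))
             (PiM V (\<lambda>_. borel)) (\<lambda>x. restrict x V)
             (PiM W (\<lambda>_. borel)) (\<lambda>x. restrict x W)))"

definition conditional_law ::
    "('d::finite, 'a::finite) config measure \<Rightarrow> 'd site set \<Rightarrow> ('d, 'a) config
       \<Rightarrow> ('d, 'a) config measure" where
  "conditional_law \<mu> V \<tau> =
     point_measure (V \<rightarrow>\<^sub>E UNIV)
       (\<lambda>\<eta>. ennreal (cond_prob (support_space \<mu>) (\<lambda>x. restrict x V = \<eta>)
                                (\<lambda>x. restrict x (outer_boundary V) = \<tau>)))"

definition conditional_marginal ::
    "('d::finite, 'a::finite) config measure \<Rightarrow> 'd site set \<Rightarrow> 'd site set \<Rightarrow> ('d, 'a) config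
       \<Rightarrow> ('d, 'a) config measure" where
  "conditional_marginal \<mu> V U \<tau> =
     distr (conditional_law \<mu> V \<tau>) (count_space (U \<rightarrow>\<^sub>E UNIV)) (\<lambda>\<eta>. restrict \<eta> U)"

definition total_variation :: "'b measure \<Rightarrow> 'b measure \<Rightarrow> real" where
  "total_variation M N = (SUP B\<in>sets M. \<bar>measure M B - measure N B\<bar>)"

fun exp_decay :: "real \<Rightarrow> enat \<Rightarrow> real" where
  "exp_decay c (enat n) = exp (- c * real n)"
| "exp_decay c \<infinity> = 0"

definition exp_strong_spatial_mixing :: "('d::finite, 'a::finite) config measure \<Rightarrow> bool" where
  "exp_strong_spatial_mixing \<mu> \<longleftrightarrow>
     (\<exists>C c. 0 < C \<and> 0 < c \<and>
        (\<forall>V U. finite V \<longrightarrow> U \<subseteq> V \<longrightarrow>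
          (\<forall>\<tau> \<in> (\<lambda>x. restrict x (outer_boundary V)) ` topological_support \<mu>.
           \<forall>\<tau>' \<in> (\<lambda>x. restrict x (outer_boundary V)) ` topological_support \<mu>.
             total_variation (conditional_marginal \<mu> V U \<tau>) (conditional_marginal \<mu> V U \<tau>')
               \<le> C * real (card U) *
                   exp_decay c (graph_dist U {i \<in> outer_boundary V. \<tau> i \<noteq> \<tau>' i}))))"


section \<open>Foelner sequences and the limit variance\<close>

definition folner :: "(nat \<Rightarrow> 'd::finite site set) \<Rightarrow> bool" where
  "folner \<Gamma> \<longleftrightarrow> (\<forall>n. finite (\<Gamma> n)) \<and>
     (\<forall>j. (\<lambda>n. real (card (\<Gamma> n \<inter> (\<lambda>g. g - j) ` \<Gamma> n)) / real (card (\<Gamma> n))) \<longlonglongrightarrow> 1)"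

definition autocovariance ::
    "('d::finite, 'a) config measure \<Rightarrow> (('d, 'a) config \<Rightarrow> real) \<Rightarrow> 'd site \<Rightarrow> real" where
  "autocovariance \<mu> v i = (LINT x|support_space \<mu>. v x * v (lattice_shift i x))"


section \<open>The space of continuous functions on the unit cube\<close>

text \<open>With the unit cube as a metric space in its own right, the library type of bounded
  continuous functions on it is the space of all continuous functions on the (compact) cube
  with the supremum norm.\<close>

typedef (overloaded) ('d::finite) unit_cube = "cbox (0::real^'d) 1"
  morphisms cube_point Cube
  by (rule exI[of _ 0]) (simp add: mem_box_cart)

instantiation unit_cube :: (finite) metric_space
begin

definition dist_unit_cube :: "'a unit_cube \<Rightarrow> 'a unit_cube \<Rightarrow> real" where
  "dist_unit_cube s t = dist (cube_point s) (cube_point t)"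

definition uniformity_unit_cube :: "('a unit_cube \<times> 'a unit_cube) filter" where
  "uniformity_unit_cube = (INF e\<in>{0 <..}. principal {(s, t). dist s t < e})"

definition open_unit_cube :: "'a unit_cube set \<Rightarrow> bool" where
  "open_unit_cube U \<longleftrightarrow> (\<forall>s\<in>U. \<forall>\<^sub>F (s', t) in uniformity. s' = s \<longrightarrow> t \<in> U)"

instance
  by standard
    (auto simp: uniformity_unit_cube_def open_unit_cube_def dist_unit_cube_def
      cube_point_inject dist_triangle2)

end

type_synonym 'd cube_fun = "'d unit_cube \<Rightarrow>\<^sub>C real"

definition weak_conv_law ::
    "(nat \<Rightarrow> 'b::topological_space measure) \<Rightarrow> 'b measure \<Rightarrow> bool" where
  "weak_conv_law P Q \<longleftrightarrow>
     (\<forall>f :: 'b \<Rightarrow> real. continuous_on UNIV f \<longrightarrow> bounded (range f) \<longrightarrow>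
        (\<lambda>n. integral\<^sup>L (P n) f) \<longlonglongrightarrow> integral\<^sup>L Q f)"


section \<open>The partial sum process\<close>

definition lattice_cell :: "'d::finite site \<Rightarrow> (real^'d) set" where
  "lattice_cell i = {y. \<forall>k. of_int (i $ k) - 1 < y $ k \<and> y $ k \<le> of_int (i $ k)}"

definition sum_process ::
    "(('d::finite, 'a) config \<Rightarrow> real) \<Rightarrow> nat \<Rightarrow> real^'d \<Rightarrow> ('d, 'a) config \<Rightarrow> real" where
  "sum_process v n t x =
     (\<Sum>i | \<forall>k. 1 \<le> i $ k \<and> i $ k \<le> int n.
        measure lborel ((\<lambda>y. real n *\<^sub>R y) ` cbox 0 t \<inter> lattice_cell i) * v (lattice_shift i x))"

definition sum_path :: "(('d::finite, 'a) config \<Rightarrow> real) \<Rightarrow> nat \<Rightarrow> ('d, 'a) config \<Rightarrow> 'd cube_fun"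
  where "sum_path v n x = Bcontfun (\<lambda>t. sum_process v n (cube_point t) x)"

text \<open>The paths of the process are continuous, so \<^const>\<open>Bcontfun\<close> is applied within its domain.\<close>

lemma continuous_cube_point [continuous_intros]: "continuous_on S cube_point"
  unfolding continuous_on_iff dist_unit_cube_def by auto

lemma scaled_box_cell:
  fixes t :: "real^'d::finite"
  assumes n: "n > 0" and i: "\<forall>k. 1 \<le> i $ k \<and> i $ k \<le> int n"
  shows "measure lborel ((\<lambda>y. real n *\<^sub>R y) ` cbox 0 t \<inter> lattice_cell i) =
    (\<Prod>k\<in>UNIV. max 0 (min (real n * t $ k) (of_int (i $ k)) - (of_int (i $ k) - 1)))"
proof -
  let ?S = "(\<lambda>y. real n *\<^sub>R y) ` cbox 0 t \<inter> lattice_cell i"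
  define a where "a = (\<chi> k. real_of_int (i $ k) - 1)"
  define b where "b = (\<chi> k. min (real n * t $ k) (real_of_int (i $ k)))"
  have i1: "1 \<le> real_of_int (i $ k)" for k
    using i by simp
  have img: "(\<lambda>y. real n *\<^sub>R y) ` cbox 0 t = {y. \<forall>k. 0 \<le> y $ k \<and> y $ k \<le> real n * t $ k}"
    (is "?L = ?R")
  proof
    show "?L \<subseteq> ?R"
      using n by (auto simp: mem_box_cart)
    show "?R \<subseteq> ?L"
    proof
      fix y assume y: "y \<in> ?R"
      have "y = real n *\<^sub>R ((1 / real n) *\<^sub>R y)"
        using n by simp
      moreover have "(1 / real n) *\<^sub>R y \<in> cbox 0 t"
        using n y by (auto simp: mem_box_cart field_simps)
      ultimately show "y \<in> ?L" by (rule image_eqI)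
    qed
  qed
  have S: "?S = {y. \<forall>k. a $ k < y $ k \<and> y $ k \<le> b $ k}"
  proof -
    have "0 \<le> y $ k" if "real_of_int (i $ k) - 1 < y $ k" for y :: "real^'d" and k
      using that i1[of k] by linarith
    then show ?thesis
      unfolding img lattice_cell_def a_def b_def by auto
  qed
  have meas: "?S \<in> sets lborel"
    unfolding S by measurable
  have sub1: "box a b \<subseteq> ?S" and sub2: "?S \<subseteq> cbox a b"
    unfolding S by (auto simp: mem_box_cart less_imp_le)
  have "measure lborel (box a b) \<le> measure lborel ?S"
  proof (rule measure_mono_fmeasurable[OF sub1])
    show "?S \<in> fmeasurable lborel"
      by (rule fmeasurableI2[OF fmeasurable_cbox sub2 meas])
  qed simp
  moreover have "measure lborel ?S \<le> measure lborel (cbox a b)"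
    by (rule measure_mono_fmeasurable[OF sub2 meas]) (rule fmeasurable_cbox)
  ultimately have "measure lborel ?S = measure lborel (cbox a b)"
    by (simp add: measure_lborel_box_eq measure_lborel_cbox_eq)
  also have "\<dots> = (\<Prod>k\<in>UNIV. max 0 (b $ k - a $ k))"
  proof (cases "\<forall>k. a $ k \<le> b $ k")
    case True
    then have "cbox a b \<noteq> {}" by (simp add: interval_ne_empty_cart)
    then show ?thesis
      using True by (simp add: content_cbox_cart max_absorb2)
  next
    case False
    then obtain k where k: "b $ k < a $ k" by (auto simp: not_le)
    then have e: "cbox a b = {}" by (auto simp: interval_eq_empty_cart)
    have "max 0 (b $ k - a $ k) = 0" using k by simp
    then have "(\<Prod>k\<in>UNIV. max 0 (b $ k - a $ k)) = 0"
      by (intro prod_zero) auto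
    then show ?thesis using e by simp
  qed
  finally show ?thesis by (simp add: a_def b_def)
qed

lemma sum_path_apply:
  "apply_bcontfun (sum_path v n x) t = sum_process v n (cube_point t) x"
proof -
  let ?f = "\<lambda>t. sum_process v n (cube_point t) x"
  have cont: "continuous_on (cbox 0 1) (\<lambda>t. sum_process v n t x)"
  proof (cases "n = 0")
    case True
    have e: "{i :: 'a site. \<forall>k. 1 \<le> i $ k \<and> i $ k \<le> int n} = {}"
      using True by (auto intro!: exI[of _ undefined])
    show ?thesis unfolding sum_process_def e by simp
  next
    case False
    have "sum_process v n t x = (\<Sum>i | \<forall>k. 1 \<le> i $ k \<and> i $ k \<le> int n.
        (\<Prod>k\<in>UNIV. max 0 (min (real n * t $ k) (of_int (i $ k)) - (of_int (i $ k) - 1)))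
          * v (lattice_shift i x))" for t
      unfolding sum_process_def
      by (rule sum.cong) (use False in \<open>auto simp: scaled_box_cell\<close>)
    then show ?thesis
      by (simp only:) (intro continuous_intros)
  qed
  have pt: "range (cube_point :: 'a unit_cube \<Rightarrow> _) \<subseteq> cbox 0 1"
    using cube_point by auto
  have "continuous_on UNIV ?f"
    by (rule continuous_on_compose2[OF cont continuous_cube_point pt])
  moreover have "bounded (range ?f)"
  proof (rule bounded_subset)
    show "bounded ((\<lambda>t. sum_process v n t x) ` cbox 0 1)"
      by (intro compact_imp_bounded compact_continuous_image cont compact_cbox)
    show "range ?f \<subseteq> (\<lambda>t. sum_process v n t x) ` cbox 0 1"
      using pt by auto
  qed
  ultimately show ?thesis
    unfolding sum_path_def by (subst Bcontfun_inverse) (auto simp: bcontfun_def)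
qed


section \<open>The Brownian sheet\<close>

text \<open>Degenerate normal distributions are Gaussian: the sheet vanishes when a coordinate does.\<close>

definition gaussian_rv :: "'w measure \<Rightarrow> ('w \<Rightarrow> real) \<Rightarrow> bool" where
  "gaussian_rv N Y \<longleftrightarrow> Y \<in> borel_measurable N \<and>
     ((\<exists>m. AE \<omega> in N. Y \<omega> = m) \<or>
      (\<exists>m s. 0 < s \<and> distributed N lborel Y (\<lambda>y. ennreal (normal_density m s y))))"

definition gaussian_field :: "'w measure \<Rightarrow> ('t \<Rightarrow> 'w \<Rightarrow> real) \<Rightarrow> bool" where
  "gaussian_field N Y \<longleftrightarrow>
     (\<forall>S a. finite S \<longrightarrow> gaussian_rv N (\<lambda>\<omega>. \<Sum>t\<in>S. a t * Y t \<omega>))"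

definition standard_brownian_sheet :: "'w measure \<Rightarrow> ('w \<Rightarrow> 'd::finite cube_fun) \<Rightarrow> bool" where
  "standard_brownian_sheet N W \<longleftrightarrow>
     prob_space N \<and> W \<in> measurable N borel \<and>
     gaussian_field N (\<lambda>t \<omega>. apply_bcontfun (W \<omega>) t) \<and>
     (\<forall>t. (LINT \<omega>|N. apply_bcontfun (W \<omega>) t) = 0) \<and>
     (\<forall>s t. (LINT \<omega>|N. apply_bcontfun (W \<omega>) s * apply_bcontfun (W \<omega>) t) =
        (\<Prod>k\<in>UNIV. min (cube_point s $ k) (cube_point t $ k)))"

end

theory Submission
  imports Defs
begin

text \<open>Conditionally on the boundary of the \<open>r\<close>-neighbourhood of its sites, a local observable is
  independent of everything outside, and strong spatial mixing makes its conditional mean almost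
  independent of the boundary condition. So its covariance with any function of the far away
  sites, however many, is exponentially small in \<open>r\<close>.
  For a weighted sum of shifts of one local observable, removing the sites nearest to a given site
  one at a time bounds every even moment of order \<open>2 q\<close> by a constant times the \<open>q\<close>-th power of the
  sum of the squared weights; the same bookkeeping shows that the characteristic function
  approximately solves Stein's equation, which gives Gaussian limits. A \<open>(d - 1)\<close>-regular observable
  is a series of local observables of dyadic ranges \<open>2 ^ j\<close> whose norms, multiplied by
  \<open>(2 ^ j) ^ d\<close>, are summable; as the constants above grow like this factor, moment bounds and
  Gaussian limits pass to the series. Convergence of the path process follows from convergence of
  the characteristic functions of its finite-dimensional marginals and a chaining estimate based on
  the moment of order \<open>8 d\<close>.\<close>

section \<open>The sup norm on the lattice\<close>

text \<open>The mixing bound must not see how many sites the second function reads, since weighted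
  sums read all of them. It is therefore stated with the \<open>L1\<close> norm of that function: on
  each boundary event the error is a constant times the mass of \<open>|F|\<close>, and these masses
  add up. The same form closes the moment induction, because the \<open>L1\<close> norm of an
  increment of \<open>s ^ (2 q + 1)\<close> is controlled by moments of order \<open>2 q\<close>.
  The factor \<open>k ^ d\<close> in the constants is the volume of the box in which observables of
  range \<open>k\<close> are too close for anything but the trivial covariance bound; Cauchy
  condensation turns \<open>(d - 1)\<close>-regularity into the matching dyadic summability.
  Nonnegativity of the limit variance is read off from characteristic functions being bounded by
  one. The functional theorem extracts no limit points of laws: a uniform \<open>L1\<close> distance
  between paths and their grid interpolations plays the role of tightness. The base 16 of the grids
  and the order \<open>8 d\<close> are matched so that scale \<open>l\<close> contributes a multiple
  of \<open>2 ^ - l\<close>.\<close>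

definition snorm :: "'d::finite site \<Rightarrow> nat" where
  "snorm i = nat (Max (range (\<lambda>m. \<bar>i $ m\<bar>)))"

lemma snorm_le_iff: "snorm i \<le> n \<longleftrightarrow> (\<forall>m. \<bar>i $ m\<bar> \<le> int n)"
  unfolding snorm_def nat_le_iff by (subst Max_le_iff) auto

lemma snorm_le_centered_box: "snorm i \<le> n \<longleftrightarrow> i \<in> centered_box n"
  by (simp add: snorm_le_iff centered_box_def)

lemma snorm_bound: "\<bar>i $ m\<bar> \<le> int (snorm i)"
  using snorm_le_iff[of i "snorm i"] by auto

lemma snorm_minus [simp]: "snorm (- i) = snorm i"
  by (simp add: snorm_def)

lemma snorm_commute: "snorm (i - j) = snorm (j - i)"
  by (metis minus_diff_eq snorm_minus)

lemma snorm_add: "snorm (i + j) \<le> snorm i + snorm j"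
  unfolding snorm_le_iff
proof
  fix m
  show "\<bar>(i + j) $ m\<bar> \<le> int (snorm i + snorm j)"
    using snorm_bound[of i m] snorm_bound[of j m] by simp
qed

lemma snorm_0 [simp]: "snorm 0 = 0"
  by (metis le_zero_eq snorm_le_iff abs_zero of_nat_0 order_refl zero_index)

lemma snorm_eq_0_iff [simp]: "snorm i = 0 \<longleftrightarrow> i = 0"
  using snorm_le_iff[of i 0] by (auto simp: vec_eq_iff)

lemma snorm_axis [simp]: "snorm (axis m (1::int)) \<le> 1"
  by (simp add: snorm_le_iff axis_def)

text \<open>Sites are vectors, whereas counting and expanding products of sums work over extensional
  functions; through this bijection boxes are counted and sums of coordinatewise products are
  factored.\<close>

lemma bij_betw_vec_lambda_PiE:
  "bij_betw vec_lambda (PiE UNIV J) {i :: 'b ^ 'd::finite. \<forall>m. i $ m \<in> J m}"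
  by (rule bij_betw_byWitness[where f' = vec_nth]) (auto simp: PiE_def extensional_def)

lemma finite_vec_box:
  assumes "\<And>m. finite (J m)"
  shows "finite {i :: 'b ^ 'd::finite. \<forall>m. i $ m \<in> J m}"
  using bij_betw_finite[OF bij_betw_vec_lambda_PiE, of J] finite_PiE[of "UNIV :: 'd set" J] assms
  by simp

lemma card_vec_box: "card {i :: 'b ^ 'd::finite. \<forall>m. i $ m \<in> J m} = (\<Prod>m\<in>UNIV. card (J m))"
  using bij_betw_same_card[OF bij_betw_vec_lambda_PiE, of J] by (simp add: card_PiE)

lemma centered_box_vec_box: "centered_box n = {i. \<forall>m. i $ m \<in> {- int n..int n}}"
  by (auto simp: centered_box_def abs_le_iff minus_le_iff)

lemma finite_centered_box [simp]: "finite (centered_box n)"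
  unfolding centered_box_vec_box by (rule finite_vec_box) auto

lemma card_centered_box: "card (centered_box n :: 'd::finite site set) = (2 * n + 1) ^ CARD('d)"
proof -
  have "nat (2 * int n + 1) = 2 * n + 1" by simp
  then show ?thesis unfolding centered_box_vec_box card_vec_box by simp
qed

lemma nn_edges_snorm: "(i, j) \<in> nn_edges ^^ n \<Longrightarrow> snorm (i - j) \<le> n"
proof (induction n arbitrary: j)
  case (Suc n)
  then obtain l where l: "(i, l) \<in> nn_edges ^^ n" "(l, j) \<in> nn_edges" by auto
  have "snorm (l - j) \<le> 1"
  proof -
    obtain k where "j - l = axis k 1 \<or> l - j = axis k 1" using l(2) by (auto simp: nn_edges_def)
    then have "snorm (l - j) = snorm (axis k (1::int) :: 'a site)"
      using snorm_commute[of l j] by auto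
    then show ?thesis using snorm_axis by metis
  qed
  moreover have "snorm (i - j) \<le> snorm (i - l) + snorm (l - j)"
    using snorm_add[of "i - l" "l - j"] by simp
  ultimately show ?case using Suc.IH[OF l(1)] by linarith
qed auto

text \<open>A path of \<open>n\<close> edges changes each coordinate by at most \<open>n\<close>, so
  separation in the sup norm bounds the graph distance from below. Only this direction is used:
  mixing is applied to sets kept apart in the sup norm. Empty sets are covered by
  \<open>Inf {} = \<infinity>\<close>.\<close>

lemma graph_dist_ge:
  assumes "\<And>i j. i \<in> V \<Longrightarrow> j \<in> W \<Longrightarrow> r \<le> snorm (i - j)"
  shows "enat r \<le> graph_dist V W"
  unfolding graph_dist_def
proof (rule Inf_greatest, clarify)
  fix n i j assume "i \<in> V" "j \<in> W" "(i, j) \<in> nn_edges ^^ n"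
  then show "enat r \<le> enat n"
    using assms[of i j] nn_edges_snorm[of i j n] by simp
qed

lemma exp_decay_le:
  assumes "enat r \<le> D" "0 < c"
  shows "exp_decay c D \<le> exp (- c * real r)"
  using assms by (cases D) auto

lemma outer_boundary_disjoint: "outer_boundary V \<inter> V = {}"
proof -
  have "graph_dist {j} V = 0" if "j \<in> V" for j
  proof -
    have "graph_dist {j} V \<le> enat 0"
      unfolding graph_dist_def using that by (intro Inf_lower) auto
    then show ?thesis by (simp add: zero_enat_def[symmetric])
  qed
  then show ?thesis by (auto simp: outer_boundary_def)
qed

lemma finite_outer_boundary:
  assumes "finite V"
  shows "finite (outer_boundary V)"
proof (rule finite_subset)
  show "outer_boundary V \<subseteq> (\<Union>i\<in>V. (\<lambda>h. h + i) ` centered_box 1)"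
  proof
    fix j assume j: "j \<in> outer_boundary V"
    have "\<exists>i\<in>V. snorm (j - i) \<le> 1"
    proof (rule ccontr)
      assume "\<not> ?thesis"
      then have "enat 2 \<le> graph_dist {j} V"
        by (intro graph_dist_ge) force
      then show False
        using j by (simp add: outer_boundary_def one_enat_def)
    qed
    then show "j \<in> (\<Union>i\<in>V. (\<lambda>h. h + i) ` centered_box 1)"
      unfolding snorm_le_centered_box by (force intro: image_eqI[where x = "j - i" for i])
  qed
qed (use assms in auto)


section \<open>Functions of finitely many coordinates\<close>

definition depends_on :: "(('b \<Rightarrow> 'c) \<Rightarrow> 'e) \<Rightarrow> 'b set \<Rightarrow> bool" where
  "depends_on f U \<longleftrightarrow> (\<forall>x y. (\<forall>i\<in>U. x i = y i) \<longrightarrow> f x = f y)"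

lemma depends_onD: "depends_on f U \<Longrightarrow> (\<And>i. i \<in> U \<Longrightarrow> x i = y i) \<Longrightarrow> f x = f y"
  by (auto simp: depends_on_def)

lemma depends_on_mono: "depends_on f U \<Longrightarrow> U \<subseteq> V \<Longrightarrow> depends_on f V"
  by (auto simp: depends_on_def)

lemma depends_on_restrict: "depends_on f U \<Longrightarrow> U \<subseteq> V \<Longrightarrow> f (restrict x V) = f x"
  by (rule depends_onD) auto

lemma finite_UNIV_discrete [simp]: "finite (UNIV :: 'a::finite discrete set)"
proof -
  have "(UNIV :: 'a discrete set) = range discrete"
    by (metis of_discrete_inverse surjI)
  then show ?thesis by (metis finite finite_imageI)
qed

lemma finite_configurations [simp]:
  "finite U \<Longrightarrow> finite (U \<rightarrow>\<^sub>E (UNIV :: 'a::finite discrete set))"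
  by (intro finite_PiE) auto

lemma finite_range_depends_on:
  fixes f :: "('b \<Rightarrow> 'a::finite discrete) \<Rightarrow> 'e"
  assumes "finite U" "depends_on f U"
  shows "finite (range f)"
proof (rule finite_subset)
  show "range f \<subseteq> f ` (U \<rightarrow>\<^sub>E UNIV)"
  proof clarify
    fix x
    have "f x = f (restrict x U)" using depends_on_restrict[OF assms(2)] by simp
    then show "f x \<in> f ` (U \<rightarrow>\<^sub>E UNIV)" by (auto intro!: image_eqI)
  qed
qed (use assms in auto)

lemma bounded_depends_on:
  fixes f :: "('b \<Rightarrow> 'a::finite discrete) \<Rightarrow> 'e::real_normed_vector"
  assumes "finite U" "depends_on f U"
  obtains B where "\<And>x. norm (f x) \<le> B"
proof -
  have "bounded (range f)" using finite_range_depends_on[OF assms] by (rule finite_imp_bounded)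
  then show ?thesis using that by (auto simp: bounded_iff)
qed

text \<open>The preimage is a finite union of cylinders, one for each pattern on \<open>U\<close>
  with value in \<open>B\<close>. The index set \<open>V\<close> may be infinite, as it is for the
  exterior region in the Markov property.\<close>

lemma measurable_depends_on_PiM:
  fixes f :: "('b \<Rightarrow> 'a::finite discrete) \<Rightarrow> 'e::topological_space"
  assumes U: "finite U" "U \<subseteq> V" and f: "depends_on f U"
  shows "f \<in> borel_measurable (PiM V (\<lambda>_. borel))"
proof (rule measurableI)
  fix B :: "'e set"
  let ?E = "{\<eta> \<in> U \<rightarrow>\<^sub>E UNIV. f \<eta> \<in> B}"
  have "f -` B \<inter> space (PiM V (\<lambda>_. borel)) =
      (\<Union>\<eta>\<in>?E. {y \<in> space (PiM V (\<lambda>_. borel)). \<forall>i\<in>U. y i \<in> {\<eta> i}})" (is "?L = ?R")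
  proof
    show "?L \<subseteq> ?R"
    proof
      fix y assume y: "y \<in> ?L"
      then have "restrict y U \<in> ?E"
        using depends_on_restrict[OF f, of U y] by auto
      then show "y \<in> ?R" using y by (intro UN_I[of "restrict y U"]) auto
    qed
    show "?R \<subseteq> ?L"
      using depends_onD[OF f] by (fastforce simp: space_PiM)
  qed
  moreover have "{y \<in> space (PiM V (\<lambda>_. borel)). \<forall>i\<in>U. y i \<in> {\<eta> i}}
      \<in> sets (PiM V (\<lambda>_. borel))" for \<eta> :: "'b \<Rightarrow> 'a discrete"
  proof (intro sets.sets_Collect_finite_All U)
    fix i assume "i \<in> U"
    then have m: "(\<lambda>y. y i) \<in> measurable (PiM V (\<lambda>_. borel)) (borel :: 'a discrete measure)"
      using U by (intro measurable_component_singleton) auto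
    show "{y \<in> space (PiM V (\<lambda>_. borel)). y i \<in> {\<eta> i}} \<in> sets (PiM V (\<lambda>_. borel))"
      by (rule measurable_sets_Collect[OF m]) auto
  qed
  moreover have "finite ?E" using U by auto
  ultimately show "f -` B \<inter> space (PiM V (\<lambda>_. borel)) \<in> sets (PiM V (\<lambda>_. borel))"
    by auto
qed auto

lemma measurable_depends_on:
  fixes f :: "('d::finite, 'a::finite) config \<Rightarrow> 'e::topological_space"
  assumes "finite U" "depends_on f U" "sets \<mu> = sets borel"
  shows "f \<in> borel_measurable \<mu>"
proof -
  have "sets \<mu> = sets (PiM UNIV (\<lambda>_. borel :: 'a discrete measure))"
    using assms(3) sets_PiM_equal_borel by metis
  then have "measurable \<mu> (borel :: 'e measure) =
      measurable (PiM UNIV (\<lambda>_. borel :: 'a discrete measure)) borel"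
    by (rule measurable_cong_sets) simp
  then show ?thesis
    using measurable_depends_on_PiM[OF assms(1) _ assms(2), of UNIV] by simp
qed

lemma sum_cylinder_indicator:
  fixes x :: "('d::finite, 'a::finite) config"
  assumes "finite D"
  shows "(\<Sum>\<tau>\<in>D \<rightarrow>\<^sub>E UNIV. indicator (cylinder D \<tau>) x :: real) = 1"
proof -
  have "(\<Sum>\<tau>\<in>D \<rightarrow>\<^sub>E UNIV. indicator (cylinder D \<tau>) x :: real) =
      (\<Sum>\<tau>\<in>D \<rightarrow>\<^sub>E UNIV. if \<tau> = restrict x D then 1 else 0)"
    by (intro sum.cong) (auto simp: cylinder_def indicator_def)
  also have "\<dots> = 1"
    using assms by (simp add: sum.delta)
  finally show ?thesis .
qed

text \<open>The extensional function \<open>\<eta>\<close> is itself a configuration, with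
  \<open>undefined\<close> off \<open>U\<close>; hence \<open>f \<eta>\<close> makes sense and
  equals \<open>f x\<close> on its cylinder.\<close>

lemma depends_on_sum_cylinder:
  fixes f :: "('d::finite, 'a::finite) config \<Rightarrow> real"
  assumes "finite U" "depends_on f U"
  shows "f x = (\<Sum>\<eta>\<in>U \<rightarrow>\<^sub>E UNIV. f \<eta> * indicator (cylinder U \<eta>) x)"
proof -
  have "(\<Sum>\<eta>\<in>U \<rightarrow>\<^sub>E UNIV. f \<eta> * indicator (cylinder U \<eta>) x) =
      (\<Sum>\<eta>\<in>U \<rightarrow>\<^sub>E UNIV. f x * indicator (cylinder U \<eta>) x)"
    using depends_on_restrict[OF assms(2), of U x]
    by (intro sum.cong) (auto simp: cylinder_def indicator_def)
  also have "\<dots> = f x"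
    using sum_cylinder_indicator[OF assms(1), of x] by (simp add: sum_distrib_left[symmetric])
  finally show ?thesis by simp
qed

lemma depends_on_indicator_cylinder:
  fixes \<eta> :: "('d::finite, 'a) config"
  shows "depends_on (indicator (cylinder U \<eta>)) U"
  unfolding depends_on_def
proof clarify
  fix x y :: "('d, 'a) config" assume "\<forall>i\<in>U. x i = y i"
  then have "restrict x U = restrict y U" by (intro restrict_ext) auto
  then show "indicator (cylinder U \<eta>) x = indicator (cylinder U \<eta>) y"
    by (simp add: cylinder_def indicator_def)
qed

lemma cylinder_sets:
  assumes "finite U" "sets \<mu> = sets borel"
  shows "cylinder U \<eta> \<in> sets (\<mu> :: ('d::finite, 'a::finite) config measure)"
proof -
  have "(indicator (cylinder U \<eta>) :: _ \<Rightarrow> real) \<in> borel_measurable \<mu>"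
    by (rule measurable_depends_on[OF assms(1) depends_on_indicator_cylinder assms(2)])
  then show ?thesis
    using sets_eq_imp_space_eq[OF assms(2)] by (simp add: borel_measurable_indicator_iff)
qed


section \<open>The topological support\<close>

lemma closed_topological_support: "closed (topological_support \<mu>)"
proof -
  have "- topological_support \<mu> = \<Union>{U. open U \<and> emeasure \<mu> U = 0}"
    by (auto simp: topological_support_def)
  then show ?thesis by (auto simp: closed_def)
qed

text \<open>The complement is a union of possibly uncountably many open null sets; the Lindelof
  property replaces it by a countable union.\<close>

lemma AE_topological_support:
  fixes \<mu> :: "'b::second_countable_topology measure"
  assumes "sets \<mu> = sets borel"
  shows "AE x in \<mu>. x \<in> topological_support \<mu>"
proof -
  let ?F = "{U. open U \<and> emeasure \<mu> U = 0}"
  obtain F' where F': "F' \<subseteq> ?F" "countable F'" "\<Union>F' = \<Union>?F"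
    using Lindelof[of ?F] by blast
  have "- topological_support \<mu> = \<Union>?F"
    by (auto simp: topological_support_def)
  moreover have "(\<Union>U\<in>F'. U) \<in> null_sets \<mu>"
    using F' assms by (intro null_sets_UN') (auto simp: null_sets_def)
  ultimately have "- topological_support \<mu> \<in> null_sets \<mu>"
    using F' by simp
  then show ?thesis by (intro AE_I'[of "- topological_support \<mu>"]) auto
qed

text \<open>Transfer between the two probability spaces: all estimates are made on \<mu>, while the
  final claims live on the support. Measurability is asked of \<open>g\<close>, since
  \<open>f\<close> may be arbitrary off the support.\<close>

lemma integral_support_space:
  fixes \<mu> :: "'b::second_countable_topology measure"
    and f :: "'b \<Rightarrow> 'e::{banach, second_countable_topology}"
  assumes "sets \<mu> = sets borel" "g \<in> borel_measurable \<mu>"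
    and "\<And>x. x \<in> topological_support \<mu> \<Longrightarrow> f x = g x"
  shows "integral\<^sup>L (support_space \<mu>) f = integral\<^sup>L \<mu> g"
proof -
  have sp: "space \<mu> = UNIV" using sets_eq_imp_space_eq[OF assms(1)] by simp
  have X: "topological_support \<mu> \<in> sets \<mu>"
    using assms(1) closed_topological_support by (metis borel_closed)
  have "integral\<^sup>L (support_space \<mu>) f = (\<integral>x. indicator (topological_support \<mu>) x *\<^sub>R f x \<partial>\<mu>)"
    unfolding support_space_def by (rule integral_restrict_space) (use X sp in auto)
  also have "\<dots> = (\<integral>x. indicator (topological_support \<mu>) x *\<^sub>R g x \<partial>\<mu>)"
    by (intro Bochner_Integration.integral_cong) (auto simp: indicator_def assms(3))
  also have "\<dots> = integral\<^sup>L \<mu> g"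
    using AE_topological_support[OF assms(1)] assms(2) X
    by (intro integral_cong_AE) (auto simp: indicator_def)
  finally show ?thesis .
qed

lemma measure_support_space:
  fixes \<mu> :: "'b::second_countable_topology measure"
  assumes "sets \<mu> = sets borel" "finite_measure \<mu>" "A \<in> sets \<mu>"
  shows "measure (support_space \<mu>) {x \<in> space (support_space \<mu>). x \<in> A} = measure \<mu> A"
proof -
  interpret finite_measure \<mu> by fact
  have sp: "space \<mu> = UNIV" using sets_eq_imp_space_eq[OF assms(1)] by simp
  have X: "topological_support \<mu> \<in> sets \<mu>"
    using assms(1) closed_topological_support by (metis borel_closed)
  have "measure (support_space \<mu>) {x \<in> space (support_space \<mu>). x \<in> A} =
      measure \<mu> (topological_support \<mu> \<inter> A)"
    unfolding support_space_def
    by (subst measure_restrict_space) (use X sp in \<open>auto simp: space_restrict_space Int_def\<close>)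
  also have "\<dots> = measure \<mu> A"
    using AE_topological_support[OF assms(1)] X assms(3)
    by (intro measure_eq_AE) auto
  finally show ?thesis .
qed

lemma prob_space_support_space:
  fixes \<mu> :: "'b::second_countable_topology measure"
  assumes "sets \<mu> = sets borel" "prob_space \<mu>"
  shows "prob_space (support_space \<mu>)"
proof -
  interpret prob_space \<mu> by fact
  have sp: "space \<mu> = UNIV" using sets_eq_imp_space_eq[OF assms(1)] by simp
  have X: "topological_support \<mu> \<in> sets \<mu>"
    using assms(1) closed_topological_support by (metis borel_closed)
  have "emeasure \<mu> (topological_support \<mu>) = 1"
    using AE_topological_support[OF assms(1)] X by (simp add: emeasure_eq_1_AE)
  then show ?thesis
    unfolding support_space_def using X sp
    by (intro prob_spaceI) (simp add: emeasure_restrict_space space_restrict_space)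
qed

section \<open>Strong spatial mixing for cylinder functions\<close>

lemma integral_uniform_measure:
  fixes g :: "'b \<Rightarrow> 'e::{banach, second_countable_topology}"
  assumes A: "A \<in> sets M" "emeasure M A \<noteq> 0" "emeasure M A \<noteq> \<infinity>" and g: "g \<in> borel_measurable M"
  shows "integral\<^sup>L (uniform_measure M A) g = (\<integral>x. indicator A x *\<^sub>R g x \<partial>M) /\<^sub>R measure M A"
proof -
  have pos: "0 < measure M A"
    using A by (simp add: measure_def enn2real_positive_iff top.not_eq_extremum zero_less_iff_neq_zero)
  have e: "emeasure M A = ennreal (measure M A)"
    using A by (intro emeasure_eq_ennreal_measure) auto
  have "uniform_measure M A = density M (\<lambda>x. ennreal (indicator A x / measure M A))"
    unfolding uniform_measure_def e using pos A divide_ennreal[of 1 "measure M A"]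
    by (intro density_cong) (auto split: split_indicator)
  then have "integral\<^sup>L (uniform_measure M A) g = (\<integral>x. (indicator A x / measure M A) *\<^sub>R g x \<partial>M)"
    using A g by (simp add: integral_density)
  also have "\<dots> = (\<integral>x. (1 / measure M A) *\<^sub>R (indicator A x *\<^sub>R g x) \<partial>M)"
    by (intro Bochner_Integration.integral_cong) auto
  also have "\<dots> = (\<integral>x. indicator A x *\<^sub>R g x \<partial>M) /\<^sub>R measure M A"
    by (simp add: divide_inverse del: scaleR_scaleR)
  finally show ?thesis .
qed

text \<open>Turns the pushed-forward point measure back into an elementary conditional probability
  under \<mu>. For a null boundary event both sides are 0 through \<open>x / 0 = 0\<close>.\<close>

lemma measure_conditional_marginal:
  fixes \<mu> :: "('d::finite, 'a::finite) config measure"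
  assumes "prob_space \<mu>" and sets: "sets \<mu> = sets borel"
    and V: "finite V" "U \<subseteq> V" and B: "B \<subseteq> U \<rightarrow>\<^sub>E UNIV"
  defines "D \<equiv> outer_boundary V"
  shows "measure (conditional_marginal \<mu> V U \<tau>) B =
    measure \<mu> ({x. restrict x U \<in> B} \<inter> cylinder D \<tau>) / measure \<mu> (cylinder D \<tau>)"
proof -
  interpret prob_space \<mu> by fact
  have finD: "finite D" unfolding D_def by (rule finite_outer_boundary[OF V(1)])
  have finU: "finite U" using V by (auto intro: finite_subset)
  have [measurable]: "cylinder W \<eta> \<in> sets \<mu>" if "finite W" for W \<eta>
    using cylinder_sets[OF that sets] .
  have cp: "cond_prob (support_space \<mu>) (\<lambda>x. restrict x V = \<eta>) (\<lambda>x. restrict x D = \<tau>) =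
      measure \<mu> (cylinder V \<eta> \<inter> cylinder D \<tau>) / measure \<mu> (cylinder D \<tau>)" for \<eta>
  proof -
    have "{x \<in> space (support_space \<mu>). restrict x V = \<eta> \<and> restrict x D = \<tau>} =
        {x \<in> space (support_space \<mu>). x \<in> cylinder V \<eta> \<inter> cylinder D \<tau>}"
      "{x \<in> space (support_space \<mu>). restrict x D = \<tau>} =
        {x \<in> space (support_space \<mu>). x \<in> cylinder D \<tau>}"
      by (auto simp: cylinder_def)
    then show ?thesis
      unfolding cond_prob_def using V finD
      by (simp add: measure_support_space[OF sets finite_measure_axioms] del: Int_iff)
  qed
  let ?E = "{\<eta> \<in> V \<rightarrow>\<^sub>E UNIV. restrict \<eta> U \<in> B}"
  let ?f = "\<lambda>\<eta>. measure \<mu> (cylinder V \<eta> \<inter> cylinder D \<tau>) / measure \<mu> (cylinder D \<tau>)"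
  have finE: "finite (V \<rightarrow>\<^sub>E (UNIV :: 'a discrete set))" using V by auto
  have "measure (conditional_marginal \<mu> V U \<tau>) B = measure (conditional_law \<mu> V \<tau>) ?E"
  proof -
    have "(\<lambda>\<eta>. restrict \<eta> U) -` B \<inter> space (conditional_law \<mu> V \<tau>) = ?E"
      by (auto simp: conditional_law_def space_point_measure)
    moreover have "(\<lambda>\<eta>. restrict \<eta> U) \<in> measurable (conditional_law \<mu> V \<tau>) (count_space (U \<rightarrow>\<^sub>E UNIV))"
      by (auto simp: conditional_law_def measurable_def space_point_measure sets_point_measure)
    ultimately show ?thesis
      unfolding conditional_marginal_def using B by (subst measure_distr) auto
  qed
  also have "\<dots> = (\<Sum>\<eta>\<in>?E. ?f \<eta>)"
    unfolding conditional_law_def D_def[symmetric] cp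
    using finE by (subst measure_point_measure_finite_if) auto
  also have "\<dots> = (\<Sum>\<eta>\<in>?E. measure \<mu> (cylinder V \<eta> \<inter> cylinder D \<tau>)) / measure \<mu> (cylinder D \<tau>)"
    by (simp add: sum_divide_distrib)
  also have "(\<Sum>\<eta>\<in>?E. measure \<mu> (cylinder V \<eta> \<inter> cylinder D \<tau>)) =
      measure \<mu> (\<Union>\<eta>\<in>?E. cylinder V \<eta> \<inter> cylinder D \<tau>)"
  proof (rule finite_measure_finite_Union[symmetric])
    show "disjoint_family_on (\<lambda>\<eta>. cylinder V \<eta> \<inter> cylinder D \<tau>) ?E"
      by (auto simp: disjoint_family_on_def cylinder_def)
  qed (use finE V finD in auto)
  also have "(\<Union>\<eta>\<in>?E. cylinder V \<eta> \<inter> cylinder D \<tau>) = {x. restrict x U \<in> B} \<inter> cylinder D \<tau>"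
  proof -
    have "restrict (restrict x V) U = restrict x U" for x :: "('d, 'a) config"
      using V by (simp add: Int_absorb1)
    then show ?thesis by (auto simp: cylinder_def)
  qed
  finally show ?thesis .
qed

lemma total_variation_bounds:
  assumes "finite_measure M" "finite_measure N" "B \<in> sets M"
  shows "\<bar>measure M B - measure N B\<bar> \<le> total_variation M N"
  unfolding total_variation_def
proof (rule cSUP_upper[OF assms(3)])
  interpret M: finite_measure M by fact
  interpret N: finite_measure N by fact
  show "bdd_above ((\<lambda>B. \<bar>measure M B - measure N B\<bar>) ` sets M)"
  proof (rule bdd_aboveI2)
    fix B
    have "measure M B \<le> measure M (space M)" "measure N B \<le> measure N (space N)"
      by (rule M.bounded_measure N.bounded_measure)+
    then show "\<bar>measure M B - measure N B\<bar> \<le> measure M (space M) + measure N (space N)"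
      using measure_nonneg[of M B] measure_nonneg[of N B] by linarith
  qed
qed

text \<open>The set where \<open>p\<close> is at least \<open>q\<close> and the set where it is
  smaller contribute at most \<open>t\<close> each. The factor 2 reflects that
  \<open>total_variation\<close> is a supremum over events.\<close>

lemma sum_abs_diff_le:
  fixes p q :: "'b \<Rightarrow> real"
  assumes "finite E" "\<And>B. B \<subseteq> E \<Longrightarrow> \<bar>sum p B - sum q B\<bar> \<le> t"
  shows "(\<Sum>e\<in>E. \<bar>p e - q e\<bar>) \<le> 2 * t"
proof -
  let ?P = "{e \<in> E. q e \<le> p e}" and ?N = "{e \<in> E. p e < q e}"
  have "(\<Sum>e\<in>E. \<bar>p e - q e\<bar>) = (\<Sum>e\<in>?P. \<bar>p e - q e\<bar>) + (\<Sum>e\<in>?N. \<bar>p e - q e\<bar>)"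
    using assms(1) by (subst sum.union_disjoint[symmetric]) (auto intro!: sum.cong)
  also have "\<dots> = (sum p ?P - sum q ?P) + (sum q ?N - sum p ?N)"
    by (simp add: sum_subtractf[symmetric] cong: sum.cong_simp)
  also have "\<dots> \<le> 2 * t"
    using assms(2)[of ?P] assms(2)[of ?N] by auto
  finally show ?thesis .
qed

text \<open>Conditioning is on the boundary \<open>D\<close> of a neighbourhood \<open>V\<close> of
  \<open>U\<close>. Given \<open>D\<close>, the functions \<open>f\<close> and \<open>F\<close> are
  independent, and the conditional mean \<open>E \<tau>\<close> is within \<delta> of the mean of
  \<open>f\<close> for every possible \<tau>. On each boundary event the error is thus at most
  \<delta> times the mass of \<open>norm F\<close> there; summing over \<tau> gives the
  \<open>L1\<close> norm of \<open>F\<close>, with no trace of the size of \<open>G\<close>.\<close>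

lemma mixing_cylinder_functions:
  fixes \<mu> :: "('d::finite, 'a::finite) config measure"
    and f :: "('d, 'a) config \<Rightarrow> real" and F :: "('d, 'a) config \<Rightarrow> complex"
  assumes ps: "prob_space \<mu>" and sets: "sets \<mu> = sets borel"
    and mrf: "markov_random_field \<mu>"
    and c: "0 < c" and C: "0 < C"
    and ssm: "\<And>V U \<tau> \<tau>'. finite V \<Longrightarrow> U \<subseteq> V \<Longrightarrow>
        \<tau> \<in> (\<lambda>x. restrict x (outer_boundary V)) ` topological_support \<mu> \<Longrightarrow>
        \<tau>' \<in> (\<lambda>x. restrict x (outer_boundary V)) ` topological_support \<mu> \<Longrightarrow>
        total_variation (conditional_marginal \<mu> V U \<tau>) (conditional_marginal \<mu> V U \<tau>')
        \<le> C * real (card U) * exp_decay c (graph_dist U {i \<in> outer_boundary V. \<tau> i \<noteq> \<tau>' i})"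
    and U: "finite U" and G: "finite G" and r: "0 < r"
    and sep: "\<And>u g. u \<in> U \<Longrightarrow> g \<in> G \<Longrightarrow> r \<le> snorm (u - g)"
    and f: "depends_on f U" and F: "depends_on F G" and b: "\<And>x. \<bar>f x\<bar> \<le> b"
  shows "norm ((\<integral>x. f x *\<^sub>R F x \<partial>\<mu>) - (\<integral>x. f x \<partial>\<mu>) *\<^sub>R (\<integral>x. F x \<partial>\<mu>))
    \<le> 2 * b * (C * real (card U) * exp (- c * real r)) * (\<integral>x. norm (F x) \<partial>\<mu>)"
proof -
  interpret prob_space \<mu> by fact
  have sp: "space \<mu> = UNIV" using sets_eq_imp_space_eq[OF sets] by simp
  define \<delta> where "\<delta> = 2 * b * (C * real (card U) * exp (- c * real r))"
  \<comment> \<open>Radius \<open>r - 1\<close> is as large as the separation permits: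
    \<open>V\<close> misses \<open>G\<close>, and every site outside \<open>V\<close>, in particular
    every boundary site, is at distance at least \<open>r\<close> from \<open>U\<close>.\<close>
  define V where "V = (\<Union>u\<in>U. (\<lambda>h. h + u) ` centered_box (r - 1))"
  define D where "D = outer_boundary V"
  have V_iff: "i \<in> V \<longleftrightarrow> (\<exists>u\<in>U. snorm (u - i) < r)" for i
  proof -
    have "i \<in> (\<lambda>h. h + u) ` centered_box (r - 1) \<longleftrightarrow> snorm (u - i) < r" for u
    proof -
      have "i \<in> (\<lambda>h. h + u) ` centered_box (r - 1) \<longleftrightarrow> i - u \<in> centered_box (r - 1)"
        by (auto intro: image_eqI[of _ _ "i - u"])
      then show ?thesis
        using r by (auto simp: snorm_le_centered_box[symmetric] snorm_commute[of u])
    qed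
    then show ?thesis by (auto simp: V_def)
  qed
  have finV: "finite V" unfolding V_def using U by auto
  have finD: "finite D" unfolding D_def by (rule finite_outer_boundary[OF finV])
  have UV: "U \<subseteq> V"
  proof
    fix u assume "u \<in> U"
    moreover have "snorm (u - u) < r" using r by simp
    ultimately show "u \<in> V" unfolding V_iff by blast
  qed
  have GV: "G \<inter> V = {}" using sep by (force simp: V_iff)
  have DV: "D \<inter> V = {}" unfolding D_def by (rule outer_boundary_disjoint)
  have Dfar: "r \<le> snorm (u - i)" if "u \<in> U" "i \<in> D" for u i
    using that DV V_iff[of i] by (meson disjoint_iff not_less)
  have b0: "0 \<le> b" using b[of undefined] by linarith
  have \<delta>0: "0 \<le> \<delta>" unfolding \<delta>_def using b0 C by simp
  have fm [measurable]: "f \<in> borel_measurable \<mu>" by (rule measurable_depends_on[OF U f sets])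
  have Fm [measurable]: "F \<in> borel_measurable \<mu>" by (rule measurable_depends_on[OF G F sets])
  obtain BF where BF: "\<And>x. norm (F x) \<le> BF" using bounded_depends_on[OF G F] by blast
  have cm [measurable]: "cylinder D \<tau> \<in> sets \<mu>" for \<tau> by (rule cylinder_sets[OF finD sets])
  have cmU [measurable]: "cylinder U \<tau> \<in> sets \<mu>" for \<tau> by (rule cylinder_sets[OF U sets])
  have int_bdd: "integrable \<mu> g" if "g \<in> borel_measurable \<mu>" "\<And>x. norm (g x) \<le> K" for K
    and g :: "_ \<Rightarrow> 'e::{banach, second_countable_topology}"
    using that by (intro integrable_const_bound[of _ K]) auto
  have intf: "integrable \<mu> f" using b by (intro int_bdd[of _ b]) auto
  have intF: "integrable \<mu> F" using BF by (intro int_bdd) auto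
  have intfF: "integrable \<mu> (\<lambda>x. f x *\<^sub>R F x)"
    using mult_mono[OF b BF] b0 by (intro int_bdd[of _ "b * BF"]) auto
  define p where "p \<tau> = measure \<mu> (cylinder D \<tau>)" for \<tau>
  define E where "E \<tau> = (\<integral>x. indicator (cylinder D \<tau>) x * f x \<partial>\<mu>) / p \<tau>" for \<tau>
  let ?T = "D \<rightarrow>\<^sub>E (UNIV :: 'a discrete set)"
  have finT: "finite ?T" using finD by simp
  have split: "(\<integral>x. g x \<partial>\<mu>) = (\<Sum>\<tau>\<in>?T. (\<integral>x. indicator (cylinder D \<tau>) x *\<^sub>R g x \<partial>\<mu>))"
    if "integrable \<mu> g" for g :: "_ \<Rightarrow> 'e::{banach, second_countable_topology}"
  proof -
    have "(\<Sum>\<tau>\<in>?T. (\<integral>x. indicator (cylinder D \<tau>) x *\<^sub>R g x \<partial>\<mu>)) =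
        (\<integral>x. (\<Sum>\<tau>\<in>?T. indicator (cylinder D \<tau>) x *\<^sub>R g x) \<partial>\<mu>)"
      using that by (intro Bochner_Integration.integral_sum[symmetric] integrable_mult_indicator) auto
    also have "\<dots> = (\<integral>x. g x \<partial>\<mu>)"
      by (simp add: scaleR_sum_left[symmetric] sum_cylinder_indicator[OF finD])
    finally show ?thesis by simp
  qed
  \<comment> \<open>Strong spatial mixing is assumed for boundary values seen in the support. Those
    of positive probability are of this kind, and the others carry no mass.\<close>
  have supp: "\<tau> \<in> (\<lambda>x. restrict x D) ` topological_support \<mu>" if "p \<tau> \<noteq> 0" for \<tau>
  proof (rule ccontr)
    assume "\<not> ?thesis"
    then have "AE x in \<mu>. x \<notin> cylinder D \<tau>"
      using AE_topological_support[OF sets] by (auto simp: cylinder_def elim!: eventually_mono)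
    then have "p \<tau> = 0" unfolding p_def by (intro prob_eq_0[THEN iffD2]) auto
    then show False using that by simp
  qed
  have E_marg: "E \<tau> = (\<Sum>\<eta>\<in>U \<rightarrow>\<^sub>E UNIV. f \<eta> * measure (conditional_marginal \<mu> V U \<tau>) {\<eta>})" for \<tau>
  proof -
    have "(\<integral>x. indicator (cylinder D \<tau>) x * f x \<partial>\<mu>) =
        (\<integral>x. (\<Sum>\<eta>\<in>U \<rightarrow>\<^sub>E UNIV. f \<eta> * indicator (cylinder U \<eta> \<inter> cylinder D \<tau>) x) \<partial>\<mu>)"
      by (subst depends_on_sum_cylinder[OF U f])
        (auto intro!: Bochner_Integration.integral_cong sum.cong simp: sum_distrib_left split: split_indicator)
    also have "\<dots> = (\<Sum>\<eta>\<in>U \<rightarrow>\<^sub>E UNIV. f \<eta> * measure \<mu> (cylinder U \<eta> \<inter> cylinder D \<tau>))"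
      by (subst Bochner_Integration.integral_sum)
        (auto simp: sp intro!: integrable_mult_right integrable_real_indicator simp: emeasure_eq_measure)
    finally have *: "E \<tau> = (\<Sum>\<eta>\<in>U \<rightarrow>\<^sub>E UNIV. f \<eta> * measure \<mu> (cylinder U \<eta> \<inter> cylinder D \<tau>)) / p \<tau>"
      by (simp add: E_def)
    have "measure (conditional_marginal \<mu> V U \<tau>) {\<eta>} = measure \<mu> (cylinder U \<eta> \<inter> cylinder D \<tau>) / p \<tau>"
      if "\<eta> \<in> U \<rightarrow>\<^sub>E UNIV" for \<eta>
    proof -
      have "{x. restrict x U \<in> {\<eta>}} = cylinder U \<eta>" by (auto simp: cylinder_def)
      then show ?thesis
        using measure_conditional_marginal[OF ps sets finV UV, of "{\<eta>}" \<tau>] that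
        by (simp add: p_def D_def)
    qed
    then show ?thesis unfolding * by (simp add: sum_divide_distrib cong: sum.cong)
  qed
  have fm_marg: "finite_measure (conditional_marginal \<mu> V U \<tau>)" for \<tau>
  proof -
    have "(\<lambda>\<eta>. restrict \<eta> U) \<in> measurable (conditional_law \<mu> V \<tau>) (count_space (U \<rightarrow>\<^sub>E UNIV))"
      by (auto simp: conditional_law_def measurable_def space_point_measure sets_point_measure)
    moreover have "finite_measure (conditional_law \<mu> V \<tau>)"
      unfolding conditional_law_def using finV
      by (intro finite_measureI) (simp add: space_point_measure emeasure_point_measure_finite)
    ultimately show ?thesis
      unfolding conditional_marginal_def by (rule finite_measure.finite_measure_distr[rotated])
  qed
  have sets_marg: "sets (conditional_marginal \<mu> V U \<tau>) = Pow (U \<rightarrow>\<^sub>E UNIV)" for \<tau>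
    by (simp add: conditional_marginal_def)
  have E_diff: "\<bar>E \<tau> - E \<tau>'\<bar> \<le> \<delta>" if "p \<tau> \<noteq> 0" "p \<tau>' \<noteq> 0" for \<tau> \<tau>'
  proof -
    let ?P = "\<lambda>\<tau> \<eta>. measure (conditional_marginal \<mu> V U \<tau>) {\<eta>}"
    let ?t = "C * real (card U) * exp (- c * real r)"
    have "total_variation (conditional_marginal \<mu> V U \<tau>) (conditional_marginal \<mu> V U \<tau>')
        \<le> C * real (card U) * exp_decay c (graph_dist U {i \<in> D. \<tau> i \<noteq> \<tau>' i})"
      unfolding D_def
      by (rule ssm[OF finV UV]) (use supp[OF that(1)] supp[OF that(2)] in \<open>simp_all add: D_def\<close>)
    also have "\<dots> \<le> ?t"
      using C c Dfar by (intro mult_left_mono exp_decay_le graph_dist_ge) auto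
    finally have tv: "total_variation (conditional_marginal \<mu> V U \<tau>) (conditional_marginal \<mu> V U \<tau>') \<le> ?t" .
    have sum_eq: "sum (?P \<tau>) B = measure (conditional_marginal \<mu> V U \<tau>) B"
      if "B \<subseteq> U \<rightarrow>\<^sub>E UNIV" for \<tau> B
    proof -
      have "finite B" using that U by (auto intro: finite_subset)
      then show ?thesis
        using that fm_marg by (intro finite_measure.finite_measure_eq_sum_singleton[symmetric])
          (auto simp: sets_marg)
    qed
    have "(\<Sum>\<eta>\<in>U \<rightarrow>\<^sub>E UNIV. \<bar>?P \<tau> \<eta> - ?P \<tau>' \<eta>\<bar>) \<le> 2 * ?t"
    proof (rule sum_abs_diff_le)
      fix B :: "('d, 'a) config set" assume B: "B \<subseteq> U \<rightarrow>\<^sub>E UNIV"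
      then show "\<bar>sum (?P \<tau>) B - sum (?P \<tau>') B\<bar> \<le> ?t"
        using total_variation_bounds[OF fm_marg fm_marg, of B \<tau> \<tau>'] tv by (simp add: sum_eq sets_marg)
    qed (use U in auto)
    then have "b * (\<Sum>\<eta>\<in>U \<rightarrow>\<^sub>E UNIV. \<bar>?P \<tau> \<eta> - ?P \<tau>' \<eta>\<bar>) \<le> \<delta>"
      using mult_left_mono[OF _ b0] by (fastforce simp: \<delta>_def mult_ac)
    moreover have "\<bar>E \<tau> - E \<tau>'\<bar> \<le> (\<Sum>\<eta>\<in>U \<rightarrow>\<^sub>E UNIV. b * \<bar>?P \<tau> \<eta> - ?P \<tau>' \<eta>\<bar>)"
    proof -
      have "E \<tau> - E \<tau>' = (\<Sum>\<eta>\<in>U \<rightarrow>\<^sub>E UNIV. f \<eta> * (?P \<tau> \<eta> - ?P \<tau>' \<eta>))"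
        unfolding E_marg by (simp add: sum_subtractf[symmetric] right_diff_distrib)
      also have "\<bar>\<dots>\<bar> \<le> (\<Sum>\<eta>\<in>U \<rightarrow>\<^sub>E UNIV. b * \<bar>?P \<tau> \<eta> - ?P \<tau>' \<eta>\<bar>)"
        using b by (intro order.trans[OF sum_abs] sum_mono) (auto simp: abs_mult intro!: mult_right_mono)
      finally show ?thesis .
    qed
    ultimately show ?thesis by (simp add: sum_distrib_left)
  qed
  have pE: "(\<integral>x. indicator (cylinder D \<tau>) x * f x \<partial>\<mu>) = p \<tau> * E \<tau>" for \<tau>
  proof (cases "p \<tau> = 0")
    case True
    then have "AE x in \<mu>. x \<notin> cylinder D \<tau>" unfolding p_def by (simp add: prob_eq_0)
    then have "(\<integral>x. indicator (cylinder D \<tau>) x * f x \<partial>\<mu>) = (\<integral>x. 0 \<partial>\<mu>)"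
      by (intro integral_cong_AE) (auto elim!: eventually_mono)
    then show ?thesis using True by simp
  qed (simp add: E_def)
  have Ef: "(\<integral>x. f x \<partial>\<mu>) = (\<Sum>\<tau>\<in>?T. p \<tau> * E \<tau>)"
    using split[OF intf] by (simp add: pE)
  have psum: "(\<Sum>\<tau>\<in>?T. p \<tau>) = 1"
  proof -
    have "(\<integral>x. 1 \<partial>\<mu>) = (\<Sum>\<tau>\<in>?T. (\<integral>x. indicator (cylinder D \<tau>) x *\<^sub>R (1::real) \<partial>\<mu>))"
      by (rule split) auto
    then show ?thesis using prob_space by (simp add: p_def sp)
  qed
  \<comment> \<open>The mean of \<open>f\<close> is the \<open>p\<close>-average of the conditional
    means, so their pairwise closeness implies closeness to it.\<close>
  have E_f: "\<bar>E \<tau> - (\<integral>x. f x \<partial>\<mu>)\<bar> \<le> \<delta>" if "p \<tau> \<noteq> 0" for \<tau>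
  proof -
    have "E \<tau> - (\<integral>x. f x \<partial>\<mu>) = (\<Sum>\<tau>'\<in>?T. p \<tau>' * (E \<tau> - E \<tau>'))"
      unfolding Ef using psum
      by (simp add: right_diff_distrib sum_subtractf sum_distrib_right[symmetric])
    also have "\<bar>\<dots>\<bar> \<le> (\<Sum>\<tau>'\<in>?T. p \<tau>' * \<delta>)"
    proof (rule order.trans[OF sum_abs sum_mono])
      fix \<tau>'
      show "\<bar>p \<tau>' * (E \<tau> - E \<tau>')\<bar> \<le> p \<tau>' * \<delta>"
        using E_diff[OF that, of \<tau>']
        by (cases "p \<tau>' = 0") (auto simp: abs_mult p_def intro!: mult_left_mono)
    qed
    also have "\<dots> = \<delta>" using psum by (simp add: sum_distrib_right[symmetric])
    finally show ?thesis .
  qed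
  have cond_indep: "(\<integral>x. indicator (cylinder D \<tau>) x *\<^sub>R (f x *\<^sub>R F x) \<partial>\<mu>) =
      E \<tau> *\<^sub>R (\<integral>x. indicator (cylinder D \<tau>) x *\<^sub>R F x \<partial>\<mu>)" if p: "p \<tau> \<noteq> 0" for \<tau>
  proof -
    let ?\<nu> = "uniform_measure \<mu> (cylinder D \<tau>)"
    let ?W = "- (V \<union> D)"
    have em: "emeasure \<mu> (cylinder D \<tau>) \<noteq> 0" "emeasure \<mu> (cylinder D \<tau>) \<noteq> \<infinity>"
      using p by (auto simp: p_def emeasure_eq_measure)
    have "0 < emeasure \<mu> (cylinder (outer_boundary V) \<tau>)"
      using em(1) by (simp add: D_def zero_less_iff_neq_zero)
    then have iv: "prob_space.indep_var ?\<nu> (PiM V (\<lambda>_. borel)) (\<lambda>x. restrict x V)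
        (PiM ?W (\<lambda>_. borel)) (\<lambda>x. restrict x ?W)"
      using mrf finV unfolding markov_random_field_def D_def by (auto simp: Let_def)
    interpret N: prob_space ?\<nu> by (rule prob_space_uniform_measure) (use em in auto)
    \<comment> \<open>\<open>G\<close> may meet the boundary \<open>D\<close>, which does not belong
      to the exterior region of the Markov property. Freezing those coordinates at \<tau> gives a
      function of the exterior alone that agrees with \<open>F\<close> on the conditioning
      event.\<close>
    define F' where "F' y = F (\<lambda>i. if i \<in> D then \<tau> i else y i)" for y
    have F': "depends_on F' (G - D)"
      unfolding depends_on_def F'_def by (auto intro!: depends_onD[OF F])
    have F'_eq: "F' x = F x" if "x \<in> cylinder D \<tau>" for x
      unfolding F'_def using that by (intro depends_onD[OF F]) (auto simp: cylinder_def)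
    have F'm [measurable]: "F' \<in> borel_measurable \<mu>"
      using G by (intro measurable_depends_on[OF _ F' sets]) auto
    have GW: "G - D \<subseteq> ?W" using GV by auto
    have "N.indep_var borel ((\<lambda>y. complex_of_real (f y)) \<circ> (\<lambda>x. restrict x V))
        borel (F' \<circ> (\<lambda>x. restrict x ?W))"
    proof (rule N.indep_var_compose[OF iv])
      show "(\<lambda>y. complex_of_real (f y)) \<in> measurable (PiM V (\<lambda>_. borel)) borel"
        using measurable_depends_on_PiM[OF U UV f] by simp
      show "F' \<in> measurable (PiM ?W (\<lambda>_. borel)) borel"
        using G by (intro measurable_depends_on_PiM[OF _ GW F']) auto
    qed
    moreover have "(\<lambda>y. complex_of_real (f y)) \<circ> (\<lambda>x. restrict x V) = (\<lambda>x. complex_of_real (f x))"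
      using depends_on_restrict[OF f UV] by (simp add: o_def)
    moreover have "F' \<circ> (\<lambda>x. restrict x ?W) = F'"
      using depends_on_restrict[OF F' GW] by (auto simp: o_def)
    ultimately have iv': "N.indep_var borel (\<lambda>x. complex_of_real (f x)) borel F'" by simp
    obtain BF' where BF': "\<And>x. norm (F' x) \<le> BF'"
      using bounded_depends_on[OF _ F'] G by blast
    have "integral\<^sup>L ?\<nu> (\<lambda>x. complex_of_real (f x) * F' x) =
        integral\<^sup>L ?\<nu> (\<lambda>x. complex_of_real (f x)) * integral\<^sup>L ?\<nu> F'"
    proof (rule N.indep_var_lebesgue_integral[OF iv'])
      show "integrable ?\<nu> (\<lambda>x. complex_of_real (f x))"
        using b by (intro N.integrable_const_bound[of _ b]) auto
      show "integrable ?\<nu> F'"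
        using BF' by (intro N.integrable_const_bound[of _ BF']) auto
    qed
    moreover have "integral\<^sup>L ?\<nu> (\<lambda>x. complex_of_real (f x)) = complex_of_real (E \<tau>)"
      using em by (simp add: integral_uniform_measure E_def p_def divide_inverse mult.commute)
    moreover have "integral\<^sup>L ?\<nu> F' = (\<integral>x. indicator (cylinder D \<tau>) x *\<^sub>R F x \<partial>\<mu>) /\<^sub>R p \<tau>"
    proof -
      have "(\<integral>x. indicator (cylinder D \<tau>) x *\<^sub>R F' x \<partial>\<mu>) = (\<integral>x. indicator (cylinder D \<tau>) x *\<^sub>R F x \<partial>\<mu>)"
        by (intro Bochner_Integration.integral_cong) (auto simp: F'_eq split: split_indicator)
      then show ?thesis using em by (simp add: integral_uniform_measure p_def)
    qed
    moreover have "integral\<^sup>L ?\<nu> (\<lambda>x. complex_of_real (f x) * F' x) =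
        (\<integral>x. indicator (cylinder D \<tau>) x *\<^sub>R (f x *\<^sub>R F x) \<partial>\<mu>) /\<^sub>R p \<tau>"
    proof -
      have "(\<integral>x. indicator (cylinder D \<tau>) x *\<^sub>R (complex_of_real (f x) * F' x) \<partial>\<mu>) =
          (\<integral>x. indicator (cylinder D \<tau>) x *\<^sub>R (f x *\<^sub>R F x) \<partial>\<mu>)"
        by (intro Bochner_Integration.integral_cong)
          (auto simp: F'_eq scaleR_conv_of_real split: split_indicator)
      then show ?thesis using em by (simp add: integral_uniform_measure p_def)
    qed
    ultimately show ?thesis
      using p by (simp add: scaleR_conv_of_real field_simps)
  qed
  let ?IF = "\<lambda>\<tau>. \<integral>x. indicator (cylinder D \<tau>) x *\<^sub>R F x \<partial>\<mu>"
  have "norm ((\<integral>x. indicator (cylinder D \<tau>) x *\<^sub>R (f x *\<^sub>R F x) \<partial>\<mu>) - (\<integral>x. f x \<partial>\<mu>) *\<^sub>R ?IF \<tau>)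
      \<le> \<delta> * (\<integral>x. indicator (cylinder D \<tau>) x *\<^sub>R norm (F x) \<partial>\<mu>)" for \<tau>
  proof (cases "p \<tau> = 0")
    case True
    then have ae: "AE x in \<mu>. x \<notin> cylinder D \<tau>" unfolding p_def by (simp add: prob_eq_0)
    have "(\<integral>x. indicator (cylinder D \<tau>) x *\<^sub>R (f x *\<^sub>R F x) \<partial>\<mu>) = (\<integral>x. 0 \<partial>\<mu>)" "?IF \<tau> = (\<integral>x. 0 \<partial>\<mu>)"
      using ae by (intro integral_cong_AE; auto elim!: eventually_mono)+
    then show ?thesis using \<delta>0 by simp
  next
    case False
    have "(\<integral>x. indicator (cylinder D \<tau>) x *\<^sub>R (f x *\<^sub>R F x) \<partial>\<mu>) - (\<integral>x. f x \<partial>\<mu>) *\<^sub>R ?IF \<tau> =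
        (E \<tau> - (\<integral>x. f x \<partial>\<mu>)) *\<^sub>R ?IF \<tau>"
      unfolding cond_indep[OF False] by (simp add: scaleR_left_diff_distrib)
    moreover have "norm (?IF \<tau>) \<le> (\<integral>x. indicator (cylinder D \<tau>) x *\<^sub>R norm (F x) \<partial>\<mu>)"
      by (rule order.trans[OF integral_norm_bound]) simp
    ultimately show ?thesis
      using E_f[OF False] \<delta>0 by (simp add: mult_mono)
  qed
  then have "norm (\<Sum>\<tau>\<in>?T. (\<integral>x. indicator (cylinder D \<tau>) x *\<^sub>R (f x *\<^sub>R F x) \<partial>\<mu>) - (\<integral>x. f x \<partial>\<mu>) *\<^sub>R ?IF \<tau>)
      \<le> (\<Sum>\<tau>\<in>?T. \<delta> * (\<integral>x. indicator (cylinder D \<tau>) x *\<^sub>R norm (F x) \<partial>\<mu>))"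
    by (intro sum_norm_le) auto
  then show ?thesis
    unfolding \<delta>_def[symmetric] split[OF intfF] split[OF intF] split[OF integrable_norm[OF intF]]
    by (simp add: sum_subtractf scaleR_sum_right sum_distrib_left)
qed

section \<open>Sums over the lattice\<close>

lemma power_le_fact_exp:
  fixes x :: real
  assumes "0 \<le> x"
  shows "x ^ n \<le> fact n * exp x"
proof -
  have "sum (\<lambda>k. inverse (fact k) * x ^ k) {n} \<le> (\<Sum>k. inverse (fact k) * x ^ k)"
    using assms by (intro sum_le_suminf summable_exp) auto
  then have "x ^ n / fact n \<le> exp x"
    by (simp add: exp_def divide_inverse mult.commute scaleR_conv_of_real)
  then show ?thesis by (simp add: field_simps)
qed

lemma summable_power_mult_exp:
  fixes c :: real
  assumes "0 < c"
  shows "summable (\<lambda>r. (2 * real r + 1) ^ n * exp (- c * real r))"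
proof (rule summable_comparison_test')
  \<comment> \<open>The bound \<open>x ^ n \<le> fact n * exp x\<close> is used at
    \<open>x = c / 4 * (2 * r + 1)\<close>; this costs \<open>exp (c / 2 * r)\<close> and leaves
    half of the decay rate.\<close>
  let ?K = "(4 / c) ^ n * fact n * exp (c / 4)"
  show "summable (\<lambda>r. ?K * exp (- c / 2) ^ r)"
    using assms by (intro summable_mult summable_geometric) simp
  show "norm ((2 * real r + 1) ^ n * exp (- c * real r)) \<le> ?K * exp (- c / 2) ^ r" for r
  proof -
    have "(c / 4 * (2 * real r + 1)) ^ n \<le> fact n * exp (c / 4 * (2 * real r + 1))"
      using assms by (intro power_le_fact_exp) simp
    then have "(4 / c) ^ n * (c / 4 * (2 * real r + 1)) ^ n
        \<le> (4 / c) ^ n * (fact n * exp (c / 4 * (2 * real r + 1)))"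
      using assms by (intro mult_left_mono) auto
    moreover have "(4 / c) ^ n * (c / 4 * (2 * real r + 1)) ^ n = (2 * real r + 1) ^ n"
    proof -
      have "(4 / c) * (c / 4 * (2 * real r + 1)) = 2 * real r + 1"
        using assms by (simp add: field_simps)
      then show ?thesis
        using power_mult_distrib[of "4 / c" "c / 4 * (2 * real r + 1)" n] by (simp only:)
    qed
    moreover have "exp (c / 4 * (2 * real r + 1)) = exp (c / 4) * exp (c / 2 * real r)"
      by (simp add: exp_add[symmetric] algebra_simps)
    ultimately have "(2 * real r + 1) ^ n \<le> ?K * exp (c / 2 * real r)" by (simp add: mult_ac)
    then have "(2 * real r + 1) ^ n * exp (- c * real r) \<le> ?K * exp (c / 2 * real r) * exp (- c * real r)"
      by (intro mult_right_mono) auto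
    also have "\<dots> = ?K * exp (- c / 2) ^ r"
      by (simp add: exp_add[symmetric] exp_of_nat_mult[symmetric] algebra_simps)
    finally show ?thesis by simp
  qed
qed

lemma real_card_centered_box:
  "real (card (centered_box n :: 'd::finite site set)) = (2 * real n + 1) ^ CARD('d)"
  by (simp add: card_centered_box add.commute)

text \<open>Sites are grouped by level, and each level set is counted by the box containing it. The
  bound is uniform in the finite set \<open>F\<close>, as summability over the lattice and the Schur
  test require.\<close>

lemma lattice_sum_bound:
  fixes lv :: "'d::finite site \<Rightarrow> nat" and g :: "nat \<Rightarrow> real"
  assumes F: "finite F" and R: "\<And>h. snorm h \<le> R (lv h)" and g: "\<And>n. 0 \<le> g n"
    and sm: "summable (\<lambda>n. (2 * real (R n) + 1) ^ CARD('d) * g n)"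
  shows "(\<Sum>h\<in>F. g (lv h)) \<le> (\<Sum>n. (2 * real (R n) + 1) ^ CARD('d) * g n)"
proof -
  have "(\<Sum>h\<in>F. g (lv h)) = (\<Sum>n\<in>lv ` F. \<Sum>h\<in>{h \<in> F. lv h = n}. g (lv h))"
    using F by (intro sum.group[symmetric]) auto
  also have "\<dots> \<le> (\<Sum>n\<in>lv ` F. (2 * real (R n) + 1) ^ CARD('d) * g n)"
  proof (rule sum_mono)
    fix n
    have "card {h \<in> F. lv h = n} \<le> card (centered_box (R n) :: 'd site set)"
      using R by (intro card_mono) (auto simp: snorm_le_centered_box[symmetric])
    then have "real (card {h \<in> F. lv h = n}) \<le> (2 * real (R n) + 1) ^ CARD('d)"
      using real_card_centered_box[of "R n", where 'd = 'd] by simp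
    then show "(\<Sum>h\<in>{h \<in> F. lv h = n}. g (lv h)) \<le> (2 * real (R n) + 1) ^ CARD('d) * g n"
      using g[of n] by (simp add: mult_right_mono cong: conj_cong)
  qed
  also have "\<dots> \<le> (\<Sum>n. (2 * real (R n) + 1) ^ CARD('d) * g n)"
    using sm F g by (intro sum_le_suminf) auto
  finally show ?thesis .
qed

text \<open>The product of two weights is at most half the sum of their squares, and evenness of
  \<open>w\<close> makes the two resulting double sums equal. A bound on row sums thus becomes a
  bound by the squared weights.\<close>

lemma schur_test:
  fixes w :: "'d::finite site \<Rightarrow> real" and a :: "'d site \<Rightarrow> real"
  assumes \<Gamma>: "finite \<Gamma>" and w: "\<And>h. 0 \<le> w h" "\<And>h. w (- h) = w h"
    and P: "\<And>F. finite F \<Longrightarrow> (\<Sum>h\<in>F. w h) \<le> P"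
  shows "(\<Sum>i\<in>\<Gamma>. \<Sum>l\<in>\<Gamma>. \<bar>a i\<bar> * \<bar>a l\<bar> * w (l - i)) \<le> P * (\<Sum>i\<in>\<Gamma>. (a i)\<^sup>2)"
proof -
  have w': "w (i - l) = w (l - i)" for i l using w(2)[of "l - i"] by simp
  have "(\<Sum>l\<in>\<Gamma>. w (l - i)) \<le> P" for i
  proof -
    have "(\<Sum>l\<in>\<Gamma>. w (l - i)) = (\<Sum>h\<in>(\<lambda>l. l - i) ` \<Gamma>. w h)"
      by (subst sum.reindex) (auto simp: inj_on_def)
    then show ?thesis using P \<Gamma> by simp
  qed
  then have 1: "(\<Sum>i\<in>\<Gamma>. \<Sum>l\<in>\<Gamma>. (a i)\<^sup>2 * w (l - i)) \<le> (\<Sum>i\<in>\<Gamma>. (a i)\<^sup>2 * P)"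
    by (intro sum_mono) (simp add: sum_distrib_left[symmetric] mult_left_mono)
  have 2: "(\<Sum>i\<in>\<Gamma>. \<Sum>l\<in>\<Gamma>. (a l)\<^sup>2 * w (l - i)) = (\<Sum>i\<in>\<Gamma>. \<Sum>l\<in>\<Gamma>. (a i)\<^sup>2 * w (l - i))"
    by (subst sum.swap) (simp add: w')
  have "(\<Sum>i\<in>\<Gamma>. \<Sum>l\<in>\<Gamma>. \<bar>a i\<bar> * \<bar>a l\<bar> * w (l - i)) \<le>
      (\<Sum>i\<in>\<Gamma>. \<Sum>l\<in>\<Gamma>. 1 / 2 * ((a i)\<^sup>2 * w (l - i)) + 1 / 2 * ((a l)\<^sup>2 * w (l - i)))"
  proof (intro sum_mono)
    fix i l
    have "0 \<le> (\<bar>a i\<bar> - \<bar>a l\<bar>)\<^sup>2" by simp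
    then have "\<bar>a i\<bar> * \<bar>a l\<bar> \<le> 1 / 2 * (a i)\<^sup>2 + 1 / 2 * (a l)\<^sup>2"
      by (simp add: power2_diff)
    then have "\<bar>a i\<bar> * \<bar>a l\<bar> * w (l - i) \<le> (1 / 2 * (a i)\<^sup>2 + 1 / 2 * (a l)\<^sup>2) * w (l - i)"
      by (rule mult_right_mono) (rule w(1))
    then show "\<bar>a i\<bar> * \<bar>a l\<bar> * w (l - i) \<le> 1 / 2 * ((a i)\<^sup>2 * w (l - i)) + 1 / 2 * ((a l)\<^sup>2 * w (l - i))"
      by (simp only: distrib_right mult.assoc)
  qed
  also have "\<dots> = 1 / 2 * (\<Sum>i\<in>\<Gamma>. \<Sum>l\<in>\<Gamma>. (a i)\<^sup>2 * w (l - i)) +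
      1 / 2 * (\<Sum>i\<in>\<Gamma>. \<Sum>l\<in>\<Gamma>. (a l)\<^sup>2 * w (l - i))"
    unfolding sum.distrib sum_distrib_left ..
  also have "\<dots> = (\<Sum>i\<in>\<Gamma>. \<Sum>l\<in>\<Gamma>. (a i)\<^sup>2 * w (l - i))"
    unfolding 2 by linarith
  also have "\<dots> \<le> (\<Sum>i\<in>\<Gamma>. (a i)\<^sup>2 * P)" by (rule 1)
  finally show ?thesis unfolding sum_distrib_right[symmetric] by (simp only: mult.commute)
qed

text \<open>In the factored difference every power is bounded by the larger of \<open>|x|\<close>
  and \<open>|y|\<close>. For even \<open>m\<close> the \<open>m\<close>-th power of the latter is
  at most \<open>x ^ m + y ^ m\<close>, which integrates to even moments.\<close>

lemma abs_power_diff_le_even: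
  fixes x y :: real
  assumes "even m"
  shows "\<bar>x ^ Suc m - y ^ Suc m\<bar> \<le> real (Suc m) * \<bar>x - y\<bar> * (x ^ m + y ^ m)"
proof -
  define M where "M = max \<bar>x\<bar> \<bar>y\<bar>"
  have M: "M ^ m \<le> x ^ m + y ^ m"
    using assms zero_le_even_power[OF assms, of x] zero_le_even_power[OF assms, of y]
    by (auto simp: M_def max_def power_even_abs)
  have "\<bar>\<Sum>p<Suc m. x ^ p * y ^ (m - p)\<bar> \<le> (\<Sum>p<Suc m. M ^ m)"
  proof (rule order.trans[OF sum_abs sum_mono])
    fix p assume p: "p \<in> {..<Suc m}"
    have "\<bar>x ^ p * y ^ (m - p)\<bar> \<le> M ^ p * M ^ (m - p)"
      unfolding abs_mult power_abs by (intro mult_mono power_mono) (auto simp: M_def)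
    also have "\<dots> = M ^ m" using p by (simp add: power_add[symmetric])
    finally show "\<bar>x ^ p * y ^ (m - p)\<bar> \<le> M ^ m" .
  qed
  also have "\<dots> = real (Suc m) * M ^ m" by simp
  also have "\<dots> \<le> real (Suc m) * (x ^ m + y ^ m)" using M by (intro mult_left_mono) auto
  finally have "\<bar>x - y\<bar> * \<bar>\<Sum>p<Suc m. x ^ p * y ^ (m - p)\<bar> \<le> \<bar>x - y\<bar> * (real (Suc m) * (x ^ m + y ^ m))"
    by (intro mult_left_mono) auto
  then show ?thesis
    by (simp only: diff_power_eq_sum abs_mult mult.assoc mult.left_commute)
qed


section \<open>Random fields with strong mixing\<close>

lemma norm_integral_le:
  fixes f :: "'b \<Rightarrow> 'e::{banach, second_countable_topology}"
  assumes "integrable M g" "\<And>x. x \<in> space M \<Longrightarrow> norm (f x) \<le> g x"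
  shows "norm (\<integral>x. f x \<partial>M) \<le> (\<integral>x. g x \<partial>M)"
proof -
  have "(\<integral>x. norm (f x) \<partial>M) \<le> (\<integral>x. g x \<partial>M)"
    by (rule integral_mono'[OF assms]) (use assms(2) norm_ge_zero order_trans in blast)+
  then show ?thesis using integral_norm_bound[of M f] by linarith
qed

text \<open>All that later arguments retain of the Markov property and strong spatial mixing. The
  error is linear in \<open>card U\<close> and in the \<open>L1\<close> norm of \<open>F\<close>,
  and \<open>G\<close> enters only through its distance; the factor 2 from total variation is
  absorbed in \<open>C\<close>.\<close>

locale mixing_field = prob_space \<mu> for \<mu> :: "('d::finite, 'a::finite) config measure" +
  fixes C c :: real
  assumes sets_eq: "sets \<mu> = sets borel"
    and shift_inv: "shift_invariant \<mu>"
    and C_pos: "0 < C" and c_pos: "0 < c"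
    and mixing: "\<And>U G r b (f :: ('d, 'a) config \<Rightarrow> real) (F :: ('d, 'a) config \<Rightarrow> complex).
      finite U \<Longrightarrow> finite G \<Longrightarrow> 0 < r \<Longrightarrow> (\<And>u g. u \<in> U \<Longrightarrow> g \<in> G \<Longrightarrow> r \<le> snorm (u - g)) \<Longrightarrow>
      depends_on f U \<Longrightarrow> depends_on F G \<Longrightarrow> (\<And>x. \<bar>f x\<bar> \<le> b) \<Longrightarrow>
      norm ((\<integral>x. f x *\<^sub>R F x \<partial>\<mu>) - (\<integral>x. f x \<partial>\<mu>) *\<^sub>R (\<integral>x. F x \<partial>\<mu>))
        \<le> b * (C * real (card U) * exp (- c * real r)) * (\<integral>x. norm (F x) \<partial>\<mu>)"

lemma mixing_field_of_strong_spatial_mixing: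
  assumes "prob_space \<mu>" "sets \<mu> = sets borel" "shift_invariant \<mu>"
    and "markov_random_field \<mu>" "exp_strong_spatial_mixing \<mu>"
  obtains C c where "mixing_field \<mu> C c"
proof -
  from assms(5)[unfolded exp_strong_spatial_mixing_def] obtain C c where Cc: "0 < C" "0 < c"
    and ssm: "\<forall>V U. finite V \<longrightarrow> U \<subseteq> V \<longrightarrow>
          (\<forall>\<tau> \<in> (\<lambda>x. restrict x (outer_boundary V)) ` topological_support \<mu>.
           \<forall>\<tau>' \<in> (\<lambda>x. restrict x (outer_boundary V)) ` topological_support \<mu>.
             total_variation (conditional_marginal \<mu> V U \<tau>) (conditional_marginal \<mu> V U \<tau>')
               \<le> C * real (card U) *
                   exp_decay c (graph_dist U {i \<in> outer_boundary V. \<tau> i \<noteq> \<tau>' i}))"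
    by (elim exE conjE)
  have "mixing_field \<mu> (2 * C) c"
  proof (intro mixing_field.intro mixing_field_axioms.intro assms)
    fix U G r b and f :: "('a, 'b) config \<Rightarrow> real" and F :: "('a, 'b) config \<Rightarrow> complex"
    assume *: "finite U" "finite G" "0 < r" "\<And>u g. u \<in> U \<Longrightarrow> g \<in> G \<Longrightarrow> r \<le> snorm (u - g)"
      "depends_on f U" "depends_on F G" "\<And>x. \<bar>f x\<bar> \<le> b"
    show "norm ((\<integral>x. f x *\<^sub>R F x \<partial>\<mu>) - (\<integral>x. f x \<partial>\<mu>) *\<^sub>R (\<integral>x. F x \<partial>\<mu>))
        \<le> b * (2 * C * real (card U) * exp (- c * real r)) * (\<integral>x. norm (F x) \<partial>\<mu>)"
    proof -
      have "norm ((\<integral>x. f x *\<^sub>R F x \<partial>\<mu>) - (\<integral>x. f x \<partial>\<mu>) *\<^sub>R (\<integral>x. F x \<partial>\<mu>))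
          \<le> 2 * b * (C * real (card U) * exp (- c * real r)) * (\<integral>x. norm (F x) \<partial>\<mu>)"
        by (rule mixing_cylinder_functions[OF assms(1,2,4) Cc(2,1)])
          (use * in \<open>auto intro!: ssm[rule_format]\<close>)
      then show ?thesis by (simp only: mult_ac)
    qed
  qed (use Cc in auto)
  then show ?thesis by (rule that)
qed

lemma continuous_lattice_shift:
  "continuous_on S (lattice_shift i :: ('d::finite, 'a) config \<Rightarrow> ('d, 'a) config)"
proof -
  have "continuous_on UNIV (lattice_shift i :: ('d, 'a) config \<Rightarrow> ('d, 'a) config)"
    unfolding lattice_shift_def
    by (intro continuous_on_coordinatewise_then_product continuous_on_product_coordinates)
  then show ?thesis by (rule continuous_on_subset) simp
qed

lemma lattice_shift_add: "lattice_shift i (lattice_shift j x) = lattice_shift (j + i) x"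
  by (simp add: lattice_shift_def add.assoc)

lemma lattice_shift_0 [simp]: "lattice_shift 0 x = x"
  by (simp add: lattice_shift_def)

lemma depends_on_shift:
  "depends_on u U \<Longrightarrow> depends_on (\<lambda>x. u (lattice_shift i x)) ((\<lambda>h. i + h) ` U)"
  unfolding depends_on_def lattice_shift_def by auto

text \<open>Real weights serve both limit theorems: constants on a Foelner set, and for the process
  products of cell fractions, their differences and linear combinations.\<close>

definition wsum :: "('d::finite site \<Rightarrow> real) \<Rightarrow> 'd site set \<Rightarrow> (('d, 'a) config \<Rightarrow> real)
    \<Rightarrow> ('d, 'a) config \<Rightarrow> real" where
  "wsum a \<Gamma> u x = (\<Sum>i\<in>\<Gamma>. a i * u (lattice_shift i x))"

definition footprint :: "nat \<Rightarrow> 'd::finite site set \<Rightarrow> 'd site set" where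
  "footprint k \<Gamma> = (\<Union>j\<in>\<Gamma>. (\<lambda>h. j + h) ` centered_box k)"

lemma finite_footprint: "finite \<Gamma> \<Longrightarrow> finite (footprint k \<Gamma>)"
  by (auto simp: footprint_def)

lemma wsum_cong_footprint:
  assumes "depends_on u (centered_box k)" "\<And>i. i \<in> footprint k \<Gamma> \<Longrightarrow> x i = y i"
  shows "wsum a \<Gamma> u x = wsum a \<Gamma> u y"
  unfolding wsum_def
proof (intro sum.cong refl)
  fix i assume "i \<in> \<Gamma>"
  then have "u (lattice_shift i x) = u (lattice_shift i y)"
    using assms(2) by (intro depends_onD[OF assms(1)]) (auto simp: footprint_def lattice_shift_def)
  then show "a i * u (lattice_shift i x) = a i * u (lattice_shift i y)" by simp
qed

text \<open>In the passage from order \<open>2 q\<close> to \<open>2 q + 2\<close>, the factor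
  \<open>2 q + 1\<close> comes from the difference of two powers, and 2 from the moments of the two
  sums, with and without the removed site.\<close>

primrec moment_const :: "nat \<Rightarrow> real" where
  "moment_const 0 = 1"
| "moment_const (Suc q) = 2 * (2 * real q + 1) * moment_const q"

lemma moment_const_pos: "0 < moment_const q"
  by (induction q) auto

section \<open>Correlation bounds and even moments in a mixing field\<close>

context mixing_field
begin

lemma space_eq [simp]: "space \<mu> = UNIV"
  using sets_eq_imp_space_eq[OF sets_eq] by simp

lemma measurable_shift [measurable]: "lattice_shift i \<in> measurable \<mu> \<mu>"
proof -
  have "lattice_shift i \<in> borel_measurable (borel :: ('d, 'a) config measure)"
    by (intro borel_measurable_continuous_onI continuous_lattice_shift)
  then show ?thesis by (simp add: measurable_cong_sets[OF sets_eq sets_eq])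
qed

lemma distr_shift: "distr \<mu> \<mu> (lattice_shift i) = \<mu>"
  using shift_inv by (simp add: shift_invariant_def)

lemma integral_shift:
  fixes g :: "_ \<Rightarrow> 'e::{banach, second_countable_topology}"
  assumes "g \<in> borel_measurable \<mu>"
  shows "(\<integral>x. g (lattice_shift i x) \<partial>\<mu>) = (\<integral>x. g x \<partial>\<mu>)"
  using integral_distr[OF measurable_shift[of i] assms] by (simp add: distr_shift)

lemma AE_shift:
  assumes "AE x in \<mu>. P x"
  shows "AE x in \<mu>. P (lattice_shift i x)"
  using AE_distrD[OF measurable_shift[of i], of P] assms by (simp only: distr_shift)

lemma integrable_bounded:
  fixes g :: "_ \<Rightarrow> 'e::{banach, second_countable_topology}"
  assumes "g \<in> borel_measurable \<mu>" "\<And>x. norm (g x) \<le> B"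
  shows "integrable \<mu> g"
  using assms by (intro integrable_const_bound[of _ B]) auto

lemma integrable_depends_on:
  fixes g :: "_ \<Rightarrow> 'e::{banach, second_countable_topology}"
  assumes "finite U" "depends_on g U"
  shows "integrable \<mu> g"
  using bounded_depends_on[OF assms] measurable_depends_on[OF assms sets_eq] integrable_bounded
  by metis

definition local_obs :: "nat \<Rightarrow> real \<Rightarrow> (('d, 'a) config \<Rightarrow> real) \<Rightarrow> bool" where
  "local_obs k b u \<longleftrightarrow> depends_on u (centered_box k) \<and> (\<forall>x. \<bar>u x\<bar> \<le> b) \<and> (\<integral>x. u x \<partial>\<mu>) = 0"

lemma local_obs_bound: "local_obs k b u \<Longrightarrow> \<bar>u x\<bar> \<le> b"
  by (simp add: local_obs_def)

lemma local_obs_nonneg: "local_obs k b u \<Longrightarrow> 0 \<le> b"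
  using local_obs_bound[of k b u undefined] by linarith

lemma local_obs_measurable: "local_obs k b u \<Longrightarrow> u \<in> borel_measurable \<mu>"
  unfolding local_obs_def by (intro measurable_depends_on[OF _ _ sets_eq, of "centered_box k"]) auto

lemma depends_on_wsum:
  assumes "local_obs k b u"
  shows "depends_on (\<lambda>x. \<Phi> (wsum a \<Gamma> u x)) (footprint k \<Gamma>)"
  unfolding depends_on_def
proof clarify
  fix x y :: "('d, 'a) config" assume *: "\<forall>j\<in>footprint k \<Gamma>. x j = y j"
  have "depends_on u (centered_box k)" using assms by (simp add: local_obs_def)
  then have "wsum a \<Gamma> u x = wsum a \<Gamma> u y" using * by (intro wsum_cong_footprint) auto
  then show "\<Phi> (wsum a \<Gamma> u x) = \<Phi> (wsum a \<Gamma> u y)" by simp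
qed

lemma integrable_wsum:
  fixes \<Phi> :: "real \<Rightarrow> 'e::{banach, second_countable_topology}"
  assumes "local_obs k b u" "finite \<Gamma>"
  shows "integrable \<mu> (\<lambda>x. \<Phi> (wsum a \<Gamma> u x))"
  using integrable_depends_on[OF finite_footprint[OF assms(2)] depends_on_wsum[OF assms(1)]] .

text \<open>For \<open>r > 3 * k\<close> this dominates the mixing error between a box of radius
  \<open>k\<close> and boxes of that radius whose centres are at distance \<open>r\<close>: the box
  has at most \<open>(2 * r + 1) ^ d\<close> sites, and the gap \<open>r - 2 * k\<close> is at least
  \<open>r / 3\<close>. The range \<open>k\<close> thus disappears from the tail.\<close>

definition decay :: "nat \<Rightarrow> real" where
  "decay r = C * (2 * real r + 1) ^ CARD('d) * exp (- (c / 3) * real r)"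

definition corr :: "nat \<Rightarrow> nat \<Rightarrow> real" where
  "corr k r = (if r \<le> 3 * k then 1 else 0) + decay r"

lemma decay_nonneg: "0 \<le> decay r"
  using C_pos by (simp add: decay_def)

lemma corr_nonneg: "0 \<le> corr k r"
  using decay_nonneg by (simp add: corr_def add_nonneg_nonneg)

lemma summable_decay: "summable (\<lambda>r. (2 * real r + 1) ^ CARD('d) * decay r)"
proof -
  have "summable (\<lambda>r. C * ((2 * real r + 1) ^ (CARD('d) + CARD('d)) * exp (- (c / 3) * real r)))"
    using c_pos by (intro summable_mult summable_power_mult_exp) simp
  then show ?thesis by (simp add: decay_def power_add mult_ac)
qed

text \<open>The first summand counts the sites with only the trivial bound and carries all the
  growth in \<open>k\<close>, of order \<open>k ^ d\<close>; the second does not involve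
  \<open>k\<close>.\<close>

definition corr_sum :: "nat \<Rightarrow> real" where
  "corr_sum k = (6 * real k + 1) ^ CARD('d) + (\<Sum>r. (2 * real r + 1) ^ CARD('d) * decay r)"

lemma sum_decay_le:
  "finite F \<Longrightarrow> (\<Sum>h\<in>F. decay (snorm (h :: 'd site))) \<le> (\<Sum>r. (2 * real r + 1) ^ CARD('d) * decay r)"
  by (rule lattice_sum_bound[where R = "\<lambda>n. n"]) (auto simp: decay_nonneg summable_decay)

lemma sum_corr_le:
  assumes "finite F"
  shows "(\<Sum>h\<in>F. corr k (snorm (h :: 'd site))) \<le> corr_sum k"
proof -
  have "(\<Sum>h\<in>F. if snorm h \<le> 3 * k then 1 else 0 :: real) = real (card (F \<inter> {h. snorm h \<le> 3 * k}))"
    using assms by (simp add: sum.If_cases)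
  also have "\<dots> \<le> real (card (centered_box (3 * k) :: 'd site set))"
    by (intro of_nat_mono card_mono) (auto simp: snorm_le_centered_box)
  also have "\<dots> = (6 * real k + 1) ^ CARD('d)" by (simp add: real_card_centered_box)
  finally show ?thesis
    using sum_decay_le[OF assms] by (simp add: corr_def corr_sum_def sum.distrib)
qed

lemma decay_sum_nonneg: "0 \<le> (\<Sum>r. (2 * real r + 1) ^ CARD('d) * decay r)"
  using decay_nonneg by (intro suminf_nonneg summable_decay) simp

lemma corr_sum_ge_1: "1 \<le> corr_sum k"
proof -
  have "1 \<le> (6 * real k + 1) ^ CARD('d)" by (rule one_le_power) simp
  then show ?thesis using decay_sum_nonneg unfolding corr_sum_def by linarith
qed

text \<open>The shifted \<open>u\<close> and the function \<open>F\<close> each reach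
  \<open>k\<close> beyond their sites, so the usable gap is \<open>r - 2 * k\<close>. For
  \<open>r \<le> 3 * k\<close> the integrand is estimated by its absolute value.\<close>

lemma decorrelate:
  fixes F :: "('d, 'a) config \<Rightarrow> complex"
  assumes u: "local_obs k b u" and \<Gamma>: "finite \<Gamma>" and r: "\<And>j. j \<in> \<Gamma> \<Longrightarrow> r \<le> snorm (j - i)"
    and F: "depends_on F (footprint k \<Gamma>)"
  shows "norm (\<integral>x. u (lattice_shift i x) *\<^sub>R F x \<partial>\<mu>) \<le> b * corr k r * (\<integral>x. norm (F x) \<partial>\<mu>)"
proof -
  have b0: "0 \<le> b" using local_obs_nonneg[OF u] .
  have ub: "\<bar>u x\<bar> \<le> b" for x using local_obs_bound[OF u] .
  have fin: "finite (footprint k \<Gamma>)" using finite_footprint[OF \<Gamma>] .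
  have [measurable]: "F \<in> borel_measurable \<mu>" by (rule measurable_depends_on[OF fin F sets_eq])
  have [measurable]: "u \<in> borel_measurable \<mu>" by (rule local_obs_measurable[OF u])
  obtain BF where BF: "\<And>x. norm (F x) \<le> BF" using bounded_depends_on[OF fin F] by blast
  have intF: "integrable \<mu> (\<lambda>x. norm (F x))" using BF by (intro integrable_bounded) auto
  have IF0: "0 \<le> (\<integral>x. norm (F x) \<partial>\<mu>)" by simp
  show ?thesis
  proof (cases "r \<le> 3 * k")
    case True
    have "norm (\<integral>x. u (lattice_shift i x) *\<^sub>R F x \<partial>\<mu>) \<le> (\<integral>x. b * norm (F x) \<partial>\<mu>)"
      using intF ub by (intro norm_integral_le) (auto intro!: mult_right_mono)
    also have "\<dots> = b * 1 * (\<integral>x. norm (F x) \<partial>\<mu>)" by simp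
    also have "\<dots> \<le> b * corr k r * (\<integral>x. norm (F x) \<partial>\<mu>)"
      using True decay_nonneg b0 by (intro mult_right_mono mult_left_mono IF0) (auto simp: corr_def)
    finally show ?thesis .
  next
    case False
    let ?U = "(\<lambda>h. i + h) ` centered_box k"
    have cardU: "card ?U = (2 * k + 1) ^ CARD('d)"
      by (subst card_image) (auto simp: inj_on_def card_centered_box)
    have mean: "(\<integral>x. u (lattice_shift i x) \<partial>\<mu>) = 0"
      using u by (simp add: integral_shift local_obs_def)
    have "norm ((\<integral>x. u (lattice_shift i x) *\<^sub>R F x \<partial>\<mu>) -
          (\<integral>x. u (lattice_shift i x) \<partial>\<mu>) *\<^sub>R (\<integral>x. F x \<partial>\<mu>))
        \<le> b * (C * real (card ?U) * exp (- c * real (r - 2 * k))) * (\<integral>x. norm (F x) \<partial>\<mu>)"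
    proof (rule mixing[OF _ fin])
      show "r - 2 * k \<le> snorm (p - g)" if "p \<in> ?U" "g \<in> footprint k \<Gamma>" for p g
      proof -
        from that(1) obtain h where h: "p = i + h" "h \<in> centered_box k" by blast
        from that(2) obtain j h' where j: "j \<in> \<Gamma>" "g = j + h'" "h' \<in> centered_box k"
          unfolding footprint_def by blast
        have e: "j - i = (g - p) + (h + - h')" using h j by simp
        have "snorm (j - i) \<le> snorm (g - p) + (snorm h + snorm (- h'))"
          using snorm_add[of "g - p" "h + - h'"] snorm_add[of h "- h'"] unfolding e by linarith
        then show ?thesis using r[OF j(1)] h(2) j(3) snorm_commute[of p g]
          by (simp add: snorm_le_centered_box[symmetric])
      qed
      show "depends_on (\<lambda>x. u (lattice_shift i x)) ?U"
        using u by (intro depends_on_shift) (simp add: local_obs_def)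
    qed (use False F ub in auto)
    also have "\<dots> \<le> b * corr k r * (\<integral>x. norm (F x) \<partial>\<mu>)"
    proof (intro mult_right_mono mult_left_mono IF0 b0)
      have 1: "real (card ?U) \<le> (2 * real r + 1) ^ CARD('d)"
        using False unfolding cardU by (simp add: power_mono)
      have 2: "exp (- c * real (r - 2 * k)) \<le> exp (- (c / 3) * real r)"
      proof -
        have "real r / 3 \<le> real (r - 2 * k)" using False by simp
        then have "c * (real r / 3) \<le> c * real (r - 2 * k)" using c_pos by (intro mult_left_mono) auto
        then show ?thesis by simp
      qed
      have "C * real (card ?U) * exp (- c * real (r - 2 * k)) \<le> decay r"
        unfolding decay_def by (rule mult_mono[OF mult_left_mono[OF 1] 2]) (use C_pos in auto)
      then show "C * real (card ?U) * exp (- c * real (r - 2 * k)) \<le> corr k r"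
        by (rule order_trans) (simp add: corr_def)
    qed
    finally show ?thesis using mean by simp
  qed
qed

text \<open>Removing the sites of \<open>\<Gamma>\<close> one at a time, nearest to \<open>i\<close> first, each increment of \<open>\<Phi>\<close> only
  sees sites at least as far from \<open>i\<close> as the removed one.\<close>

lemma decorrelate_telescope:
  fixes \<Phi> :: "real \<Rightarrow> complex"
  assumes u: "local_obs k b u" and \<Gamma>: "finite \<Gamma>"
    and K: "\<And>\<Gamma>' l. \<Gamma>' \<subseteq> \<Gamma> \<Longrightarrow> l \<in> \<Gamma>' \<Longrightarrow>
      (\<integral>x. norm (\<Phi> (wsum a \<Gamma>' u x) - \<Phi> (wsum a (\<Gamma>' - {l}) u x)) \<partial>\<mu>) \<le> K * \<bar>a l\<bar>"
  shows "norm (\<integral>x. u (lattice_shift i x) *\<^sub>R \<Phi> (wsum a \<Gamma> u x) \<partial>\<mu>)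
    \<le> (\<Sum>l\<in>\<Gamma>. b * corr k (snorm (l - i)) * (K * \<bar>a l\<bar>))"
  using \<Gamma> K
proof (induction \<Gamma> rule: finite_psubset_induct)
  case (psubset \<Gamma>)
  have b0: "0 \<le> b" using local_obs_nonneg[OF u] .
  have [measurable]: "u \<in> borel_measurable \<mu>" by (rule local_obs_measurable[OF u])
  have int: "integrable \<mu> (\<lambda>x. u (lattice_shift i x) *\<^sub>R \<Phi> (wsum a \<Gamma>' u x))" if "finite \<Gamma>'" for \<Gamma>'
  proof -
    have "depends_on (\<lambda>x. u (lattice_shift i x) *\<^sub>R \<Phi> (wsum a \<Gamma>' u x)) (footprint k (insert i \<Gamma>'))"
      unfolding depends_on_def
    proof clarify
      fix x y :: "('d, 'a) config" assume *: "\<forall>j\<in>footprint k (insert i \<Gamma>'). x j = y j"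
      have "u (lattice_shift i x) = u (lattice_shift i y)"
        using * u by (intro depends_onD[of u "centered_box k"])
          (auto simp: local_obs_def footprint_def lattice_shift_def)
      moreover have "wsum a \<Gamma>' u x = wsum a \<Gamma>' u y"
        using * u by (intro wsum_cong_footprint[of u k]) (auto simp: local_obs_def footprint_def)
      ultimately show "u (lattice_shift i x) *\<^sub>R \<Phi> (wsum a \<Gamma>' u x) = u (lattice_shift i y) *\<^sub>R \<Phi> (wsum a \<Gamma>' u y)"
        by simp
    qed
    then show ?thesis by (rule integrable_depends_on[rotated]) (use that in \<open>auto intro: finite_footprint\<close>)
  qed
  show ?case
  proof (cases "\<Gamma> = {}")
    case True
    \<comment> \<open>With no sites left only the constant \<open>\<Phi> 0\<close> remains, and
      \<open>u\<close> is centred.\<close>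
    have "integrable \<mu> (\<lambda>x. u (lattice_shift i x))"
      using local_obs_bound[OF u] by (intro integrable_bounded[of _ b]) auto
    then have "(\<integral>x. u (lattice_shift i x) *\<^sub>R \<Phi> 0 \<partial>\<mu>) = (\<integral>x. u (lattice_shift i x) \<partial>\<mu>) *\<^sub>R \<Phi> 0"
      by (intro integral_scaleR_left)
    then show ?thesis using u True by (simp add: wsum_def integral_shift local_obs_def)
  next
    case False
    define l where "l = arg_min_on (\<lambda>l. snorm (l - i)) \<Gamma>"
    have l: "l \<in> \<Gamma>" "\<And>j. j \<in> \<Gamma> \<Longrightarrow> snorm (l - i) \<le> snorm (j - i)"
      using arg_min_if_finite[OF psubset.hyps False, of "\<lambda>l. snorm (l - i)"]
      by (auto simp: l_def not_less)
    define F where "F x = \<Phi> (wsum a \<Gamma> u x) - \<Phi> (wsum a (\<Gamma> - {l}) u x)" for x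
    have F: "depends_on F (footprint k \<Gamma>)"
      unfolding depends_on_def
    proof clarify
      fix x y :: "('d, 'a) config" assume *: "\<forall>j\<in>footprint k \<Gamma>. x j = y j"
      have dep: "depends_on u (centered_box k)" using u by (simp add: local_obs_def)
      have "wsum a \<Gamma> u x = wsum a \<Gamma> u y"
        using * by (intro wsum_cong_footprint[OF dep]) auto
      moreover have "wsum a (\<Gamma> - {l}) u x = wsum a (\<Gamma> - {l}) u y"
        using * by (intro wsum_cong_footprint[OF dep]) (auto simp: footprint_def)
      ultimately show "F x = F y" by (simp add: F_def)
    qed
    have "(\<integral>x. u (lattice_shift i x) *\<^sub>R \<Phi> (wsum a \<Gamma> u x) \<partial>\<mu>) =
        (\<integral>x. u (lattice_shift i x) *\<^sub>R F x \<partial>\<mu>) +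
        (\<integral>x. u (lattice_shift i x) *\<^sub>R \<Phi> (wsum a (\<Gamma> - {l}) u x) \<partial>\<mu>)"
      using int[OF psubset.hyps] int[of "\<Gamma> - {l}"] psubset.hyps
      by (simp add: F_def scaleR_diff_right)
    then have "norm (\<integral>x. u (lattice_shift i x) *\<^sub>R \<Phi> (wsum a \<Gamma> u x) \<partial>\<mu>) \<le>
        norm (\<integral>x. u (lattice_shift i x) *\<^sub>R F x \<partial>\<mu>) +
        norm (\<integral>x. u (lattice_shift i x) *\<^sub>R \<Phi> (wsum a (\<Gamma> - {l}) u x) \<partial>\<mu>)"
      by (simp add: norm_triangle_ineq)
    also have "norm (\<integral>x. u (lattice_shift i x) *\<^sub>R F x \<partial>\<mu>) \<le>
        b * corr k (snorm (l - i)) * (\<integral>x. norm (F x) \<partial>\<mu>)"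
      by (rule decorrelate[OF u psubset.hyps l(2) F])
    also have "\<dots> \<le> b * corr k (snorm (l - i)) * (K * \<bar>a l\<bar>)"
      using psubset.prems[of \<Gamma> l] l b0 corr_nonneg
      by (intro mult_left_mono) (auto simp: F_def)
    \<comment> \<open>The constant \<open>K\<close> is assumed for all subsets of \<Gamma>, so the
      assumption passes to the smaller set.\<close>
    also have "norm (\<integral>x. u (lattice_shift i x) *\<^sub>R \<Phi> (wsum a (\<Gamma> - {l}) u x) \<partial>\<mu>) \<le>
        (\<Sum>j\<in>\<Gamma> - {l}. b * corr k (snorm (j - i)) * (K * \<bar>a j\<bar>))"
      using l by (intro psubset.IH) (auto intro!: psubset.prems)
    also have "b * corr k (snorm (l - i)) * (K * \<bar>a l\<bar>) +
        (\<Sum>j\<in>\<Gamma> - {l}. b * corr k (snorm (j - i)) * (K * \<bar>a j\<bar>)) =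
        (\<Sum>j\<in>\<Gamma>. b * corr k (snorm (j - i)) * (K * \<bar>a j\<bar>))"
      by (rule sum.remove[OF psubset.hyps l(1), symmetric])
    finally show ?thesis by simp
  qed
qed

lemma wsum_diff_remove:
  assumes "finite \<Gamma>" "l \<in> \<Gamma>"
  shows "wsum a \<Gamma> u x - wsum a (\<Gamma> - {l}) u x = a l * u (lattice_shift l x)"
  using assms by (simp add: wsum_def sum.remove)

lemma abs_wsum_diff_remove:
  assumes "local_obs k b u" "finite \<Gamma>" "l \<in> \<Gamma>"
  shows "\<bar>wsum a \<Gamma> u x - wsum a (\<Gamma> - {l}) u x\<bar> \<le> b * \<bar>a l\<bar>"
proof -
  have "\<bar>a l\<bar> * \<bar>u (lattice_shift l x)\<bar> \<le> \<bar>a l\<bar> * b"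
    by (intro mult_left_mono local_obs_bound[OF assms(1)]) simp
  then show ?thesis
    unfolding wsum_diff_remove[OF assms(2,3)] abs_mult by (simp add: mult.commute)
qed

text \<open>One factor is expanded: with \<open>S\<close> the weighted sum,
  \<open>S ^ (2 q + 2)\<close> is the sum over \<open>i\<close> of \<open>a i\<close> times the
  shifted \<open>u\<close> times \<open>S ^ (2 q + 1)\<close>. Telescoping each term leaves
  \<open>L1\<close> norms of increments, which are bounded by moments of order \<open>2 q\<close> of
  sums over subsets; hence the induction runs over all \<Gamma> at once. The remaining double sum is
  a quadratic form for the Schur test.\<close>

lemma moment_bound:
  assumes u: "local_obs k b u" and \<Gamma>: "finite \<Gamma>"
  shows "(\<integral>x. wsum a \<Gamma> u x ^ (2 * q) \<partial>\<mu>) \<le>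
    moment_const q * (b\<^sup>2 * corr_sum k * (\<Sum>i\<in>\<Gamma>. (a i)\<^sup>2)) ^ q"
  using \<Gamma>
proof (induction q arbitrary: \<Gamma>)
  case 0
  then show ?case using prob_space by simp
next
  case (Suc q)
  have b0: "0 \<le> b" using local_obs_nonneg[OF u] .
  have [measurable]: "u \<in> borel_measurable \<mu>" by (rule local_obs_measurable[OF u])
  define A where "A = (\<Sum>i\<in>\<Gamma>. (a i)\<^sup>2)"
  define M where "M = moment_const q * (b\<^sup>2 * corr_sum k * A) ^ q"
  define K where "K = real (Suc (2 * q)) * b * (2 * M)"
  have cs: "0 \<le> corr_sum k" using corr_sum_ge_1[of k] by simp
  \<comment> \<open>Subsets have smaller sums of squared weights, so one bound \<open>M\<close>
    serves all sets met in the telescoping.\<close>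
  have IH: "(\<integral>x. wsum a \<Gamma>' u x ^ (2 * q) \<partial>\<mu>) \<le> M" if "\<Gamma>' \<subseteq> \<Gamma>" for \<Gamma>'
  proof -
    have fin: "finite \<Gamma>'" using that Suc.prems by (rule finite_subset)
    have "(\<Sum>i\<in>\<Gamma>'. (a i)\<^sup>2) \<le> A"
      unfolding A_def using that Suc.prems by (intro sum_mono2) auto
    then have "moment_const q * (b\<^sup>2 * corr_sum k * (\<Sum>i\<in>\<Gamma>'. (a i)\<^sup>2)) ^ q \<le> M"
      unfolding M_def using moment_const_pos[of q] cs
      by (intro mult_left_mono power_mono) (auto intro!: mult_nonneg_nonneg sum_nonneg)
    then show ?thesis using Suc.IH[OF fin] by linarith
  qed
  let ?\<Phi> = "\<lambda>s. complex_of_real (s ^ Suc (2 * q))"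
  have K: "(\<integral>x. norm (?\<Phi> (wsum a \<Gamma>' u x) - ?\<Phi> (wsum a (\<Gamma>' - {l}) u x)) \<partial>\<mu>) \<le> K * \<bar>a l\<bar>"
    if "\<Gamma>' \<subseteq> \<Gamma>" "l \<in> \<Gamma>'" for \<Gamma>' l
  proof -
    have fin: "finite \<Gamma>'" using that(1) Suc.prems by (rule finite_subset)
    let ?x = "\<lambda>x. wsum a \<Gamma>' u x" and ?y = "\<lambda>x. wsum a (\<Gamma>' - {l}) u x"
    have "(\<integral>x. norm (?\<Phi> (?x x) - ?\<Phi> (?y x)) \<partial>\<mu>) \<le>
        (\<integral>x. real (Suc (2 * q)) * (b * \<bar>a l\<bar>) * (?x x ^ (2 * q) + ?y x ^ (2 * q)) \<partial>\<mu>)"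
    proof (rule integral_mono)
      show "integrable \<mu> (\<lambda>x. norm (?\<Phi> (?x x) - ?\<Phi> (?y x)))"
        using fin by (intro integrable_norm Bochner_Integration.integrable_diff integrable_wsum[OF u]) auto
      show "integrable \<mu> (\<lambda>x. real (Suc (2 * q)) * (b * \<bar>a l\<bar>) * (?x x ^ (2 * q) + ?y x ^ (2 * q)))"
        using fin
        by (intro integrable_mult_right Bochner_Integration.integrable_add integrable_wsum[OF u]) auto
      fix x
      have "norm (?\<Phi> (?x x) - ?\<Phi> (?y x)) = \<bar>?x x ^ Suc (2 * q) - ?y x ^ Suc (2 * q)\<bar>"
        by (simp only: of_real_diff[symmetric] norm_of_real)
      also have "\<dots> \<le> real (Suc (2 * q)) * \<bar>?x x - ?y x\<bar> * (?x x ^ (2 * q) + ?y x ^ (2 * q))"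
        by (intro abs_power_diff_le_even) simp
      also have "\<dots> \<le> real (Suc (2 * q)) * (b * \<bar>a l\<bar>) * (?x x ^ (2 * q) + ?y x ^ (2 * q))"
        by (intro mult_right_mono mult_left_mono abs_wsum_diff_remove[OF u fin that(2)])
          (auto intro!: add_nonneg_nonneg)
      finally show "norm (?\<Phi> (?x x) - ?\<Phi> (?y x)) \<le>
        real (Suc (2 * q)) * (b * \<bar>a l\<bar>) * (?x x ^ (2 * q) + ?y x ^ (2 * q))" .
    qed
    also have "\<dots> = real (Suc (2 * q)) * (b * \<bar>a l\<bar>) *
        ((\<integral>x. ?x x ^ (2 * q) \<partial>\<mu>) + (\<integral>x. ?y x ^ (2 * q) \<partial>\<mu>))"
      using fin integrable_wsum[OF u, of _ "\<lambda>s. s ^ (2 * q)" a] by simp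
    also have "\<dots> \<le> real (Suc (2 * q)) * (b * \<bar>a l\<bar>) * (2 * M)"
    proof (rule mult_left_mono)
      have "\<Gamma>' - {l} \<subseteq> \<Gamma>" using that by blast
      then show "(\<integral>x. ?x x ^ (2 * q) \<partial>\<mu>) + (\<integral>x. ?y x ^ (2 * q) \<partial>\<mu>) \<le> 2 * M"
        using IH[of \<Gamma>'] IH[of "\<Gamma>' - {l}"] that by linarith
    qed (use b0 in simp)
    finally show ?thesis by (simp add: K_def mult_ac)
  qed
  have int_i: "integrable \<mu> (\<lambda>x. a i * (u (lattice_shift i x) * wsum a \<Gamma> u x ^ Suc (2 * q)))" if "i \<in> \<Gamma>" for i
  proof -
    obtain B where B: "\<And>x. norm (wsum a \<Gamma> u x ^ Suc (2 * q)) \<le> B"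
      using bounded_depends_on[OF finite_footprint[OF Suc.prems] depends_on_wsum[OF u, of "\<lambda>s. s ^ Suc (2 * q)" a \<Gamma>]]
      by blast
    have [measurable]: "(\<lambda>x. wsum a \<Gamma> u x ^ Suc (2 * q)) \<in> borel_measurable \<mu>"
      using integrable_wsum[OF u Suc.prems, of "\<lambda>s. s ^ Suc (2 * q)" a] by (rule borel_measurable_integrable)
    have "norm (u (lattice_shift i x) * wsum a \<Gamma> u x ^ Suc (2 * q)) \<le> b * B" for x
      unfolding norm_mult using B[of x] b0 local_obs_bound[OF u]
      by (intro mult_mono) auto
    moreover have "(\<lambda>x. u (lattice_shift i x) * wsum a \<Gamma> u x ^ Suc (2 * q)) \<in> borel_measurable \<mu>"
      by measurable
    ultimately show ?thesis
      by (intro integrable_mult_right integrable_bounded)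
  qed
  have "(\<integral>x. wsum a \<Gamma> u x ^ (2 * Suc q) \<partial>\<mu>) =
      (\<integral>x. (\<Sum>i\<in>\<Gamma>. a i * (u (lattice_shift i x) * wsum a \<Gamma> u x ^ Suc (2 * q))) \<partial>\<mu>)"
  proof (intro Bochner_Integration.integral_cong refl)
    fix x
    have "wsum a \<Gamma> u x ^ (2 * Suc q) = wsum a \<Gamma> u x * wsum a \<Gamma> u x ^ Suc (2 * q)" by simp
    also have "\<dots> = (\<Sum>i\<in>\<Gamma>. a i * (u (lattice_shift i x) * wsum a \<Gamma> u x ^ Suc (2 * q)))"
      by (subst (1) wsum_def) (simp only: sum_distrib_right mult.assoc)
    finally show "wsum a \<Gamma> u x ^ (2 * Suc q) =
      (\<Sum>i\<in>\<Gamma>. a i * (u (lattice_shift i x) * wsum a \<Gamma> u x ^ Suc (2 * q)))" .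
  qed
  also have "\<dots> = (\<Sum>i\<in>\<Gamma>. a i * (\<integral>x. u (lattice_shift i x) * wsum a \<Gamma> u x ^ Suc (2 * q) \<partial>\<mu>))"
    using int_i by (subst Bochner_Integration.integral_sum) auto
  also have "\<dots> \<le> (\<Sum>i\<in>\<Gamma>. \<bar>a i\<bar> * (\<Sum>l\<in>\<Gamma>. b * corr k (snorm (l - i)) * (K * \<bar>a l\<bar>)))"
  proof (rule sum_mono)
    fix i assume "i \<in> \<Gamma>"
    have "(\<integral>x. u (lattice_shift i x) *\<^sub>R ?\<Phi> (wsum a \<Gamma> u x) \<partial>\<mu>) =
        complex_of_real (\<integral>x. u (lattice_shift i x) * wsum a \<Gamma> u x ^ Suc (2 * q) \<partial>\<mu>)"
      by (simp only: scaleR_conv_of_real of_real_mult[symmetric] integral_complex_of_real)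
    then have "\<bar>\<integral>x. u (lattice_shift i x) * wsum a \<Gamma> u x ^ Suc (2 * q) \<partial>\<mu>\<bar> \<le>
        (\<Sum>l\<in>\<Gamma>. b * corr k (snorm (l - i)) * (K * \<bar>a l\<bar>))"
      using decorrelate_telescope[OF u Suc.prems K, of i] by (simp only: norm_of_real)
    then have "\<bar>a i\<bar> * \<bar>\<integral>x. u (lattice_shift i x) * wsum a \<Gamma> u x ^ Suc (2 * q) \<partial>\<mu>\<bar> \<le>
        \<bar>a i\<bar> * (\<Sum>l\<in>\<Gamma>. b * corr k (snorm (l - i)) * (K * \<bar>a l\<bar>))"
      by (intro mult_left_mono) auto
    then show "a i * (\<integral>x. u (lattice_shift i x) * wsum a \<Gamma> u x ^ Suc (2 * q) \<partial>\<mu>) \<le>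
        \<bar>a i\<bar> * (\<Sum>l\<in>\<Gamma>. b * corr k (snorm (l - i)) * (K * \<bar>a l\<bar>))"
      by (rule order.trans[OF order.trans[OF abs_ge_self eq_refl[OF abs_mult]]])
  qed
  also have "\<dots> = b * K * (\<Sum>i\<in>\<Gamma>. \<Sum>l\<in>\<Gamma>. \<bar>a i\<bar> * \<bar>a l\<bar> * corr k (snorm (l - i)))"
    by (simp add: sum_distrib_left mult_ac)
  also have "\<dots> \<le> b * K * (corr_sum k * A)"
  proof (rule mult_left_mono)
    show "(\<Sum>i\<in>\<Gamma>. \<Sum>l\<in>\<Gamma>. \<bar>a i\<bar> * \<bar>a l\<bar> * corr k (snorm (l - i))) \<le> corr_sum k * A"
      unfolding A_def
      by (rule schur_test[OF Suc.prems, where w = "\<lambda>h. corr k (snorm h)"])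
        (auto simp: corr_nonneg sum_corr_le)
    have "0 \<le> b\<^sup>2 * corr_sum k * A" unfolding A_def using cs by (simp add: sum_nonneg)
    then have "0 \<le> M" unfolding M_def using moment_const_pos[of q] by simp
    then show "0 \<le> b * K" unfolding K_def using b0 by simp
  qed
  also have "\<dots> = moment_const (Suc q) * (b\<^sup>2 * corr_sum k * A) ^ Suc q"
    by (simp add: K_def M_def power2_eq_square mult_ac)
  finally show ?case unfolding A_def .
qed

end

section \<open>The central limit theorem for local observables\<close>

lemma has_vector_derivative_quadratic:
  fixes f :: "real \<Rightarrow> 'e::real_normed_vector"
  assumes "\<And>h. norm (f (x + h) - f x - h *\<^sub>R D) \<le> M * h\<^sup>2"
  shows "(f has_vector_derivative D) (at x)"
  unfolding has_vector_derivative_def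
proof (rule has_derivativeI_sandwich[of 1 _ _ _ _ "\<lambda>y. M * \<bar>y - x\<bar>"])
  show "bounded_linear (\<lambda>h. h *\<^sub>R D)" by (rule bounded_linear_scaleR_left)
  fix y assume "y \<noteq> x"
  then have "norm (f y - f x - (y - x) *\<^sub>R D) / norm (y - x) \<le> M * (y - x)\<^sup>2 / \<bar>y - x\<bar>"
    using assms[of "y - x"] by (simp add: divide_right_mono)
  also have "M * (y - x)\<^sup>2 / \<bar>y - x\<bar> = M * \<bar>y - x\<bar>"
    using \<open>y \<noteq> x\<close> by (simp add: power2_eq_square field_simps abs_mult_self_eq)
  finally show "norm (f y - f x - (y - x) *\<^sub>R D) / norm (y - x) \<le> M * \<bar>y - x\<bar>" .
next
  have "((\<lambda>y. M * \<bar>y - x\<bar>) \<longlongrightarrow> M * \<bar>x - x\<bar>) (at x)" by (intro tendsto_intros)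
  then show "((\<lambda>y. M * \<bar>y - x\<bar>) \<longlongrightarrow> 0) (at x)" by simp
qed auto

lemma norm_iexp [simp]: "norm (iexp x) = 1"
  by (simp add: norm_exp_i_times)

lemma norm_iexp_diff: "norm (iexp x - iexp y) \<le> \<bar>x - y\<bar>"
proof -
  have "iexp x - iexp y = iexp y * (iexp (x - y) - 1)"
    by (simp add: exp_diff right_diff_distrib)
  then have "norm (iexp x - iexp y) = norm (iexp (x - y) - 1)"
    by (simp add: norm_mult)
  then show ?thesis using iexp_approx1[of "x - y" 0] by simp
qed

lemma norm_iexp_linear: "norm (iexp x - 1 - \<i> * x) \<le> x\<^sup>2 / 2"
  using iexp_approx1[of x 1] by (simp add: diff_diff_eq power2_eq_square)

section \<open>Covariances and Stein's equation for local observables\<close>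

context mixing_field
begin

lemma integrable_local:
  fixes g :: "_ \<Rightarrow> 'e::{banach, second_countable_topology}"
  assumes u: "local_obs k b u" and G: "finite G"
    and g: "\<And>x y. (\<And>i. i \<in> G \<Longrightarrow> u (lattice_shift i x) = u (lattice_shift i y)) \<Longrightarrow> g x = g y"
  shows "integrable \<mu> g"
proof (rule integrable_depends_on[OF finite_footprint[OF G, of k]])
  show "depends_on g (footprint k G)"
    unfolding depends_on_def
  proof (intro allI impI)
    fix x y :: "('d, 'a) config" assume *: "\<forall>i\<in>footprint k G. x i = y i"
    show "g x = g y"
    proof (rule g)
      fix i assume "i \<in> G"
      then show "u (lattice_shift i x) = u (lattice_shift i y)"
        using * u by (intro depends_onD[of u "centered_box k"])
          (auto simp: local_obs_def footprint_def lattice_shift_def)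
    qed
  qed
qed

definition cov :: "(('d, 'a) config \<Rightarrow> real) \<Rightarrow> 'd site \<Rightarrow> real" where
  "cov u h = (\<integral>x. u x * u (lattice_shift h x) \<partial>\<mu>)"

lemma local_obs_mono:
  assumes "local_obs k b u" "k \<le> k'"
  shows "local_obs k' b u"
proof -
  have "centered_box k \<subseteq> (centered_box k' :: 'd site set)"
    using assms(2) by (auto simp: snorm_le_centered_box[symmetric])
  then show ?thesis using assms(1) depends_on_mono unfolding local_obs_def by blast
qed

text \<open>Different ranges are allowed because the pieces of a dyadic expansion are compared with
  one another. Both observables are read at the larger range, and \<open>decorrelate\<close> is
  applied with the single site 0.\<close>

lemma abs_cross_cov_le:
  assumes f: "local_obs k b f" and g: "local_obs k' b' g"
  shows "\<bar>\<integral>x. f x * g (lattice_shift h x) \<partial>\<mu>\<bar> \<le> b * b' * corr (max k k') (snorm h)"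
proof -
  let ?k = "max k k'"
  have f': "local_obs ?k b f" and g': "local_obs ?k b' g"
    using f g by (auto intro: local_obs_mono)
  have b0: "0 \<le> b'" using local_obs_nonneg[OF g] .
  have "norm (\<integral>x. g (lattice_shift h x) *\<^sub>R complex_of_real (f x) \<partial>\<mu>)
      \<le> b' * corr ?k (snorm h) * (\<integral>x. norm (complex_of_real (f x)) \<partial>\<mu>)"
  proof (rule decorrelate[OF g', of "{0}"])
    show "depends_on (\<lambda>x. complex_of_real (f x)) (footprint ?k {0})"
      using f' by (auto simp: local_obs_def footprint_def depends_on_def)
  qed auto
  moreover have "(\<integral>x. g (lattice_shift h x) *\<^sub>R complex_of_real (f x) \<partial>\<mu>) =
      complex_of_real (\<integral>x. f x * g (lattice_shift h x) \<partial>\<mu>)"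
    by (simp add: scaleR_conv_of_real integral_complex_of_real[symmetric] mult.commute)
  moreover have "(\<integral>x. norm (complex_of_real (f x)) \<partial>\<mu>) \<le> b"
  proof -
    have "norm (\<integral>x. norm (complex_of_real (f x)) \<partial>\<mu>) \<le> (\<integral>x. b \<partial>\<mu>)"
      using local_obs_bound[OF f] by (intro norm_integral_le) auto
    then show ?thesis using prob_space by simp
  qed
  ultimately have "\<bar>\<integral>x. f x * g (lattice_shift h x) \<partial>\<mu>\<bar> \<le>
      b' * corr ?k (snorm h) * (\<integral>x. norm (complex_of_real (f x)) \<partial>\<mu>)"
    "(\<integral>x. norm (complex_of_real (f x)) \<partial>\<mu>) \<le> b" by simp_all
  then have "\<bar>\<integral>x. f x * g (lattice_shift h x) \<partial>\<mu>\<bar> \<le> b' * corr ?k (snorm h) * b"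
    using b0 corr_nonneg[of ?k "snorm h"] by (meson mult_left_mono mult_nonneg_nonneg order_trans)
  then show ?thesis by (simp add: mult_ac)
qed

lemma abs_cov_le: "local_obs k b u \<Longrightarrow> \<bar>cov u h\<bar> \<le> b\<^sup>2 * corr k (snorm h)"
  using abs_cross_cov_le[of k b u k b u h] by (simp add: cov_def power2_eq_square)

lemma cov_summable:
  assumes u: "local_obs k b u"
  shows "cov u summable_on UNIV"
proof -
  have "(\<lambda>h. norm (cov u h)) summable_on UNIV"
  proof (rule nonneg_bdd_above_summable_on)
    show "bdd_above (sum (\<lambda>h. norm (cov u h)) ` {F. F \<subseteq> UNIV \<and> finite F})"
    proof (rule bdd_aboveI2)
      fix F :: "'d site set" assume "F \<in> {F. F \<subseteq> UNIV \<and> finite F}"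
      then have F: "finite F" by simp
      have "(\<Sum>h\<in>F. norm (cov u h)) \<le> (\<Sum>h\<in>F. b\<^sup>2 * corr k (snorm h))"
        using abs_cov_le[OF u] by (intro sum_mono) simp
      also have "\<dots> \<le> b\<^sup>2 * corr_sum k"
        using sum_corr_le[OF F] by (simp add: sum_distrib_left[symmetric] mult_left_mono)
      finally show "(\<Sum>h\<in>F. norm (cov u h)) \<le> b\<^sup>2 * corr_sum k" .
    qed
  qed simp
  then show ?thesis by (rule abs_summable_summable)
qed

text \<open>Dominates the correlations at distance more than \<open>m\<close> as soon as
  \<open>3 * k \<le> m\<close>. The cut sits inside the sum so that \<open>lattice_sum_bound\<close>
  applies unchanged.\<close>

definition decay_tail :: "nat \<Rightarrow> real" where
  "decay_tail m = (\<Sum>n. (2 * real n + 1) ^ CARD('d) * (if m < n then decay n else 0))"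

lemma decay_tail_summable:
  "summable (\<lambda>n. (2 * real n + 1) ^ CARD('d) * (if m < n then decay n else 0))"
  by (rule summable_comparison_test'[OF summable_decay, of 0]) (auto simp: decay_nonneg)

lemma decay_tail_tendsto: "decay_tail \<longlonglongrightarrow> 0"
proof -
  let ?f = "\<lambda>n. (2 * real n + 1) ^ CARD('d) * decay n"
  have eq: "decay_tail m = (\<Sum>n. ?f (n + Suc m))" for m
  proof -
    have "decay_tail m = (\<Sum>n. (2 * real (n + Suc m) + 1) ^ CARD('d) * (if m < n + Suc m then decay (n + Suc m) else 0))
       + (\<Sum>n<Suc m. (2 * real n + 1) ^ CARD('d) * (if m < n then decay n else 0))"
      unfolding decay_tail_def by (rule suminf_split_initial_segment[OF decay_tail_summable])
    then show ?thesis by simp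
  qed
  show ?thesis
  proof (rule LIMSEQ_I)
    fix r :: real assume "0 < r"
    then obtain N where N: "\<And>n. N \<le> n \<Longrightarrow> norm (\<Sum>i. ?f (i + n)) < r"
      using suminf_exist_split[OF _ summable_decay] by blast
    have "norm (decay_tail m - 0) < r" if "N \<le> m" for m
      using N[of "Suc m"] that unfolding eq by simp
    then show "\<exists>N. \<forall>m\<ge>N. norm (decay_tail m - 0) < r" by blast
  qed
qed

lemma decay_tail_nonneg: "0 \<le> decay_tail m"
  unfolding decay_tail_def by (intro suminf_nonneg decay_tail_summable) (auto simp: decay_nonneg)

lemma sum_corr_tail_le:
  fixes F :: "'d site set"
  assumes "finite F" "3 * k \<le> m"
  shows "(\<Sum>h\<in>F. if m < snorm h then corr k (snorm h) else 0) \<le> decay_tail m"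
proof -
  have "(\<Sum>h\<in>F. if m < snorm h then corr k (snorm h) else 0) =
      (\<Sum>h\<in>F. if m < snorm h then decay (snorm h) else 0)"
    using assms by (intro sum.cong) (auto simp: corr_def)
  also have "\<dots> \<le> decay_tail m"
    unfolding decay_tail_def
    by (rule lattice_sum_bound[where R = "\<lambda>n. n" and g = "\<lambda>n. if m < n then decay n else 0"])
      (use assms decay_tail_summable in \<open>auto simp: decay_nonneg\<close>)
  finally show ?thesis .
qed

text \<open>The square of \<open>wsum\<close> restricted to pairs of sites at distance at most
  \<open>m\<close>, which acts as a random variance in Stein's equation; sites \<open>i + h\<close>
  outside \<Gamma> will have weight 0. With \<open>h\<close> in the outer sum, each inner sum is a
  weighted sum of shifts of one local observable.\<close>

definition near_sum :: "nat \<Rightarrow> ('d site \<Rightarrow> real) \<Rightarrow> 'd site set \<Rightarrow> (('d, 'a) config \<Rightarrow> real)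
    \<Rightarrow> ('d, 'a) config \<Rightarrow> real" where
  "near_sum m a \<Gamma> u x = (\<Sum>h\<in>centered_box m. \<Sum>i\<in>\<Gamma>.
     a i * a (i + h) * (u (lattice_shift i x) * u (lattice_shift (i + h) x)))"

lemma sum_shifted_squares_le:
  fixes a :: "'d site \<Rightarrow> real"
  assumes "finite \<Gamma>" "\<And>i. i \<notin> \<Gamma> \<Longrightarrow> a i = 0" "finite G"
  shows "(\<Sum>i\<in>G. (a (i + h))\<^sup>2) \<le> (\<Sum>i\<in>\<Gamma>. (a i)\<^sup>2)"
proof -
  have "(\<Sum>i\<in>G. (a (i + h))\<^sup>2) = (\<Sum>i\<in>(\<lambda>i. i + h) ` G. (a i)\<^sup>2)"
    by (subst sum.reindex) (auto simp: inj_on_def)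
  also have "\<dots> = (\<Sum>i\<in>(\<lambda>i. i + h) ` G \<inter> \<Gamma>. (a i)\<^sup>2)"
    using assms by (intro sum.mono_neutral_right) auto
  also have "\<dots> \<le> (\<Sum>i\<in>\<Gamma>. (a i)\<^sup>2)" using assms by (intro sum_mono2) auto
  finally show ?thesis .
qed

text \<open>For each site \<open>i\<close> the sum \<open>S\<close> splits into a near part
  \<open>N\<close> and a far part \<open>R\<close>. A first order expansion of
  \<open>iexp (- t N)\<close> replaces \<open>iexp (t S)\<close>, tested against the shifted
  \<open>u\<close>, by \<open>\<i> t N * iexp (t S)\<close> plus \<open>iexp (t R)\<close> plus a
  remainder of order \<open>t\<^sup>2 N\<^sup>2\<close>. The term with \<open>R\<close> is small by
  telescoping over the far sites alone.\<close>

lemma stein_estimate: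
  assumes u: "local_obs k b u" and \<Gamma>: "finite \<Gamma>" and a0: "\<And>i. i \<notin> \<Gamma> \<Longrightarrow> a i = 0"
    and al: "\<And>i. \<bar>a i\<bar> \<le> \<alpha>" and m: "3 * k \<le> m"
  defines "A \<equiv> \<Sum>i\<in>\<Gamma>. (a i)\<^sup>2"
  shows "norm ((\<integral>x. wsum a \<Gamma> u x *\<^sub>R iexp (t * wsum a \<Gamma> u x) \<partial>\<mu>) -
      (\<i> * t) * (\<integral>x. near_sum m a \<Gamma> u x *\<^sub>R iexp (t * wsum a \<Gamma> u x) \<partial>\<mu>))
    \<le> \<bar>t\<bar> * b\<^sup>2 * decay_tail m * A + t\<^sup>2 * b ^ 3 * \<alpha> * ((2 * real m + 1) ^ CARD('d))\<^sup>2 * A"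
proof -
  have b0: "0 \<le> b" using local_obs_nonneg[OF u] .
  have ub: "\<bar>u x\<bar> \<le> b" for x using local_obs_bound[OF u] .
  have \<alpha>0: "0 \<le> \<alpha>" using al[of undefined] by linarith
  define G where "G = \<Gamma> \<union> (\<Union>i\<in>\<Gamma>. (\<lambda>h. i + h) ` centered_box m)"
  have G: "finite G" "\<Gamma> \<subseteq> G" "\<And>i h. i \<in> \<Gamma> \<Longrightarrow> h \<in> centered_box m \<Longrightarrow> i + h \<in> G"
    using \<Gamma> by (auto simp: G_def)
  let ?S = "\<lambda>x. wsum a \<Gamma> u x"
  define N where "N i x = (\<Sum>h\<in>centered_box m. a (i + h) * u (lattice_shift (i + h) x))" for i x
  define \<Gamma>f where "\<Gamma>f i = {j \<in> \<Gamma>. m < snorm (j - i)}" for i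
  have fin_f: "finite (\<Gamma>f i)" for i using \<Gamma> by (simp add: \<Gamma>f_def)
  have split: "?S x = N i x + wsum a (\<Gamma>f i) u x" for i x
  proof -
    have "N i x = (\<Sum>j\<in>(\<lambda>h. i + h) ` centered_box m. a j * u (lattice_shift j x))"
      unfolding N_def by (subst sum.reindex) (auto simp: inj_on_def)
    also have "\<dots> = (\<Sum>j\<in>\<Gamma> - \<Gamma>f i. a j * u (lattice_shift j x))"
    proof (rule sum.mono_neutral_right)
      show "\<Gamma> - \<Gamma>f i \<subseteq> (\<lambda>h. i + h) ` centered_box m"
      proof
        fix j assume "j \<in> \<Gamma> - \<Gamma>f i"
        then have "j - i \<in> centered_box m"
          by (auto simp: \<Gamma>f_def snorm_le_centered_box[symmetric] not_less)
        then show "j \<in> (\<lambda>h. i + h) ` centered_box m" by (auto intro: image_eqI[of _ _ "j - i"])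
      qed
      show "\<forall>j\<in>(\<lambda>h. i + h) ` centered_box m - (\<Gamma> - \<Gamma>f i). a j * u (lattice_shift j x) = 0"
        using a0 by (auto simp: \<Gamma>f_def snorm_le_centered_box[symmetric])
    qed auto
    finally have "N i x = (\<Sum>j\<in>\<Gamma> - \<Gamma>f i. a j * u (lattice_shift j x))" .
    then show ?thesis
      using \<Gamma> sum.subset_diff[of "\<Gamma>f i" \<Gamma> "\<lambda>j. a j * u (lattice_shift j x)"]
      by (simp add: wsum_def \<Gamma>f_def)
  qed
  have near: "near_sum m a \<Gamma> u x = (\<Sum>i\<in>\<Gamma>. a i * (u (lattice_shift i x) * N i x))" for x
    unfolding near_sum_def N_def sum_distrib_left by (subst sum.swap) (simp add: mult_ac)
  \<comment> \<open>Cauchy-Schwarz over the box. Exchanging the sums over \<open>h\<close> and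
    \<open>i\<close> at the end costs the box volume a second time, hence its square in the
    claim.\<close>
  have N2: "(N i x)\<^sup>2 \<le> b\<^sup>2 * (2 * real m + 1) ^ CARD('d) * (\<Sum>h\<in>centered_box m. (a (i + h))\<^sup>2)" for i x
  proof -
    have "(N i x)\<^sup>2 \<le> (2 * real m + 1) ^ CARD('d) * (\<Sum>h\<in>centered_box m. (a (i + h) * u (lattice_shift (i + h) x))\<^sup>2)"
      unfolding N_def real_card_centered_box[symmetric]
      by (rule order_trans[OF sum_squared_le_sum_of_squares]) (auto simp: mult.commute)
    also have "\<dots> \<le> (2 * real m + 1) ^ CARD('d) * (\<Sum>h\<in>centered_box m. (a (i + h))\<^sup>2 * b\<^sup>2)"
      using ub by (intro mult_left_mono sum_mono)
        (auto simp: power_mult_distrib intro!: mult_left_mono power2_le_iff_abs_le[THEN iffD2] b0)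
    finally show ?thesis unfolding sum_distrib_right[symmetric] by (simp only: mult_ac)
  qed
  have int: "integrable \<mu> (\<lambda>x. \<Psi> (u (lattice_shift i x)) (N i x) (wsum a \<Gamma>' u x))"
    if i: "i \<in> \<Gamma>" and \<Gamma>': "\<Gamma>' \<subseteq> \<Gamma>" for \<Psi> :: "real \<Rightarrow> real \<Rightarrow> real \<Rightarrow> complex" and i \<Gamma>'
  proof (rule integrable_local[OF u G(1)])
    fix x y assume *: "\<And>i. i \<in> G \<Longrightarrow> u (lattice_shift i x) = u (lattice_shift i y)"
    have "u (lattice_shift i x) = u (lattice_shift i y)" using * G(2) i by blast
    moreover have "N i x = N i y"
      unfolding N_def using * G(3)[OF i] by (intro sum.cong) auto
    moreover have "wsum a \<Gamma>' u x = wsum a \<Gamma>' u y"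
      unfolding wsum_def using * G(2) \<Gamma>' by (intro sum.cong) (auto simp: subset_iff)
    ultimately show "\<Psi> (u (lattice_shift i x)) (N i x) (wsum a \<Gamma>' u x) =
        \<Psi> (u (lattice_shift i y)) (N i y) (wsum a \<Gamma>' u y)" by simp
  qed
  define e where "e i = b * (\<Sum>l\<in>\<Gamma>f i. corr k (snorm (l - i)) * (\<bar>t\<bar> * b * \<bar>a l\<bar>)) +
      b * (t\<^sup>2 * (b\<^sup>2 * (2 * real m + 1) ^ CARD('d) * (\<Sum>h\<in>centered_box m. (a (i + h))\<^sup>2)))" for i
  have site: "norm ((\<integral>x. u (lattice_shift i x) *\<^sub>R iexp (t * ?S x) \<partial>\<mu>) -
      (\<i> * t) * (\<integral>x. (u (lattice_shift i x) * N i x) *\<^sub>R iexp (t * ?S x) \<partial>\<mu>)) \<le> e i"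
    if i: "i \<in> \<Gamma>" for i
  proof -
    let ?u = "\<lambda>x. u (lattice_shift i x)" and ?R = "\<lambda>x. wsum a (\<Gamma>f i) u x"
    have I1: "integrable \<mu> (\<lambda>x. ?u x *\<^sub>R iexp (t * ?S x))"
      by (rule int[OF i, of \<Gamma> "\<lambda>p q r. p *\<^sub>R iexp (t * r)"]) simp
    have I2: "integrable \<mu> (\<lambda>x. (?u x * N i x) *\<^sub>R iexp (t * ?S x))"
      by (rule int[OF i, of \<Gamma> "\<lambda>p q r. (p * q) *\<^sub>R iexp (t * r)"]) simp
    have I3: "integrable \<mu> (\<lambda>x. ?u x *\<^sub>R iexp (t * ?R x))"
      by (rule int[OF i, of "\<Gamma>f i" "\<lambda>p q r. p *\<^sub>R iexp (t * r)"]) (simp add: \<Gamma>f_def)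
    define rem where "rem x = ?u x *\<^sub>R (iexp (t * ?S x) * (1 - iexp (- (t * N i x)) - \<i> * (t * N i x)))" for x
    have eq: "?u x *\<^sub>R iexp (t * ?S x) - (\<i> * t) * ((?u x * N i x) *\<^sub>R iexp (t * ?S x)) =
        ?u x *\<^sub>R iexp (t * ?R x) + rem x" for x
    proof -
      have "iexp (t * ?R x) = iexp (t * ?S x) * iexp (- (t * N i x))"
        unfolding split[of x i] by (simp add: exp_add[symmetric] algebra_simps)
      then show ?thesis by (simp add: rem_def scaleR_conv_of_real algebra_simps)
    qed
    have "(\<integral>x. ?u x *\<^sub>R iexp (t * ?S x) \<partial>\<mu>) - (\<i> * t) * (\<integral>x. (?u x * N i x) *\<^sub>R iexp (t * ?S x) \<partial>\<mu>) =
        (\<integral>x. ?u x *\<^sub>R iexp (t * ?S x) - (\<i> * t) * ((?u x * N i x) *\<^sub>R iexp (t * ?S x)) \<partial>\<mu>)"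
      using Bochner_Integration.integral_diff[OF I1 integrable_mult_right[OF I2, of "\<i> * t"]]
      by (simp only: integral_mult_right_zero)
    also have "\<dots> = (\<integral>x. ?u x *\<^sub>R iexp (t * ?R x) + rem x \<partial>\<mu>)" unfolding eq ..
    also have "\<dots> = (\<integral>x. ?u x *\<^sub>R iexp (t * ?R x) \<partial>\<mu>) + (\<integral>x. rem x \<partial>\<mu>)"
    proof (rule Bochner_Integration.integral_add[OF I3])
      show "integrable \<mu> rem"
        unfolding rem_def
        by (rule int[OF i, of \<Gamma> "\<lambda>p q r. p *\<^sub>R (iexp (t * r) * (1 - iexp (- (t * q)) - \<i> * (t * q)))"]) simp
    qed
    finally have "norm ((\<integral>x. ?u x *\<^sub>R iexp (t * ?S x) \<partial>\<mu>) -
        (\<i> * t) * (\<integral>x. (?u x * N i x) *\<^sub>R iexp (t * ?S x) \<partial>\<mu>)) \<le>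
        norm (\<integral>x. ?u x *\<^sub>R iexp (t * ?R x) \<partial>\<mu>) + norm (\<integral>x. rem x \<partial>\<mu>)"
      by (simp add: norm_triangle_ineq)
    also have "norm (\<integral>x. ?u x *\<^sub>R iexp (t * ?R x) \<partial>\<mu>) \<le>
        (\<Sum>l\<in>\<Gamma>f i. b * corr k (snorm (l - i)) * (\<bar>t\<bar> * b * \<bar>a l\<bar>))"
    proof (rule decorrelate_telescope[OF u fin_f, of _ "\<lambda>s. iexp (t * s)"])
      fix \<Gamma>' l assume *: "\<Gamma>' \<subseteq> \<Gamma>f i" "l \<in> \<Gamma>'"
      have fin': "finite \<Gamma>'" using * fin_f by (auto intro: finite_subset)
      have "norm (\<integral>x. norm (iexp (t * wsum a \<Gamma>' u x) - iexp (t * wsum a (\<Gamma>' - {l}) u x)) \<partial>\<mu>) \<le>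
          (\<integral>x. \<bar>t\<bar> * (b * \<bar>a l\<bar>) \<partial>\<mu>)"
      proof (rule norm_integral_le)
        fix x
        have "norm (iexp (t * wsum a \<Gamma>' u x) - iexp (t * wsum a (\<Gamma>' - {l}) u x)) \<le>
            \<bar>t * wsum a \<Gamma>' u x - t * wsum a (\<Gamma>' - {l}) u x\<bar>"
          by (rule norm_iexp_diff)
        also have "\<dots> = \<bar>t\<bar> * \<bar>wsum a \<Gamma>' u x - wsum a (\<Gamma>' - {l}) u x\<bar>"
          by (simp add: right_diff_distrib[symmetric] abs_mult)
        also have "\<dots> \<le> \<bar>t\<bar> * (b * \<bar>a l\<bar>)"
          by (intro mult_left_mono abs_wsum_diff_remove[OF u fin' *(2)]) simp
        finally show "norm (norm (iexp (t * wsum a \<Gamma>' u x) - iexp (t * wsum a (\<Gamma>' - {l}) u x)))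
            \<le> \<bar>t\<bar> * (b * \<bar>a l\<bar>)" by simp
      qed simp
      then show "(\<integral>x. norm (iexp (t * wsum a \<Gamma>' u x) - iexp (t * wsum a (\<Gamma>' - {l}) u x)) \<partial>\<mu>)
          \<le> \<bar>t\<bar> * b * \<bar>a l\<bar>"
        using prob_space by (simp add: mult_ac)
    qed
    also have "norm (\<integral>x. rem x \<partial>\<mu>) \<le>
        (\<integral>x. b * (t\<^sup>2 * (b\<^sup>2 * (2 * real m + 1) ^ CARD('d) * (\<Sum>h\<in>centered_box m. (a (i + h))\<^sup>2))) \<partial>\<mu>)"
    proof (rule norm_integral_le)
      fix x
      have "norm (1 - iexp (- (t * N i x)) - \<i> * (t * N i x)) =
          norm (iexp (- (t * N i x)) - 1 - \<i> * (- (t * N i x)))"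
        by (subst norm_minus_cancel[symmetric]) (simp add: algebra_simps)
      also have "\<dots> \<le> (- (t * N i x))\<^sup>2 / 2"
        using norm_iexp_linear[of "- (t * N i x)"] by simp
      also have "\<dots> \<le> t\<^sup>2 * (N i x)\<^sup>2" by (simp add: power_mult_distrib)
      also have "\<dots> \<le> t\<^sup>2 * (b\<^sup>2 * (2 * real m + 1) ^ CARD('d) * (\<Sum>h\<in>centered_box m. (a (i + h))\<^sup>2))"
        by (intro mult_left_mono N2) simp
      finally have *: "norm (1 - iexp (- (t * N i x)) - \<i> * (t * N i x)) \<le>
          t\<^sup>2 * (b\<^sup>2 * (2 * real m + 1) ^ CARD('d) * (\<Sum>h\<in>centered_box m. (a (i + h))\<^sup>2))" .
      have "norm (rem x) = \<bar>?u x\<bar> * norm (1 - iexp (- (t * N i x)) - \<i> * (t * N i x))"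
        by (simp add: rem_def norm_mult)
      also have "\<dots> \<le> b * (t\<^sup>2 * (b\<^sup>2 * (2 * real m + 1) ^ CARD('d) * (\<Sum>h\<in>centered_box m. (a (i + h))\<^sup>2)))"
        by (intro mult_mono ub *) (use b0 in auto)
      finally show "norm (rem x) \<le> b * (t\<^sup>2 * (b\<^sup>2 * (2 * real m + 1) ^ CARD('d) * (\<Sum>h\<in>centered_box m. (a (i + h))\<^sup>2)))" .
    qed simp
    finally show ?thesis
      using prob_space by (simp add: e_def sum_distrib_left mult.assoc)
  qed
  have IS: "integrable \<mu> (\<lambda>x. a i *\<^sub>R (u (lattice_shift i x) *\<^sub>R iexp (t * ?S x)))"
    "integrable \<mu> (\<lambda>x. a i *\<^sub>R ((u (lattice_shift i x) * N i x) *\<^sub>R iexp (t * ?S x)))" if "i \<in> \<Gamma>" for i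
    using int[OF that, of \<Gamma> "\<lambda>p q r. a i *\<^sub>R (p *\<^sub>R iexp (t * r))"]
      int[OF that, of \<Gamma> "\<lambda>p q r. a i *\<^sub>R ((p * q) *\<^sub>R iexp (t * r))"] by simp_all
  have "(\<integral>x. ?S x *\<^sub>R iexp (t * ?S x) \<partial>\<mu>) =
      (\<Sum>i\<in>\<Gamma>. a i *\<^sub>R (\<integral>x. u (lattice_shift i x) *\<^sub>R iexp (t * ?S x) \<partial>\<mu>))"
  proof -
    have "?S x *\<^sub>R iexp (t * ?S x) = (\<Sum>i\<in>\<Gamma>. a i *\<^sub>R (u (lattice_shift i x) *\<^sub>R iexp (t * ?S x)))" for x
      by (subst (1) wsum_def) (simp only: scaleR_sum_left scaleR_scaleR)
    then show ?thesis using IS(1) by (simp only: Bochner_Integration.integral_sum integral_scaleR_right)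
  qed
  moreover have "(\<integral>x. near_sum m a \<Gamma> u x *\<^sub>R iexp (t * ?S x) \<partial>\<mu>) =
      (\<Sum>i\<in>\<Gamma>. a i *\<^sub>R (\<integral>x. (u (lattice_shift i x) * N i x) *\<^sub>R iexp (t * ?S x) \<partial>\<mu>))"
  proof -
    have "near_sum m a \<Gamma> u x *\<^sub>R iexp (t * ?S x) =
        (\<Sum>i\<in>\<Gamma>. a i *\<^sub>R ((u (lattice_shift i x) * N i x) *\<^sub>R iexp (t * ?S x)))" for x
      unfolding near by (simp only: scaleR_sum_left scaleR_scaleR)
    then show ?thesis using IS(2) by (simp only: Bochner_Integration.integral_sum integral_scaleR_right)
  qed
  ultimately have "(\<integral>x. ?S x *\<^sub>R iexp (t * ?S x) \<partial>\<mu>) -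
      (\<i> * t) * (\<integral>x. near_sum m a \<Gamma> u x *\<^sub>R iexp (t * ?S x) \<partial>\<mu>) =
      (\<Sum>i\<in>\<Gamma>. a i *\<^sub>R ((\<integral>x. u (lattice_shift i x) *\<^sub>R iexp (t * ?S x) \<partial>\<mu>) -
        (\<i> * t) * (\<integral>x. (u (lattice_shift i x) * N i x) *\<^sub>R iexp (t * ?S x) \<partial>\<mu>)))"
    by (simp add: sum_distrib_left sum_subtractf scaleR_diff_right)
  then have "norm ((\<integral>x. ?S x *\<^sub>R iexp (t * ?S x) \<partial>\<mu>) -
      (\<i> * t) * (\<integral>x. near_sum m a \<Gamma> u x *\<^sub>R iexp (t * ?S x) \<partial>\<mu>)) \<le> (\<Sum>i\<in>\<Gamma>. \<bar>a i\<bar> * e i)"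
    using site by (auto intro!: sum_norm_le mult_left_mono)
  also have "\<dots> = \<bar>t\<bar> * b\<^sup>2 * (\<Sum>i\<in>\<Gamma>. \<Sum>l\<in>\<Gamma>f i. \<bar>a i\<bar> * \<bar>a l\<bar> * corr k (snorm (l - i))) +
      t\<^sup>2 * b ^ 3 * (2 * real m + 1) ^ CARD('d) * (\<Sum>i\<in>\<Gamma>. \<bar>a i\<bar> * (\<Sum>h\<in>centered_box m. (a (i + h))\<^sup>2))"
    by (simp add: e_def distrib_left sum.distrib sum_distrib_left power2_eq_square power3_eq_cube mult_ac)
  also have "\<dots> \<le> \<bar>t\<bar> * b\<^sup>2 * (decay_tail m * A) + t\<^sup>2 * b ^ 3 * (2 * real m + 1) ^ CARD('d) * (\<alpha> * ((2 * real m + 1) ^ CARD('d) * A))"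
  proof (intro add_mono mult_left_mono)
    have "(\<Sum>l\<in>\<Gamma>f i. \<bar>a i\<bar> * \<bar>a l\<bar> * corr k (snorm (l - i))) =
        (\<Sum>l\<in>\<Gamma>. \<bar>a i\<bar> * \<bar>a l\<bar> * (if m < snorm (l - i) then corr k (snorm (l - i)) else 0))" for i
      unfolding \<Gamma>f_def using \<Gamma>
      by (subst sum.inter_filter) (auto intro!: sum.cong)
    then show "(\<Sum>i\<in>\<Gamma>. \<Sum>l\<in>\<Gamma>f i. \<bar>a i\<bar> * \<bar>a l\<bar> * corr k (snorm (l - i))) \<le> decay_tail m * A"
      unfolding A_def
      using schur_test[OF \<Gamma>, of "\<lambda>h. if m < snorm h then corr k (snorm h) else 0" "decay_tail m" a]
        sum_corr_tail_le[OF _ m] corr_nonneg by simp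
    have "(\<Sum>i\<in>\<Gamma>. \<bar>a i\<bar> * (\<Sum>h\<in>centered_box m. (a (i + h))\<^sup>2)) \<le>
        (\<Sum>i\<in>\<Gamma>. \<alpha> * (\<Sum>h\<in>centered_box m. (a (i + h))\<^sup>2))"
      by (intro sum_mono mult_right_mono al sum_nonneg) auto
    also have "\<dots> = \<alpha> * (\<Sum>h\<in>centered_box m. \<Sum>i\<in>\<Gamma>. (a (i + h))\<^sup>2)"
      by (simp add: sum_distrib_left[symmetric] sum.swap[of _ _ \<Gamma>])
    also have "\<dots> \<le> \<alpha> * (\<Sum>h\<in>(centered_box m :: 'd site set). A)"
      unfolding A_def
      by (intro mult_left_mono sum_mono sum_shifted_squares_le \<Gamma> a0 \<alpha>0)
    also have "\<dots> = \<alpha> * ((2 * real m + 1) ^ CARD('d) * A)" by (simp add: real_card_centered_box)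
    finally show "(\<Sum>i\<in>\<Gamma>. \<bar>a i\<bar> * (\<Sum>h\<in>centered_box m. (a (i + h))\<^sup>2)) \<le> \<alpha> * ((2 * real m + 1) ^ CARD('d) * A)" .
  qed (use b0 in auto)
  finally show ?thesis by (simp add: power2_eq_square mult_ac)
qed

lemma expectation_abs_le_sqrt:
  fixes Y :: "('d, 'a) config \<Rightarrow> real"
  assumes "integrable \<mu> Y" "integrable \<mu> (\<lambda>x. (Y x)\<^sup>2)" "(\<integral>x. (Y x)\<^sup>2 \<partial>\<mu>) \<le> s"
  shows "(\<integral>x. \<bar>Y x\<bar> \<partial>\<mu>) \<le> sqrt s"
proof (rule real_le_rsqrt)
  have "0 \<le> variance (\<lambda>x. \<bar>Y x\<bar>)" by (rule variance_positive)
  then have "(\<integral>x. \<bar>Y x\<bar> \<partial>\<mu>)\<^sup>2 \<le> (\<integral>x. (Y x)\<^sup>2 \<partial>\<mu>)"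
    using assms by (subst (asm) variance_eq) auto
  then show "(\<integral>x. \<bar>Y x\<bar> \<partial>\<mu>)\<^sup>2 \<le> s" using assms(3) by linarith
qed

text \<open>For fixed \<open>h\<close> the centred product \<open>Y h\<close> is again a local
  observable, of range \<open>k + m\<close> and bound \<open>2 * b\<^sup>2\<close>, so the second
  moment bound applies with weights \<open>a i * a (i + h)\<close>. Their squares sum to at most
  \<open>\<alpha>\<^sup>2 * A\<close>, which is small when no single weight is large. The constant
  is \<open>2 * (2 * b\<^sup>2)\<^sup>2 = 8 * b ^ 4\<close>.\<close>

lemma near_sum_concentration:
  assumes u: "local_obs k b u" and \<Gamma>: "finite \<Gamma>" and a0: "\<And>i. i \<notin> \<Gamma> \<Longrightarrow> a i = 0"
    and al: "\<And>i. \<bar>a i\<bar> \<le> \<alpha>"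
  defines "A \<equiv> \<Sum>i\<in>\<Gamma>. (a i)\<^sup>2"
  shows "(\<integral>x. \<bar>near_sum m a \<Gamma> u x - (\<Sum>h\<in>centered_box m. cov u h * (\<Sum>i\<in>\<Gamma>. a i * a (i + h)))\<bar> \<partial>\<mu>)
    \<le> (2 * real m + 1) ^ CARD('d) * sqrt (8 * b ^ 4 * corr_sum (k + m) * (\<alpha>\<^sup>2 * A))"
proof -
  have b0: "0 \<le> b" using local_obs_nonneg[OF u] .
  have ub: "\<bar>u x\<bar> \<le> b" for x using local_obs_bound[OF u] .
  have [measurable]: "u \<in> borel_measurable \<mu>" by (rule local_obs_measurable[OF u])
  have uu: "\<bar>u x * u y\<bar> \<le> b\<^sup>2" for x y
    unfolding abs_mult power2_eq_square by (intro mult_mono ub b0) auto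
  define Y where "Y h x = u x * u (lattice_shift h x) - cov u h" for h x
  have covb: "\<bar>cov u h\<bar> \<le> b\<^sup>2" for h
  proof -
    have "norm (\<integral>x. u x * u (lattice_shift h x) \<partial>\<mu>) \<le> (\<integral>x. b\<^sup>2 \<partial>\<mu>)"
      using uu by (intro norm_integral_le) auto
    then show ?thesis using prob_space by (simp add: cov_def)
  qed
  have Y: "local_obs (k + m) (2 * b\<^sup>2) (Y h)" if "h \<in> centered_box m" for h
    unfolding local_obs_def
  proof (intro conjI allI)
    show "depends_on (Y h) (centered_box (k + m))"
      unfolding depends_on_def
    proof clarify
      fix x y :: "('d, 'a) config" assume *: "\<forall>i\<in>centered_box (k + m). x i = y i"
      have "u x = u y"
        using u * by (intro depends_onD[of u "centered_box k"])
          (auto simp: local_obs_def snorm_le_centered_box[symmetric])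
      moreover have "u (lattice_shift h x) = u (lattice_shift h y)"
      proof (rule depends_onD[of u "centered_box k"])
        fix i :: "'d site" assume "i \<in> centered_box k"
        then have "h + i \<in> centered_box (k + m)"
          using that snorm_add[of h i] by (simp add: snorm_le_centered_box[symmetric])
        then show "lattice_shift h x i = lattice_shift h y i" using * by (simp add: lattice_shift_def)
      qed (use u in \<open>simp add: local_obs_def\<close>)
      ultimately show "Y h x = Y h y" by (simp add: Y_def)
    qed
    show "\<bar>Y h x\<bar> \<le> 2 * b\<^sup>2" for x
      using uu[of x "lattice_shift h x"] covb[of h] unfolding Y_def by linarith
    have "integrable \<mu> (\<lambda>x. u x * u (lattice_shift h x))"
      using uu by (intro integrable_bounded[of _ "b\<^sup>2"]) auto
    then show "(\<integral>x. Y h x \<partial>\<mu>) = 0"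
      using prob_space by (simp add: Y_def cov_def)
  qed
  define ah where "ah h i = a i * a (i + h)" for h i
  have eq: "near_sum m a \<Gamma> u x - (\<Sum>h\<in>centered_box m. cov u h * (\<Sum>i\<in>\<Gamma>. a i * a (i + h))) =
      (\<Sum>h\<in>centered_box m. wsum (ah h) \<Gamma> (Y h) x)" for x
    by (simp add: near_sum_def wsum_def Y_def ah_def sum_subtractf[symmetric] sum_distrib_left
        lattice_shift_add right_diff_distrib mult_ac)
  have single: "(\<integral>x. \<bar>wsum (ah h) \<Gamma> (Y h) x\<bar> \<partial>\<mu>) \<le> sqrt (8 * b ^ 4 * corr_sum (k + m) * (\<alpha>\<^sup>2 * A))"
    if h: "h \<in> centered_box m" for h
  proof (rule expectation_abs_le_sqrt)
    show "integrable \<mu> (wsum (ah h) \<Gamma> (Y h))"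
      using integrable_wsum[OF Y[OF h] \<Gamma>, of "\<lambda>s. s"] by simp
    show "integrable \<mu> (\<lambda>x. (wsum (ah h) \<Gamma> (Y h) x)\<^sup>2)"
      by (rule integrable_wsum[OF Y[OF h] \<Gamma>])
    have "(\<integral>x. (wsum (ah h) \<Gamma> (Y h) x)\<^sup>2 \<partial>\<mu>) \<le>
        2 * ((2 * b\<^sup>2)\<^sup>2 * corr_sum (k + m) * (\<Sum>i\<in>\<Gamma>. (ah h i)\<^sup>2))"
      using moment_bound[OF Y[OF h] \<Gamma>, of "ah h" 1] by simp
    also have "\<dots> \<le> 2 * ((2 * b\<^sup>2)\<^sup>2 * corr_sum (k + m) * (\<alpha>\<^sup>2 * A))"
    proof (intro mult_left_mono)
      have "(\<Sum>i\<in>\<Gamma>. (ah h i)\<^sup>2) \<le> (\<Sum>i\<in>\<Gamma>. \<alpha>\<^sup>2 * (a i)\<^sup>2)"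
      proof (rule sum_mono)
        fix i
        have "(a (i + h))\<^sup>2 \<le> \<alpha>\<^sup>2"
          using al[of "i + h"] by (simp add: abs_le_square_iff[symmetric])
        then have "(a (i + h))\<^sup>2 * (a i)\<^sup>2 \<le> \<alpha>\<^sup>2 * (a i)\<^sup>2" by (intro mult_right_mono) auto
        then show "(ah h i)\<^sup>2 \<le> \<alpha>\<^sup>2 * (a i)\<^sup>2" by (simp add: ah_def power_mult_distrib mult.commute)
      qed
      then show "(\<Sum>i\<in>\<Gamma>. (ah h i)\<^sup>2) \<le> \<alpha>\<^sup>2 * A" by (simp add: A_def sum_distrib_left)
    qed (use corr_sum_ge_1[of "k + m"] in auto)
    also have "\<dots> = 8 * b ^ 4 * corr_sum (k + m) * (\<alpha>\<^sup>2 * A)"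
      by (simp add: power_mult_distrib)
    finally show "(\<integral>x. (wsum (ah h) \<Gamma> (Y h) x)\<^sup>2 \<partial>\<mu>) \<le> 8 * b ^ 4 * corr_sum (k + m) * (\<alpha>\<^sup>2 * A)" .
  qed
  have int: "integrable \<mu> (\<lambda>x. \<bar>wsum (ah h) \<Gamma> (Y h) x\<bar>)" if "h \<in> centered_box m" for h
    by (rule integrable_wsum[OF Y[OF that] \<Gamma>])
  have "(\<integral>x. \<bar>\<Sum>h\<in>centered_box m. wsum (ah h) \<Gamma> (Y h) x\<bar> \<partial>\<mu>) \<le>
      (\<integral>x. (\<Sum>h\<in>centered_box m. \<bar>wsum (ah h) \<Gamma> (Y h) x\<bar>) \<partial>\<mu>)"
    using int by (intro integral_mono' Bochner_Integration.integrable_sum sum_abs sum_nonneg) auto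
  also have "\<dots> = (\<Sum>h\<in>centered_box m. (\<integral>x. \<bar>wsum (ah h) \<Gamma> (Y h) x\<bar> \<partial>\<mu>))"
    using int by (rule Bochner_Integration.integral_sum)
  also have "\<dots> \<le> (\<Sum>h\<in>(centered_box m :: 'd site set). sqrt (8 * b ^ 4 * corr_sum (k + m) * (\<alpha>\<^sup>2 * A)))"
    by (intro sum_mono single)
  finally show ?thesis unfolding eq by (simp add: real_card_centered_box)
qed

end

section \<open>Characteristic functions of weighted sums\<close>

context mixing_field
begin

definition char_sum :: "('d site \<Rightarrow> real) \<Rightarrow> 'd site set \<Rightarrow> (('d, 'a) config \<Rightarrow> real) \<Rightarrow> real \<Rightarrow> complex" where
  "char_sum a \<Gamma> u t = (\<integral>x. iexp (t * wsum a \<Gamma> u x) \<partial>\<mu>)"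

lemma norm_char_sum_le: "norm (char_sum a \<Gamma> u t) \<le> 1"
proof -
  have "norm (\<integral>x. iexp (t * wsum a \<Gamma> u x) \<partial>\<mu>) \<le> (\<integral>x. 1 \<partial>\<mu>)"
    by (intro norm_integral_le) auto
  then show ?thesis using prob_space by (simp add: char_sum_def)
qed

text \<open>For a local observable the sum is bounded by some \<open>B\<close>, so the second order
  remainder of the integrand is uniform in the configuration and can be integrated.\<close>

lemma char_sum_has_derivative:
  assumes u: "local_obs k b u" and \<Gamma>: "finite \<Gamma>"
  shows "(char_sum a \<Gamma> u has_vector_derivative
    \<i> * (\<integral>x. wsum a \<Gamma> u x *\<^sub>R iexp (t * wsum a \<Gamma> u x) \<partial>\<mu>)) (at t)"
proof -
  let ?S = "wsum a \<Gamma> u"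
  obtain B where B: "\<And>x. norm (?S x) \<le> B"
    using bounded_depends_on[OF finite_footprint[OF \<Gamma>] depends_on_wsum[OF u, of "\<lambda>s. s" a \<Gamma>]]
    by auto
  have B0: "0 \<le> B" using B[of undefined] norm_ge_zero order_trans by blast
  have I: "integrable \<mu> (\<lambda>x. \<Psi> (?S x))" for \<Psi> :: "real \<Rightarrow> complex"
    by (rule integrable_wsum[OF u \<Gamma>])
  show ?thesis
  proof (rule has_vector_derivative_quadratic[of _ _ _ "B\<^sup>2"])
    fix h
    have "char_sum a \<Gamma> u (t + h) - char_sum a \<Gamma> u t -
        h *\<^sub>R (\<i> * (\<integral>x. ?S x *\<^sub>R iexp (t * ?S x) \<partial>\<mu>)) =
        (\<integral>x. iexp ((t + h) * ?S x) - iexp (t * ?S x) - h *\<^sub>R (\<i> * (?S x *\<^sub>R iexp (t * ?S x))) \<partial>\<mu>)"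
      unfolding char_sum_def
      by (subst Bochner_Integration.integral_diff, intro Bochner_Integration.integrable_diff I,
          rule I[of "\<lambda>s. h *\<^sub>R (\<i> * (s *\<^sub>R iexp (t * s)))"],
          subst Bochner_Integration.integral_diff, rule I, rule I)
        (simp only: integral_scaleR_right integral_mult_right_zero)
    also have "norm \<dots> \<le> (\<integral>x. B\<^sup>2 * h\<^sup>2 \<partial>\<mu>)"
    proof (rule norm_integral_le)
      fix x
      have "iexp ((t + h) * ?S x) - iexp (t * ?S x) - h *\<^sub>R (\<i> * (?S x *\<^sub>R iexp (t * ?S x))) =
          iexp (t * ?S x) * (iexp (h * ?S x) - 1 - \<i> * (h * ?S x))"
      proof -
        have "iexp ((t + h) * ?S x) = iexp (t * ?S x) * iexp (h * ?S x)"
          by (simp add: exp_add[symmetric] algebra_simps)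
        then show ?thesis by (simp add: scaleR_conv_of_real algebra_simps)
      qed
      then have "norm (iexp ((t + h) * ?S x) - iexp (t * ?S x) - h *\<^sub>R (\<i> * (?S x *\<^sub>R iexp (t * ?S x)))) =
          norm (iexp (h * ?S x) - 1 - \<i> * (h * ?S x))"
        by (simp only: norm_mult norm_iexp mult_1_left)
      also have "\<dots> \<le> (h * ?S x)\<^sup>2 / 2" using norm_iexp_linear[of "h * ?S x"] by simp
      also have "\<dots> \<le> (h * ?S x)\<^sup>2" by simp
      also have "\<dots> \<le> B\<^sup>2 * h\<^sup>2"
      proof -
        have "(?S x)\<^sup>2 \<le> B\<^sup>2" using B[of x] B0 by (simp add: abs_le_square_iff[symmetric])
        then have "(?S x)\<^sup>2 * h\<^sup>2 \<le> B\<^sup>2 * h\<^sup>2" by (rule mult_right_mono) simp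
        then show ?thesis by (simp only: power_mult_distrib mult.commute)
      qed
      finally show "norm (iexp ((t + h) * ?S x) - iexp (t * ?S x) - h *\<^sub>R (\<i> * (?S x *\<^sub>R iexp (t * ?S x))))
          \<le> B\<^sup>2 * h\<^sup>2" .
    qed simp
    finally show "norm (char_sum a \<Gamma> u (t + h) - char_sum a \<Gamma> u t -
        h *\<^sub>R (\<i> * (\<integral>x. ?S x *\<^sub>R iexp (t * ?S x) \<partial>\<mu>))) \<le> B\<^sup>2 * h\<^sup>2"
      using prob_space by simp
  qed
qed

text \<open>The first two summands are those of \<open>stein_estimate\<close>, the square root is
  the fluctuation of \<open>near_sum\<close>, and the last term compares its mean with the target
  variance \<open>s\<close>. \<open>L\<close> stands for \<open>|t|\<close>; the error grows with
  it, so its value at \<open>t\<close> covers all arguments between 0 and \<open>t\<close>.\<close>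

definition stein_error :: "nat \<Rightarrow> real \<Rightarrow> (('d, 'a) config \<Rightarrow> real) \<Rightarrow> nat \<Rightarrow>
    ('d site \<Rightarrow> real) \<Rightarrow> 'd site set \<Rightarrow> real \<Rightarrow> real \<Rightarrow> real \<Rightarrow> real" where
  "stein_error k b u m a \<Gamma> \<alpha> s L = (let A = (\<Sum>i\<in>\<Gamma>. (a i)\<^sup>2) in
     L * b\<^sup>2 * decay_tail m * A + L\<^sup>2 * b ^ 3 * \<alpha> * ((2 * real m + 1) ^ CARD('d))\<^sup>2 * A +
     L * ((2 * real m + 1) ^ CARD('d) * sqrt (8 * b ^ 4 * corr_sum (k + m) * (\<alpha>\<^sup>2 * A)) +
       \<bar>(\<Sum>h\<in>centered_box m. cov u h * (\<Sum>i\<in>\<Gamma>. a i * a (i + h))) - s\<bar>))"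

text \<open>Stein's equation \<open>\<phi>' = - s t \<phi>\<close> for the characteristic function holds up to the error, and
  multiplying with the integrating factor \<open>exp (s t\<^sup>2 / 2)\<close> solves it approximately.\<close>

lemma char_sum_gaussian_estimate:
  assumes u: "local_obs k b u" and \<Gamma>: "finite \<Gamma>" and a0: "\<And>i. i \<notin> \<Gamma> \<Longrightarrow> a i = 0"
    and al: "\<And>i. \<bar>a i\<bar> \<le> \<alpha>" and m: "3 * k \<le> m"
  shows "norm (char_sum a \<Gamma> u t - complex_of_real (exp (- (s * t\<^sup>2 / 2)))) \<le>
    stein_error k b u m a \<Gamma> \<alpha> s \<bar>t\<bar> * (exp (\<bar>s\<bar> * t\<^sup>2 / 2) * \<bar>t\<bar> * exp (- (s * t\<^sup>2 / 2)))"
proof -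
  have b0: "0 \<le> b" using local_obs_nonneg[OF u] .
  have \<alpha>0: "0 \<le> \<alpha>" using al[of undefined] by linarith
  let ?S = "wsum a \<Gamma> u" and ?\<phi> = "char_sum a \<Gamma> u"
  define A where "A = (\<Sum>i\<in>\<Gamma>. (a i)\<^sup>2)"
  have A0: "0 \<le> A" unfolding A_def by (simp add: sum_nonneg)
  define EZ where "EZ = (\<Sum>h\<in>centered_box m. cov u h * (\<Sum>i\<in>\<Gamma>. a i * a (i + h)))"
  define err where "err = stein_error k b u m a \<Gamma> \<alpha> s \<bar>t\<bar>"
  define conc where "conc = (2 * real m + 1) ^ CARD('d) * sqrt (8 * b ^ 4 * corr_sum (k + m) * (\<alpha>\<^sup>2 * A))"
  have conc: "(\<integral>x. \<bar>near_sum m a \<Gamma> u x - EZ\<bar> \<partial>\<mu>) \<le> conc"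
    unfolding conc_def EZ_def A_def by (rule near_sum_concentration[OF u \<Gamma> a0 al])
  have conc0: "0 \<le> conc" using conc by (meson Bochner_Integration.integral_nonneg abs_ge_zero order_trans)
  define \<phi>' where "\<phi>' r = \<i> * (\<integral>x. ?S x *\<^sub>R iexp (r * ?S x) \<partial>\<mu>)" for r
  have I\<phi>: "integrable \<mu> (\<lambda>x. iexp (r * ?S x))" for r
    by (rule integrable_wsum[OF u \<Gamma>])
  define G where "G = \<Gamma> \<union> (\<Union>i\<in>\<Gamma>. (\<lambda>h. i + h) ` centered_box m)"
  have G: "finite G" "\<Gamma> \<subseteq> G" "\<And>i h. i \<in> \<Gamma> \<Longrightarrow> h \<in> centered_box m \<Longrightarrow> i + h \<in> G"
    using \<Gamma> by (auto simp: G_def)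
  have near_cong: "near_sum m a \<Gamma> u x = near_sum m a \<Gamma> u y"
    if "\<And>i. i \<in> G \<Longrightarrow> u (lattice_shift i x) = u (lattice_shift i y)" for x y
    unfolding near_sum_def using G that by (intro sum.cong refl) (auto simp: subset_iff)
  have S_cong: "?S x = ?S y"
    if "\<And>i. i \<in> G \<Longrightarrow> u (lattice_shift i x) = u (lattice_shift i y)" for x y
    unfolding wsum_def using G that by (intro sum.cong refl) (auto simp: subset_iff)
  have IN: "integrable \<mu> (\<lambda>x. near_sum m a \<Gamma> u x *\<^sub>R iexp (r * ?S x))" for r
    by (rule integrable_local[OF u G(1)]) (metis near_cong S_cong)
  have IN': "integrable \<mu> (\<lambda>x. \<bar>near_sum m a \<Gamma> u x - EZ\<bar>)"
    by (rule integrable_local[OF u G(1)]) (metis near_cong)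
  have stein: "norm (\<phi>' r + (r * s) *\<^sub>R ?\<phi> r) \<le> err" if r: "\<bar>r\<bar> \<le> \<bar>t\<bar>" for r
  proof -
    let ?N = "\<integral>x. near_sum m a \<Gamma> u x *\<^sub>R iexp (r * ?S x) \<partial>\<mu>"
    have r2: "r\<^sup>2 \<le> \<bar>t\<bar>\<^sup>2" using r by (simp add: abs_le_square_iff)
    have "\<phi>' r + (r * s) *\<^sub>R ?\<phi> r =
        \<i> * ((\<integral>x. ?S x *\<^sub>R iexp (r * ?S x) \<partial>\<mu>) - (\<i> * r) * ?N) +
        (r *\<^sub>R ((EZ *\<^sub>R ?\<phi> r - ?N) - (EZ - s) *\<^sub>R ?\<phi> r))"
      by (simp add: \<phi>'_def scaleR_conv_of_real algebra_simps)
    then have "norm (\<phi>' r + (r * s) *\<^sub>R ?\<phi> r) \<le>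
        norm ((\<integral>x. ?S x *\<^sub>R iexp (r * ?S x) \<partial>\<mu>) - (\<i> * r) * ?N) +
        \<bar>r\<bar> * norm ((EZ *\<^sub>R ?\<phi> r - ?N) - (EZ - s) *\<^sub>R ?\<phi> r)"
      by (metis (no_types, lifting) norm_triangle_ineq norm_mult norm_ii mult_1 norm_scaleR)
    also have "norm ((\<integral>x. ?S x *\<^sub>R iexp (r * ?S x) \<partial>\<mu>) - (\<i> * r) * ?N) \<le>
        \<bar>r\<bar> * b\<^sup>2 * decay_tail m * A + r\<^sup>2 * b ^ 3 * \<alpha> * ((2 * real m + 1) ^ CARD('d))\<^sup>2 * A"
      unfolding A_def by (rule stein_estimate[OF u \<Gamma> a0 al m])
    also have "\<dots> \<le> \<bar>t\<bar> * b\<^sup>2 * decay_tail m * A + \<bar>t\<bar>\<^sup>2 * b ^ 3 * \<alpha> * ((2 * real m + 1) ^ CARD('d))\<^sup>2 * A"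
      using r r2 b0 \<alpha>0 A0 decay_tail_nonneg
      by (intro add_mono mult_right_mono) auto
    also have "norm ((EZ *\<^sub>R ?\<phi> r - ?N) - (EZ - s) *\<^sub>R ?\<phi> r) \<le> conc + \<bar>EZ - s\<bar>"
    proof (rule order_trans[OF norm_triangle_ineq4 add_mono])
      have "EZ *\<^sub>R ?\<phi> r - ?N = (\<integral>x. EZ *\<^sub>R iexp (r * ?S x) - near_sum m a \<Gamma> u x *\<^sub>R iexp (r * ?S x) \<partial>\<mu>)"
        unfolding char_sum_def using IN I\<phi> by simp
      also have "norm \<dots> \<le> (\<integral>x. \<bar>near_sum m a \<Gamma> u x - EZ\<bar> \<partial>\<mu>)"
        by (rule norm_integral_le[OF IN'])
          (simp add: scaleR_diff_left[symmetric] abs_minus_commute del: scaleR_diff_left)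
      finally show "norm (EZ *\<^sub>R ?\<phi> r - ?N) \<le> conc" using conc by linarith
      show "norm ((EZ - s) *\<^sub>R ?\<phi> r) \<le> \<bar>EZ - s\<bar>"
        using mult_left_mono[OF norm_char_sum_le[of a \<Gamma> u r], of "\<bar>EZ - s\<bar>"] by simp
    qed
    also have "\<bar>r\<bar> * (conc + \<bar>EZ - s\<bar>) \<le> \<bar>t\<bar> * (conc + \<bar>EZ - s\<bar>)"
      using r conc0 by (intro mult_right_mono) auto
    finally show ?thesis
      by (simp add: err_def stein_error_def Let_def A_def EZ_def conc_def mult_left_mono)
  qed
  define \<psi> where "\<psi> r = ?\<phi> r * complex_of_real (exp (s * r\<^sup>2 / 2))" for r
  have der: "(\<psi> has_vector_derivative (\<phi>' r + (r * s) *\<^sub>R ?\<phi> r) * complex_of_real (exp (s * r\<^sup>2 / 2))) (at r)" for r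
  proof -
    have "((\<lambda>r. exp (s * r\<^sup>2 / 2)) has_real_derivative exp (s * r\<^sup>2 / 2) * (s * r)) (at r)"
      by (auto intro!: derivative_eq_intros)
    then have "((\<lambda>r. complex_of_real (exp (s * r\<^sup>2 / 2))) has_vector_derivative
        complex_of_real (exp (s * r\<^sup>2 / 2) * (s * r))) (at r)"
      by (intro has_vector_derivative_of_real) (simp add: has_real_derivative_iff_has_vector_derivative)
    then have "(\<psi> has_vector_derivative ?\<phi> r * complex_of_real (exp (s * r\<^sup>2 / 2) * (s * r)) +
        \<phi>' r * complex_of_real (exp (s * r\<^sup>2 / 2))) (at r)"
      unfolding \<psi>_def \<phi>'_def by (intro has_vector_derivative_mult char_sum_has_derivative[OF u \<Gamma>])
    moreover have "?\<phi> r * complex_of_real (exp (s * r\<^sup>2 / 2) * (s * r)) +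
        \<phi>' r * complex_of_real (exp (s * r\<^sup>2 / 2)) =
        (\<phi>' r + (r * s) *\<^sub>R ?\<phi> r) * complex_of_real (exp (s * r\<^sup>2 / 2))"
      by (simp add: scaleR_conv_of_real algebra_simps)
    ultimately show ?thesis by (simp only:)
  qed
  have err0: "0 \<le> err" using stein[of 0] norm_ge_zero order_trans by (metis abs_ge_zero abs_zero)
  \<comment> \<open>The symmetric interval treats both signs of \<open>t\<close>. Here
    \<open>s\<close> may be negative, because nonnegativity of the limit variance is deduced later
    from this very estimate; hence the integrating factor is bounded with
    \<open>|s|\<close>.\<close>
  define I where "I = {- \<bar>t\<bar>..\<bar>t\<bar>}"
  have "norm (\<psi> t - \<psi> 0) \<le> (err * exp (\<bar>s\<bar> * t\<^sup>2 / 2)) * norm (t - 0)"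
  proof (rule differentiable_bound[of I])
    fix r assume "r \<in> I"
    then have r: "\<bar>r\<bar> \<le> \<bar>t\<bar>" by (auto simp: I_def)
    show "(\<psi> has_derivative (\<lambda>h. h *\<^sub>R ((\<phi>' r + (r * s) *\<^sub>R ?\<phi> r) * complex_of_real (exp (s * r\<^sup>2 / 2)))))
        (at r within I)"
      using der[of r] unfolding has_vector_derivative_def by (rule has_derivative_at_withinI)
    have "s * r\<^sup>2 \<le> \<bar>s\<bar> * t\<^sup>2"
      using r by (intro mult_mono) (auto simp: abs_le_square_iff)
    then have e: "exp (s * r\<^sup>2 / 2) \<le> exp (\<bar>s\<bar> * t\<^sup>2 / 2)" by simp
    have D: "norm ((\<phi>' r + (r * s) *\<^sub>R ?\<phi> r) * complex_of_real (exp (s * r\<^sup>2 / 2))) \<le>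
        err * exp (\<bar>s\<bar> * t\<^sup>2 / 2)"
      unfolding norm_mult norm_of_real abs_exp_cancel by (intro mult_mono stein r e err0) auto
    show "onorm (\<lambda>h. h *\<^sub>R ((\<phi>' r + (r * s) *\<^sub>R ?\<phi> r) * complex_of_real (exp (s * r\<^sup>2 / 2)))) \<le>
        err * exp (\<bar>s\<bar> * t\<^sup>2 / 2)"
    proof (rule onorm_le)
      fix h :: real
      show "norm (h *\<^sub>R ((\<phi>' r + (r * s) *\<^sub>R ?\<phi> r) * complex_of_real (exp (s * r\<^sup>2 / 2)))) \<le>
          err * exp (\<bar>s\<bar> * t\<^sup>2 / 2) * norm h"
        using mult_left_mono[OF D, of "\<bar>h\<bar>"] by (simp add: mult.commute)
    qed
  qed (auto simp: I_def)
  moreover have "\<psi> 0 = 1" using prob_space by (simp add: \<psi>_def char_sum_def)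
  ultimately have 1: "norm (\<psi> t - 1) \<le> err * exp (\<bar>s\<bar> * t\<^sup>2 / 2) * \<bar>t\<bar>" by simp
  have "?\<phi> t - complex_of_real (exp (- (s * t\<^sup>2 / 2))) =
      (\<psi> t - 1) * complex_of_real (exp (- (s * t\<^sup>2 / 2)))"
    unfolding \<psi>_def left_diff_distrib mult.assoc of_real_mult[symmetric] exp_add[symmetric]
    by simp
  then have "norm (?\<phi> t - complex_of_real (exp (- (s * t\<^sup>2 / 2)))) =
      norm (\<psi> t - 1) * exp (- (s * t\<^sup>2 / 2))" by (simp only: norm_mult norm_of_real abs_exp_cancel)
  also have "\<dots> \<le> (err * exp (\<bar>s\<bar> * t\<^sup>2 / 2) * \<bar>t\<bar>) * exp (- (s * t\<^sup>2 / 2))"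
    by (intro mult_right_mono 1) simp
  finally show ?thesis by (simp add: err_def mult_ac)
qed

end

text \<open>A condition on triangular arrays of weights that covers Foelner sequences as well as
  discretised linear functionals of the sheet.\<close>

locale weight_array =
  fixes a :: "nat \<Rightarrow> 'd::finite site \<Rightarrow> real" and \<Gamma> :: "nat \<Rightarrow> 'd site set" and V :: real
  assumes finite_\<Gamma>: "\<And>n. finite (\<Gamma> n)"
    and a_0: "\<And>n i. i \<notin> \<Gamma> n \<Longrightarrow> a n i = 0"
    and overlap: "\<And>h. (\<lambda>n. \<Sum>i\<in>\<Gamma> n. a n i * a n (i + h)) \<longlonglongrightarrow> V"
begin

definition amax :: "nat \<Rightarrow> real" where
  "amax n = Max (insert 0 ((\<lambda>i. \<bar>a n i\<bar>) ` \<Gamma> n))"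

lemma abs_le_amax: "\<bar>a n i\<bar> \<le> amax n"
  unfolding amax_def using finite_\<Gamma> a_0 by (cases "i \<in> \<Gamma> n") auto

lemma sum_squares_tendsto: "(\<lambda>n. \<Sum>i\<in>\<Gamma> n. (a n i)\<^sup>2) \<longlonglongrightarrow> V"
  using overlap[of 0] by (simp add: power2_eq_square)

text \<open>The left side is one term of the sum of all squared differences at lag \<open>h\<close>,
  which is then expanded; shifting does not increase the sum of squares. The index set includes
  \<open>i\<close>, which may lie outside \<open>\<Gamma> n\<close> although \<open>i + h\<close>
  does not.\<close>

lemma square_diff_le:
  "(a n (i + h) - a n i)\<^sup>2 \<le> 2 * (\<Sum>j\<in>\<Gamma> n. (a n j)\<^sup>2) - 2 * (\<Sum>j\<in>\<Gamma> n. a n j * a n (j + h))"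
proof -
  let ?G = "insert i (\<Gamma> n)"
  have "(a n (i + h) - a n i)\<^sup>2 \<le> (\<Sum>j\<in>?G. (a n (j + h) - a n j)\<^sup>2)"
    using finite_\<Gamma>[of n] by (intro member_le_sum) auto
  also have "\<dots> = (\<Sum>j\<in>?G. (a n (j + h))\<^sup>2) + (\<Sum>j\<in>?G. (a n j)\<^sup>2) - 2 * (\<Sum>j\<in>?G. a n j * a n (j + h))"
    by (simp only: power2_diff sum.distrib sum_subtractf sum_distrib_left mult_ac)
  also have "(\<Sum>j\<in>?G. (a n (j + h))\<^sup>2) \<le> (\<Sum>j\<in>\<Gamma> n. (a n j)\<^sup>2)"
  proof -
    have "(\<Sum>j\<in>?G. (a n (j + h))\<^sup>2) = (\<Sum>j\<in>(\<lambda>j. j + h) ` ?G. (a n j)\<^sup>2)"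
      by (subst sum.reindex) (auto simp: inj_on_def)
    also have "\<dots> = (\<Sum>j\<in>(\<lambda>j. j + h) ` ?G \<inter> \<Gamma> n. (a n j)\<^sup>2)"
      using finite_\<Gamma>[of n] a_0 by (intro sum.mono_neutral_right) auto
    also have "\<dots> \<le> (\<Sum>j\<in>\<Gamma> n. (a n j)\<^sup>2)" using finite_\<Gamma>[of n] by (intro sum_mono2) auto
    finally show ?thesis .
  qed
  also have "(\<Sum>j\<in>?G. (a n j)\<^sup>2) = (\<Sum>j\<in>\<Gamma> n. (a n j)\<^sup>2)"
    using finite_\<Gamma>[of n] a_0 by (intro sum.mono_neutral_right) auto
  also have "(\<Sum>j\<in>?G. a n j * a n (j + h)) = (\<Sum>j\<in>\<Gamma> n. a n j * a n (j + h))"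
    using finite_\<Gamma>[of n] a_0 by (intro sum.mono_neutral_right) auto
  finally show ?thesis by simp
qed

text \<open>A large weight would force many large weights along a coordinate line.\<close>

lemma amax_tendsto: "amax \<longlonglongrightarrow> 0"
proof (rule LIMSEQ_I)
  fix r :: real assume r: "0 < r"
  define e where "e = (undefined :: 'd)"
  define p where "p l = axis e (int l)" for l
  have inj: "inj_on (\<lambda>l. i + p l) {..<M}" for i M
    by (auto simp: inj_on_def p_def axis_eq_axis)
  define A where "A n = (\<Sum>j\<in>\<Gamma> n. (a n j)\<^sup>2)" for n
  define D where "D n l = (\<Sum>j\<in>\<Gamma> n. a n j * a n (j + p l))" for n l
  \<comment> \<open>\<open>M\<close> points on a line through \<open>i\<close> carry weights close
    to \<open>a n i\<close>, while the sum of all squares tends to \<open>V\<close>. Therefore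
    \<open>M * (a n i)\<^sup>2\<close> is eventually below \<open>2 * V + 1\<close>, and this choice
    of \<open>M\<close> forces \<open>|a n i| < r\<close>.\<close>
  obtain M where M: "(2 * V + 1) / r\<^sup>2 < real M" using reals_Archimedean2 by blast
  have key: "real M * (a n i)\<^sup>2 \<le> 2 * A n + 4 * (\<Sum>l<M. A n - D n l)" for n i
  proof -
    have "real M * (a n i)\<^sup>2 = (\<Sum>l<M. (a n i)\<^sup>2)" by simp
    also have "\<dots> \<le> (\<Sum>l<M. 2 * (a n (i + p l))\<^sup>2 + 4 * (A n - D n l))"
    proof (rule sum_mono)
      fix l
      have "(a n i)\<^sup>2 \<le> 2 * (a n (i + p l))\<^sup>2 + 2 * (a n (i + p l) - a n i)\<^sup>2"
        using sum_squares_ge_zero[of "a n i - 2 * a n (i + p l)" 0]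
        by (simp add: power2_eq_square algebra_simps)
      then show "(a n i)\<^sup>2 \<le> 2 * (a n (i + p l))\<^sup>2 + 4 * (A n - D n l)"
        using square_diff_le[of n i "p l", folded A_def, folded D_def]
          mult_left_mono[of "(a n (i + p l) - a n i)\<^sup>2" "2 * A n - 2 * D n l" 2] by simp
    qed
    also have "\<dots> = 2 * (\<Sum>l<M. (a n (i + p l))\<^sup>2) + 4 * (\<Sum>l<M. A n - D n l)"
      by (simp only: sum.distrib sum_distrib_left)
    also have "(\<Sum>l<M. (a n (i + p l))\<^sup>2) \<le> A n"
    proof -
      have "(\<Sum>l<M. (a n (i + p l))\<^sup>2) = (\<Sum>j\<in>(\<lambda>l. i + p l) ` {..<M}. (a n j)\<^sup>2)"
        by (subst sum.reindex[OF inj]) simp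
      also have "\<dots> = (\<Sum>j\<in>(\<lambda>l. i + p l) ` {..<M} \<inter> \<Gamma> n. (a n j)\<^sup>2)"
        using a_0 by (intro sum.mono_neutral_right) auto
      also have "\<dots> \<le> A n" unfolding A_def using finite_\<Gamma>[of n] by (intro sum_mono2) auto
      finally show ?thesis .
    qed
    finally show ?thesis by simp
  qed
  have "(\<lambda>n. 2 * A n + 4 * (\<Sum>l<M. A n - D n l)) \<longlonglongrightarrow> 2 * V + 4 * (\<Sum>l<M. V - V)"
    unfolding A_def D_def by (intro tendsto_intros sum_squares_tendsto overlap)
  then have "eventually (\<lambda>n. 2 * A n + 4 * (\<Sum>l<M. A n - D n l) < 2 * V + 1) sequentially"
    by (intro order_tendstoD(2)) auto
  then obtain N where N: "\<And>n. N \<le> n \<Longrightarrow> 2 * A n + 4 * (\<Sum>l<M. A n - D n l) < 2 * V + 1"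
    by (auto simp: eventually_sequentially)
  show "\<exists>N. \<forall>n\<ge>N. norm (amax n - 0) < r"
  proof (intro exI[of _ N] allI impI)
    fix n assume n: "N \<le> n"
    have "\<bar>a n i\<bar> < r" for i
    proof -
      have lt: "real M * (a n i)\<^sup>2 < 2 * V + 1" using key[of n i] N[OF n] by linarith
      also have "2 * V + 1 < real M * r\<^sup>2" using M r by (simp add: field_simps)
      finally have "(a n i)\<^sup>2 < r\<^sup>2" by (rule mult_left_less_imp_less) simp
      then show ?thesis using r power2_less_imp_less[of "\<bar>a n i\<bar>" r] by simp
    qed
    then have "amax n < r" unfolding amax_def using finite_\<Gamma>[of n] r by (subst Max_less_iff) auto
    moreover have "0 \<le> amax n" using abs_le_amax[of n undefined] by linarith
    ultimately show "norm (amax n - 0) < r" by simp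
  qed
qed

end

lemma filterlim_centered_box: "filterlim centered_box (finite_subsets_at_top UNIV) sequentially"
  unfolding filterlim_finite_subsets_at_top
proof (intro allI impI)
  fix F :: "'d::finite site set" assume F: "finite F \<and> F \<subseteq> UNIV"
  show "eventually (\<lambda>m. finite (centered_box m) \<and> F \<subseteq> centered_box m \<and> centered_box m \<subseteq> (UNIV :: 'd site set)) sequentially"
  proof (rule eventually_sequentiallyI)
    fix m assume m: "Max (insert 0 (snorm ` F)) \<le> m"
    have "snorm i \<le> m" if "i \<in> F" for i
      using F that m by (auto intro: order_trans[OF Max_ge])
    then show "finite (centered_box m) \<and> F \<subseteq> centered_box m \<and> centered_box m \<subseteq> (UNIV :: 'd site set)"
      by (auto simp: snorm_le_centered_box[symmetric])
  qed
qed

text \<open>The limits are taken in order: first \<open>n\<close> with the cutoff \<open>m\<close>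
  fixed, which removes the terms with the largest weight, then \<open>m\<close>, which removes the
  far correlations and completes the truncated sum of covariances.\<close>

lemma (in mixing_field) char_sum_tendsto_local:
  assumes u: "local_obs k b u" and "weight_array a \<Gamma> V"
  shows "(\<lambda>n. char_sum (a n) (\<Gamma> n) u t) \<longlonglongrightarrow>
    complex_of_real (exp (- ((\<Sum>\<^sub>\<infinity>h\<in>UNIV. cov u h) * V * t\<^sup>2 / 2)))"
proof -
  interpret weight_array a \<Gamma> V by fact
  define \<sigma> where "\<sigma> = (\<Sum>\<^sub>\<infinity>h\<in>UNIV. cov u h)"
  define K where "K = exp (\<bar>\<sigma> * V\<bar> * t\<^sup>2 / 2) * \<bar>t\<bar> * exp (- (\<sigma> * V * t\<^sup>2 / 2))"
  define E where "E m = (\<bar>t\<bar> * b\<^sup>2 * decay_tail m * V + \<bar>t\<bar> * \<bar>(\<Sum>h\<in>centered_box m. cov u h) * V - \<sigma> * V\<bar>) * K" for m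
  define e where "e m n = stein_error k b u m (a n) (\<Gamma> n) (amax n) (\<sigma> * V) \<bar>t\<bar> * K" for m n
  have E_lim: "E \<longlonglongrightarrow> 0"
  proof -
    have "(\<lambda>m. \<Sum>h\<in>centered_box m. cov u h) \<longlonglongrightarrow> \<sigma>"
      unfolding \<sigma>_def
      by (rule filterlim_compose[OF infsum_tendsto[OF cov_summable[OF u]] filterlim_centered_box])
    then have "E \<longlonglongrightarrow> (\<bar>t\<bar> * b\<^sup>2 * 0 * V + \<bar>t\<bar> * \<bar>\<sigma> * V - \<sigma> * V\<bar>) * K"
      unfolding E_def by (intro tendsto_intros decay_tail_tendsto)
    then show ?thesis by simp
  qed
  have e_lim: "e m \<longlonglongrightarrow> E m" for m
  proof -
    have "e m \<longlonglongrightarrow> (\<bar>t\<bar> * b\<^sup>2 * decay_tail m * V + \<bar>t\<bar>\<^sup>2 * b ^ 3 * 0 * ((2 * real m + 1) ^ CARD('d))\<^sup>2 * V +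
        \<bar>t\<bar> * ((2 * real m + 1) ^ CARD('d) * sqrt (8 * b ^ 4 * corr_sum (k + m) * (0\<^sup>2 * V)) +
         \<bar>(\<Sum>h\<in>centered_box m. cov u h * V) - \<sigma> * V\<bar>)) * K"
      unfolding e_def stein_error_def Let_def
      by (intro tendsto_intros amax_tendsto sum_squares_tendsto overlap)
    then show ?thesis by (simp add: E_def sum_distrib_right)
  qed
  have bound: "norm (char_sum (a n) (\<Gamma> n) u t - complex_of_real (exp (- (\<sigma> * V * t\<^sup>2 / 2)))) \<le> e m n"
    if "3 * k \<le> m" for m n
    unfolding e_def K_def
    by (rule char_sum_gaussian_estimate[OF u finite_\<Gamma> a_0 abs_le_amax that])
  have "(\<lambda>n. char_sum (a n) (\<Gamma> n) u t) \<longlonglongrightarrow> complex_of_real (exp (- (\<sigma> * V * t\<^sup>2 / 2)))"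
  proof (rule LIMSEQ_I)
    fix r :: real assume r: "0 < r"
    have "eventually (\<lambda>m. E m < r \<and> 3 * k \<le> m) sequentially"
      using order_tendstoD(2)[OF E_lim r] eventually_ge_at_top[of "3 * k"] by eventually_elim simp
    then obtain m where m: "E m < r" "3 * k \<le> m"
      using eventually_happens'[OF sequentially_bot] by blast
    obtain N where "\<And>n. N \<le> n \<Longrightarrow> e m n < r"
      using order_tendstoD(2)[OF e_lim m(1)] by (auto simp: eventually_sequentially)
    then show "\<exists>N. \<forall>n\<ge>N. norm (char_sum (a n) (\<Gamma> n) u t - complex_of_real (exp (- (\<sigma> * V * t\<^sup>2 / 2)))) < r"
      using bound[OF m(2)] le_less_trans by blast
  qed
  then show ?thesis by (simp add: \<sigma>_def)
qed

section \<open>Regular observables as series of local observables\<close>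

text \<open>Minkowski's inequality for even exponents without roots: with \<open>s\<close> the sum
  of the \<open>c j\<close>, convexity of the power is applied to the average of the
  \<open>s / c j * Y j\<close> with weights \<open>c j / s\<close>.\<close>

lemma minkowski_even_power:
  fixes Y :: "nat \<Rightarrow> 'b \<Rightarrow> real"
  assumes J: "finite J" and q: "0 < q" and K: "0 \<le> K" and c: "\<And>j. j \<in> J \<Longrightarrow> 0 < c j"
    and I: "\<And>j. j \<in> J \<Longrightarrow> integrable M (\<lambda>x. Y j x ^ (2 * q))"
    and b: "\<And>j. j \<in> J \<Longrightarrow> (\<integral>x. Y j x ^ (2 * q) \<partial>M) \<le> K * c j ^ (2 * q)"
  shows "(\<integral>x. (\<Sum>j\<in>J. Y j x) ^ (2 * q) \<partial>M) \<le> K * (\<Sum>j\<in>J. c j) ^ (2 * q)"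
proof (cases "J = {}")
  case True
  then show ?thesis using q by (simp add: power_0_left)
next
  case False
  define s where "s = (\<Sum>j\<in>J. c j)"
  have s: "0 < s" unfolding s_def using J c False by (intro sum_pos) auto
  have p: "(\<Sum>j\<in>J. c j / s) = 1" using s by (simp add: s_def sum_divide_distrib[symmetric])
  have conv: "(\<Sum>j\<in>J. Y j x) ^ (2 * q) \<le> (\<Sum>j\<in>J. c j / s * ((s / c j) ^ (2 * q) * Y j x ^ (2 * q)))" for x
  proof -
    have "(\<Sum>j\<in>J. Y j x) = (\<Sum>j\<in>J. (c j / s) *\<^sub>R (s / c j * Y j x))"
    proof (intro sum.cong refl)
      fix j assume "j \<in> J"
      then show "Y j x = (c j / s) *\<^sub>R (s / c j * Y j x)" using c[of j] s by simp
    qed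
    moreover have "(\<Sum>j\<in>J. (c j / s) *\<^sub>R (s / c j * Y j x)) ^ (2 * q) \<le>
        (\<Sum>j\<in>J. c j / s * (s / c j * Y j x) ^ (2 * q))"
      by (rule convex_on_sum[OF J False convex_power_even p])
        (use c s in \<open>auto intro: less_imp_le\<close>)
    ultimately have "(\<Sum>j\<in>J. Y j x) ^ (2 * q) \<le> (\<Sum>j\<in>J. c j / s * (s / c j * Y j x) ^ (2 * q))"
      by (simp only:)
    then show ?thesis by (simp only: power_mult_distrib)
  qed
  have "(\<integral>x. (\<Sum>j\<in>J. Y j x) ^ (2 * q) \<partial>M) \<le>
      (\<integral>x. (\<Sum>j\<in>J. c j / s * ((s / c j) ^ (2 * q) * Y j x ^ (2 * q))) \<partial>M)"
  proof (rule integral_mono'[OF _ conv])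
    show "integrable M (\<lambda>x. \<Sum>j\<in>J. c j / s * ((s / c j) ^ (2 * q) * Y j x ^ (2 * q)))"
      using I by (intro Bochner_Integration.integrable_sum integrable_mult_right)
    show "0 \<le> (\<Sum>j\<in>J. c j / s * ((s / c j) ^ (2 * q) * Y j x ^ (2 * q)))" for x
      by (rule order_trans[OF zero_le_even_power conv]) simp
  qed
  also have "\<dots> = (\<Sum>j\<in>J. c j / s * ((s / c j) ^ (2 * q) * (\<integral>x. Y j x ^ (2 * q) \<partial>M)))"
    using I by (subst Bochner_Integration.integral_sum) auto
  also have "\<dots> \<le> (\<Sum>j\<in>J. c j / s * (K * s ^ (2 * q)))"
  proof (intro sum_mono mult_left_mono)
    fix j assume j: "j \<in> J"
    have "(s / c j) ^ (2 * q) * (\<integral>x. Y j x ^ (2 * q) \<partial>M) \<le> (s / c j) ^ (2 * q) * (K * c j ^ (2 * q))"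
      by (intro mult_left_mono b j zero_le_even_power) simp
    also have "\<dots> = K * s ^ (2 * q)" using c[OF j] by (simp add: power_divide)
    finally show "(s / c j) ^ (2 * q) * (\<integral>x. Y j x ^ (2 * q) \<partial>M) \<le> K * s ^ (2 * q)" .
    show "0 \<le> c j / s" using c[OF j] s by simp
  qed
  also have "\<dots> = K * s ^ (2 * q)" using p by (simp only: sum_distrib_right[symmetric] mult_1_left)
  finally show ?thesis by (simp only: s_def)
qed

text \<open>The form in which regularity is used. Convergence is asked almost everywhere because
  \<open>v\<close> is controlled on the support alone; the factor \<open>(2 ^ j) ^ d\<close> matches
  the growth of \<open>corr_sum (2 ^ j)\<close>.\<close>

locale local_expansion = mixing_field \<mu> C c for \<mu> :: "('d::finite, 'a::finite) config measure" and C c +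
  fixes v :: "('d, 'a) config \<Rightarrow> real" and y :: "nat \<Rightarrow> ('d, 'a) config \<Rightarrow> real" and \<beta> :: "nat \<Rightarrow> real"
  assumes v_measurable [measurable]: "v \<in> borel_measurable \<mu>"
    and y_local: "\<And>j. local_obs (2 ^ j) (\<beta> j) (y j)"
    and expansion: "AE x in \<mu>. (\<lambda>J. \<Sum>j<J. y j x) \<longlonglongrightarrow> v x"
    and \<beta>_summable: "summable (\<lambda>j. (2 ^ j) ^ CARD('d) * \<beta> j)"
begin

lemma y_measurable [measurable]: "y j \<in> borel_measurable \<mu>"
  by (rule local_obs_measurable[OF y_local])

lemma \<beta>_nonneg: "0 \<le> \<beta> j"
  by (rule local_obs_nonneg[OF y_local])

text \<open>Since \<open>corr_sum\<close> is at least 1, one majorant serves twice: its square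
  dominates the constant \<open>(\<beta> j)\<^sup>2 * corr_sum (2 ^ j)\<close> of the moment bounds,
  and \<open>\<gamma> j * \<gamma> j'\<close> dominates the sums of cross covariances, in which the
  larger of two ranges enters.\<close>

definition \<gamma> :: "nat \<Rightarrow> real" where "\<gamma> j = \<beta> j * corr_sum (2 ^ j)"

text \<open>The geometric term only makes all of these positive.\<close>

definition \<rho> :: "nat \<Rightarrow> real" where "\<rho> j = \<gamma> j + (1 / 2) ^ j"

lemma \<gamma>_nonneg: "0 \<le> \<gamma> j"
  unfolding \<gamma>_def using \<beta>_nonneg corr_sum_ge_1[of "2 ^ j"] by simp

lemma \<beta>_le_\<gamma>: "\<beta> j \<le> \<gamma> j"
  unfolding \<gamma>_def using \<beta>_nonneg[of j] corr_sum_ge_1[of "2 ^ j"]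
  by (simp add: mult_le_cancel_left1)

lemma \<gamma>_summable: "summable \<gamma>"
proof (rule summable_comparison_test')
  \<comment> \<open>The 7 comes from \<open>6 * 2 ^ j + 1 \<le> 7 * 2 ^ j\<close>; the part of
    \<open>corr_sum\<close> free of the range is merely multiplied by a factor at least 1.\<close>
  define K where "K = 7 ^ CARD('d) + (\<Sum>r. (2 * real r + 1) ^ CARD('d) * decay r)"
  show "summable (\<lambda>j. K * ((2 ^ j) ^ CARD('d) * \<beta> j))" by (rule summable_mult[OF \<beta>_summable])
  fix j
  have 1: "(1::real) \<le> (2 ^ j) ^ CARD('d)" by simp
  have "(6 * real (2 ^ j) + 1) ^ CARD('d) \<le> (7 * 2 ^ j) ^ CARD('d)"
    by (intro power_mono) auto
  moreover have "(\<Sum>r. (2 * real r + 1) ^ CARD('d) * decay r) \<le>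
      (\<Sum>r. (2 * real r + 1) ^ CARD('d) * decay r) * (2 ^ j) ^ CARD('d)"
    using mult_left_mono[OF 1 decay_sum_nonneg] by simp
  ultimately have "corr_sum (2 ^ j) \<le> K * (2 ^ j) ^ CARD('d)"
    unfolding corr_sum_def K_def distrib_right by (simp add: power_mult_distrib)
  then have "\<gamma> j \<le> \<beta> j * (K * (2 ^ j) ^ CARD('d))"
    unfolding \<gamma>_def by (rule mult_left_mono) (rule \<beta>_nonneg)
  then show "norm (\<gamma> j) \<le> K * ((2 ^ j) ^ CARD('d) * \<beta> j)"
    using \<gamma>_nonneg[of j] by (simp add: mult_ac)
qed

lemma \<beta>_abs_summable: "summable \<beta>"
  by (rule summable_comparison_test'[OF \<gamma>_summable, of 0]) (use \<beta>_nonneg \<beta>_le_\<gamma> in auto)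

lemma \<rho>_summable: "summable \<rho>"
  unfolding \<rho>_def by (intro summable_add \<gamma>_summable summable_geometric) simp

lemma \<rho>_pos: "0 < \<rho> j"
  unfolding \<rho>_def using \<gamma>_nonneg by (simp add: add_nonneg_pos)

definition partial :: "nat \<Rightarrow> ('d, 'a) config \<Rightarrow> real" where
  "partial J x = (\<Sum>j<J. y j x)"

lemma partial_measurable [measurable]: "partial J \<in> borel_measurable \<mu>"
  unfolding partial_def by measurable

lemma partial_local: "local_obs (2 ^ J) (\<Sum>j<J. \<beta> j) (partial J)"
  unfolding local_obs_def
proof (intro conjI allI)
  show "depends_on (partial J) (centered_box (2 ^ J))"
    unfolding depends_on_def
  proof clarify
    fix x z :: "('d, 'a) config" assume *: "\<forall>i\<in>centered_box (2 ^ J). x i = z i"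
    have "y j x = y j z" if "j < J" for j
    proof -
      have "local_obs (2 ^ J) (\<beta> j) (y j)"
        by (rule local_obs_mono[OF y_local]) (use that in simp)
      then show ?thesis using * unfolding local_obs_def by (auto intro: depends_onD)
    qed
    then show "partial J x = partial J z" by (simp add: partial_def)
  qed
  show "\<bar>partial J x\<bar> \<le> (\<Sum>j<J. \<beta> j)" for x
    unfolding partial_def using local_obs_bound[OF y_local]
    by (intro order_trans[OF sum_abs] sum_mono)
  have "integrable \<mu> (y j)" for j
    using local_obs_bound[OF y_local] by (intro integrable_bounded[of _ "\<beta> j"]) auto
  then show "(\<integral>x. partial J x \<partial>\<mu>) = 0"
    using y_local by (simp add: partial_def local_obs_def Bochner_Integration.integral_sum)
qed

definition vbound :: real where "vbound = (\<Sum>j. \<beta> j)"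

lemma partial_bound: "\<bar>partial J x\<bar> \<le> vbound"
proof -
  have "(\<Sum>j<J. \<beta> j) \<le> vbound"
    unfolding vbound_def by (intro sum_le_suminf \<beta>_abs_summable) (auto simp: \<beta>_nonneg)
  then show ?thesis using local_obs_bound[OF partial_local, of J x] by linarith
qed

lemma vbound_nonneg: "0 \<le> vbound"
  using partial_bound[of 0 undefined] by (simp add: partial_def)

lemma expansion_shift: "AE x in \<mu>. \<forall>i. (\<lambda>J. partial J (lattice_shift i x)) \<longlonglongrightarrow> v (lattice_shift i x)"
  unfolding AE_all_countable partial_def using AE_shift[OF expansion] by blast

lemma wsum_partial: "wsum a \<Gamma> (partial J) x = (\<Sum>j<J. wsum a \<Gamma> (y j) x)"
  unfolding wsum_def partial_def sum_distrib_left by (rule sum.swap)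

lemma wsum_partial_bound: "\<bar>wsum a \<Gamma> (partial J) x\<bar> \<le> (\<Sum>i\<in>\<Gamma>. \<bar>a i\<bar>) * vbound"
  unfolding wsum_def sum_distrib_right
  by (intro order_trans[OF sum_abs] sum_mono) (simp add: abs_mult mult_left_mono partial_bound)

lemma wsum_measurable [measurable]:
  "f \<in> borel_measurable \<mu> \<Longrightarrow> wsum a \<Gamma> f \<in> borel_measurable \<mu>"
  unfolding wsum_def[abs_def]
  by (intro borel_measurable_sum borel_measurable_times borel_measurable_const
      measurable_compose[OF measurable_shift])

lemma wsum_partial_tendsto: "AE x in \<mu>. (\<lambda>J. wsum a \<Gamma> (partial J) x) \<longlonglongrightarrow> wsum a \<Gamma> v x"
  using expansion_shift
proof eventually_elim
  case (elim x)
  then show ?case unfolding wsum_def by (intro tendsto_intros) auto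
qed

lemma moment_pieces:
  assumes \<Gamma>: "finite \<Gamma>" and q: "0 < q" and I: "finite I"
  shows "(\<integral>x. (\<Sum>j\<in>I. wsum a \<Gamma> (y j) x) ^ (2 * q) \<partial>\<mu>) \<le>
    moment_const q * (\<Sum>i\<in>\<Gamma>. (a i)\<^sup>2) ^ q * (\<Sum>j\<in>I. \<rho> j) ^ (2 * q)"
proof (rule minkowski_even_power[OF I q _ \<rho>_pos])
  let ?A = "\<Sum>i\<in>\<Gamma>. (a i)\<^sup>2"
  have A0: "0 \<le> ?A" by (simp add: sum_nonneg)
  show "0 \<le> moment_const q * ?A ^ q" using moment_const_pos[of q] A0 by simp
  show "integrable \<mu> (\<lambda>x. wsum a \<Gamma> (y j) x ^ (2 * q))" for j
    by (rule integrable_wsum[OF y_local \<Gamma>])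
  fix j
  have cs: "1 \<le> corr_sum (2 ^ j)" by (rule corr_sum_ge_1)
  have "(\<beta> j)\<^sup>2 * corr_sum (2 ^ j) \<le> (\<rho> j)\<^sup>2"
  proof -
    have "(\<beta> j)\<^sup>2 * corr_sum (2 ^ j) \<le> (\<gamma> j)\<^sup>2"
      unfolding \<gamma>_def power_mult_distrib using cs
      by (intro mult_left_mono) (auto simp: power2_eq_square)
    also have "\<dots> \<le> (\<rho> j)\<^sup>2" using \<gamma>_nonneg by (intro power_mono) (auto simp: \<rho>_def)
    finally show ?thesis .
  qed
  then have "(\<beta> j)\<^sup>2 * corr_sum (2 ^ j) * ?A \<le> (\<rho> j)\<^sup>2 * ?A"
    using A0 by (rule mult_right_mono)
  then have "moment_const q * ((\<beta> j)\<^sup>2 * corr_sum (2 ^ j) * ?A) ^ q \<le> moment_const q * ((\<rho> j)\<^sup>2 * ?A) ^ q"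
    using A0 cs moment_const_pos[of q] by (intro mult_left_mono power_mono) auto
  also have "\<dots> = moment_const q * ?A ^ q * \<rho> j ^ (2 * q)"
    by (simp add: power_mult_distrib power_mult)
  finally show "(\<integral>x. wsum a \<Gamma> (y j) x ^ (2 * q) \<partial>\<mu>) \<le> moment_const q * ?A ^ q * \<rho> j ^ (2 * q)"
    using moment_bound[OF y_local[of j] \<Gamma>, of a q] by linarith
qed

lemma wsum_bound_AE: "AE x in \<mu>. \<bar>wsum a \<Gamma> v x\<bar> \<le> (\<Sum>i\<in>\<Gamma>. \<bar>a i\<bar>) * vbound"
  using wsum_partial_tendsto[of a \<Gamma>]
proof eventually_elim
  case (elim x)
  show ?case
    by (rule LIMSEQ_le_const2[OF tendsto_rabs[OF elim]]) (auto intro: wsum_partial_bound)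
qed

text \<open>The bound for finitely many pieces does not depend on their number, so it survives the
  limit in \<open>J\<close>; dominated convergence applies because all partial sums are bounded by
  \<open>vbound\<close>.\<close>

lemma moment_remainder:
  assumes \<Gamma>: "finite \<Gamma>" and q: "0 < q"
  shows "(\<integral>x. (wsum a \<Gamma> v x - wsum a \<Gamma> (partial L) x) ^ (2 * q) \<partial>\<mu>) \<le>
    moment_const q * (\<Sum>i\<in>\<Gamma>. (a i)\<^sup>2) ^ q * (\<Sum>j. \<rho> (j + L)) ^ (2 * q)"
proof (rule LIMSEQ_le_const2)
  let ?W = "(\<Sum>i\<in>\<Gamma>. \<bar>a i\<bar>) * vbound"
  show "(\<lambda>J. \<integral>x. (wsum a \<Gamma> (partial J) x - wsum a \<Gamma> (partial L) x) ^ (2 * q) \<partial>\<mu>) \<longlonglongrightarrow>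
      (\<integral>x. (wsum a \<Gamma> v x - wsum a \<Gamma> (partial L) x) ^ (2 * q) \<partial>\<mu>)"
  proof (rule integral_dominated_convergence[where w = "\<lambda>_. (2 * ?W) ^ (2 * q)"])
    show "AE x in \<mu>. (\<lambda>J. (wsum a \<Gamma> (partial J) x - wsum a \<Gamma> (partial L) x) ^ (2 * q))
        \<longlonglongrightarrow> (wsum a \<Gamma> v x - wsum a \<Gamma> (partial L) x) ^ (2 * q)"
      using wsum_partial_tendsto[of a \<Gamma>] by eventually_elim (intro tendsto_intros)
    have "norm ((wsum a \<Gamma> (partial J) x - wsum a \<Gamma> (partial L) x) ^ (2 * q)) \<le> (2 * ?W) ^ (2 * q)" for J x
    proof -
      have "\<bar>wsum a \<Gamma> (partial J) x - wsum a \<Gamma> (partial L) x\<bar> \<le> 2 * ?W"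
        using wsum_partial_bound[of a \<Gamma> J x] wsum_partial_bound[of a \<Gamma> L x] by linarith
      then show ?thesis unfolding real_norm_def power_abs by (intro power_mono) auto
    qed
    then show "AE x in \<mu>. norm ((wsum a \<Gamma> (partial J) x - wsum a \<Gamma> (partial L) x) ^ (2 * q)) \<le> (2 * ?W) ^ (2 * q)" for J
      by simp
  qed auto
  show "\<exists>N. \<forall>J\<ge>N. (\<integral>x. (wsum a \<Gamma> (partial J) x - wsum a \<Gamma> (partial L) x) ^ (2 * q) \<partial>\<mu>) \<le>
      moment_const q * (\<Sum>i\<in>\<Gamma>. (a i)\<^sup>2) ^ q * (\<Sum>j. \<rho> (j + L)) ^ (2 * q)"
  proof (intro exI[of _ L] allI impI)
    fix J assume J: "L \<le> J"
    have "wsum a \<Gamma> (partial J) x - wsum a \<Gamma> (partial L) x = (\<Sum>j\<in>{L..<J}. wsum a \<Gamma> (y j) x)" for x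
      unfolding wsum_partial using J by (simp add: sum_diff_nat_ivl lessThan_atLeast0)
    then have "(\<integral>x. (wsum a \<Gamma> (partial J) x - wsum a \<Gamma> (partial L) x) ^ (2 * q) \<partial>\<mu>) \<le>
        moment_const q * (\<Sum>i\<in>\<Gamma>. (a i)\<^sup>2) ^ q * (\<Sum>j\<in>{L..<J}. \<rho> j) ^ (2 * q)"
      using moment_pieces[OF \<Gamma> q, of "{L..<J}" a] by simp
    also have "\<dots> \<le> moment_const q * (\<Sum>i\<in>\<Gamma>. (a i)\<^sup>2) ^ q * (\<Sum>j. \<rho> (j + L)) ^ (2 * q)"
    proof (intro mult_left_mono power_mono)
      have "(\<Sum>j\<in>{L..<J}. \<rho> j) = (\<Sum>j<J - L. \<rho> (j + L))"
        using J sum.shift_bounds_nat_ivl[of \<rho> 0 L "J - L"] by (simp add: lessThan_atLeast0)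
      also have "\<dots> \<le> (\<Sum>j. \<rho> (j + L))"
        using \<rho>_pos by (intro sum_le_suminf summable_ignore_initial_segment \<rho>_summable) (auto intro: less_imp_le)
      finally show "(\<Sum>j\<in>{L..<J}. \<rho> j) \<le> (\<Sum>j. \<rho> (j + L))" .
      show "0 \<le> (\<Sum>j\<in>{L..<J}. \<rho> j)" using \<rho>_pos by (intro sum_nonneg) (auto intro: less_imp_le)
      have "0 \<le> (\<Sum>i\<in>\<Gamma>. (a i)\<^sup>2)" by (simp add: sum_nonneg)
      then show "0 \<le> moment_const q * (\<Sum>i\<in>\<Gamma>. (a i)\<^sup>2) ^ q" using moment_const_pos[of q] by simp
    qed
    finally show "(\<integral>x. (wsum a \<Gamma> (partial J) x - wsum a \<Gamma> (partial L) x) ^ (2 * q) \<partial>\<mu>) \<le>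
      moment_const q * (\<Sum>i\<in>\<Gamma>. (a i)\<^sup>2) ^ q * (\<Sum>j. \<rho> (j + L)) ^ (2 * q)" .
  qed
qed

corollary moment_wsum:
  assumes "finite \<Gamma>" "0 < q"
  shows "(\<integral>x. wsum a \<Gamma> v x ^ (2 * q) \<partial>\<mu>) \<le>
    moment_const q * (\<Sum>j. \<rho> j) ^ (2 * q) * (\<Sum>i\<in>\<Gamma>. (a i)\<^sup>2) ^ q"
  using moment_remainder[OF assms, of a 0] by (simp add: wsum_def partial_def mult_ac)

lemma integrable_wsum_power: "integrable \<mu> (\<lambda>x. wsum a \<Gamma> v x ^ n)"
proof (rule integrable_const_bound)
  show "AE x in \<mu>. norm (wsum a \<Gamma> v x ^ n) \<le> ((\<Sum>i\<in>\<Gamma>. \<bar>a i\<bar>) * vbound) ^ n"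
    using wsum_bound_AE by eventually_elim (auto simp: power_abs intro: power_mono)
qed measurable

definition \<gamma>_partial :: "nat \<Rightarrow> real" where "\<gamma>_partial J = (\<Sum>j<J. \<gamma> j)"

lemma sum_abs_cross_cov_le:
  assumes "finite F"
  shows "(\<Sum>h\<in>F. \<bar>\<integral>x. y j x * y j' (lattice_shift h x) \<partial>\<mu>\<bar>) \<le> \<gamma> j * \<gamma> j'"
proof -
  let ?k = "max (2 ^ j) (2 ^ j') :: nat"
  have "(\<Sum>h\<in>F. \<bar>\<integral>x. y j x * y j' (lattice_shift h x) \<partial>\<mu>\<bar>) \<le>
      (\<Sum>h\<in>F. \<beta> j * \<beta> j' * corr ?k (snorm h))"
    by (intro sum_mono abs_cross_cov_le[OF y_local y_local])
  also have "\<dots> \<le> \<beta> j * \<beta> j' * corr_sum ?k"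
    using sum_corr_le[OF assms, of ?k] \<beta>_nonneg by (simp add: sum_distrib_left[symmetric] mult_left_mono)
  also have "\<dots> \<le> \<beta> j * \<beta> j' * (corr_sum (2 ^ j) * corr_sum (2 ^ j'))"
  proof (rule mult_left_mono)
    \<comment> \<open>Both factors are at least 1, so the product dominates the constant of the
      larger range.\<close>
    have "corr_sum ?k \<le> corr_sum (2 ^ j) * corr_sum (2 ^ j')"
      using corr_sum_ge_1[of "2 ^ j"] corr_sum_ge_1[of "2 ^ j'"]
        mult_left_mono[of 1 "corr_sum (2 ^ j')" "corr_sum (2 ^ j)"]
        mult_right_mono[of 1 "corr_sum (2 ^ j)" "corr_sum (2 ^ j')"]
      by (simp add: max_def)
    then show "corr_sum ?k \<le> corr_sum (2 ^ j) * corr_sum (2 ^ j')" .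
  qed (simp add: \<beta>_nonneg)
  finally show ?thesis by (simp add: \<gamma>_def mult_ac)
qed

lemma cov_partial: "cov (partial J) h =
  (\<Sum>(j, j')\<in>{..<J} \<times> {..<J}. \<integral>x. y j x * y j' (lattice_shift h x) \<partial>\<mu>)"
proof -
  have int: "integrable \<mu> (\<lambda>x. y j x * y j' (lattice_shift h x))" for j j'
  proof (rule integrable_bounded)
    show "norm (y j x * y j' (lattice_shift h x)) \<le> \<beta> j * \<beta> j'" for x
      unfolding norm_mult using local_obs_bound[OF y_local] \<beta>_nonneg
      by (intro mult_mono) auto
  qed measurable
  have "cov (partial J) h = (\<integral>x. (\<Sum>(j, j')\<in>{..<J} \<times> {..<J}. y j x * y j' (lattice_shift h x)) \<partial>\<mu>)"
    by (simp add: cov_def partial_def sum_product sum.cartesian_product)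
  also have "\<dots> = (\<Sum>(j, j')\<in>{..<J} \<times> {..<J}. \<integral>x. y j x * y j' (lattice_shift h x) \<partial>\<mu>)"
    using int by (simp add: case_prod_unfold)
  finally show ?thesis .
qed

text \<open>The difference is a sum over index pairs outside the square of side \<open>J\<close>.
  The product form of the bound on cross covariances makes it a difference of two squares,
  independent of the finite set \<open>F\<close>.\<close>

lemma sum_cov_partial_diff_le:
  assumes F: "finite F" and J: "J \<le> J'"
  shows "(\<Sum>h\<in>F. \<bar>cov (partial J') h - cov (partial J) h\<bar>) \<le> (\<gamma>_partial J')\<^sup>2 - (\<gamma>_partial J)\<^sup>2"
proof -
  let ?D = "{..<J'} \<times> {..<J'} - {..<J} \<times> {..<J}"
  let ?X = "\<lambda>h (j, j'). \<integral>x. y j x * y j' (lattice_shift h x) \<partial>\<mu>"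
  have sub: "{..<J} \<times> {..<J} \<subseteq> {..<J'} \<times> {..<J'}" using J by auto
  have "cov (partial J') h - cov (partial J) h = sum (?X h) ?D" for h
    unfolding cov_partial using sum_diff[OF _ sub, of "?X h"] by simp
  then have "(\<Sum>h\<in>F. \<bar>cov (partial J') h - cov (partial J) h\<bar>) \<le> (\<Sum>h\<in>F. \<Sum>p\<in>?D. \<bar>?X h p\<bar>)"
    by (intro sum_mono) (simp only: sum_abs)
  also have "\<dots> = (\<Sum>p\<in>?D. \<Sum>h\<in>F. \<bar>?X h p\<bar>)" by (rule sum.swap)
  also have "\<dots> \<le> (\<Sum>(j, j')\<in>?D. \<gamma> j * \<gamma> j')"
    using sum_abs_cross_cov_le[OF F] by (intro sum_mono) auto
  also have "\<dots> = (\<Sum>(j, j')\<in>{..<J'} \<times> {..<J'}. \<gamma> j * \<gamma> j') - (\<Sum>(j, j')\<in>{..<J} \<times> {..<J}. \<gamma> j * \<gamma> j')"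
    using sub by (intro sum_diff) auto
  also have "\<dots> = (\<gamma>_partial J')\<^sup>2 - (\<gamma>_partial J)\<^sup>2"
    by (simp add: \<gamma>_partial_def power2_eq_square sum_product sum.cartesian_product)
  finally show ?thesis .
qed

lemma \<gamma>_partial_tendsto: "\<gamma>_partial \<longlonglongrightarrow> (\<Sum>j. \<gamma> j)"
  unfolding \<gamma>_partial_def by (rule summable_LIMSEQ[OF \<gamma>_summable])

lemma cov_partial_tendsto: "(\<lambda>J. cov (partial J) h) \<longlonglongrightarrow> cov v h"
  unfolding cov_def
proof (rule integral_dominated_convergence[where w = "\<lambda>_. vbound * vbound"])
  show "AE x in \<mu>. (\<lambda>J. partial J x * partial J (lattice_shift h x)) \<longlonglongrightarrow> v x * v (lattice_shift h x)"
    using expansion_shift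
  proof eventually_elim
    case (elim x)
    from elim[rule_format, of 0] elim[rule_format, of h] show ?case
      by (auto intro: tendsto_mult)
  qed
  show "AE x in \<mu>. norm (partial J x * partial J (lattice_shift h x)) \<le> vbound * vbound" for J
    unfolding norm_mult using partial_bound vbound_nonneg by (intro AE_I2 mult_mono) auto
qed auto

lemma sum_cov_diff_le:
  assumes F: "finite F"
  shows "(\<Sum>h\<in>F. \<bar>cov v h - cov (partial J) h\<bar>) \<le> (\<Sum>j. \<gamma> j)\<^sup>2 - (\<gamma>_partial J)\<^sup>2"
proof (rule LIMSEQ_le)
  show "(\<lambda>J'. \<Sum>h\<in>F. \<bar>cov (partial J') h - cov (partial J) h\<bar>) \<longlonglongrightarrow> (\<Sum>h\<in>F. \<bar>cov v h - cov (partial J) h\<bar>)"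
    by (intro tendsto_intros cov_partial_tendsto)
  show "(\<lambda>J'. (\<gamma>_partial J')\<^sup>2 - (\<gamma>_partial J)\<^sup>2) \<longlonglongrightarrow> (\<Sum>j. \<gamma> j)\<^sup>2 - (\<gamma>_partial J)\<^sup>2"
    by (intro tendsto_intros \<gamma>_partial_tendsto)
  show "\<exists>N. \<forall>J'\<ge>N. (\<Sum>h\<in>F. \<bar>cov (partial J') h - cov (partial J) h\<bar>) \<le> (\<gamma>_partial J')\<^sup>2 - (\<gamma>_partial J)\<^sup>2"
    using sum_cov_partial_diff_le[OF F] by blast
qed

lemma cov_diff_summable: "(\<lambda>h. cov v h - cov (partial J) h) summable_on UNIV"
proof -
  have "(\<lambda>h. norm (cov v h - cov (partial J) h)) summable_on UNIV"
  proof (rule nonneg_bdd_above_summable_on)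
    show "bdd_above (sum (\<lambda>h. norm (cov v h - cov (partial J) h)) ` {F. F \<subseteq> UNIV \<and> finite F})"
      using sum_cov_diff_le[of _ J] by (intro bdd_aboveI2[of _ _ "(\<Sum>j. \<gamma> j)\<^sup>2 - (\<gamma>_partial J)\<^sup>2"]) auto
  qed simp
  then show ?thesis by (rule abs_summable_summable)
qed

text \<open>Since \<open>partial 0\<close> is 0, summability of the differences at
  \<open>J = 0\<close> is already the claim.\<close>

lemma cov_v_summable: "cov v summable_on UNIV"
proof -
  have "cov (partial 0) h = 0" for h by (simp add: cov_def partial_def)
  then show ?thesis using cov_diff_summable[of 0] by simp
qed

text \<open>The bound on the differences is uniform over finite sets of sites, so it passes to the
  unconditional sums.\<close>

lemma infsum_cov_tendsto: "(\<lambda>J. \<Sum>\<^sub>\<infinity>h\<in>UNIV. cov (partial J) h) \<longlonglongrightarrow> (\<Sum>\<^sub>\<infinity>h\<in>UNIV. cov v h)"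
proof -
  let ?b = "\<lambda>J. (\<Sum>j. \<gamma> j)\<^sup>2 - (\<gamma>_partial J)\<^sup>2"
  have "\<bar>(\<Sum>\<^sub>\<infinity>h\<in>UNIV. cov (partial J) h) - (\<Sum>\<^sub>\<infinity>h\<in>UNIV. cov v h)\<bar> \<le> ?b J" for J
  proof -
    have "(\<Sum>\<^sub>\<infinity>h\<in>UNIV. cov v h - cov (partial J) h) =
        (\<Sum>\<^sub>\<infinity>h\<in>UNIV. cov v h) - (\<Sum>\<^sub>\<infinity>h\<in>UNIV. cov (partial J) h)"
      using infsum_add[OF cov_diff_summable[of J] cov_summable[OF partial_local[of J]]] by simp
    moreover have "norm (\<Sum>\<^sub>\<infinity>h\<in>UNIV. cov v h - cov (partial J) h) \<le> ?b J"
    proof (rule tendsto_upperbound[OF tendsto_norm[OF infsum_tendsto[OF cov_diff_summable]]])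
      show "eventually (\<lambda>F. norm (\<Sum>h\<in>F. cov v h - cov (partial J) h) \<le> ?b J) (finite_subsets_at_top UNIV)"
      proof (rule eventually_finite_subsets_at_top_weakI)
        fix F :: "'d site set" assume "finite F"
        then show "norm (\<Sum>h\<in>F. cov v h - cov (partial J) h) \<le> ?b J"
          unfolding real_norm_def by (rule order_trans[OF sum_abs sum_cov_diff_le])
      qed
    qed simp
    ultimately show ?thesis by (simp add: abs_minus_commute)
  qed
  then have "eventually (\<lambda>J. norm ((\<Sum>\<^sub>\<infinity>h\<in>UNIV. cov (partial J) h) - (\<Sum>\<^sub>\<infinity>h\<in>UNIV. cov v h)) \<le> ?b J) sequentially"
    by simp
  moreover have "?b \<longlonglongrightarrow> 0"
  proof -
    have "?b \<longlonglongrightarrow> (\<Sum>j. \<gamma> j)\<^sup>2 - (\<Sum>j. \<gamma> j)\<^sup>2" by (intro tendsto_intros \<gamma>_partial_tendsto)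
    then show ?thesis by simp
  qed
  ultimately show ?thesis by (rule LIM_zero_cancel[OF Lim_null_comparison])
qed

definition \<rho>_tail :: "nat \<Rightarrow> real" where "\<rho>_tail L = (\<Sum>j. \<rho> (j + L))"

lemma \<rho>_tail_tendsto: "\<rho>_tail \<longlonglongrightarrow> 0"
  unfolding \<rho>_tail_def by (rule suminf_exist_split2[OF \<rho>_summable])

lemma \<rho>_tail_nonneg: "0 \<le> \<rho>_tail L"
  unfolding \<rho>_tail_def using \<rho>_pos
  by (intro suminf_nonneg summable_ignore_initial_segment \<rho>_summable) (auto intro: less_imp_le)

text \<open>\<open>iexp\<close> is 1-Lipschitz, and the remainder is small in \<open>L2\<close>
  relative to the squared weights alone. The approximation is thus uniform along an array of weights
  with bounded square sums, which permits exchanging the limits in \<open>n\<close> and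
  \<open>L\<close>.\<close>

lemma char_sum_approx:
  assumes \<Gamma>: "finite \<Gamma>"
  shows "norm (char_sum a \<Gamma> v t - char_sum a \<Gamma> (partial L) t) \<le>
    \<bar>t\<bar> * (sqrt (2 * (\<Sum>i\<in>\<Gamma>. (a i)\<^sup>2)) * \<rho>_tail L)"
proof -
  let ?D = "\<lambda>x. wsum a \<Gamma> v x - wsum a \<Gamma> (partial L) x"
  let ?W = "(\<Sum>i\<in>\<Gamma>. \<bar>a i\<bar>) * vbound"
  have bd: "AE x in \<mu>. \<bar>?D x\<bar> \<le> 2 * ?W"
    using wsum_bound_AE[of a \<Gamma>]
  proof eventually_elim
    case (elim x)
    then show ?case using wsum_partial_bound[of a \<Gamma> L x] by linarith
  qed
  have ID: "integrable \<mu> ?D"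
    using bd by (intro integrable_const_bound[of _ "2 * ?W"]) auto
  have ID2: "integrable \<mu> (\<lambda>x. (?D x)\<^sup>2)"
  proof (rule integrable_const_bound)
    show "AE x in \<mu>. norm ((?D x)\<^sup>2) \<le> (2 * ?W)\<^sup>2"
      using bd by eventually_elim (unfold real_norm_def power_abs, rule power_mono, auto)
  qed measurable
  have "(\<integral>x. (?D x)\<^sup>2 \<partial>\<mu>) \<le> 2 * (\<Sum>i\<in>\<Gamma>. (a i)\<^sup>2) * (\<rho>_tail L)\<^sup>2"
    using moment_remainder[OF \<Gamma>, of 1 a L] by (simp add: \<rho>_tail_def)
  then have "(\<integral>x. \<bar>?D x\<bar> \<partial>\<mu>) \<le> sqrt (2 * (\<Sum>i\<in>\<Gamma>. (a i)\<^sup>2) * (\<rho>_tail L)\<^sup>2)"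
    by (rule expectation_abs_le_sqrt[OF ID ID2])
  then have *: "(\<integral>x. \<bar>?D x\<bar> \<partial>\<mu>) \<le> sqrt (2 * (\<Sum>i\<in>\<Gamma>. (a i)\<^sup>2)) * \<rho>_tail L"
    using \<rho>_tail_nonneg by (simp add: real_sqrt_mult)
  have I: "integrable \<mu> (\<lambda>x. iexp (t * wsum a \<Gamma> f x))" if [measurable]: "f \<in> borel_measurable \<mu>" for f
    by (rule integrable_bounded[of _ 1]) auto
  have "char_sum a \<Gamma> v t - char_sum a \<Gamma> (partial L) t =
      (\<integral>x. iexp (t * wsum a \<Gamma> v x) - iexp (t * wsum a \<Gamma> (partial L) x) \<partial>\<mu>)"
    unfolding char_sum_def
    by (rule Bochner_Integration.integral_diff[OF I[OF v_measurable] I[OF partial_measurable], symmetric])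
  also have "norm \<dots> \<le> (\<integral>x. \<bar>t\<bar> * \<bar>?D x\<bar> \<partial>\<mu>)"
  proof (rule norm_integral_le)
    fix x
    show "norm (iexp (t * wsum a \<Gamma> v x) - iexp (t * wsum a \<Gamma> (partial L) x)) \<le> \<bar>t\<bar> * \<bar>?D x\<bar>"
      using norm_iexp_diff[of "t * wsum a \<Gamma> v x" "t * wsum a \<Gamma> (partial L) x"]
      by (simp only: right_diff_distrib[symmetric] abs_mult)
  qed (use ID in auto)
  also have "\<dots> = \<bar>t\<bar> * (\<integral>x. \<bar>?D x\<bar> \<partial>\<mu>)" by simp
  also have "\<dots> \<le> \<bar>t\<bar> * (sqrt (2 * (\<Sum>i\<in>\<Gamma>. (a i)\<^sup>2)) * \<rho>_tail L)"
    by (rule mult_left_mono[OF *]) simp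
  finally show ?thesis .
qed

theorem char_sum_tendsto:
  assumes "weight_array a \<Gamma> V"
  shows "(\<lambda>n. char_sum (a n) (\<Gamma> n) v t) \<longlonglongrightarrow>
    complex_of_real (exp (- ((\<Sum>\<^sub>\<infinity>h\<in>UNIV. cov v h) * V * t\<^sup>2 / 2)))"
proof -
  interpret weight_array a \<Gamma> V by fact
  define lim where "lim \<sigma> = complex_of_real (exp (- (\<sigma> * V * t\<^sup>2 / 2)))" for \<sigma> :: real
  define \<sigma> where "\<sigma> = (\<Sum>\<^sub>\<infinity>h\<in>UNIV. cov v h)"
  define \<sigma>J where "\<sigma>J J = (\<Sum>\<^sub>\<infinity>h\<in>UNIV. cov (partial J) h)" for J
  define E where "E J n = \<bar>t\<bar> * (sqrt (2 * (\<Sum>i\<in>\<Gamma> n. (a n i)\<^sup>2)) * \<rho>_tail J)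
      + norm (char_sum (a n) (\<Gamma> n) (partial J) t - lim (\<sigma>J J)) + norm (lim (\<sigma>J J) - lim \<sigma>)" for J n
  define E' where "E' J = \<bar>t\<bar> * (sqrt (2 * V) * \<rho>_tail J) + norm (lim (\<sigma>J J) - lim \<sigma>)" for J
  have lim_tendsto: "(\<lambda>J. lim (\<sigma>J J)) \<longlonglongrightarrow> lim \<sigma>"
    unfolding lim_def \<sigma>J_def \<sigma>_def by (intro tendsto_intros infsum_cov_tendsto) simp
  have E': "E' \<longlonglongrightarrow> 0"
  proof -
    have "E' \<longlonglongrightarrow> \<bar>t\<bar> * (sqrt (2 * V) * 0) + norm (lim \<sigma> - lim \<sigma>)"
      unfolding E'_def by (intro tendsto_intros lim_tendsto \<rho>_tail_tendsto)
    then show ?thesis by simp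
  qed
  have E: "E J \<longlonglongrightarrow> E' J" for J
  proof -
    have "(\<lambda>n. char_sum (a n) (\<Gamma> n) (partial J) t) \<longlonglongrightarrow> lim (\<sigma>J J)"
      unfolding lim_def \<sigma>J_def by (rule char_sum_tendsto_local[OF partial_local assms])
    then have "E J \<longlonglongrightarrow> \<bar>t\<bar> * (sqrt (2 * V) * \<rho>_tail J) + norm (lim (\<sigma>J J) - lim (\<sigma>J J)) + norm (lim (\<sigma>J J) - lim \<sigma>)"
      unfolding E_def by (intro tendsto_intros sum_squares_tendsto)
    then show ?thesis by (simp add: E'_def)
  qed
  have bound: "norm (char_sum (a n) (\<Gamma> n) v t - lim \<sigma>) \<le> E J n" for J n
  proof -
    let ?x = "char_sum (a n) (\<Gamma> n) v t - char_sum (a n) (\<Gamma> n) (partial J) t"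
    let ?y = "char_sum (a n) (\<Gamma> n) (partial J) t - lim (\<sigma>J J)"
    let ?z = "lim (\<sigma>J J) - lim \<sigma>"
    have "char_sum (a n) (\<Gamma> n) v t - lim \<sigma> = ?x + ?y + ?z" by simp
    then have "norm (char_sum (a n) (\<Gamma> n) v t - lim \<sigma>) \<le> norm ?x + norm ?y + norm ?z"
      using norm_triangle_ineq[of "?x + ?y" ?z] norm_triangle_ineq[of ?x ?y] by simp
    then show ?thesis
      using char_sum_approx[OF finite_\<Gamma>[of n], of "a n" t J] unfolding E_def by linarith
  qed
  have "(\<lambda>n. char_sum (a n) (\<Gamma> n) v t) \<longlonglongrightarrow> lim \<sigma>"
  proof (rule LIMSEQ_I)
    fix r :: real assume r: "0 < r"
    obtain J where J: "E' J < r"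
      using eventually_happens'[OF sequentially_bot order_tendstoD(2)[OF E' r]] by blast
    obtain N where "\<And>n. N \<le> n \<Longrightarrow> E J n < r"
      using order_tendstoD(2)[OF E J] by (auto simp: eventually_sequentially)
    then show "\<exists>N. \<forall>n\<ge>N. norm (char_sum (a n) (\<Gamma> n) v t - lim \<sigma>) < r"
      using bound[of _ J] le_less_trans by blast
  qed
  then show ?thesis by (simp add: lim_def \<sigma>_def)
qed

end

section \<open>Weak convergence of random continuous functions\<close>

text \<open>The inf-convolution of \<open>f\<close> with a multiple of the distance; for bounded
  \<open>f\<close> it is the largest \<open>k\<close>-Lipschitz function below
  \<open>f\<close>.\<close>

definition lip_minorant :: "('b::metric_space \<Rightarrow> real) \<Rightarrow> nat \<Rightarrow> 'b \<Rightarrow> real" where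
  "lip_minorant f k x = (INF z. f z + real k * dist x z)"

context
  fixes f :: "'b::metric_space \<Rightarrow> real" and B :: real
  assumes f_bound: "\<And>x. \<bar>f x\<bar> \<le> B"
begin

lemma lip_minorant_bdd: "bdd_below (range (\<lambda>z. f z + real k * dist x z))"
proof (rule bdd_belowI2)
  fix z
  show "- B \<le> f z + real k * dist x z"
    using f_bound[of z] by (smt (verit) mult_nonneg_nonneg of_nat_0_le_iff zero_le_dist)
qed

lemma lip_minorant_le: "lip_minorant f k x \<le> f z + real k * dist x z"
  unfolding lip_minorant_def by (rule cINF_lower[OF lip_minorant_bdd]) simp

lemma lip_minorant_le_self: "lip_minorant f k x \<le> f x"
  using lip_minorant_le[of k x x] by simp

lemma lip_minorant_ge: "(\<And>z. c \<le> f z + real k * dist x z) \<Longrightarrow> c \<le> lip_minorant f k x"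
  unfolding lip_minorant_def by (rule cINF_greatest) auto

lemma lip_minorant_lipschitz: "\<bar>lip_minorant f k x - lip_minorant f k y\<bar> \<le> real k * dist x y"
proof -
  have "lip_minorant f k x - real k * dist x y \<le> lip_minorant f k y" for x y
  proof (rule lip_minorant_ge)
    fix z
    have "real k * dist x z \<le> real k * dist x y + real k * dist y z"
      unfolding distrib_left[symmetric] by (intro mult_left_mono dist_triangle) simp
    then show "lip_minorant f k x - real k * dist x y \<le> f z + real k * dist y z"
      using lip_minorant_le[of k x z] by linarith
  qed
  from this[of x y] this[of y x] show ?thesis by (simp add: dist_commute abs_le_iff)
qed

lemma lip_minorant_bound: "\<bar>lip_minorant f k x\<bar> \<le> B"
proof -
  have "- B \<le> lip_minorant f k x"
  proof (rule lip_minorant_ge)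
    fix z
    show "- B \<le> f z + real k * dist x z"
      using f_bound[of z] by (smt (verit) mult_nonneg_nonneg of_nat_0_le_iff zero_le_dist)
  qed
  then show ?thesis using lip_minorant_le_self[of k x] f_bound[of x] by linarith
qed

lemma lip_minorant_tendsto:
  assumes "isCont f x"
  shows "(\<lambda>k. lip_minorant f k x) \<longlonglongrightarrow> f x"
proof (rule LIMSEQ_I)
  fix e :: real assume e: "0 < e"
  obtain d where d: "0 < d" "\<And>z. dist z x < d \<Longrightarrow> dist (f z) (f x) < e / 2"
    using assms e unfolding continuous_at_eps_delta by (metis half_gt_zero)
  \<comment> \<open>A point at distance at least \<open>d\<close> pays at least
    \<open>2 * B\<close>, the full range of \<open>f\<close>, and so cannot bring the infimum below
    \<open>f x\<close>.\<close>
  obtain N :: nat where N: "2 * B / d \<le> real N" using real_arch_simple by blast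
  show "\<exists>N. \<forall>k\<ge>N. norm (lip_minorant f k x - f x) < e"
  proof (intro exI[of _ N] allI impI)
    fix k assume k: "N \<le> k"
    have "f x - e / 2 \<le> lip_minorant f k x"
    proof (rule lip_minorant_ge)
      fix z
      show "f x - e / 2 \<le> f z + real k * dist x z"
      proof (cases "dist z x < d")
        case True
        then have "f x - e / 2 \<le> f z" using d(2)[OF True] unfolding dist_real_def by linarith
        then show ?thesis by (smt (verit) mult_nonneg_nonneg of_nat_0_le_iff zero_le_dist)
      next
        case False
        have "2 * B \<le> real N * d" using N d(1) by (simp add: field_simps)
        also have "\<dots> \<le> real k * dist x z"
          using k False d(1) by (intro mult_mono) (auto simp: dist_commute)
        finally show ?thesis using f_bound[of x] f_bound[of z] e by linarith
      qed
    qed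
    then show "norm (lip_minorant f k x - f x) < e"
      using lip_minorant_le_self[of k x] e by simp
  qed
qed

end

text \<open>Lipschitz minorants give the lower estimate for every bounded continuous function;
  applied to \<open>f\<close> and to its negative this is convergence.\<close>

lemma weak_conv_law_lipschitz:
  fixes P :: "nat \<Rightarrow> 'b::metric_space measure" and Q :: "'b measure"
  assumes P: "\<And>n. prob_space (P n)" "\<And>n. sets (P n) = sets borel"
    and Q: "prob_space Q" "sets Q = sets borel"
    and lip: "\<And>f L B. (\<And>x y. \<bar>f x - f y\<bar> \<le> L * dist x y) \<Longrightarrow> (\<And>x. \<bar>f x\<bar> \<le> B) \<Longrightarrow>
      (\<lambda>n. integral\<^sup>L (P n) f) \<longlonglongrightarrow> integral\<^sup>L Q f"
  shows "weak_conv_law P Q"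
proof -
  have lower: "eventually (\<lambda>n. integral\<^sup>L Q f - e < integral\<^sup>L (P n) f) sequentially"
    if f: "continuous_on UNIV f" and B: "\<And>x. \<bar>f x\<bar> \<le> B" and e: "0 < e" for f :: "'b \<Rightarrow> real" and B e
  proof -
    interpret Q: prob_space Q by fact
    let ?g = "lip_minorant f"
    have g_meas: "?g k \<in> borel_measurable borel" for k
    proof (rule borel_measurable_continuous_onI)
      have "isCont (?g k) x" for x
        unfolding continuous_at_eps_delta
      proof (intro allI impI)
        fix e :: real assume e: "0 < e"
        have "dist (?g k y) (?g k x) < e" if "dist y x < e / (real k + 1)" for y
        proof -
          have "dist (?g k y) (?g k x) \<le> real k * dist y x"
            using lip_minorant_lipschitz[of f B k y x] B by (simp add: dist_real_def)
          also have "\<dots> \<le> (real k + 1) * dist y x" by (intro mult_right_mono) auto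
          also have "\<dots> < e" using that by (simp add: field_simps)
          finally show ?thesis .
        qed
        then show "\<exists>d>0. \<forall>y. dist y x < d \<longrightarrow> dist (?g k y) (?g k x) < e"
          using e by (intro exI[of _ "e / (real k + 1)"]) auto
      qed
      then show "continuous_on UNIV (?g k)" by (simp add: continuous_on_eq_continuous_at)
    qed
    have f_meas: "f \<in> borel_measurable borel" using f by (rule borel_measurable_continuous_onI)
    have "(\<lambda>k. integral\<^sup>L Q (?g k)) \<longlonglongrightarrow> integral\<^sup>L Q f"
    proof (rule integral_dominated_convergence[where w = "\<lambda>_. B"])
      show "f \<in> borel_measurable Q" "\<And>k. ?g k \<in> borel_measurable Q"
        using f_meas g_meas Q(2) by (simp_all cong: measurable_cong_sets)
      show "AE x in Q. (\<lambda>k. ?g k x) \<longlonglongrightarrow> f x"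
        using f B by (intro AE_I2 lip_minorant_tendsto) (auto simp: continuous_on_eq_continuous_at)
      show "AE x in Q. norm (?g k x) \<le> B" for k
        using lip_minorant_bound[of f B] B by (intro AE_I2) auto
    qed auto
    then obtain k where k: "integral\<^sup>L Q f - e / 2 < integral\<^sup>L Q (?g k)"
      using eventually_happens'[OF sequentially_bot order_tendstoD(1)] e
      by (metis diff_less_eq half_gt_zero less_add_same_cancel1)
    have "(\<lambda>n. integral\<^sup>L (P n) (?g k)) \<longlonglongrightarrow> integral\<^sup>L Q (?g k)"
      using lip_minorant_lipschitz[of f B k] lip_minorant_bound[of f B k] B by (intro lip) auto
    then have "eventually (\<lambda>n. integral\<^sup>L Q f - e < integral\<^sup>L (P n) (?g k)) sequentially"
      by (rule order_tendstoD(1)) (use k e in linarith)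
    then show ?thesis
    proof eventually_elim
      case (elim n)
      interpret Pn: prob_space "P n" by (rule P)
      have "integral\<^sup>L (P n) (?g k) \<le> integral\<^sup>L (P n) f"
      proof (rule integral_mono)
        show "integrable (P n) (?g k)"
          using g_meas[of k] lip_minorant_bound[of f B k] B P(2)
          by (intro Pn.integrable_const_bound[of _ B]) (auto cong: measurable_cong_sets)
        show "integrable (P n) f"
          using f_meas B P(2) by (intro Pn.integrable_const_bound[of _ B]) (auto cong: measurable_cong_sets)
      qed (use lip_minorant_le_self[of f B] B in auto)
      then show ?case using elim by linarith
    qed
  qed
  show ?thesis
    unfolding weak_conv_law_def
  proof (intro allI impI)
    fix f :: "'b \<Rightarrow> real" assume f: "continuous_on UNIV f" "bounded (range f)"
    then obtain B where B: "\<And>x. \<bar>f x\<bar> \<le> B" by (auto simp: bounded_iff)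
    show "(\<lambda>n. integral\<^sup>L (P n) f) \<longlonglongrightarrow> integral\<^sup>L Q f"
    proof (rule LIMSEQ_I)
      fix e :: real assume e: "0 < e"
      have "eventually (\<lambda>n. integral\<^sup>L Q f - e < integral\<^sup>L (P n) f) sequentially"
        by (rule lower[OF f(1) B e])
      moreover have "eventually (\<lambda>n. integral\<^sup>L Q (\<lambda>x. - f x) - e < integral\<^sup>L (P n) (\<lambda>x. - f x)) sequentially"
        using f(1) B by (intro lower[OF _ _ e, of _ B] continuous_intros) auto
      ultimately have "eventually (\<lambda>n. norm (integral\<^sup>L (P n) f - integral\<^sup>L Q f) < e) sequentially"
        by eventually_elim (auto simp: abs_less_iff)
      then show "\<exists>N. \<forall>n\<ge>N. norm (integral\<^sup>L (P n) f - integral\<^sup>L Q f) < e"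
        by (simp add: eventually_sequentially)
    qed
  qed
qed


subsection \<open>Finite-dimensional convergence from characteristic functions\<close>

text \<open>Finite sums of characters in the first \<open>K\<close> coordinates: their integrals are
  combinations of characteristic functions. Presented inductively because both convergence and
  closure under products are proved by induction on the terms.\<close>

inductive trig_poly :: "nat \<Rightarrow> ((nat \<Rightarrow> real) \<Rightarrow> complex) \<Rightarrow> bool" for K where
  char: "trig_poly K (\<lambda>p. c * iexp (\<Sum>i<K. w i * p i))"
| add: "trig_poly K f \<Longrightarrow> trig_poly K g \<Longrightarrow> trig_poly K (\<lambda>p. f p + g p)"

lemma trig_poly_char_mult:
  assumes "trig_poly K g"
  shows "trig_poly K (\<lambda>p. (c * iexp (\<Sum>i<K. w i * p i)) * g p)"
  using assms
proof induction
  case (char c' w')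
  have "(\<lambda>p. (c * iexp (\<Sum>i<K. w i * p i)) * (c' * iexp (\<Sum>i<K. w' i * p i))) =
      (\<lambda>p. (c * c') * iexp (\<Sum>i<K. (w i + w' i) * p i))"
    by (rule ext) (simp add: exp_add distrib_left distrib_right sum.distrib mult_ac)
  then show ?case by (simp only: trig_poly.char)
next
  case (add f g)
  show ?case unfolding distrib_left by (rule trig_poly.add[OF add.IH])
qed

lemma trig_poly_mult:
  assumes "trig_poly K f" "trig_poly K g"
  shows "trig_poly K (\<lambda>p. f p * g p)"
  using assms(1)
proof induction
  case (char c w)
  then show ?case by (rule trig_poly_char_mult[OF assms(2)])
next
  case (add f f')
  show ?case unfolding distrib_right by (rule trig_poly.add[OF add.IH])
qed

lemma trig_poly_const: "trig_poly K (\<lambda>p. c)"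
  using trig_poly.char[of K c "\<lambda>_. 0"] by simp

lemma trig_poly_sin:
  assumes "i < K"
  shows "trig_poly K (\<lambda>p. complex_of_real (sin (\<alpha> * p i)))"
proof -
  define w where "w s j = (if j = i then s else 0)" for s :: real and j
  have w: "(\<Sum>j<K. w s j * p j) = s * p i" for s p
    using assms by (simp add: w_def if_distrib[of "\<lambda>x. x * _"] cong: if_cong)
  have "complex_of_real (sin (\<alpha> * p i)) =
      (- \<i> / 2) * iexp (\<Sum>j<K. w \<alpha> j * p j) + (\<i> / 2) * iexp (\<Sum>j<K. w (- \<alpha>) j * p j)" for p
    unfolding w by (simp add: sin_of_real[symmetric] sin_exp_eq field_simps)
  then show ?thesis by (simp only:) (intro trig_poly.intros)
qed

lemma abs_sin_diff_le: "\<bar>sin x - x\<bar> \<le> (x::real)\<^sup>2 / 2"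
proof -
  have "\<bar>Im (iexp x - 1 - \<i> * x)\<bar> \<le> norm (iexp x - 1 - \<i> * x)" by (rule abs_Im_le_cmod)
  also have "\<dots> \<le> x\<^sup>2 / 2" by (rule norm_iexp_linear)
  finally show ?thesis by (simp add: Im_exp)
qed

lemma trig_poly_integrable:
  assumes "prob_space M" and [measurable]: "\<And>i. Y i \<in> borel_measurable M" and "trig_poly K h"
  shows "integrable M (\<lambda>x. h (\<lambda>i. Y i x))"
  using assms(3)
proof induction
  case (char c w)
  interpret prob_space M by fact
  show ?case by (intro integrable_const_bound[of _ "norm c"]) (auto simp: norm_mult)
next
  case (add f g)
  show ?case by (rule Bochner_Integration.integrable_add[OF add.IH])
qed

text \<open>Pinning the coordinates from \<open>K\<close> on at 0 keeps one type of sequences for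
  all dimensions and lets the first \<open>K\<close> coordinates separate points.\<close>

lemma compact_sin_cube: "compact (PiE UNIV (\<lambda>i::nat. if i < K then {-1..1::real} else {0}))"
proof -
  have "compactin (product_topology (\<lambda>i::nat. euclidean) UNIV)
      (PiE UNIV (\<lambda>i. if i < K then {-1..1::real} else {0}))"
    unfolding compactin_PiE by auto
  then show ?thesis unfolding euclidean_product_topology by simp
qed

text \<open>Stone-Weierstrass for the algebra of continuous functions on the cube that become
  trigonometric polynomials after inserting the sines; it contains the separating
  coordinates.\<close>

lemma trig_poly_approx:
  fixes f :: "(nat \<Rightarrow> real) \<Rightarrow> real"
  assumes "continuous_on UNIV f" "0 < e"
  obtains h where "trig_poly K (\<lambda>p. complex_of_real (h p))"
    "\<And>p. \<bar>f (\<lambda>i. if i < K then sin (\<alpha> * p i) else 0) - h p\<bar> < e"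
proof -
  let ?S = "PiE UNIV (\<lambda>i::nat. if i < K then {-1..1::real} else {0})"
  let ?s = "\<lambda>p i. if i < K then sin (\<alpha> * p i) else 0"
  let ?P = "\<lambda>f. continuous_on ?S f \<and> trig_poly K (\<lambda>p. complex_of_real (f (?s p)))"
  have "\<exists>g. ?P g \<and> (\<forall>x\<in>?S. \<bar>f x - g x\<bar> < e)"
  proof (rule Stone_Weierstrass_HOL[OF compact_sin_cube, where P = ?P])
    show "?P (\<lambda>x. c)" for c using trig_poly_const by auto
    show "continuous_on ?S f" using assms(1) by (rule continuous_on_subset) simp
    show "?P (\<lambda>x. f x + g x)" if "?P f \<and> ?P g" for f g
      using that trig_poly.add by (auto intro: continuous_intros)
    show "?P (\<lambda>x. f x * g x)" if "?P f \<and> ?P g" for f g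
      using that trig_poly_mult by (auto intro: continuous_intros)
    show "\<exists>f. ?P f \<and> f x \<noteq> f y" if xy: "x \<in> ?S \<and> y \<in> ?S \<and> x \<noteq> y" for x y
    proof -
      obtain i where i: "x i \<noteq> y i" using xy by (metis ext)
      have "i < K"
      proof (rule ccontr)
        assume "\<not> i < K"
        then have "x i = 0" "y i = 0"
          using PiE_mem[OF conjunct1[OF xy], of i] PiE_mem[OF conjunct1[OF conjunct2[OF xy]], of i] by auto
        then show False using i by simp
      qed
      then have "?P (\<lambda>x. x i)"
        using trig_poly_sin[of i K \<alpha>] continuous_on_subset[OF continuous_on_product_coordinates[of i]]
        by auto
      then show ?thesis using i by blast
    qed
  qed (use assms(2) in auto)
  then obtain g where g: "?P g" "\<And>x. x \<in> ?S \<Longrightarrow> \<bar>f x - g x\<bar> < e" by blast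
  show ?thesis
  proof (rule that[of "\<lambda>p. g (?s p)"])
    show "\<bar>f (?s p) - g (?s p)\<bar> < e" for p by (rule g(2)) auto
  qed (use g(1) in auto)
qed

lemma finite_lipschitz_continuous:
  fixes g :: "(nat \<Rightarrow> real) \<Rightarrow> real"
  assumes "\<And>p q. \<bar>g p - g q\<bar> \<le> L * (\<Sum>i<K. \<bar>p i - q i\<bar>)"
  shows "continuous_on UNIV g"
proof (rule continuous_at_imp_continuous_on, rule ballI)
  fix p
  have "((\<lambda>q. L * (\<Sum>i<K. \<bar>q i - p i\<bar>)) \<longlongrightarrow> L * (\<Sum>i<K. \<bar>p i - p i\<bar>)) (at p)"
  proof (intro tendsto_intros)
    show "((\<lambda>q. q i) \<longlongrightarrow> p i) (at p)" for i
    proof -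
      have "isCont (\<lambda>q :: nat \<Rightarrow> real. q i) p"
        using continuous_on_product_coordinates[of i] continuous_on_eq_continuous_at[OF open_UNIV]
        by blast
      then show ?thesis by (simp only: isCont_def)
    qed
  qed
  then have lim: "((\<lambda>q. L * (\<Sum>i<K. \<bar>q i - p i\<bar>)) \<longlongrightarrow> 0) (at p)" by simp
  have "((\<lambda>q. g q - g p) \<longlongrightarrow> 0) (at p)"
    by (rule Lim_null_comparison[OF _ lim]) (simp add: assms)
  then show "isCont g p" unfolding isCont_def by (rule LIM_zero_cancel)
qed

text \<open>A multidimensional continuity theorem with a uniform second moment bound in place of
  tightness: this bound controls the cost of replacing coordinates by bounded periodic ones.\<close>

lemma finite_dim_convergence:
  fixes Y :: "nat \<Rightarrow> nat \<Rightarrow> 'w \<Rightarrow> real" and Z :: "nat \<Rightarrow> 'v \<Rightarrow> real"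
  assumes M: "prob_space M" and N: "prob_space N"
    and Ym [measurable]: "\<And>n i. Y n i \<in> borel_measurable M" and Zm [measurable]: "\<And>i. Z i \<in> borel_measurable N"
    and cf: "\<And>w. (\<lambda>n. \<integral>x. iexp (\<Sum>i<K. w i * Y n i x) \<partial>M) \<longlonglongrightarrow> (\<integral>x. iexp (\<Sum>i<K. w i * Z i x) \<partial>N)"
    and Y2: "\<And>n i. i < K \<Longrightarrow> integrable M (\<lambda>x. (Y n i x)\<^sup>2)" "\<And>n i. i < K \<Longrightarrow> (\<integral>x. (Y n i x)\<^sup>2 \<partial>M) \<le> D"
    and Z2: "\<And>i. i < K \<Longrightarrow> integrable N (\<lambda>x. (Z i x)\<^sup>2)" "\<And>i. i < K \<Longrightarrow> (\<integral>x. (Z i x)\<^sup>2 \<partial>N) \<le> D"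
    and lip: "\<And>p q. \<bar>g p - g q\<bar> \<le> L * (\<Sum>i<K. \<bar>p i - q i\<bar>)" and B: "\<And>p. \<bar>g p\<bar> \<le> B"
    and L: "0 \<le> L"
  shows "(\<lambda>n. \<integral>x. g (\<lambda>i. Y n i x) \<partial>M) \<longlonglongrightarrow> (\<integral>x. g (\<lambda>i. Z i x) \<partial>N)"
proof -
  interpret M: prob_space M by fact
  interpret N: prob_space N by fact
  have conv: "(\<lambda>n. \<integral>x. h (\<lambda>i. Y n i x) \<partial>M) \<longlonglongrightarrow> (\<integral>x. h (\<lambda>i. Z i x) \<partial>N)" if "trig_poly K h" for h
    using that
  proof induction
    case (char c w)
    show ?case using tendsto_mult[OF tendsto_const cf[of w], of c] by simp
  next
    case (add f g)
    have "(\<integral>x. f (\<lambda>i. Y n i x) + g (\<lambda>i. Y n i x) \<partial>M) =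
        (\<integral>x. f (\<lambda>i. Y n i x) \<partial>M) + (\<integral>x. g (\<lambda>i. Y n i x) \<partial>M)" for n
      by (intro Bochner_Integration.integral_add trig_poly_integrable[OF M, of "Y n" K] Ym add.hyps)
    moreover have "(\<integral>x. f (\<lambda>i. Z i x) + g (\<lambda>i. Z i x) \<partial>N) =
        (\<integral>x. f (\<lambda>i. Z i x) \<partial>N) + (\<integral>x. g (\<lambda>i. Z i x) \<partial>N)"
      by (intro Bochner_Integration.integral_add trig_poly_integrable[OF N, of Z K] Zm add.hyps)
    ultimately show ?case using tendsto_add[OF add.IH] by simp
  qed
  have gc: "continuous_on UNIV g" by (rule finite_lipschitz_continuous[OF lip])
  have gm: "g \<in> borel_measurable borel" by (rule borel_measurable_continuous_onI[OF gc])
  have comp: "(\<lambda>x. g (\<lambda>i. Q i x)) \<in> borel_measurable R" if "\<And>i. Q i \<in> borel_measurable R" for Q and R :: "'z measure"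
    by (rule measurable_compose[OF measurable_coordinatewise_then_product gm]) (use that in auto)
  \<comment> \<open>\<open>sin (\<alpha> y) / \<alpha>\<close> is close to \<open>y\<close> in mean, so \<open>g\<close> may be replaced by a function of bounded
    periodic coordinates, to which the Stone-Weierstrass theorem applies.\<close>
  have approx: "\<bar>(\<integral>x. g (\<lambda>i. Q i x) \<partial>R) - (\<integral>x. h (\<lambda>i. Q i x) \<partial>R)\<bar> \<le> L * (real K * (\<alpha> * D)) + e"
    if R: "prob_space R" and Qm [measurable]: "\<And>i. Q i \<in> borel_measurable R"
      and Q2: "\<And>i. i < K \<Longrightarrow> integrable R (\<lambda>x. (Q i x)\<^sup>2)" "\<And>i. i < K \<Longrightarrow> (\<integral>x. (Q i x)\<^sup>2 \<partial>R) \<le> D"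
      and \<alpha>: "0 < \<alpha>" and h: "trig_poly K (\<lambda>p. complex_of_real (h p))"
      and ap: "\<And>p. \<bar>g (\<lambda>i. if i < K then sin (\<alpha> * p i) / \<alpha> else 0) - h p\<bar> < e"
    for R :: "'z measure" and Q \<alpha> h e
  proof -
    interpret R: prob_space R by fact
    have Ih: "integrable R (\<lambda>x. h (\<lambda>i. Q i x))"
      using trig_poly_integrable[OF R Qm h] by (simp add: complex_of_real_integrable_eq)
    have Ig: "integrable R (\<lambda>x. g (\<lambda>i. Q i x))"
      using B comp[OF Qm] by (intro R.integrable_const_bound[of _ B]) auto
    have "\<bar>(\<integral>x. g (\<lambda>i. Q i x) \<partial>R) - (\<integral>x. h (\<lambda>i. Q i x) \<partial>R)\<bar> =
        norm (\<integral>x. g (\<lambda>i. Q i x) - h (\<lambda>i. Q i x) \<partial>R)"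
      using Ih Ig by simp
    also have "\<dots> \<le> (\<integral>x. L * (\<Sum>i<K. \<alpha> * (Q i x)\<^sup>2) + e \<partial>R)"
    proof (rule norm_integral_le)
      show "integrable R (\<lambda>x. L * (\<Sum>i<K. \<alpha> * (Q i x)\<^sup>2) + e)"
        using Q2 by (intro Bochner_Integration.integrable_add integrable_mult_right
          Bochner_Integration.integrable_sum) auto
      fix x
      let ?s = "\<lambda>i. if i < K then sin (\<alpha> * Q i x) / \<alpha> else 0"
      have "\<bar>g (\<lambda>i. Q i x) - g ?s\<bar> \<le> L * (\<Sum>i<K. \<bar>Q i x - ?s i\<bar>)" by (rule lip)
      also have "\<dots> \<le> L * (\<Sum>i<K. \<alpha> * (Q i x)\<^sup>2)"
      proof (intro mult_left_mono sum_mono L)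
        fix i assume "i \<in> {..<K}"
        have "\<bar>Q i x - sin (\<alpha> * Q i x) / \<alpha>\<bar> = \<bar>sin (\<alpha> * Q i x) - \<alpha> * Q i x\<bar> / \<alpha>"
        proof -
          have "Q i x - sin (\<alpha> * Q i x) / \<alpha> = - ((sin (\<alpha> * Q i x) - \<alpha> * Q i x) / \<alpha>)"
            using \<alpha> by (simp add: field_simps)
          then show ?thesis using \<alpha> by (simp only: abs_minus_cancel abs_divide abs_of_pos)
        qed
        also have "\<dots> \<le> ((\<alpha> * Q i x)\<^sup>2 / 2) / \<alpha>"
          using \<alpha> by (intro divide_right_mono abs_sin_diff_le) auto
        also have "\<dots> = \<alpha> * (Q i x)\<^sup>2 / 2" using \<alpha> by (simp add: power2_eq_square)
        also have "\<dots> \<le> \<alpha> * (Q i x)\<^sup>2" using \<alpha> by simp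
        finally show "\<bar>Q i x - ?s i\<bar> \<le> \<alpha> * (Q i x)\<^sup>2" using \<open>i \<in> {..<K}\<close> by simp
      qed
      finally show "norm (g (\<lambda>i. Q i x) - h (\<lambda>i. Q i x)) \<le> L * (\<Sum>i<K. \<alpha> * (Q i x)\<^sup>2) + e"
        using ap[of "\<lambda>i. Q i x"] unfolding real_norm_def by linarith
    qed
    also have "\<dots> = L * (\<Sum>i<K. \<alpha> * (\<integral>x. (Q i x)\<^sup>2 \<partial>R)) + e"
    proof -
      have IS: "integrable R (\<lambda>x. \<Sum>i<K. \<alpha> * (Q i x)\<^sup>2)"
        using Q2 by (intro Bochner_Integration.integrable_sum integrable_mult_right) auto
      have "(\<integral>x. L * (\<Sum>i<K. \<alpha> * (Q i x)\<^sup>2) + e \<partial>R) = L * (\<integral>x. (\<Sum>i<K. \<alpha> * (Q i x)\<^sup>2) \<partial>R) + e"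
        using IS R.prob_space by simp
      also have "(\<integral>x. (\<Sum>i<K. \<alpha> * (Q i x)\<^sup>2) \<partial>R) = (\<Sum>i<K. \<alpha> * (\<integral>x. (Q i x)\<^sup>2 \<partial>R))"
        using Q2 by (subst Bochner_Integration.integral_sum) auto
      finally show ?thesis .
    qed
    also have "\<dots> \<le> L * (\<Sum>i<K. \<alpha> * D) + e"
      using Q2 \<alpha> L by (intro add_right_mono mult_left_mono sum_mono) auto
    finally show ?thesis by simp
  qed
  show ?thesis
  proof (rule LIMSEQ_I)
    fix r :: real assume r: "0 < r"
    \<comment> \<open>The choice makes the replacement cost at most \<open>r / 6\<close>. With
      \<open>r / 6\<close> from Stone-Weierstrass each of the two laws contributes
      \<open>r / 3\<close>, and so does the convergence of the trigonometric polynomial.\<close>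
    define \<alpha> where "\<alpha> = r / (6 * (\<bar>L * (real K * D)\<bar> + 1))"
    have \<alpha>: "0 < \<alpha>" unfolding \<alpha>_def using r by simp
    have small: "L * (real K * (\<alpha> * D)) \<le> r / 6"
    proof -
      have "L * (real K * (\<alpha> * D)) \<le> \<alpha> * (\<bar>L * (real K * D)\<bar> + 1)"
        using \<alpha> mult_left_mono[of "L * (real K * D)" "\<bar>L * (real K * D)\<bar> + 1" \<alpha>] by (simp add: mult_ac)
      also have "\<dots> = r / 6" unfolding \<alpha>_def by (simp add: field_simps)
      finally show ?thesis .
    qed
    define f where "f w = g (\<lambda>i. if i < K then w i / \<alpha> else 0)" for w
    have "continuous_on UNIV f"
    proof (rule finite_lipschitz_continuous)
      fix p q
      have "\<bar>f p - f q\<bar> \<le> L * (\<Sum>i<K. \<bar>p i / \<alpha> - q i / \<alpha>\<bar>)"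
        unfolding f_def using lip[of "\<lambda>i. if i < K then p i / \<alpha> else 0" "\<lambda>i. if i < K then q i / \<alpha> else 0"]
        by simp
      also have "\<dots> = (L / \<alpha>) * (\<Sum>i<K. \<bar>p i - q i\<bar>)"
        using \<alpha> by (simp add: diff_divide_distrib[symmetric] sum_divide_distrib[symmetric])
      finally show "\<bar>f p - f q\<bar> \<le> (L / \<alpha>) * (\<Sum>i<K. \<bar>p i - q i\<bar>)" .
    qed
    then obtain h where h: "trig_poly K (\<lambda>p. complex_of_real (h p))"
      "\<And>p. \<bar>f (\<lambda>i. if i < K then sin (\<alpha> * p i) else 0) - h p\<bar> < r / 6"
      using trig_poly_approx[of f "r / 6" K \<alpha>] r by auto
    have h': "\<bar>g (\<lambda>i. if i < K then sin (\<alpha> * p i) / \<alpha> else 0) - h p\<bar> < r / 6" for p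
      using h(2)[of p] by (simp add: f_def cong: if_cong)
    have "(\<lambda>n. \<integral>x. h (\<lambda>i. Y n i x) \<partial>M) \<longlonglongrightarrow> (\<integral>x. h (\<lambda>i. Z i x) \<partial>N)"
      using tendsto_Re[OF conv[OF h(1)]] by simp
    then obtain n0 where n0: "\<And>n. n0 \<le> n \<Longrightarrow> \<bar>(\<integral>x. h (\<lambda>i. Y n i x) \<partial>M) - (\<integral>x. h (\<lambda>i. Z i x) \<partial>N)\<bar> < r / 3"
      using r unfolding LIMSEQ_iff real_norm_def by (metis divide_pos_pos zero_less_numeral)
    show "\<exists>n0. \<forall>n\<ge>n0. norm ((\<integral>x. g (\<lambda>i. Y n i x) \<partial>M) - (\<integral>x. g (\<lambda>i. Z i x) \<partial>N)) < r"
    proof (intro exI[of _ n0] allI impI)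
      fix n assume n: "n0 \<le> n"
      show "norm ((\<integral>x. g (\<lambda>i. Y n i x) \<partial>M) - (\<integral>x. g (\<lambda>i. Z i x) \<partial>N)) < r"
        using approx[of M "Y n", OF M Ym Y2 \<alpha> h(1) h'] approx[of N Z, OF N Zm Z2 \<alpha> h(1) h'] n0[OF n] small
        unfolding real_norm_def by linarith
    qed
  qed
qed


subsection \<open>Convergence in spaces of continuous functions\<close>

lemma dist_apply_bcontfun_le: "\<bar>apply_bcontfun f t - apply_bcontfun g t\<bar> \<le> dist f (g :: 't::topological_space \<Rightarrow>\<^sub>C real)"
  using dist_bounded[of f t g] by (simp add: dist_real_def)

lemma continuous_apply_bcontfun:
  "continuous_on UNIV (\<lambda>f :: 't::topological_space \<Rightarrow>\<^sub>C real. apply_bcontfun f t)"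
  unfolding continuous_on_iff
  using dist_apply_bcontfun_le le_less_trans unfolding dist_real_def by blast

definition interpolate :: "nat \<Rightarrow> (nat \<Rightarrow> 't) \<Rightarrow> (nat \<Rightarrow> 't::topological_space \<Rightarrow>\<^sub>C real) \<Rightarrow>
    (nat \<Rightarrow> real) \<Rightarrow> 't \<Rightarrow>\<^sub>C real" where
  "interpolate K t \<rho> p = (\<Sum>i<K. p i *\<^sub>R \<rho> i)"

lemma norm_interpolate_diff:
  assumes "\<And>i. i < K \<Longrightarrow> norm (\<rho> i) \<le> 1"
  shows "dist (interpolate K t \<rho> p) (interpolate K t \<rho> q) \<le> (\<Sum>i<K. \<bar>p i - q i\<bar>)"
proof -
  have "dist (interpolate K t \<rho> p) (interpolate K t \<rho> q) = norm (\<Sum>i<K. (p i - q i) *\<^sub>R \<rho> i)"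
    by (simp add: dist_norm interpolate_def sum_subtractf scaleR_left_diff_distrib)
  also have "\<dots> \<le> (\<Sum>i<K. \<bar>p i - q i\<bar>)"
    using assms by (intro sum_norm_le) (simp add: mult_left_le)
  finally show ?thesis .
qed

lemma continuous_interpolate:
  fixes t :: "nat \<Rightarrow> 't::topological_space"
  shows "continuous_on UNIV (\<lambda>f :: 't \<Rightarrow>\<^sub>C real. interpolate K t \<rho> (\<lambda>i. apply_bcontfun f (t i)))"
  unfolding interpolate_def
  by (intro continuous_on_sum continuous_on_scaleR continuous_apply_bcontfun continuous_on_const)

text \<open>Three comparisons: \<open>f (Y n x)\<close> and \<open>f (\<pi> m (Y n x))\<close>
  differ in mean by at most the Lipschitz constant times \<open>\<eta> m\<close>, uniformly in
  \<open>n\<close>; the function \<open>f\<close> after \<open>\<pi> m\<close> sees finitely many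
  evaluations; and \<open>\<pi> m (Z x)\<close> tends to \<open>Z x\<close> in the sup norm. Here
  \<open>m\<close> is fixed before \<open>n\<close>.\<close>

theorem weak_conv_law_bcontfun:
  fixes Y :: "nat \<Rightarrow> 'w \<Rightarrow> ('t::metric_space \<Rightarrow>\<^sub>C real)" and Z :: "'v \<Rightarrow> ('t \<Rightarrow>\<^sub>C real)"
    and K :: "nat \<Rightarrow> nat" and t :: "nat \<Rightarrow> nat \<Rightarrow> 't" and \<rho> :: "nat \<Rightarrow> nat \<Rightarrow> ('t \<Rightarrow>\<^sub>C real)"
  defines "\<pi> m f \<equiv> interpolate (K m) (t m) (\<rho> m) (\<lambda>i. apply_bcontfun f (t m i))"
  assumes M: "prob_space M" and N: "prob_space N"
    and Y [measurable]: "\<And>n. Y n \<in> borel_measurable M" and Z [measurable]: "Z \<in> borel_measurable N"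
    and \<rho>: "\<And>m i. i < K m \<Longrightarrow> norm (\<rho> m i) \<le> 1"
    and \<pi>_tendsto: "\<And>f. (\<lambda>m. \<pi> m f) \<longlonglongrightarrow> f"
    and tight: "\<And>n m. (\<integral>x. norm (Y n x - \<pi> m (Y n x)) \<partial>M) \<le> \<eta> m"
      "\<And>n m. integrable M (\<lambda>x. norm (Y n x - \<pi> m (Y n x)))" "\<eta> \<longlonglongrightarrow> 0"
    and char: "\<And>k (s :: nat \<Rightarrow> 't) w. (\<lambda>n. \<integral>x. iexp (\<Sum>i<k. w i * apply_bcontfun (Y n x) (s i)) \<partial>M)
      \<longlonglongrightarrow> (\<integral>x. iexp (\<Sum>i<k. w i * apply_bcontfun (Z x) (s i)) \<partial>N)"
    and Y2: "\<And>n s. integrable M (\<lambda>x. (apply_bcontfun (Y n x) s)\<^sup>2)"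
      "\<And>n s. (\<integral>x. (apply_bcontfun (Y n x) s)\<^sup>2 \<partial>M) \<le> D"
    and Z2: "\<And>s. integrable N (\<lambda>x. (apply_bcontfun (Z x) s)\<^sup>2)"
      "\<And>s. (\<integral>x. (apply_bcontfun (Z x) s)\<^sup>2 \<partial>N) \<le> D"
  shows "weak_conv_law (\<lambda>n. distr M borel (Y n)) (distr N borel Z)"
proof (rule weak_conv_law_lipschitz)
  interpret M: prob_space M by fact
  interpret N: prob_space N by fact
  show "prob_space (distr M borel (Y n))" for n by (rule M.prob_space_distr) simp
  show "prob_space (distr N borel Z)" by (rule N.prob_space_distr) simp
  fix f :: "('t \<Rightarrow>\<^sub>C real) \<Rightarrow> real" and L B
  assume lip': "\<And>x y :: 't \<Rightarrow>\<^sub>C real. \<bar>f x - f y\<bar> \<le> L * dist x y" and B: "\<And>x. \<bar>f x\<bar> \<le> B"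
  define L' where "L' = \<bar>L\<bar>"
  have L: "0 \<le> L'" by (simp add: L'_def)
  have lip: "\<bar>f x - f y\<bar> \<le> L' * dist x y" for x y :: "'t \<Rightarrow>\<^sub>C real"
    using lip'[of x y] mult_right_mono[OF abs_ge_self[of L] zero_le_dist[of x y]]
    unfolding L'_def by linarith
  have fc: "continuous_on UNIV f"
  proof (rule continuous_at_imp_continuous_on, rule ballI)
    fix x :: "'t \<Rightarrow>\<^sub>C real"
    have "((\<lambda>y. L' * dist y x) \<longlongrightarrow> L' * dist x x) (at x)" by (intro tendsto_intros)
    then have lim: "((\<lambda>y. L' * dist y x) \<longlongrightarrow> 0) (at x)" by simp
    have "((\<lambda>y. f y - f x) \<longlongrightarrow> 0) (at x)"
      by (rule Lim_null_comparison[OF _ lim]) (simp add: lip)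
    then show "isCont f x" unfolding isCont_def by (rule LIM_zero_cancel)
  qed
  have fm [measurable]: "f \<in> borel_measurable borel" by (rule borel_measurable_continuous_onI[OF fc])
  have \<pi>m [measurable]: "\<pi> m \<in> borel_measurable borel" for m
    unfolding \<pi>_def by (rule borel_measurable_continuous_onI[OF continuous_interpolate])
  have am [measurable]: "(\<lambda>g :: 't \<Rightarrow>\<^sub>C real. apply_bcontfun g s) \<in> borel_measurable borel" for s
    by (rule borel_measurable_continuous_onI[OF continuous_apply_bcontfun])
  have int: "integrable R (\<lambda>x. f (Q x))" if "prob_space R" "Q \<in> borel_measurable R" for R :: "'z measure" and Q
  proof -
    interpret R: prob_space R by fact
    have [measurable]: "Q \<in> borel_measurable R" by fact
    show ?thesis using B by (intro R.integrable_const_bound[of _ B]) auto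
  qed
  have step: "(\<lambda>n. \<integral>x. f (\<pi> m (Y n x)) \<partial>M) \<longlonglongrightarrow> (\<integral>x. f (\<pi> m (Z x)) \<partial>N)" for m
    unfolding \<pi>_def
  proof (rule finite_dim_convergence[where g = "\<lambda>p. f (interpolate (K m) (t m) (\<rho> m) p)" and K = "K m"
        and Y = "\<lambda>n i x. apply_bcontfun (Y n x) (t m i)" and Z = "\<lambda>i x. apply_bcontfun (Z x) (t m i)"
        and D = D and L = L' and B = B])
    show "\<bar>f (interpolate (K m) (t m) (\<rho> m) p) - f (interpolate (K m) (t m) (\<rho> m) q)\<bar> \<le>
        L' * (\<Sum>i<K m. \<bar>p i - q i\<bar>)" for p q
      by (rule order_trans[OF lip mult_left_mono[OF norm_interpolate_diff[OF \<rho>] L]])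
  qed (use M N Y2 Z2 B L char in auto)
  have "(\<lambda>n. \<integral>x. f (Y n x) \<partial>M) \<longlonglongrightarrow> (\<integral>x. f (Z x) \<partial>N)"
  proof (rule LIMSEQ_I)
    fix r :: real assume r: "0 < r"
    have "(\<lambda>m. \<integral>x. f (\<pi> m (Z x)) \<partial>N) \<longlonglongrightarrow> (\<integral>x. f (Z x) \<partial>N)"
    proof (rule integral_dominated_convergence[where w = "\<lambda>_. B"])
      show "AE x in N. (\<lambda>m. f (\<pi> m (Z x))) \<longlonglongrightarrow> f (Z x)"
        using fc \<pi>_tendsto by (intro AE_I2 isCont_tendsto_compose[of _ f]) (auto simp: continuous_on_eq_continuous_at)
    qed (use B in auto)
    then have "eventually (\<lambda>m. dist (\<integral>x. f (\<pi> m (Z x)) \<partial>N) (\<integral>x. f (Z x) \<partial>N) < r / 3) sequentially"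
      using r by (intro tendstoD) auto
    moreover have "(\<lambda>m. L' * \<eta> m) \<longlonglongrightarrow> L' * 0" by (intro tendsto_intros tight)
    then have "eventually (\<lambda>m. L' * \<eta> m < r / 3) sequentially"
      using r by (intro order_tendstoD(2)) auto
    ultimately have "eventually (\<lambda>m. dist (\<integral>x. f (\<pi> m (Z x)) \<partial>N) (\<integral>x. f (Z x) \<partial>N) < r / 3 \<and>
        L' * \<eta> m < r / 3) sequentially" by eventually_elim simp
    then obtain m where m: "dist (\<integral>x. f (\<pi> m (Z x)) \<partial>N) (\<integral>x. f (Z x) \<partial>N) < r / 3" "L' * \<eta> m < r / 3"
      using eventually_happens'[OF sequentially_bot] by blast
    have a: "\<bar>(\<integral>x. f (Y n x) \<partial>M) - (\<integral>x. f (\<pi> m (Y n x)) \<partial>M)\<bar> \<le> L' * \<eta> m" for n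
    proof -
      have "(\<integral>x. f (Y n x) \<partial>M) - (\<integral>x. f (\<pi> m (Y n x)) \<partial>M) = (\<integral>x. f (Y n x) - f (\<pi> m (Y n x)) \<partial>M)"
        using int[OF M] by simp
      also have "norm \<dots> \<le> (\<integral>x. L' * norm (Y n x - \<pi> m (Y n x)) \<partial>M)"
        using tight(2) lip by (intro norm_integral_le) (auto simp: dist_norm)
      also have "\<dots> \<le> L' * \<eta> m" using tight(1) L by (simp add: mult_left_mono)
      finally show ?thesis by simp
    qed
    obtain n0 where n0: "\<And>n. n0 \<le> n \<Longrightarrow> \<bar>(\<integral>x. f (\<pi> m (Y n x)) \<partial>M) - (\<integral>x. f (\<pi> m (Z x)) \<partial>N)\<bar> < r / 3"
      using step[of m] r unfolding LIMSEQ_iff real_norm_def by (metis divide_pos_pos zero_less_numeral)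
    show "\<exists>n0. \<forall>n\<ge>n0. norm ((\<integral>x. f (Y n x) \<partial>M) - (\<integral>x. f (Z x) \<partial>N)) < r"
    proof (intro exI[of _ n0] allI impI)
      fix n assume "n0 \<le> n"
      then show "norm ((\<integral>x. f (Y n x) \<partial>M) - (\<integral>x. f (Z x) \<partial>N)) < r"
        using a[of n] n0[of n] m unfolding real_norm_def dist_real_def by linarith
    qed
  qed
  then show "(\<lambda>n. integral\<^sup>L (distr M borel (Y n)) f) \<longlonglongrightarrow> integral\<^sup>L (distr N borel Z) f"
    by (simp add: integral_distr)
qed auto

section \<open>Chaining on the unit cube\<close>

text \<open>The \<open>l1\<close> distance: the squared increments of the sheet weights are
  estimated by it one coordinate at a time, and it dominates the metric of the cube.\<close>

definition cube_dist :: "'d::finite unit_cube \<Rightarrow> 'd unit_cube \<Rightarrow> real" where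
  "cube_dist s t = (\<Sum>k\<in>UNIV. \<bar>cube_point s $ k - cube_point t $ k\<bar>)"

lemma cube_dist_nonneg: "0 \<le> cube_dist s t"
  by (simp add: cube_dist_def sum_nonneg)

lemma cube_dist_commute: "cube_dist s t = cube_dist t s"
  by (simp add: cube_dist_def abs_minus_commute)

lemma cube_dist_triangle: "cube_dist s u \<le> cube_dist s t + cube_dist t u"
  unfolding cube_dist_def sum.distrib[symmetric] by (intro sum_mono) simp

lemma dist_le_cube_dist: "dist s t \<le> cube_dist s t"
  unfolding dist_unit_cube_def cube_dist_def dist_norm
  using norm_le_l1_cart[of "cube_point s - cube_point t"] by simp

lemma cube_coord: "0 \<le> cube_point s $ k" "cube_point s $ k \<le> 1"
  using cube_point[of s] by (auto simp: mem_box_cart)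

lemma continuous_cube_dist [continuous_intros]: "continuous_on UNIV (\<lambda>s. cube_dist s t)"
  unfolding cube_dist_def by (intro continuous_intros)

lemma compact_unit_cube: "compact (UNIV :: 'd::finite unit_cube set)"
proof -
  have "continuous_on (cbox 0 1) (Cube :: real^'d \<Rightarrow> 'd unit_cube)"
    unfolding continuous_on_iff dist_unit_cube_def by (auto simp: Cube_inverse)
  then have "compact (Cube ` cbox (0 :: real^'d) 1)"
    by (intro compact_continuous_image compact_cbox)
  moreover have "Cube ` cbox (0 :: real^'d) 1 = UNIV"
    by (metis (no_types) UNIV_eq_I cube_point cube_point_inverse image_eqI)
  ultimately show ?thesis by simp
qed

text \<open>Base 16 balances the exponents: up to constants, \<open>16 ^ (2 l d)\<close> pairs,
  moments of order \<open>8 d\<close> of size \<open>16 ^ (- 4 l d)\<close> and the Markov factor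
  \<open>2 ^ (l (8 d - 1))\<close> multiply to \<open>2 ^ - l\<close>.\<close>

definition grid_point :: "nat \<Rightarrow> ('d::finite \<Rightarrow> nat) \<Rightarrow> 'd unit_cube" where
  "grid_point l j = Cube (\<chi> k. real (j k) / 16 ^ l)"

definition grid :: "nat \<Rightarrow> 'd::finite unit_cube set" where
  "grid l = grid_point l ` (PiE UNIV (\<lambda>_. {..16 ^ l}))"

definition grid_floor :: "nat \<Rightarrow> 'd::finite unit_cube \<Rightarrow> 'd unit_cube" where
  "grid_floor l s = grid_point l (\<lambda>k. nat \<lfloor>16 ^ l * cube_point s $ k\<rfloor>)"

lemma finite_grid [simp]: "finite (grid l)"
  unfolding grid_def by (intro finite_imageI finite_PiE) auto

lemma card_grid: "card (grid l :: 'd::finite unit_cube set) \<le> (16 ^ l + 1) ^ CARD('d)"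
proof -
  have "card (grid l :: 'd unit_cube set) \<le> card (PiE (UNIV :: 'd set) (\<lambda>_. {..16 ^ l :: nat}))"
    unfolding grid_def by (intro card_image_le finite_PiE) auto
  then show ?thesis by (simp add: card_PiE)
qed

lemma cube_point_grid_point:
  assumes "\<And>k. j k \<le> 16 ^ l"
  shows "cube_point (grid_point l j) = (\<chi> k. real (j k) / 16 ^ l)"
  unfolding grid_point_def
proof (rule Cube_inverse)
  have "real (j k) \<le> 16 ^ l" for k using assms[of k] by (metis of_nat_le_iff of_nat_numeral of_nat_power)
  then show "(\<chi> k. real (j k) / 16 ^ l) \<in> cbox 0 1" by (simp add: mem_box_cart)
qed

lemma floor_le_grid: "nat \<lfloor>16 ^ l * cube_point s $ k\<rfloor> \<le> 16 ^ l"
proof -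
  have "16 ^ l * cube_point s $ k \<le> 16 ^ l * 1"
    by (rule mult_left_mono[OF cube_coord(2)]) simp
  then have "\<lfloor>16 ^ l * cube_point s $ k\<rfloor> \<le> \<lfloor>16 ^ l :: real\<rfloor>" by (intro floor_mono) simp
  then show ?thesis by (simp add: nat_le_iff)
qed

lemma grid_floor_in_grid: "grid_floor l s \<in> grid l"
  unfolding grid_floor_def grid_def using floor_le_grid by (intro imageI) auto

lemma cube_dist_grid_floor: "cube_dist (grid_floor l (s :: 'd::finite unit_cube)) s \<le> real CARD('d) / 16 ^ l"
proof -
  have "\<bar>cube_point (grid_floor l s) $ k - cube_point s $ k\<bar> \<le> 1 / 16 ^ l" for k
  proof -
    let ?r = "16 ^ l * cube_point s $ k"
    have r0: "0 \<le> ?r" using cube_coord(1)[of s k] by simp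
    have "cube_point (grid_floor l s) $ k = real (nat \<lfloor>?r\<rfloor>) / 16 ^ l"
      unfolding grid_floor_def by (subst cube_point_grid_point[OF floor_le_grid]) simp
    also have "real (nat \<lfloor>?r\<rfloor>) = of_int \<lfloor>?r\<rfloor>" using r0 by simp
    finally have e: "cube_point (grid_floor l s) $ k = of_int \<lfloor>?r\<rfloor> / 16 ^ l" .
    have "cube_point (grid_floor l s) $ k - cube_point s $ k = (of_int \<lfloor>?r\<rfloor> - ?r) / 16 ^ l"
      unfolding e by (simp add: field_simps)
    also have "\<bar>\<dots>\<bar> \<le> 1 / 16 ^ l"
    proof -
      have "\<bar>of_int \<lfloor>?r\<rfloor> - ?r\<bar> \<le> 1" by linarith
      then show ?thesis by (simp add: abs_divide divide_right_mono)
    qed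
    finally show ?thesis .
  qed
  then have "cube_dist (grid_floor l s) s \<le> (\<Sum>k\<in>(UNIV :: 'd set). 1 / 16 ^ l)"
    unfolding cube_dist_def by (intro sum_mono)
  then show ?thesis by simp
qed

lemma grid_Suc: "grid l \<subseteq> grid (Suc l)"
proof
  fix t :: "'d::finite unit_cube" assume "t \<in> grid l"
  then obtain j where j: "t = grid_point l j" "\<And>k. j k \<le> 16 ^ l" by (auto simp: grid_def)
  have "t = grid_point (Suc l) (\<lambda>k. 16 * j k)"
    unfolding j(1) grid_point_def by simp
  then show "t \<in> grid (Suc l)" unfolding grid_def using j(2) by (intro image_eqI) auto
qed

lemma grid_floor_tendsto: "(\<lambda>l. grid_floor l s) \<longlonglongrightarrow> (s :: 'd::finite unit_cube)"
proof (rule metric_tendsto_imp_tendsto[of "\<lambda>l. real CARD('d) / 16 ^ l" 0])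
  have "(\<lambda>l. real CARD('d) * (1 / 16) ^ l) \<longlonglongrightarrow> real CARD('d) * 0"
    by (intro tendsto_intros LIMSEQ_power_zero) simp
  then show "(\<lambda>l. real CARD('d) / 16 ^ l) \<longlonglongrightarrow> 0" by (simp add: power_divide)
  show "eventually (\<lambda>l. dist (grid_floor l s) s \<le> dist (real CARD('d) / 16 ^ l) 0) sequentially"
    using order_trans[OF dist_le_cube_dist cube_dist_grid_floor] by (intro always_eventually) auto
qed

text \<open>A numbering, since the convergence criterion takes its evaluation points from a
  sequence.\<close>

definition grid_enum :: "nat \<Rightarrow> nat \<Rightarrow> 'd::finite unit_cube" where
  "grid_enum m = (SOME h. bij_betw h {0..<card (grid m :: 'd unit_cube set)} (grid m))"

lemma grid_enum_bij:
  "bij_betw (grid_enum m) {0..<card (grid m :: 'd unit_cube set)} (grid m :: 'd::finite unit_cube set)"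
  unfolding grid_enum_def using ex_bij_betw_nat_finite[OF finite_grid] by (rule someI_ex)

text \<open>Every point has a grid point within \<open>d / 16 ^ m\<close>. The doubled radius makes
  the bump of that grid point strictly positive, so the normalising sum never vanishes.\<close>

definition bump :: "nat \<Rightarrow> 'd::finite unit_cube \<Rightarrow> 'd unit_cube \<Rightarrow> real" where
  "bump m t s = max 0 (2 * real CARD('d) / 16 ^ m - cube_dist s t)"

definition bump_sum :: "nat \<Rightarrow> 'd::finite unit_cube \<Rightarrow> real" where
  "bump_sum m s = (\<Sum>i<card (grid m :: 'd unit_cube set). bump m (grid_enum m i) s)"

lemma bump_nonneg: "0 \<le> bump m t s"
  by (simp add: bump_def)

lemma bump_sum_pos: "0 < bump_sum m (s :: 'd::finite unit_cube)"
proof -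
  obtain i where i: "i < card (grid m :: 'd unit_cube set)" "grid_enum m i = grid_floor m s"
    using bij_betw_imp_surj_on[OF grid_enum_bij[of m]] grid_floor_in_grid[of m s] by force
  have "real CARD('d) / 16 ^ m < 2 * real CARD('d) / 16 ^ m" by (simp add: divide_strict_right_mono)
  then have "0 < bump m (grid_enum m i) s"
    using cube_dist_grid_floor[of m s] unfolding bump_def i(2) by (simp add: cube_dist_commute)
  then show ?thesis
    unfolding bump_sum_def using i(1) bump_nonneg by (intro sum_pos2[of _ i]) auto
qed

definition partition_fun :: "nat \<Rightarrow> nat \<Rightarrow> 'd::finite cube_fun" where
  "partition_fun m i = Bcontfun (\<lambda>s. bump m (grid_enum m i) s / bump_sum m s)"

lemma bump_le_sum: "i < card (grid m :: 'd::finite unit_cube set) \<Longrightarrow> bump m (grid_enum m i) s \<le> bump_sum m (s :: 'd unit_cube)"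
  unfolding bump_sum_def using bump_nonneg by (intro member_le_sum) auto

lemma partition_fun_apply:
  assumes "i < card (grid m :: 'd::finite unit_cube set)"
  shows "apply_bcontfun (partition_fun m i :: 'd cube_fun) s = bump m (grid_enum m i) s / bump_sum m s"
proof -
  have "(\<lambda>s :: 'd unit_cube. bump m (grid_enum m i) s / bump_sum m s) \<in> bcontfun"
  proof (rule bcontfun_normI)
    show "continuous_on UNIV (\<lambda>s :: 'd unit_cube. bump m (grid_enum m i) s / bump_sum m s)"
    proof (rule continuous_on_divide)
      show "continuous_on UNIV (bump m (grid_enum m i :: 'd unit_cube))"
        unfolding bump_def by (intro continuous_intros)
      show "continuous_on UNIV (bump_sum m :: 'd unit_cube \<Rightarrow> real)"
        unfolding bump_sum_def bump_def by (intro continuous_intros)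
      show "\<forall>s :: 'd unit_cube \<in> UNIV. bump_sum m s \<noteq> 0"
        using bump_sum_pos less_imp_neq by metis
    qed
    show "norm (bump m (grid_enum m i) s / bump_sum m s) \<le> 1" for s :: "'d unit_cube"
      using bump_le_sum[OF assms, of s] bump_nonneg[of m "grid_enum m i" s] bump_sum_pos[of m s] by simp
  qed
  then show ?thesis by (simp add: partition_fun_def Bcontfun_inverse)
qed

lemma norm_partition_fun:
  assumes "i < card (grid m :: 'd::finite unit_cube set)"
  shows "norm (partition_fun m i :: 'd cube_fun) \<le> 1"
proof (rule norm_bound)
  fix s :: "'d unit_cube"
  show "norm (apply_bcontfun (partition_fun m i) s) \<le> 1"
    unfolding partition_fun_apply[OF assms]
    using bump_le_sum[OF assms, of s] bump_nonneg[of m "grid_enum m i" s] bump_sum_pos[of m s] by simp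
qed

abbreviation grid_interpolate :: "nat \<Rightarrow> 'd::finite cube_fun \<Rightarrow> 'd cube_fun" where
  "grid_interpolate m f \<equiv> interpolate (card (grid m :: 'd unit_cube set)) (grid_enum m) (partition_fun m)
     (\<lambda>i. apply_bcontfun f (grid_enum m i))"

lemma apply_bcontfun_sum:
  fixes f :: "'i \<Rightarrow> 't::topological_space \<Rightarrow>\<^sub>C real"
  shows "apply_bcontfun (sum f A) s = (\<Sum>i\<in>A. apply_bcontfun (f i) s)"
  by (induction A rule: infinite_finite_induct) auto

text \<open>The interpolation at \<open>s\<close> is a convex combination of the values of
  \<open>f\<close> at the grid points whose bump is positive at \<open>s\<close>.\<close>

lemma grid_interpolate_close:
  fixes f :: "'d::finite cube_fun"
  assumes "\<And>t. t \<in> grid m \<Longrightarrow> cube_dist s t < 2 * real CARD('d) / 16 ^ m \<Longrightarrow> \<bar>c - apply_bcontfun f t\<bar> \<le> B"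
  shows "\<bar>c - apply_bcontfun (grid_interpolate m f) s\<bar> \<le> B"
proof -
  let ?K = "card (grid m :: 'd unit_cube set)"
  let ?w = "\<lambda>i. bump m (grid_enum m i) s / bump_sum m s"
  have w: "(\<Sum>i<?K. ?w i) = 1"
    using bump_sum_pos[of m s] by (simp add: sum_divide_distrib[symmetric] bump_sum_def[symmetric])
  have app: "apply_bcontfun (grid_interpolate m f) s = (\<Sum>i<?K. apply_bcontfun f (grid_enum m i) * ?w i)"
    by (simp add: interpolate_def apply_bcontfun_sum partition_fun_apply)
  have "c - apply_bcontfun (grid_interpolate m f) s = (\<Sum>i<?K. c * ?w i) - (\<Sum>i<?K. apply_bcontfun f (grid_enum m i) * ?w i)"
    unfolding app using w by (simp only: sum_distrib_left[symmetric] mult_1_right)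
  also have "\<dots> = (\<Sum>i<?K. ?w i * (c - apply_bcontfun f (grid_enum m i)))"
    unfolding sum_subtractf[symmetric] by (intro sum.cong refl) (simp only: left_diff_distrib right_diff_distrib mult.commute)
  also have "\<bar>\<dots>\<bar> \<le> (\<Sum>i<?K. ?w i * B)"
  proof (rule order_trans[OF sum_abs sum_mono])
    fix i assume i: "i \<in> {..<?K}"
    have w0: "0 \<le> ?w i" using bump_nonneg[of m "grid_enum m i" s] bump_sum_pos[of m s] by simp
    show "\<bar>?w i * (c - apply_bcontfun f (grid_enum m i))\<bar> \<le> ?w i * B"
    proof (cases "bump m (grid_enum m i) s = 0")
      case False
      then have "cube_dist s (grid_enum m i) < 2 * real CARD('d) / 16 ^ m"
        by (auto simp: bump_def max_def split: if_splits)
      moreover have "grid_enum m i \<in> (grid m :: 'd unit_cube set)"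
        using bij_betwE[OF grid_enum_bij[of m]] i by auto
      ultimately show ?thesis
        using assms w0 unfolding abs_mult abs_of_nonneg[OF w0] by (intro mult_left_mono) auto
    qed simp
  qed
  also have "\<dots> = B" using w by (simp only: sum_distrib_right[symmetric] mult_1_left)
  finally show ?thesis .
qed

lemma grid_interpolate_tendsto: "(\<lambda>m. grid_interpolate m f) \<longlonglongrightarrow> (f :: 'd::finite cube_fun)"
proof (rule metric_LIMSEQ_I)
  fix e :: real assume e: "0 < e"
  have "uniformly_continuous_on UNIV (apply_bcontfun f)"
    by (rule compact_uniformly_continuous[OF _ compact_unit_cube]) (use apply_bcontfun[of f] in \<open>auto simp: bcontfun_def\<close>)
  then obtain \<delta> where \<delta>: "0 < \<delta>"
    "\<And>s t. dist t s < \<delta> \<Longrightarrow> dist (apply_bcontfun f t) (apply_bcontfun f s) < e / 2"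
    using e unfolding uniformly_continuous_on_def by (metis UNIV_I half_gt_zero)
  have "(\<lambda>m. 2 * real CARD('d) * (1 / 16) ^ m) \<longlonglongrightarrow> 2 * real CARD('d) * 0"
    by (intro tendsto_intros LIMSEQ_power_zero) simp
  then have "eventually (\<lambda>m. 2 * real CARD('d) * (1 / 16) ^ m < \<delta>) sequentially"
    using \<delta>(1) by (intro order_tendstoD(2)) auto
  then obtain m0 where m0: "\<And>m. m0 \<le> m \<Longrightarrow> 2 * real CARD('d) / 16 ^ m < \<delta>"
    by (auto simp: eventually_sequentially power_divide)
  show "\<exists>m0. \<forall>m\<ge>m0. dist (grid_interpolate m f) f < e"
  proof (intro exI[of _ m0] allI impI)
    fix m assume m: "m0 \<le> m"
    have "dist (grid_interpolate m f) f \<le> e / 2"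
    proof (rule dist_bound)
      fix s
      have "\<bar>apply_bcontfun f s - apply_bcontfun (grid_interpolate m f) s\<bar> \<le> e / 2"
      proof (rule grid_interpolate_close)
        fix t assume "cube_dist s t < 2 * real CARD('d) / 16 ^ m"
        then have "dist s t < \<delta>" using dist_le_cube_dist[of s t] m0[OF m] by linarith
        then show "\<bar>apply_bcontfun f s - apply_bcontfun f t\<bar> \<le> e / 2"
          using \<delta>(2)[of s t] unfolding dist_real_def by linarith
      qed
      then show "dist (apply_bcontfun (grid_interpolate m f) s) (apply_bcontfun f s) \<le> e / 2"
        by (simp add: dist_real_def abs_minus_commute)
    qed
    then show "dist (grid_interpolate m f) f < e" using e by linarith
  qed
qed

text \<open>The constant is \<open>17 = 16 + 1\<close>: the floors of one point at scales
  \<open>l - 1\<close> and \<open>l\<close> are at most \<open>16 d / 16 ^ l + d / 16 ^ l\<close>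
  apart. It also covers \<open>3 d / 16 ^ m\<close>, met when the coarsest floor is compared with
  the interpolation points.\<close>

definition near_pairs :: "nat \<Rightarrow> ('d::finite unit_cube \<times> 'd unit_cube) set" where
  "near_pairs l = {(t, t') \<in> grid l \<times> grid l. cube_dist t t' \<le> 17 * real CARD('d) / 16 ^ l}"

lemma finite_near_pairs [simp]: "finite (near_pairs l)"
  by (rule finite_subset[of _ "grid l \<times> grid l"]) (auto simp: near_pairs_def)

lemma card_near_pairs: "real (card (near_pairs l :: ('d::finite unit_cube \<times> 'd unit_cube) set)) \<le> 4 ^ CARD('d) * 16 ^ (2 * l * CARD('d))"
proof -
  have "card (near_pairs l :: ('d unit_cube \<times> 'd unit_cube) set) \<le> card (grid l \<times> grid l :: ('d unit_cube \<times> 'd unit_cube) set)"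
    by (rule card_mono[OF finite_cartesian_product[OF finite_grid finite_grid]]) (auto simp: near_pairs_def)
  also have "\<dots> \<le> (16 ^ l + 1) ^ CARD('d) * (16 ^ l + 1) ^ CARD('d)"
    unfolding card_cartesian_product by (intro mult_mono card_grid) auto
  also have "\<dots> \<le> (2 * 16 ^ l) ^ CARD('d) * (2 * 16 ^ l) ^ CARD('d)"
    by (intro mult_mono power_mono) auto
  also have "\<dots> = 4 ^ CARD('d) * 16 ^ (2 * l * CARD('d))"
  proof -
    have "(2 * 16 ^ l) * (2 * 16 ^ l) = (4 :: nat) * 16 ^ (2 * l)" by (simp add: mult_2[of l] power_add)
    then have "(2 * 16 ^ l) ^ CARD('d) * (2 * 16 ^ l) ^ CARD('d) = ((4 :: nat) * 16 ^ (2 * l)) ^ CARD('d)"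
      by (simp only: power_mult_distrib[symmetric])
    then show ?thesis by (simp only: power_mult_distrib power_mult)
  qed
  finally show ?thesis by (metis (mono_tags, lifting) of_nat_le_iff of_nat_mult of_nat_numeral of_nat_power)
qed

text \<open>The increments of \<open>f\<close> over all near pairs of grid points at scale \<open>16 ^ - l\<close> are at most
  \<open>chain_bound\<close>: either they are below \<open>2 ^ - l\<close>, or Markov's inequality applies.\<close>

definition chain_bound :: "nat \<Rightarrow> 'd::finite cube_fun \<Rightarrow> real" where
  "chain_bound l f = (1 / 2) ^ l + 2 ^ (l * (8 * CARD('d) - 1)) *
     (\<Sum>(t, t')\<in>near_pairs l. (apply_bcontfun f t - apply_bcontfun f t') ^ (8 * CARD('d)))"

lemma chain_bound_nonneg: "0 \<le> chain_bound l f"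
  unfolding chain_bound_def
  by (intro add_nonneg_nonneg mult_nonneg_nonneg sum_nonneg) (auto intro!: zero_le_even_power)

lemma increment_le_chain_bound:
  fixes f :: "'d::finite cube_fun"
  assumes "(t, t') \<in> near_pairs l"
  shows "\<bar>apply_bcontfun f t - apply_bcontfun f t'\<bar> \<le> chain_bound l f"
proof -
  let ?a = "\<bar>apply_bcontfun f t - apply_bcontfun f t'\<bar>" and ?p = "8 * CARD('d) - 1"
  let ?Q = "\<Sum>(t, t')\<in>near_pairs l. (apply_bcontfun f t - apply_bcontfun f t') ^ (8 * CARD('d))"
  have p: "8 * CARD('d) = Suc ?p" using zero_less_card_finite[where 'a = 'd] by simp
  have Q: "?a ^ Suc ?p \<le> ?Q"
  proof -
    have "(\<lambda>(t, t'). (apply_bcontfun f t - apply_bcontfun f t') ^ (8 * CARD('d))) (t, t') \<le> ?Q"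
      using assms by (intro member_le_sum) (auto intro!: zero_le_even_power)
    then show ?thesis unfolding p[symmetric] by (simp add: power_even_abs)
  qed
  show ?thesis
  proof (cases "?a \<le> (1 / 2) ^ l")
    case True
    have "0 \<le> 2 ^ (l * ?p) * ?Q"
      by (intro mult_nonneg_nonneg sum_nonneg) (auto intro!: zero_le_even_power)
    then show ?thesis unfolding chain_bound_def using True by linarith
  next
    case False
    \<comment> \<open>Now \<open>2 ^ l * ?a\<close> is at least 1, so its power of order
      \<open>8 d - 1\<close> may be inserted as a factor.\<close>
    then have "(1 / 2) ^ l \<le> ?a" by simp
    then have "((1 / 2) ^ l) ^ ?p \<le> ?a ^ ?p" by (intro power_mono) auto
    then have "2 ^ (l * ?p) * ((1 / 2) ^ l) ^ ?p \<le> 2 ^ (l * ?p) * ?a ^ ?p" by (intro mult_left_mono) auto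
    moreover have "2 ^ (l * ?p) * ((1 / 2) ^ l) ^ ?p = (1 :: real)"
      unfolding power_mult[symmetric] power_mult_distrib[symmetric] by simp
    ultimately have "1 \<le> 2 ^ (l * ?p) * ?a ^ ?p" by (simp only:)
    then have "?a \<le> ?a * (2 ^ (l * ?p) * ?a ^ ?p)" using mult_left_mono[of 1 _ ?a] by fastforce
    also have "\<dots> = 2 ^ (l * ?p) * ?a ^ Suc ?p" by (simp only: power_Suc mult.left_commute)
    also have "\<dots> \<le> 2 ^ (l * ?p) * ?Q" by (intro mult_left_mono Q) simp
    also have "\<dots> \<le> chain_bound l f" by (simp add: chain_bound_def)
    finally show ?thesis .
  qed
qed

text \<open>Telescoping along the floors of \<open>s\<close>: the step from the interpolation to the
  floor at scale \<open>m\<close> costs one term, and each refinement costs one more. The bound is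
  independent of \<open>s\<close>.\<close>

lemma chain_grid_floor:
  fixes f :: "'d::finite cube_fun"
  shows "\<bar>apply_bcontfun f (grid_floor (m + L) s) - apply_bcontfun (grid_interpolate m f) s\<bar>
    \<le> (\<Sum>l\<le>L. chain_bound (l + m) f)"
proof (induction L)
  case 0
  have "\<bar>apply_bcontfun f (grid_floor m s) - apply_bcontfun (grid_interpolate m f) s\<bar> \<le> chain_bound m f"
  proof (rule grid_interpolate_close)
    fix t :: "'d unit_cube" assume t: "t \<in> grid m" "cube_dist s t < 2 * real CARD('d) / 16 ^ m"
    have "cube_dist (grid_floor m s) t \<le> real CARD('d) / 16 ^ m + 2 * real CARD('d) / 16 ^ m"
      using cube_dist_triangle[of "grid_floor m s" t s] cube_dist_grid_floor[of m s] t(2) by linarith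
    also have "\<dots> \<le> 17 * real CARD('d) / 16 ^ m"
      by (simp add: add_divide_distrib[symmetric] divide_right_mono)
    finally have "(grid_floor m s, t) \<in> near_pairs m"
      using grid_floor_in_grid t(1) by (simp add: near_pairs_def)
    then show "\<bar>apply_bcontfun f (grid_floor m s) - apply_bcontfun f t\<bar> \<le> chain_bound m f"
      by (rule increment_le_chain_bound)
  qed
  then show ?case by simp
next
  case (Suc L)
  let ?l = "m + L"
  have "cube_dist (grid_floor (Suc ?l) s) (grid_floor ?l s) \<le>
      real CARD('d) / 16 ^ Suc ?l + real CARD('d) / 16 ^ ?l"
    using cube_dist_triangle[of "grid_floor (Suc ?l) s" "grid_floor ?l s" s]
      cube_dist_grid_floor[of "Suc ?l" s] cube_dist_grid_floor[of ?l s]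
    unfolding cube_dist_commute[of s] by linarith
  also have "\<dots> = 17 * real CARD('d) / 16 ^ Suc ?l"
    by (simp add: field_simps)
  finally have "(grid_floor (Suc ?l) s, grid_floor ?l s) \<in> near_pairs (Suc ?l)"
    using grid_floor_in_grid[of "Suc ?l" s] grid_floor_in_grid[of ?l s] grid_Suc[of ?l]
    by (auto simp: near_pairs_def)
  then have "\<bar>apply_bcontfun f (grid_floor (Suc ?l) s) - apply_bcontfun f (grid_floor ?l s)\<bar> \<le>
      chain_bound (Suc ?l) f"
    by (rule increment_le_chain_bound)
  then show ?case using Suc.IH by (simp add: add.commute)
qed

text \<open>Stated in \<open>ennreal\<close> because the series may diverge for a particular
  \<open>f\<close>. Continuity carries the bound from the floors to every point of the cube.\<close>

lemma norm_diff_interpolate_le: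
  fixes f :: "'d::finite cube_fun"
  shows "ennreal (norm (f - grid_interpolate m f)) \<le> (\<Sum>l. ennreal (chain_bound (l + m) f))"
proof (cases "\<Sum>l. ennreal (chain_bound (l + m) f)")
  case (real r)
  have pt: "\<bar>apply_bcontfun f s - apply_bcontfun (grid_interpolate m f) s\<bar> \<le> r" for s
  proof (rule LIMSEQ_le_const2)
    show "(\<lambda>L. \<bar>apply_bcontfun f (grid_floor (m + L) s) - apply_bcontfun (grid_interpolate m f) s\<bar>) \<longlonglongrightarrow>
        \<bar>apply_bcontfun f s - apply_bcontfun (grid_interpolate m f) s\<bar>"
    proof (intro tendsto_intros isCont_tendsto_compose[of _ "apply_bcontfun f"])
      show "isCont (apply_bcontfun f) s"
        using apply_bcontfun[of f] by (auto simp: bcontfun_def continuous_on_eq_continuous_at)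
      have "(\<lambda>L. grid_floor (L + m) s) \<longlonglongrightarrow> s" by (rule LIMSEQ_ignore_initial_segment[OF grid_floor_tendsto])
      then show "(\<lambda>L. grid_floor (m + L) s) \<longlonglongrightarrow> s" by (simp add: add.commute)
    qed
    have "(\<Sum>l\<le>L. chain_bound (l + m) f) \<le> r" for L
    proof -
      have "ennreal (\<Sum>l\<le>L. chain_bound (l + m) f) = (\<Sum>l\<le>L. ennreal (chain_bound (l + m) f))"
        by (rule sum_ennreal[symmetric]) (rule chain_bound_nonneg)
      also have "\<dots> \<le> ennreal r" unfolding real(2)[symmetric] by (intro sum_le_suminf) auto
      finally show ?thesis using real(1) by (simp add: ennreal_le_iff)
    qed
    then show "\<exists>N. \<forall>L\<ge>N. \<bar>apply_bcontfun f (grid_floor (m + L) s) - apply_bcontfun (grid_interpolate m f) s\<bar> \<le> r"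
      using chain_grid_floor[of f m _ s] order_trans by blast
  qed
  have "norm (f - grid_interpolate m f) \<le> r"
    by (rule norm_bound) (use pt in \<open>simp add: minus_bcontfun.rep_eq\<close>)
  then show ?thesis unfolding real(2) by (rule ennreal_leI)
qed simp

lemma chaining_bound:
  fixes Y :: "'w \<Rightarrow> 'd::finite cube_fun"
  assumes M: "prob_space M" and Ym [measurable]: "Y \<in> borel_measurable M" and C: "0 \<le> C"
    and int: "\<And>s t. integrable M (\<lambda>x. (apply_bcontfun (Y x) s - apply_bcontfun (Y x) t) ^ (8 * CARD('d)))"
    and mom: "\<And>s t. (\<integral>x. (apply_bcontfun (Y x) s - apply_bcontfun (Y x) t) ^ (8 * CARD('d)) \<partial>M) \<le>
      C * cube_dist s t ^ (4 * CARD('d))"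
  defines "C' \<equiv> 1 + C * (17 * real CARD('d)) ^ (4 * CARD('d)) * 4 ^ CARD('d)"
  shows "integrable M (\<lambda>x. norm (Y x - grid_interpolate m (Y x)))"
    and "(\<integral>x. norm (Y x - grid_interpolate m (Y x)) \<partial>M) \<le> 2 * C' * (1 / 2) ^ m"
proof -
  interpret prob_space M by fact
  have [measurable]: "(\<lambda>f :: 'd cube_fun. apply_bcontfun f s) \<in> borel_measurable borel" for s
    by (rule borel_measurable_continuous_onI[OF continuous_apply_bcontfun])
  have cont: "continuous_on UNIV (\<lambda>f :: 'd cube_fun. norm (f - grid_interpolate m f))"
    by (intro continuous_intros continuous_interpolate)
  have nm: "(\<lambda>x. norm (Y x - grid_interpolate m (Y x))) \<in> borel_measurable M"
    by (rule measurable_compose[OF Ym borel_measurable_continuous_onI[OF cont]])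
  have Icb: "integrable M (\<lambda>x. chain_bound l (Y x))" for l
    unfolding chain_bound_def
    by (intro Bochner_Integration.integrable_add integrable_mult_right Bochner_Integration.integrable_sum)
      (auto intro: int)
  have C'0: "0 \<le> C'" unfolding C'_def using C by simp
  have Ecb: "(\<integral>x. chain_bound l (Y x) \<partial>M) \<le> C' * (1 / 2) ^ l" for l
  proof -
    let ?d = "CARD('d)"
    have d: "1 \<le> ?d" using zero_less_card_finite[where 'a = 'd] by simp
    let ?Q = "\<lambda>x. \<Sum>(t, t')\<in>near_pairs l. (apply_bcontfun (Y x) t - apply_bcontfun (Y x) t') ^ (8 * ?d)"
    have IQ: "integrable M ?Q"
      by (intro Bochner_Integration.integrable_sum) (auto intro: int)
    have "(\<integral>x. ?Q x \<partial>M) = (\<Sum>(t, t')\<in>near_pairs l.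
        (\<integral>x. (apply_bcontfun (Y x) t - apply_bcontfun (Y x) t') ^ (8 * ?d) \<partial>M))"
      using int by (simp add: case_prod_unfold Bochner_Integration.integral_sum)
    also have "\<dots> \<le> (\<Sum>(t, t')\<in>(near_pairs l :: ('d unit_cube \<times> 'd unit_cube) set). C * (17 * real ?d / 16 ^ l) ^ (4 * ?d))"
    proof (intro sum_mono, clarify)
      fix t t' :: "'d unit_cube" assume "(t, t') \<in> near_pairs l"
      then have "cube_dist t t' ^ (4 * ?d) \<le> (17 * real ?d / 16 ^ l) ^ (4 * ?d)"
        by (intro power_mono cube_dist_nonneg) (simp add: near_pairs_def)
      then show "(\<integral>x. (apply_bcontfun (Y x) t - apply_bcontfun (Y x) t') ^ (8 * ?d) \<partial>M) \<le>
          C * (17 * real ?d / 16 ^ l) ^ (4 * ?d)"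
        using mom[of t t'] mult_left_mono[OF _ C] order_trans by blast
    qed
    also have "\<dots> = real (card (near_pairs l :: ('d unit_cube \<times> 'd unit_cube) set)) * (C * (17 * real ?d / 16 ^ l) ^ (4 * ?d))"
      by (simp add: case_prod_unfold)
    also have "\<dots> \<le> (4 ^ ?d * 16 ^ (2 * l * ?d)) * (C * (17 * real ?d / 16 ^ l) ^ (4 * ?d))"
      by (intro mult_right_mono card_near_pairs) (use C in auto)
    finally have EQ: "(\<integral>x. ?Q x \<partial>M) \<le> (4 ^ ?d * 16 ^ (2 * l * ?d)) * (C * (17 * real ?d / 16 ^ l) ^ (4 * ?d))" .
    have "(\<integral>x. chain_bound l (Y x) \<partial>M) = (1 / 2) ^ l + 2 ^ (l * (8 * ?d - 1)) * (\<integral>x. ?Q x \<partial>M)"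
      unfolding chain_bound_def using IQ prob_space by simp
    also have "\<dots> \<le> (1 / 2) ^ l + 2 ^ (l * (8 * ?d - 1)) *
        ((4 ^ ?d * 16 ^ (2 * l * ?d)) * (C * (17 * real ?d / 16 ^ l) ^ (4 * ?d)))"
      by (intro add_left_mono mult_left_mono EQ) simp
    also have "\<dots> = C' * (1 / 2) ^ l"
    proof -
      \<comment> \<open>In powers of 2 the exponents on the left add up to
        \<open>16 l d - l\<close>; after cancelling \<open>(16 ^ l) ^ (4 d)\<close> against the
        moment bound, the factor \<open>2 ^ - l\<close> remains.\<close>
      have e: "(2::real) ^ (l * (8 * ?d - 1)) * 16 ^ (2 * l * ?d) = (1 / 2) ^ l * (16 ^ l) ^ (4 * ?d)"
      proof -
        have "(2::real) ^ l * (2 ^ (l * (8 * ?d - 1)) * 16 ^ (2 * l * ?d)) = 2 ^ (l + l * (8 * ?d - 1)) * (2 ^ 4) ^ (2 * l * ?d)"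
          by (simp add: power_add)
        also have "l + l * (8 * ?d - 1) = 8 * l * ?d"
          using d by (cases ?d) (auto simp: algebra_simps)
        also have "(2::real) ^ (8 * l * ?d) * (2 ^ 4) ^ (2 * l * ?d) = 2 ^ (16 * l * ?d)"
          unfolding power_mult[symmetric] power_add[symmetric] by (simp add: algebra_simps)
        also have "\<dots> = ((2 ^ 4) ^ l) ^ (4 * ?d)"
          unfolding power_mult[symmetric] by (simp add: algebra_simps)
        finally have "(2::real) ^ l * (2 ^ (l * (8 * ?d - 1)) * 16 ^ (2 * l * ?d)) = (16 ^ l) ^ (4 * ?d)" by simp
        then show ?thesis by (simp add: power_divide field_simps)
      qed
      have "2 ^ (l * (8 * ?d - 1)) * ((4 ^ ?d * 16 ^ (2 * l * ?d)) * (C * (17 * real ?d / 16 ^ l) ^ (4 * ?d))) =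
          (2 ^ (l * (8 * ?d - 1)) * 16 ^ (2 * l * ?d)) * (4 ^ ?d * C * (17 * real ?d / 16 ^ l) ^ (4 * ?d))"
        by (simp only: mult_ac)
      also have "\<dots> = (1 / 2) ^ l * (4 ^ ?d * C * (17 * real ?d) ^ (4 * ?d))"
        unfolding e power_divide[of "17 * real ?d"] by simp
      finally show ?thesis by (simp add: C'_def algebra_simps)
    qed
    finally show ?thesis .
  qed
  have gs: "summable (\<lambda>l. C' * (1 / 2) ^ (l + m))"
    by (intro summable_mult summable_ignore_initial_segment summable_geometric) simp
  have geo: "(\<Sum>l. C' * (1 / 2) ^ (l + m)) = 2 * C' * (1 / 2) ^ m"
  proof -
    have "(\<Sum>l. C' * (1 / 2) ^ (l + m)) = (\<Sum>l. (C' * (1 / 2) ^ m) * (1 / 2) ^ l)"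
      by (simp add: power_add mult_ac)
    also have "\<dots> = (C' * (1 / 2) ^ m) * 2"
      by (subst suminf_mult) (auto simp: suminf_geometric summable_geometric)
    finally show ?thesis by simp
  qed
  have "(\<integral>\<^sup>+x. ennreal (norm (Y x - grid_interpolate m (Y x))) \<partial>M) \<le>
      (\<integral>\<^sup>+x. (\<Sum>l. ennreal (chain_bound (l + m) (Y x))) \<partial>M)"
    by (intro nn_integral_mono norm_diff_interpolate_le)
  also have "\<dots> = (\<Sum>l. \<integral>\<^sup>+x. ennreal (chain_bound (l + m) (Y x)) \<partial>M)"
    using Icb by (intro nn_integral_suminf) auto
  also have "\<dots> \<le> (\<Sum>l. ennreal (C' * (1 / 2) ^ (l + m)))"
  proof (intro suminf_le)
    fix l
    have "(\<integral>\<^sup>+x. ennreal (chain_bound (l + m) (Y x)) \<partial>M) = ennreal (\<integral>x. chain_bound (l + m) (Y x) \<partial>M)"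
      by (rule nn_integral_eq_integral[OF Icb]) (simp add: chain_bound_nonneg)
    also have "\<dots> \<le> ennreal (C' * (1 / 2) ^ (l + m))" by (intro ennreal_leI Ecb)
    finally show "(\<integral>\<^sup>+x. ennreal (chain_bound (l + m) (Y x)) \<partial>M) \<le> ennreal (C' * (1 / 2) ^ (l + m))" .
  qed auto
  also have "\<dots> = ennreal (2 * C' * (1 / 2) ^ m)"
    unfolding geo[symmetric] using gs C'0 by (intro suminf_ennreal2) auto
  finally have nn: "(\<integral>\<^sup>+x. ennreal (norm (Y x - grid_interpolate m (Y x))) \<partial>M) \<le> ennreal (2 * C' * (1 / 2) ^ m)" .
  show I: "integrable M (\<lambda>x. norm (Y x - grid_interpolate m (Y x)))"
    using nm le_less_trans[OF nn] by (intro integrableI_bounded) auto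
  have "ennreal (\<integral>x. norm (Y x - grid_interpolate m (Y x)) \<partial>M) \<le> ennreal (2 * C' * (1 / 2) ^ m)"
    using nn nn_integral_eq_integral[OF I] by simp
  then show "(\<integral>x. norm (Y x - grid_interpolate m (Y x)) \<partial>M) \<le> 2 * C' * (1 / 2) ^ m"
    using C'0 by (subst (asm) ennreal_le_iff) auto
qed

section \<open>The weights of the partial sum process\<close>

text \<open>For \<open>s \<ge> 0\<close> and a cell in the range, the length of
  \<open>[0, n s]\<close> inside \<open>(j - 1, j]\<close>: the one-dimensional factor of the
  volumes in the process. It is 0 for cells outside the range, as weight arrays require.\<close>

definition cell_weight :: "nat \<Rightarrow> real \<Rightarrow> int \<Rightarrow> real" where
  "cell_weight n s j = (if 1 \<le> j \<and> j \<le> int n then max 0 (min (real n * s) (of_int j) - (of_int j - 1)) else 0)"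

lemma cell_weight_nonneg: "0 \<le> cell_weight n s j"
  by (simp add: cell_weight_def)

lemma cell_weight_le_1: "cell_weight n s j \<le> 1"
  by (simp add: cell_weight_def)

lemma cell_weight_mono: "s \<le> t \<Longrightarrow> cell_weight n s j \<le> cell_weight n t j"
proof -
  assume "s \<le> t"
  then have "real n * s \<le> real n * t" by (simp add: mult_left_mono)
  then show ?thesis by (auto simp: cell_weight_def min_def max_def)
qed

lemma sum_telescope_int: "(\<Sum>j\<in>{1..int N}. g j - g (j - 1)) = g (int N) - (g 0 :: real)"
proof (induction N)
  case (Suc N)
  have "{1..int (Suc N)} = insert (int (Suc N)) {1..int N}" by auto
  then show ?case using Suc by simp
qed simp

lemma sum_cell_weight:
  assumes "0 \<le> s" "s \<le> 1"
  shows "(\<Sum>j\<in>{1..int n}. cell_weight n s j) = real n * s"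
proof -
  let ?g = "\<lambda>j. min (real n * s) (real_of_int j)"
  have ns: "0 \<le> real n * s" "real n * s \<le> real n"
    using assms mult_left_mono[of s 1 "real n"] by simp_all
  have "(\<Sum>j\<in>{1..int n}. cell_weight n s j) = (\<Sum>j\<in>{1..int n}. ?g j - ?g (j - 1))"
    using ns by (intro sum.cong) (auto simp: cell_weight_def min_def max_def)
  also have "\<dots> = ?g (int n) - ?g 0" by (rule sum_telescope_int)
  also have "\<dots> = real n * s" using ns by simp
  finally show ?thesis .
qed

text \<open>The weights are monotone in the endpoint, so all differences have one sign and total
  lengths can be subtracted.\<close>

lemma sum_cell_weight_diff:
  assumes "0 \<le> s" "s \<le> 1" "0 \<le> t" "t \<le> 1"
  shows "(\<Sum>j\<in>{1..int n}. \<bar>cell_weight n s j - cell_weight n t j\<bar>) = real n * \<bar>s - t\<bar>"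
proof -
  have *: "(\<Sum>j\<in>{1..int n}. \<bar>cell_weight n s j - cell_weight n t j\<bar>) = real n * (t - s)"
    if "s \<le> t" "0 \<le> s" "t \<le> 1" for s t
  proof -
    have "(\<Sum>j\<in>{1..int n}. \<bar>cell_weight n s j - cell_weight n t j\<bar>) =
        (\<Sum>j\<in>{1..int n}. cell_weight n t j - cell_weight n s j)"
      by (intro sum.cong refl, subst abs_minus_commute, rule abs_of_nonneg)
        (simp add: cell_weight_mono[OF that(1)])
    then show ?thesis using that by (simp add: sum_subtractf sum_cell_weight right_diff_distrib)
  qed
  show ?thesis
  proof (cases "s \<le> t")
    case True
    then show ?thesis using *[of s t] assms by simp
  next
    case False
    then show ?thesis using *[of t s] assms by (simp add: abs_minus_commute)
  qed
qed

text \<open>The upper bound replaces one of the two factors by 1. The lower bound counts cells where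
  both weights are 1; a fractional cell and the shift at either end account for
  \<open>1 + 2 * |h|\<close>.\<close>

lemma sum_cell_weight_overlap:
  assumes s: "0 \<le> s" "s \<le> 1" and t: "0 \<le> t" "t \<le> 1"
  shows "\<bar>(\<Sum>j\<in>{1..int n}. cell_weight n s j * cell_weight n t (j + h)) - real n * min s t\<bar>
    \<le> 1 + 2 * \<bar>real_of_int h\<bar>"
proof -
  let ?S = "\<Sum>j\<in>{1..int n}. cell_weight n s j * cell_weight n t (j + h)"
  have up1: "?S \<le> real n * s"
  proof -
    have "?S \<le> (\<Sum>j\<in>{1..int n}. cell_weight n s j * 1)"
      by (intro sum_mono mult_left_mono cell_weight_nonneg cell_weight_le_1)
    then show ?thesis using sum_cell_weight[OF s] by simp
  qed
  have up2: "?S \<le> real n * t"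
  proof -
    have "?S \<le> (\<Sum>j\<in>{1..int n}. 1 * cell_weight n t (j + h))"
      by (intro sum_mono mult_right_mono cell_weight_nonneg cell_weight_le_1)
    also have "\<dots> = (\<Sum>j\<in>(\<lambda>j. j + h) ` {1..int n}. cell_weight n t j)"
      by (subst sum.reindex) (auto simp: inj_on_def)
    also have "\<dots> = (\<Sum>j\<in>(\<lambda>j. j + h) ` {1..int n} \<inter> {1..int n}. cell_weight n t j)"
      by (intro sum.mono_neutral_right) (auto simp: cell_weight_def)
    also have "\<dots> \<le> (\<Sum>j\<in>{1..int n}. cell_weight n t j)"
      by (intro sum_mono2) (auto simp: cell_weight_nonneg)
    finally show ?thesis using sum_cell_weight[OF t] by simp
  qed
  have low: "real n * min s t - 1 - 2 * \<bar>real_of_int h\<bar> \<le> ?S"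
  proof -
    let ?m = "real n * min s t"
    \<comment> \<open>For \<open>j\<close> in this range both \<open>j\<close> and
      \<open>j + h\<close> lie between 1 and the smaller endpoint, whatever the sign of
      \<open>h\<close>.\<close>
    let ?J = "{1 + \<bar>h\<bar>..\<lfloor>?m\<rfloor> - \<bar>h\<bar>}"
    have m: "?m \<le> real n * s" "?m \<le> real n * t" "?m \<le> real n"
      using s t mult_left_mono[of "min s t" 1 "real n"] by (auto intro: mult_left_mono)
    have fl: "real_of_int j \<le> ?m" if "j \<le> \<lfloor>?m\<rfloor>" for j using that by (simp add: le_floor_iff)
    have one: "cell_weight n r j = 1" if "1 \<le> j" "j \<le> \<lfloor>?m\<rfloor>" "?m \<le> real n * r" for r j
    proof -
      have "real_of_int j \<le> real n * r" "j \<le> int n" using fl[OF that(2)] that(3) m(3) by linarith+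
      then show ?thesis using that by (simp add: cell_weight_def min_def)
    qed
    have "real n * min s t - 1 - 2 * \<bar>real_of_int h\<bar> \<le> real (card ?J)"
    proof -
      have "?m - 1 < of_int \<lfloor>?m\<rfloor>" by linarith
      moreover have "card ?J = nat (\<lfloor>?m\<rfloor> - 2 * \<bar>h\<bar>)" by simp
      moreover have "real_of_int z \<le> real (nat z)" for z by (cases "0 \<le> z") auto
      from this[of "\<lfloor>?m\<rfloor> - 2 * \<bar>h\<bar>"]
      have "real_of_int \<lfloor>?m\<rfloor> - 2 * \<bar>real_of_int h\<bar> \<le> real (nat (\<lfloor>?m\<rfloor> - 2 * \<bar>h\<bar>))" by simp
      ultimately show ?thesis by linarith
    qed
    also have "\<dots> = (\<Sum>j\<in>?J. cell_weight n s j * cell_weight n t (j + h))"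
    proof -
      have "(\<Sum>j\<in>?J. cell_weight n s j * cell_weight n t (j + h)) = (\<Sum>j\<in>?J. 1)"
        by (intro sum.cong refl) (use m in \<open>auto simp: one\<close>)
      then show ?thesis by simp
    qed
    also have "\<dots> \<le> ?S"
    proof (rule sum_mono2)
      show "?J \<subseteq> {1..int n}"
      proof
        fix j assume j: "j \<in> ?J"
        then have "real_of_int j \<le> ?m" by (intro fl) auto
        then have "j \<le> int n" using m(3) by linarith
        then show "j \<in> {1..int n}" using j by auto
      qed
    qed (auto simp: cell_weight_nonneg)
    finally show ?thesis .
  qed
  have "?S \<le> real n * min s t" using up1 up2 by (simp add: min_def)
  then show ?thesis using low by (simp add: abs_le_iff)
qed

lemma cell_overlap_tendsto:
  assumes "0 \<le> s" "s \<le> 1" "0 \<le> t" "t \<le> 1"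
  shows "(\<lambda>n. (\<Sum>j\<in>{1..int n}. cell_weight n s j * cell_weight n t (j + h)) / real n) \<longlonglongrightarrow> min s t"
proof (rule LIM_zero_cancel)
  let ?S = "\<lambda>n. \<Sum>j\<in>{1..int n}. cell_weight n s j * cell_weight n t (j + h)"
  have lim: "(\<lambda>n. (1 + 2 * \<bar>real_of_int h\<bar>) * (1 / real n)) \<longlonglongrightarrow> 0"
    by (intro tendsto_mult_right_zero lim_1_over_n)
  show "(\<lambda>n. ?S n / real n - min s t) \<longlonglongrightarrow> 0"
  proof (rule Lim_null_comparison[OF _ lim])
    show "eventually (\<lambda>n. norm (?S n / real n - min s t) \<le> (1 + 2 * \<bar>real_of_int h\<bar>) * (1 / real n)) sequentially"
    proof (rule eventually_sequentiallyI[of 1])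
      fix n :: nat assume n: "1 \<le> n"
      have "?S n / real n - min s t = (?S n - real n * min s t) / real n"
        using n by (simp add: field_simps)
      then have "norm (?S n / real n - min s t) = \<bar>?S n - real n * min s t\<bar> / real n" by simp
      also have "\<dots> \<le> (1 + 2 * \<bar>real_of_int h\<bar>) / real n"
        by (intro divide_right_mono sum_cell_weight_overlap assms) simp
      finally show "norm (?S n / real n - min s t) \<le> (1 + 2 * \<bar>real_of_int h\<bar>) * (1 / real n)" by simp
    qed
  qed
qed

definition pos_box :: "nat \<Rightarrow> 'd::finite site set" where
  "pos_box n = {i. \<forall>k. i $ k \<in> {1..int n}}"

lemma finite_pos_box [simp]: "finite (pos_box n)"
  unfolding pos_box_def by (rule finite_vec_box) auto

text \<open>Reduces overlaps and increments of the product weights to one-dimensional sums.\<close>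

lemma sum_pos_box_prod:
  fixes g :: "'d::finite \<Rightarrow> int \<Rightarrow> real"
  shows "(\<Sum>i\<in>pos_box n. \<Prod>k\<in>UNIV. g k (i $ k)) = (\<Prod>k\<in>UNIV. \<Sum>j\<in>{1..int n}. g k j)"
proof -
  have "(\<Sum>i\<in>pos_box n. \<Prod>k\<in>UNIV. g k (i $ k)) =
      (\<Sum>p\<in>PiE UNIV (\<lambda>_. {1..int n}). \<Prod>k\<in>UNIV. g k (vec_lambda p $ k))"
    unfolding pos_box_def by (rule sum.reindex_bij_betw[OF bij_betw_vec_lambda_PiE, symmetric])
  also have "\<dots> = (\<Prod>k\<in>UNIV. \<Sum>j\<in>{1..int n}. g k j)"
    by (subst prod_sum_PiE) auto
  finally show ?thesis .
qed

definition sheet_weight :: "nat \<Rightarrow> real ^ 'd::finite \<Rightarrow> 'd site \<Rightarrow> real" where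
  "sheet_weight n t i = (\<Prod>k\<in>UNIV. cell_weight n (t $ k) (i $ k))"

lemma sheet_weight_outside: "i \<notin> pos_box n \<Longrightarrow> sheet_weight n t i = 0"
  unfolding sheet_weight_def by (rule prod_zero) (auto simp: pos_box_def cell_weight_def)

lemma sheet_weight_bounds: "0 \<le> sheet_weight n t i" "sheet_weight n t i \<le> 1"
  unfolding sheet_weight_def
  by (auto intro!: prod_nonneg prod_le_1 cell_weight_nonneg cell_weight_le_1)

lemma sum_process_eq_wsum: "sum_process v n t x = wsum (sheet_weight n t) (pos_box n) v x"
  unfolding sum_process_def wsum_def
proof (rule sum.cong)
  show "{i. \<forall>k. 1 \<le> i $ k \<and> i $ k \<le> int n} = pos_box n" by (auto simp: pos_box_def)
  fix i :: "'a site" assume i: "i \<in> pos_box n"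
  then have *: "\<forall>k. 1 \<le> i $ k \<and> i $ k \<le> int n" by (simp add: pos_box_def)
  then have n: "n > 0" by (metis of_nat_0_less_iff le_less_trans less_le_trans zero_less_one)
  show "measure lborel ((*\<^sub>R) (real n) ` cbox 0 t \<inter> lattice_cell i) * v (lattice_shift i x) =
      sheet_weight n t i * v (lattice_shift i x)"
    using scaled_box_cell[OF n *, of t] * by (simp add: sheet_weight_def cell_weight_def)
qed

lemma sheet_overlap_tendsto:
  fixes s t :: "real ^ 'd::finite"
  assumes "s \<in> cbox 0 1" "t \<in> cbox 0 1"
  shows "(\<lambda>n. (\<Sum>i\<in>pos_box n. sheet_weight n s i * sheet_weight n t (i + h)) / real n ^ CARD('d))
    \<longlonglongrightarrow> (\<Prod>k\<in>UNIV. min (s $ k) (t $ k))"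
proof -
  have eq: "(\<Sum>i\<in>pos_box n. sheet_weight n s i * sheet_weight n t (i + h)) / real n ^ CARD('d) =
      (\<Prod>k\<in>UNIV. (\<Sum>j\<in>{1..int n}. cell_weight n (s $ k) j * cell_weight n (t $ k) (j + h $ k)) / real n)" for n
  proof -
    have "(\<Sum>i\<in>pos_box n. sheet_weight n s i * sheet_weight n t (i + h)) =
        (\<Prod>k\<in>UNIV. \<Sum>j\<in>{1..int n}. cell_weight n (s $ k) j * cell_weight n (t $ k) (j + h $ k))"
      unfolding sheet_weight_def prod.distrib[symmetric] vector_add_component
      by (rule sum_pos_box_prod)
    then show ?thesis by (simp add: prod_dividef)
  qed
  show ?thesis
    unfolding eq using assms by (intro tendsto_prod cell_overlap_tendsto) (auto simp: mem_box_cart)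
qed

text \<open>For weights in \<open>[0, 1]\<close> a squared difference is at most the absolute
  difference, and a difference of products is at most the sum of the coordinate differences. Each of
  these sums to \<open>n\<close> times a coordinate distance in one direction and gives a factor
  \<open>n\<close> in every other.\<close>

lemma sum_sheet_weight_diff_squared:
  fixes s t :: "'d::finite unit_cube"
  shows "(\<Sum>i\<in>pos_box n. (sheet_weight n (cube_point s) i - sheet_weight n (cube_point t) i)\<^sup>2)
    \<le> real n ^ CARD('d) * cube_dist s t"
proof -
  let ?s = "cube_point s" and ?t = "cube_point t"
  let ?D = "\<lambda>k j. \<bar>cell_weight n (?s $ k) j - cell_weight n (?t $ k) j\<bar>"
  have "(\<Sum>i\<in>pos_box n. (sheet_weight n ?s i - sheet_weight n ?t i)\<^sup>2) \<le>
      (\<Sum>i\<in>pos_box n. \<Sum>k\<in>UNIV. ?D k (i $ k))"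
  proof (rule sum_mono)
    fix i :: "'d site"
    let ?x = "sheet_weight n ?s i - sheet_weight n ?t i"
    have "\<bar>?x\<bar> \<le> 1"
      using sheet_weight_bounds[of n ?s i] sheet_weight_bounds[of n ?t i] by linarith
    then have "?x\<^sup>2 \<le> \<bar>?x\<bar>"
      using mult_left_le[of "\<bar>?x\<bar>" "\<bar>?x\<bar>"] by (simp add: power2_eq_square abs_mult_self_eq)
    also have "\<bar>?x\<bar> \<le> (\<Sum>k\<in>UNIV. ?D k (i $ k))"
      unfolding sheet_weight_def
      using norm_prod_diff[of UNIV "\<lambda>k. cell_weight n (?s $ k) (i $ k)" "\<lambda>k. cell_weight n (?t $ k) (i $ k)"]
      by (simp add: cell_weight_nonneg cell_weight_le_1)
    finally show "?x\<^sup>2 \<le> (\<Sum>k\<in>UNIV. ?D k (i $ k))" .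
  qed
  also have "\<dots> = (\<Sum>k\<in>UNIV. \<Sum>i\<in>pos_box n. ?D k (i $ k))" by (rule sum.swap)
  also have "\<dots> = (\<Sum>k\<in>UNIV. real n ^ CARD('d) * \<bar>?s $ k - ?t $ k\<bar>)"
  proof (rule sum.cong[OF refl])
    fix k :: 'd
    have "(\<Sum>i\<in>pos_box n. ?D k (i $ k)) = (\<Sum>i\<in>pos_box n. \<Prod>l\<in>UNIV. if l = k then ?D k (i $ l) else 1)"
      by (simp add: prod.delta)
    also have "\<dots> = (\<Prod>l\<in>UNIV. \<Sum>j\<in>{1..int n}. if l = k then ?D k j else 1)"
      using sum_pos_box_prod[of "\<lambda>l j. if l = k then ?D k j else 1" n] by simp
    also have "\<dots> = (\<Prod>l\<in>UNIV. if l = k then \<Sum>j\<in>{1..int n}. ?D k j else real n)"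
      by (intro prod.cong) auto
    also have "\<dots> = (\<Sum>j\<in>{1..int n}. ?D k j) * real n ^ (CARD('d) - 1)"
      by (subst prod.remove[of _ k]) (auto simp: card_Diff_singleton)
    also have "\<dots> = real n * \<bar>?s $ k - ?t $ k\<bar> * real n ^ (CARD('d) - 1)"
      by (simp add: sum_cell_weight_diff cube_coord)
    also have "\<dots> = real n ^ CARD('d) * \<bar>?s $ k - ?t $ k\<bar>"
      by (cases "CARD('d)") auto
    finally show "(\<Sum>i\<in>pos_box n. ?D k (i $ k)) = real n ^ CARD('d) * \<bar>?s $ k - ?t $ k\<bar>" .
  qed
  finally show ?thesis by (simp add: cube_dist_def sum_distrib_left)
qed

text \<open>For \<open>n = 0\<close> and \<open>d > 0\<close> both sides are 0 by the conventions
  for \<open>0 powr x\<close> and division by zero, so that \<open>n = 0\<close> and empty sets need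
  no separate treatment.\<close>

lemma powr_half_squared:
  assumes "n > 0 \<or> d > 0"
  shows "(real n powr (- real d / 2))\<^sup>2 = 1 / real n ^ d"
proof (cases "n = 0")
  case False
  have "(real n powr (- real d / 2))\<^sup>2 = real n powr (- real d / 2 + - real d / 2)"
    by (simp only: power2_eq_square powr_add)
  also have "- real d / 2 + - real d / 2 = - real d" by simp
  also have "real n powr (- real d) = inverse (real n powr real d)" by (rule powr_minus)
  also have "real n powr real d = real n ^ d" using False by (intro powr_realpow) simp
  finally show ?thesis by (simp only: inverse_eq_divide)
qed (use assms in auto)

text \<open>The Cramer-Wold device: a linear combination of evaluations of the process is a single
  weighted sum, and its overlaps tend to the variance of the same combination of the Brownian sheet,
  since a fixed shift \<open>h\<close> is negligible at scale \<open>n\<close>.\<close>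

lemma sheet_weight_array:
  fixes t :: "nat \<Rightarrow> 'd::finite unit_cube"
  shows "weight_array (\<lambda>n i. real n powr (- real CARD('d) / 2) * (\<Sum>r<K. \<alpha> r * sheet_weight n (cube_point (t r)) i))
    pos_box (\<Sum>r<K. \<Sum>r'<K. \<alpha> r * \<alpha> r' * (\<Prod>k\<in>UNIV. min (cube_point (t r) $ k) (cube_point (t r') $ k)))"
proof
  let ?c = "\<lambda>n. real n powr (- real CARD('d) / 2)"
  let ?w = "\<lambda>n r i. sheet_weight n (cube_point (t r)) i"
  show "?c n * (\<Sum>r<K. \<alpha> r * ?w n r i) = 0" if "i \<notin> pos_box n" for n i
    using that by (simp add: sheet_weight_outside)
  fix h :: "'d site"
  have eq: "(\<Sum>i\<in>pos_box n. (?c n * (\<Sum>r<K. \<alpha> r * ?w n r i)) * (?c n * (\<Sum>r<K. \<alpha> r * ?w n r (i + h)))) =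
      (\<Sum>r<K. \<Sum>r'<K. \<alpha> r * \<alpha> r' * ((\<Sum>i\<in>pos_box n. ?w n r i * ?w n r' (i + h)) / real n ^ CARD('d)))" for n
  proof -
    have c: "?c n * ?c n = 1 / real n ^ CARD('d)"
      using powr_half_squared[of n "CARD('d)"] by (simp add: power2_eq_square)
    have "(\<Sum>i\<in>pos_box n. (?c n * (\<Sum>r<K. \<alpha> r * ?w n r i)) * (?c n * (\<Sum>r<K. \<alpha> r * ?w n r (i + h)))) =
        (\<Sum>i\<in>pos_box n. (?c n * ?c n) * (\<Sum>r<K. \<Sum>r'<K. (\<alpha> r * ?w n r i) * (\<alpha> r' * ?w n r' (i + h))))"
    proof (intro sum.cong refl)
      fix i
      have "(?c n * (\<Sum>r<K. \<alpha> r * ?w n r i)) * (?c n * (\<Sum>r<K. \<alpha> r * ?w n r (i + h))) =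
          (?c n * ?c n) * ((\<Sum>r<K. \<alpha> r * ?w n r i) * (\<Sum>r<K. \<alpha> r * ?w n r (i + h)))"
        by (simp only: mult_ac)
      then show "(?c n * (\<Sum>r<K. \<alpha> r * ?w n r i)) * (?c n * (\<Sum>r<K. \<alpha> r * ?w n r (i + h))) =
          (?c n * ?c n) * (\<Sum>r<K. \<Sum>r'<K. (\<alpha> r * ?w n r i) * (\<alpha> r' * ?w n r' (i + h)))"
        by (simp only: sum_product)
    qed
    also have "\<dots> = (?c n * ?c n) * (\<Sum>r<K. \<Sum>r'<K. \<Sum>i\<in>pos_box n. (\<alpha> r * ?w n r i) * (\<alpha> r' * ?w n r' (i + h)))"
    proof -
      have "(\<Sum>i\<in>pos_box n. \<Sum>r<K. \<Sum>r'<K. (\<alpha> r * ?w n r i) * (\<alpha> r' * ?w n r' (i + h))) =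
          (\<Sum>r<K. \<Sum>i\<in>pos_box n. \<Sum>r'<K. (\<alpha> r * ?w n r i) * (\<alpha> r' * ?w n r' (i + h)))"
        by (rule sum.swap)
      also have "\<dots> = (\<Sum>r<K. \<Sum>r'<K. \<Sum>i\<in>pos_box n. (\<alpha> r * ?w n r i) * (\<alpha> r' * ?w n r' (i + h)))"
        by (intro sum.cong refl sum.swap)
      finally show ?thesis by (simp only: sum_distrib_left[symmetric])
    qed
    also have "\<dots> = (\<Sum>r<K. \<Sum>r'<K. \<alpha> r * \<alpha> r' * ((\<Sum>i\<in>pos_box n. ?w n r i * ?w n r' (i + h)) * (?c n * ?c n)))"
      by (simp add: sum_distrib_left sum_distrib_right mult_ac)
    finally show ?thesis unfolding c by simp
  qed
  show "(\<lambda>n. \<Sum>i\<in>pos_box n. (?c n * (\<Sum>r<K. \<alpha> r * ?w n r i)) * (?c n * (\<Sum>r<K. \<alpha> r * ?w n r (i + h)))) \<longlonglongrightarrow>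
      (\<Sum>r<K. \<Sum>r'<K. \<alpha> r * \<alpha> r' * (\<Prod>k\<in>UNIV. min (cube_point (t r) $ k) (cube_point (t r') $ k)))"
    unfolding eq by (intro tendsto_intros sheet_overlap_tendsto cube_point)
qed simp

text \<open>With these weights the overlap at \<open>h\<close> is exactly the quotient in the
  Foelner condition.\<close>

lemma folner_weight_array:
  assumes "folner \<Gamma>"
  shows "weight_array (\<lambda>n i. if i \<in> \<Gamma> n then real (card (\<Gamma> n)) powr (- 1 / 2) else 0) \<Gamma> 1"
proof
  show fin: "finite (\<Gamma> n)" for n using assms by (simp add: folner_def)
  fix h
  let ?a = "\<lambda>n i. if i \<in> \<Gamma> n then real (card (\<Gamma> n)) powr (- 1 / 2) else 0"
  have "(\<Sum>i\<in>\<Gamma> n. ?a n i * ?a n (i + h)) =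
      real (card (\<Gamma> n \<inter> (\<lambda>g. g - h) ` \<Gamma> n)) / real (card (\<Gamma> n))" for n
  proof -
    have "(\<Sum>i\<in>\<Gamma> n. ?a n i * ?a n (i + h)) =
        (\<Sum>i\<in>\<Gamma> n. if i \<in> (\<lambda>g. g - h) ` \<Gamma> n then (real (card (\<Gamma> n)) powr (- 1 / 2))\<^sup>2 else 0)"
    proof (intro sum.cong refl)
      fix i assume "i \<in> \<Gamma> n"
      moreover have "i \<in> (\<lambda>g. g - h) ` \<Gamma> n \<longleftrightarrow> i + h \<in> \<Gamma> n"
        by (auto intro: image_eqI[of _ _ "i + h"])
      ultimately show "?a n i * ?a n (i + h) =
          (if i \<in> (\<lambda>g. g - h) ` \<Gamma> n then (real (card (\<Gamma> n)) powr (- 1 / 2))\<^sup>2 else 0)"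
        by (simp add: power2_eq_square)
    qed
    also have "\<dots> = real (card (\<Gamma> n \<inter> (\<lambda>g. g - h) ` \<Gamma> n)) * (real (card (\<Gamma> n)) powr (- 1 / 2))\<^sup>2"
      using fin[of n] by (simp add: sum.If_cases)
    finally show ?thesis using powr_half_squared[of "card (\<Gamma> n)" 1] by simp
  qed
  then show "(\<lambda>n. \<Sum>i\<in>\<Gamma> n. ?a n i * ?a n (i + h)) \<longlonglongrightarrow> 1"
    using assms by (simp add: folner_def)
qed auto


section \<open>Gaussian random variables\<close>

lemma normal_moments_char:
  assumes N: "prob_space N" and D: "distributed N lborel G (\<lambda>y. ennreal (normal_density m s y))" and s: "0 < s"
  shows "integrable N G" "integrable N (\<lambda>x. (G x)\<^sup>2)" "(\<integral>x. G x \<partial>N) = m" "(\<integral>x. (G x)\<^sup>2 \<partial>N) = s\<^sup>2 + m\<^sup>2"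
    "(\<integral>x. iexp (t * G x) \<partial>N) = iexp (t * m) * complex_of_real (exp (- (s\<^sup>2 * t\<^sup>2 / 2)))"
proof -
  interpret prob_space N by fact
  define Z where "Z x = (G x - m) / s" for x
  have DZ: "distributed N lborel Z (\<lambda>y. ennreal (std_normal_density y))"
    using normal_standard_normal_convert[OF s, of G m] D unfolding Z_def by simp
  have Zm [measurable]: "Z \<in> borel_measurable N"
    using distributed_measurable[OF DZ] by simp
  have dZ: "distr N borel Z = std_normal_distribution"
  proof -
    have "distr N borel Z = distr N lborel Z" by (rule distr_cong) auto
    then show ?thesis using distributed_distr_eq_density[OF DZ] by simp
  qed
  have G: "G = (\<lambda>x. s * Z x + m)" using s by (auto simp: Z_def)
  have IZ: "integrable N (\<lambda>x. Z x ^ k)" for k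
  proof -
    have "integrable (distr N borel Z) (\<lambda>x. x ^ k)"
      unfolding dZ by (rule integrable_std_normal_distribution_moment)
    then show ?thesis by (subst (asm) integrable_distr_eq) auto
  qed
  have EZ: "(\<integral>x. Z x ^ k \<partial>N) = (\<integral>x. x ^ k \<partial>std_normal_distribution)" for k
    unfolding dZ[symmetric] by (subst integral_distr) auto
  have EZ1: "(\<integral>x. Z x \<partial>N) = 0"
    using EZ[of 1] integral_std_normal_distribution_moment_odd[of 1] by simp
  have EZ2: "(\<integral>x. (Z x)\<^sup>2 \<partial>N) = 1"
  proof -
    have "(\<integral>x. (Z x)\<^sup>2 \<partial>N) = (\<integral>x. x ^ (2 * 1) \<partial>std_normal_distribution)" using EZ[of 2] by simp
    also have "\<dots> = 1" by (subst std_normal_distribution_even_moments(1)) simp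
    finally show ?thesis .
  qed
  have I1: "integrable N Z" using IZ[of 1] by simp
  have I2: "integrable N (\<lambda>x. (Z x)\<^sup>2)" by (rule IZ)
  show "integrable N G" unfolding G using I1 by simp
  have sq: "(G x)\<^sup>2 = s\<^sup>2 * (Z x)\<^sup>2 + (2 * s * m) * Z x + m\<^sup>2" for x
    unfolding G by (simp add: power2_eq_square algebra_simps)
  show "integrable N (\<lambda>x. (G x)\<^sup>2)" unfolding sq using I1 I2 by simp
  show "(\<integral>x. G x \<partial>N) = m" unfolding G using I1 EZ1 prob_space by simp
  show "(\<integral>x. (G x)\<^sup>2 \<partial>N) = s\<^sup>2 + m\<^sup>2" unfolding sq using I1 I2 EZ1 EZ2 prob_space by simp
  have "(\<integral>x. iexp (t * G x) \<partial>N) = (\<integral>x. iexp (t * m) * iexp ((t * s) * Z x) \<partial>N)"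
    unfolding G by (intro Bochner_Integration.integral_cong) (auto simp: exp_add[symmetric] algebra_simps)
  also have "\<dots> = iexp (t * m) * (\<integral>x. iexp ((t * s) * Z x) \<partial>N)" by simp
  also have "(\<integral>x. iexp ((t * s) * Z x) \<partial>N) = char (distr N borel Z) (t * s)"
    unfolding char_def by (subst integral_distr) auto
  also have "\<dots> = complex_of_real (exp (- ((t * s)\<^sup>2) / 2))"
    unfolding dZ char_std_normal_distribution by simp
  finally show "(\<integral>x. iexp (t * G x) \<partial>N) = iexp (t * m) * complex_of_real (exp (- (s\<^sup>2 * t\<^sup>2 / 2)))"
    by (simp add: power_mult_distrib mult.commute)
qed

lemma gaussian_rv_integrable:
  assumes "prob_space N" "gaussian_rv N G"
  shows "integrable N G" "integrable N (\<lambda>x. (G x)\<^sup>2)"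
proof -
  interpret prob_space N by fact
  have [measurable]: "G \<in> borel_measurable N" using assms(2) by (simp add: gaussian_rv_def)
  have "integrable N G \<and> integrable N (\<lambda>x. (G x)\<^sup>2)"
    using assms(2) unfolding gaussian_rv_def
  proof (elim conjE disjE exE)
    fix m assume m: "AE x in N. G x = m"
    have "integrable N G"
      by (rule integrable_const_bound[of _ "\<bar>m\<bar>"]) (use m in \<open>auto elim!: eventually_mono\<close>)
    moreover have "integrable N (\<lambda>x. (G x)\<^sup>2)"
      by (rule integrable_const_bound[of _ "m\<^sup>2"]) (use m in \<open>auto elim!: eventually_mono\<close>)
    ultimately show ?thesis ..
  next
    fix m s :: real assume "0 < s" "distributed N lborel G (\<lambda>y. ennreal (normal_density m s y))"
    then show ?thesis using normal_moments_char(1,2)[OF assms(1)] by blast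
  qed
  then show "integrable N G" "integrable N (\<lambda>x. (G x)\<^sup>2)" by auto
qed

lemma gaussian_rv_char:
  assumes "prob_space N" "gaussian_rv N G" "(\<integral>x. G x \<partial>N) = 0"
  shows "(\<integral>x. iexp (t * G x) \<partial>N) = complex_of_real (exp (- ((\<integral>x. (G x)\<^sup>2 \<partial>N) * t\<^sup>2 / 2)))"
proof -
  interpret prob_space N by fact
  have [measurable]: "G \<in> borel_measurable N" using assms(2) by (simp add: gaussian_rv_def)
  show ?thesis
    using assms(2) unfolding gaussian_rv_def
  proof (elim conjE disjE exE)
    fix m assume m: "AE x in N. G x = m"
    have "(\<integral>x. G x \<partial>N) = (\<integral>x. m \<partial>N)" using m by (intro integral_cong_AE) auto
    then have m0: "m = 0" using assms(3) prob_space by simp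
    have "(\<integral>x. (G x)\<^sup>2 \<partial>N) = (\<integral>x. 0 \<partial>N)"
      using m m0 by (intro integral_cong_AE) (auto elim!: eventually_mono)
    moreover have "(\<integral>x. iexp (t * G x) \<partial>N) = (\<integral>x. 1 \<partial>N)"
      using m m0 by (intro integral_cong_AE) (auto elim!: eventually_mono)
    ultimately show ?thesis using prob_space by simp
  next
    fix m s :: real assume *: "0 < s" "distributed N lborel G (\<lambda>y. ennreal (normal_density m s y))"
    show ?thesis
      using normal_moments_char(3,4,5)[OF assms(1) *(2,1)] assms(3) by simp
  qed
qed

lemma brownian_sheet_char:
  fixes W :: "'w \<Rightarrow> 'd::finite cube_fun" and s :: "nat \<Rightarrow> 'd unit_cube"
  assumes "standard_brownian_sheet N W"
  shows "(\<integral>x. iexp (t * (\<Sum>r<K. \<alpha> r * apply_bcontfun (W x) (s r))) \<partial>N) =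
    complex_of_real (exp (- ((\<Sum>r<K. \<Sum>r'<K. \<alpha> r * \<alpha> r' *
      (\<Prod>k\<in>UNIV. min (cube_point (s r) $ k) (cube_point (s r') $ k))) * t\<^sup>2 / 2)))"
proof -
  have N: "prob_space N" and gf: "gaussian_field N (\<lambda>t \<omega>. apply_bcontfun (W \<omega>) t)"
    and mean: "\<And>t. (\<integral>x. apply_bcontfun (W x) t \<partial>N) = 0"
    and cov: "\<And>s t. (\<integral>x. apply_bcontfun (W x) s * apply_bcontfun (W x) t \<partial>N) =
        (\<Prod>k\<in>UNIV. min (cube_point s $ k) (cube_point t $ k))"
    using assms by (auto simp: standard_brownian_sheet_def)
  let ?W = "\<lambda>r x. apply_bcontfun (W x) (s r)"
  let ?G = "\<lambda>x. \<Sum>r<K. \<alpha> r * ?W r x"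
  have single: "gaussian_rv N (\<lambda>x. apply_bcontfun (W x) t)" for t
    using gf[unfolded gaussian_field_def, rule_format, of "{t}" "\<lambda>_. 1"] by simp
  have I: "integrable N (\<lambda>x. apply_bcontfun (W x) t)" "integrable N (\<lambda>x. (apply_bcontfun (W x) t)\<^sup>2)" for t
    using gaussian_rv_integrable[OF N single] by auto
  have I2: "integrable N (\<lambda>x. apply_bcontfun (W x) u * apply_bcontfun (W x) t)" for u t
  proof (rule Bochner_Integration.integrable_bound[OF Bochner_Integration.integrable_add[OF I(2)[of u] I(2)[of t]]])
    show "(\<lambda>x. apply_bcontfun (W x) u * apply_bcontfun (W x) t) \<in> borel_measurable N"
      using I(1) by (intro borel_measurable_times borel_measurable_integrable)
    show "AE x in N. norm (apply_bcontfun (W x) u * apply_bcontfun (W x) t) \<le>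
        norm ((apply_bcontfun (W x) u)\<^sup>2 + (apply_bcontfun (W x) t)\<^sup>2)"
    proof (rule AE_I2)
      fix x
      let ?a = "\<bar>apply_bcontfun (W x) u\<bar>" and ?b = "\<bar>apply_bcontfun (W x) t\<bar>"
      have "2 * (?a * ?b) \<le> ?a\<^sup>2 + ?b\<^sup>2" using sum_squares_bound[of ?a ?b] by (simp add: mult.assoc)
      moreover have "0 \<le> ?a * ?b" by simp
      ultimately have "?a * ?b \<le> ?a\<^sup>2 + ?b\<^sup>2" by linarith
      then show "norm (apply_bcontfun (W x) u * apply_bcontfun (W x) t) \<le>
          norm ((apply_bcontfun (W x) u)\<^sup>2 + (apply_bcontfun (W x) t)\<^sup>2)"
        by (simp add: abs_mult)
    qed
  qed
  \<comment> \<open>The points \<open>s r\<close> may coincide, while \<open>gaussian_field\<close>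
    takes one coefficient for each point of a set; the coefficients of equal points are therefore
    added.\<close>
  have G: "gaussian_rv N ?G"
  proof -
    let ?a = "\<lambda>t. \<Sum>r\<in>{r \<in> {..<K}. s r = t}. \<alpha> r"
    have "?G x = (\<Sum>t\<in>s ` {..<K}. ?a t * apply_bcontfun (W x) t)" for x
    proof -
      have "?G x = (\<Sum>t\<in>s ` {..<K}. \<Sum>r\<in>{r \<in> {..<K}. s r = t}. \<alpha> r * ?W r x)"
        by (intro sum.group[symmetric]) auto
      also have "\<dots> = (\<Sum>t\<in>s ` {..<K}. ?a t * apply_bcontfun (W x) t)"
        unfolding sum_distrib_right by (intro sum.cong refl) auto
      finally show ?thesis .
    qed
    then show ?thesis
      using gf[unfolded gaussian_field_def, rule_format, of "s ` {..<K}" ?a] by simp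
  qed
  have EG: "(\<integral>x. ?G x \<partial>N) = 0"
    using I(1) mean by (simp add: Bochner_Integration.integral_sum)
  have "(\<integral>x. (?G x)\<^sup>2 \<partial>N) = (\<integral>x. (\<Sum>r<K. \<Sum>r'<K. (\<alpha> r * \<alpha> r') * (?W r x * ?W r' x)) \<partial>N)"
    by (intro Bochner_Integration.integral_cong refl) (simp add: power2_eq_square sum_product mult_ac)
  also have "\<dots> = (\<Sum>r<K. \<Sum>r'<K. \<alpha> r * \<alpha> r' * (\<Prod>k\<in>UNIV. min (cube_point (s r) $ k) (cube_point (s r') $ k)))"
    using I2 cov by (simp add: Bochner_Integration.integral_sum Bochner_Integration.integrable_sum)
  finally show ?thesis using gaussian_rv_char[OF N G EG, of t] by simp
qed

section \<open>Local expansion of regular observables\<close>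

text \<open>Cauchy condensation. For \<open>k\<close> between \<open>2 ^ J\<close> and
  \<open>2 ^ Suc J - 1\<close> the index \<open>Suc k\<close> is at least \<open>2 ^ J\<close> and
  at most \<open>2 ^ Suc J\<close>, so each of the \<open>2 ^ J\<close> terms is at least
  \<open>(2 ^ J) ^ D * \<delta> (2 ^ Suc J)\<close>. The doubled argument costs the constant
  \<open>2 ^ Suc D\<close>.\<close>

lemma summable_dyadic:
  fixes \<delta> :: "nat \<Rightarrow> real"
  assumes nonneg: "\<And>k. 0 \<le> \<delta> k" and anti: "\<And>k l. k \<le> l \<Longrightarrow> \<delta> l \<le> \<delta> k"
    and sm: "summable (\<lambda>k. real (Suc k) ^ D * \<delta> (Suc k))"
  shows "summable (\<lambda>j. (2 ^ j) ^ Suc D * \<delta> (2 ^ j))"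
proof -
  let ?f = "\<lambda>k. real (Suc k) ^ D * \<delta> (Suc k)"
  have "(\<Sum>j<J. (2 ^ j) ^ Suc D * \<delta> (2 ^ Suc j)) \<le> (\<Sum>k<2 ^ J. ?f k)" for J
  proof (induction J)
    case (Suc J)
    have "(2 ^ J) ^ Suc D * \<delta> (2 ^ Suc J) = (\<Sum>k\<in>{2 ^ J..<2 ^ Suc J :: nat}. (2 ^ J) ^ D * \<delta> (2 ^ Suc J))"
      by simp
    also have "\<dots> \<le> (\<Sum>k\<in>{2 ^ J..<2 ^ Suc J :: nat}. ?f k)"
    proof (intro sum_mono mult_mono power_mono)
      fix k :: nat assume k: "k \<in> {2 ^ J..<2 ^ Suc J}"
      have "2 ^ J \<le> Suc k" using k by auto
      then show "2 ^ J \<le> real (Suc k)" by (metis of_nat_le_iff of_nat_numeral of_nat_power)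
      show "\<delta> (2 ^ Suc J) \<le> \<delta> (Suc k)" using k by (intro anti) auto
    qed (auto simp: nonneg)
    finally have "(2 ^ J) ^ Suc D * \<delta> (2 ^ Suc J) \<le> (\<Sum>k\<in>{2 ^ J..<2 ^ Suc J :: nat}. ?f k)" .
    moreover have "(\<Sum>k<2 ^ Suc J. ?f k) = (\<Sum>k<2 ^ J. ?f k) + (\<Sum>k\<in>{2 ^ J..<2 ^ Suc J :: nat}. ?f k)"
      unfolding lessThan_atLeast0 by (rule sum.atLeastLessThan_concat[symmetric]) auto
    ultimately show ?case using Suc.IH by simp
  qed (simp add: nonneg)
  moreover have "(\<Sum>k<2 ^ J. ?f k) \<le> (\<Sum>k. ?f k)" for J
    using nonneg by (intro sum_le_suminf sm) auto
  ultimately have "summable (\<lambda>j. (2 ^ j) ^ Suc D * \<delta> (2 ^ Suc j))"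
    using nonneg by (intro summableI_nonneg_bounded[of _ "\<Sum>k. ?f k"]) (auto intro: order_trans)
  then have "summable (\<lambda>j. 2 ^ Suc D * ((2 ^ j) ^ Suc D * \<delta> (2 ^ Suc j)))" by (rule summable_mult)
  then have "summable (\<lambda>j. (2 ^ Suc j) ^ Suc D * \<delta> (2 ^ Suc j))"
    by (simp add: power_mult_distrib mult_ac)
  then show ?thesis by (subst (asm) summable_Suc_iff[of "\<lambda>j. (2 ^ j) ^ Suc D * \<delta> (2 ^ j)"])
qed

lemma compact_configurations: "compact (UNIV :: ('d::finite, 'a::finite) config set)"
proof -
  have "compactin (product_topology (\<lambda>_ :: 'd site. euclidean) UNIV) (PiE UNIV (\<lambda>_. UNIV :: 'a discrete set))"
    unfolding compactin_PiE by (auto intro: finite_imp_compact)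
  then show ?thesis unfolding euclidean_product_topology by (simp add: PiE_UNIV_domain)
qed

section \<open>Local versions of an observable\<close>

context
  fixes X :: "('d::finite, 'a::finite) config set" and v :: "('d, 'a) config \<Rightarrow> real" and B :: real
  assumes X: "X \<noteq> {}" and B: "\<And>x. x \<in> X \<Longrightarrow> \<bar>v x\<bar> \<le> B"
begin

lemma oscillation_bdd:
  "bdd_above {\<bar>v x - v x'\<bar> | x x'. x \<in> X \<and> x' \<in> X \<and> (\<forall>i\<in>centered_box k. x i = x' i)}"
proof (rule bdd_aboveI, clarify)
  fix x x' assume "x \<in> X" "x' \<in> X"
  then show "\<bar>v x - v x'\<bar> \<le> 2 * B" using B[of x] B[of x'] by linarith
qed

lemma oscillation_upper:
  assumes "x \<in> X" "x' \<in> X" "\<And>i. i \<in> centered_box k \<Longrightarrow> x i = x' i"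
  shows "\<bar>v x - v x'\<bar> \<le> oscillation X v k"
  unfolding oscillation_def using assms by (intro cSup_upper oscillation_bdd) blast

lemma oscillation_nonneg: "0 \<le> oscillation X v k"
proof -
  obtain x where "x \<in> X" using X by auto
  then show ?thesis using oscillation_upper[of x x k] by simp
qed

lemma oscillation_antimono:
  assumes "k \<le> l"
  shows "oscillation X v l \<le> oscillation X v k"
  unfolding oscillation_def
proof (rule cSup_subset_mono[OF _ oscillation_bdd])
  show "{\<bar>v x - v x'\<bar> | x x'. x \<in> X \<and> x' \<in> X \<and> (\<forall>i\<in>centered_box l. x i = x' i)} \<noteq> {}"
    using X by blast
  have "centered_box k \<subseteq> (centered_box l :: 'd site set)"
    using assms by (auto simp: snorm_le_centered_box[symmetric])
  then show "{\<bar>v x - v x'\<bar> | x x'. x \<in> X \<and> x' \<in> X \<and> (\<forall>i\<in>centered_box l. x i = x' i)} \<subseteq>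
      {\<bar>v x - v x'\<bar> | x x'. x \<in> X \<and> x' \<in> X \<and> (\<forall>i\<in>centered_box k. x i = x' i)}"
    by blast
qed

text \<open>A choice of witness takes the place of a conditional expectation. The result is local
  because the choice depends on the pattern alone, and it is close to \<open>v\<close> on
  \<open>X\<close> by the definition of the oscillation; patterns absent from \<open>X\<close> get
  the default 0.\<close>

definition local_version :: "nat \<Rightarrow> ('d, 'a) config \<Rightarrow> real" where
  "local_version k x = (if \<exists>x'\<in>X. \<forall>i\<in>centered_box k. x i = x' i
     then v (SOME x'. x' \<in> X \<and> (\<forall>i\<in>centered_box k. x i = x' i)) else 0)"

lemma local_version_depends_on: "depends_on (local_version k) (centered_box k)"
  unfolding depends_on_def
proof clarify
  fix x y :: "('d, 'a) config" assume *: "\<forall>i\<in>centered_box k. x i = y i"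
  then have "(\<forall>i\<in>centered_box k. x i = x' i) \<longleftrightarrow> (\<forall>i\<in>centered_box k. y i = x' i)" for x' by auto
  then show "local_version k x = local_version k y" unfolding local_version_def by (simp only:)
qed

lemma local_version_witness:
  assumes "\<exists>x'\<in>X. \<forall>i\<in>centered_box k. x i = x' i"
  obtains x' where "x' \<in> X" "\<And>i. i \<in> centered_box k \<Longrightarrow> x i = x' i" "local_version k x = v x'"
proof -
  let ?x' = "SOME x'. x' \<in> X \<and> (\<forall>i\<in>centered_box k. x i = x' i)"
  have "?x' \<in> X \<and> (\<forall>i\<in>centered_box k. x i = ?x' i)"
    using assms unfolding Bex_def by (rule someI_ex)
  moreover have "local_version k x = v ?x'" unfolding local_version_def by (rule if_P[OF assms])
  ultimately show ?thesis using that[of ?x'] by blast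
qed

lemma local_version_bound: "\<bar>local_version k x\<bar> \<le> B"
proof (cases "\<exists>x'\<in>X. \<forall>i\<in>centered_box k. x i = x' i")
  case True
  from local_version_witness[OF this] show ?thesis using B by metis
next
  case False
  obtain x where "x \<in> X" using X by auto
  then have "0 \<le> B" using B[of x] by linarith
  then show ?thesis unfolding local_version_def if_not_P[OF False] by simp
qed

lemma local_version_close:
  assumes "x \<in> X"
  shows "\<bar>v x - local_version k x\<bar> \<le> oscillation X v k"
proof -
  obtain x' where x': "x' \<in> X" "\<And>i. i \<in> centered_box k \<Longrightarrow> x i = x' i" "local_version k x = v x'"
    using local_version_witness[of k x] assms by blast
  show ?thesis unfolding x'(3) by (rule oscillation_upper[OF assms x'(1,2)])
qed

end

text \<open>The pieces are increments of centred local versions of ranges \<open>2 ^ j\<close>. On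
  the support a local version is within \<open>\<delta> (2 ^ j)\<close> of \<open>v\<close>; as
  \<open>v\<close> has mean 0, centring moves it by no more than that again. So the error is
  \<open>2 * \<delta> (2 ^ j)\<close>, and an increment is at most
  \<open>4 * \<delta> (2 ^ i)\<close>.\<close>

lemma (in mixing_field) local_expansion_of_regular:
  assumes reg: "regular_on (topological_support \<mu>) (real CARD('d) - 1) v"
    and mean: "(\<integral>x. indicator (topological_support \<mu>) x * v x \<partial>\<mu>) = 0"
  obtains y \<beta> where "local_expansion \<mu> C c (\<lambda>x. indicator (topological_support \<mu>) x * v x) y \<beta>"
proof -
  let ?X = "topological_support \<mu>"
  let ?v = "\<lambda>x. indicator ?X x * v x"
  have Xs: "?X \<in> sets \<mu>" using closed_topological_support sets_eq by (metis borel_closed)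
  have AEX: "AE x in \<mu>. x \<in> ?X" by (rule AE_topological_support[OF sets_eq])
  have Xne: "?X \<noteq> {}"
  proof
    assume "?X = {}"
    then have "AE x in \<mu>. False" using AEX by simp
    then show False by simp
  qed
  have vc: "continuous_on ?X v" using reg by (simp add: regular_on_def)
  have "compact ?X"
    using compact_Int_closed[OF compact_configurations closed_topological_support] by simp
  then have "bounded (v ` ?X)" by (intro compact_imp_bounded compact_continuous_image vc)
  then obtain B where B: "\<And>x. x \<in> ?X \<Longrightarrow> \<bar>v x\<bar> \<le> B" by (auto simp: bounded_iff)
  have B0: "0 \<le> B" using B Xne abs_ge_zero order_trans by blast
  have vm: "?v \<in> borel_measurable \<mu>"
  proof -
    have "(\<lambda>x. indicator ?X x *\<^sub>R v x) \<in> borel_measurable borel"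
      by (intro borel_measurable_continuous_on_indicator vc borel_closed[OF closed_topological_support])
    then show ?thesis using sets_eq by (simp cong: measurable_cong_sets)
  qed
  have vB: "\<bar>?v x\<bar> \<le> B" for x using B[of x] B0 by (simp add: indicator_def)
  define \<delta> where "\<delta> k = oscillation ?X v k" for k
  define loc where "loc k = local_version ?X v k" for k
  note osc = Xne B
  have \<delta>0: "0 \<le> \<delta> k" for k unfolding \<delta>_def by (rule oscillation_nonneg[OF osc])
  have \<delta>anti: "\<delta> l \<le> \<delta> k" if "k \<le> l" for k l
    unfolding \<delta>_def by (rule oscillation_antimono[OF osc that])
  have loc_dep: "depends_on (loc k) (centered_box k)" for k
    unfolding loc_def by (rule local_version_depends_on[OF osc])
  have loc_bound: "\<bar>loc k x\<bar> \<le> B" for k x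
    unfolding loc_def by (rule local_version_bound[OF osc])
  have loc_close: "\<bar>v x - loc k x\<bar> \<le> \<delta> k" if "x \<in> ?X" for k x
    unfolding loc_def \<delta>_def by (rule local_version_close[OF osc that])
  have dyadic: "summable (\<lambda>j. (2 ^ j) ^ CARD('d) * \<delta> (2 ^ j))"
  proof -
    define D where "D = CARD('d) - 1"
    have D: "CARD('d) = Suc D" using zero_less_card_finite[where 'a = 'd] by (simp add: D_def)
    have "summable (\<lambda>k. real (Suc k) powr (real CARD('d) - 1) * \<delta> (Suc k))"
      using reg by (simp add: regular_on_def \<delta>_def)
    moreover have "real (Suc k) powr (real CARD('d) - 1) = real (Suc k) ^ D" for k
      using powr_realpow[of "real (Suc k)" D] by (simp add: D)
    ultimately have "summable (\<lambda>k. real (Suc k) ^ D * \<delta> (Suc k))" by (simp only:)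
    then show ?thesis unfolding D by (intro summable_dyadic \<delta>0 \<delta>anti)
  qed
  have locm [measurable]: "loc k \<in> borel_measurable \<mu>" for k
    by (rule measurable_depends_on[OF _ loc_dep sets_eq]) simp
  have locI: "integrable \<mu> (loc k)" for k
    using loc_bound by (intro integrable_bounded[of _ B]) auto
  have vI: "integrable \<mu> ?v" using vB vm by (intro integrable_bounded[of _ B]) auto
  define u where "u j x = loc (2 ^ j) x - (\<integral>x. loc (2 ^ j) x \<partial>\<mu>)" for j x
  have mean_close: "\<bar>\<integral>x. loc k x \<partial>\<mu>\<bar> \<le> \<delta> k" for k
  proof -
    have "(\<integral>x. loc k x \<partial>\<mu>) = (\<integral>x. loc k x - ?v x \<partial>\<mu>)" using locI vI mean by simp
    also have "\<bar>\<dots>\<bar> \<le> (\<integral>x. \<bar>loc k x - ?v x\<bar> \<partial>\<mu>)" by (rule integral_abs_bound)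
    also have "\<dots> \<le> (\<integral>x. \<delta> k \<partial>\<mu>)"
    proof (rule integral_mono_AE)
      show "AE x in \<mu>. \<bar>loc k x - ?v x\<bar> \<le> \<delta> k"
        using AEX
      proof eventually_elim
        case (elim x)
        then show ?case using loc_close[OF elim, of k] by (simp add: abs_minus_commute)
      qed
    qed (use locI vI in auto)
    finally show ?thesis using prob_space by simp
  qed
  have u_close: "\<bar>v x - u j x\<bar> \<le> 2 * \<delta> (2 ^ j)" if "x \<in> ?X" for x j
    using loc_close[OF that, of "2 ^ j"] mean_close[of "2 ^ j"] unfolding u_def by linarith
  have um [measurable]: "u j \<in> borel_measurable \<mu>" for j unfolding u_def by measurable
  have u_mean: "(\<integral>x. u j x \<partial>\<mu>) = 0" for j
    unfolding u_def using locI prob_space by simp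
  have u_I: "integrable \<mu> (u j)" for j unfolding u_def using locI by simp
  have u_dep: "depends_on (u j) (centered_box (2 ^ j))" for j
    using loc_dep[of "2 ^ j"] unfolding u_def depends_on_def by auto
  have u_bound: "\<bar>u j x\<bar> \<le> 2 * B" for j x
  proof -
    have "norm (\<integral>x. loc (2 ^ j) x \<partial>\<mu>) \<le> (\<integral>x. B \<partial>\<mu>)"
      using loc_bound by (intro norm_integral_le) auto
    then show ?thesis using loc_bound[of "2 ^ j" x] prob_space unfolding u_def by simp
  qed
  \<comment> \<open>Truncation only changes the increments on a null set, where they need not be small.\<close>
  define inc where "inc i x = max (- (4 * \<delta> (2 ^ i))) (min (4 * \<delta> (2 ^ i)) (u (Suc i) x - u i x))" for i x
  have inc_eq: "inc i x = u (Suc i) x - u i x" if "x \<in> ?X" for i x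
  proof -
    have "\<delta> (2 ^ Suc i) \<le> \<delta> (2 ^ i)" by (rule \<delta>anti) simp
    then have "\<bar>u (Suc i) x - u i x\<bar> \<le> 4 * \<delta> (2 ^ i)"
      using u_close[OF that, of i] u_close[OF that, of "Suc i"] by linarith
    then show ?thesis unfolding inc_def by linarith
  qed
  define y where "y j = (case j of 0 \<Rightarrow> u 0 | Suc i \<Rightarrow> inc i)" for j
  \<comment> \<open>The first piece is no increment and gets the crude bound \<open>2 * B\<close>; a
    single term does not affect summability.\<close>
  define \<beta> where "\<beta> j = (case j of 0 \<Rightarrow> 2 * B | Suc i \<Rightarrow> 4 * \<delta> (2 ^ i))" for j
  have "local_expansion \<mu> C c ?v y \<beta>"
  proof (intro local_expansion.intro local_expansion_axioms.intro)
    show "mixing_field \<mu> C c" by (rule mixing_field_axioms)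
    show "?v \<in> borel_measurable \<mu>" by (rule vm)
    show "local_obs (2 ^ j) (\<beta> j) (y j)" for j
    proof (cases j)
      case 0
      then show ?thesis using u_dep[of 0] u_bound u_mean by (simp add: y_def \<beta>_def local_obs_def)
    next
      case (Suc i)
      have "depends_on (inc i) (centered_box (2 ^ Suc i))"
      proof -
        have "centered_box (2 ^ i) \<subseteq> (centered_box (2 ^ Suc i) :: 'd site set)"
          by (auto simp: snorm_le_centered_box[symmetric])
        then have "depends_on (u i) (centered_box (2 ^ Suc i))" by (rule depends_on_mono[OF u_dep])
        then show ?thesis using u_dep[of "Suc i"] unfolding inc_def depends_on_def by metis
      qed
      moreover have "\<bar>inc i x\<bar> \<le> 4 * \<delta> (2 ^ i)" for x
        using \<delta>0[of "2 ^ i"] unfolding inc_def by linarith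
      moreover have "(\<integral>x. inc i x \<partial>\<mu>) = 0"
      proof -
        have "(\<integral>x. inc i x \<partial>\<mu>) = (\<integral>x. u (Suc i) x - u i x \<partial>\<mu>)"
        proof (rule integral_cong_AE)
          show "inc i \<in> borel_measurable \<mu>" unfolding inc_def by measurable
          show "AE x in \<mu>. inc i x = u (Suc i) x - u i x" using AEX by eventually_elim (rule inc_eq)
        qed auto
        then show ?thesis using u_I u_mean by simp
      qed
      ultimately show ?thesis by (simp add: Suc y_def \<beta>_def local_obs_def)
    qed
    show "AE x in \<mu>. (\<lambda>J. \<Sum>j<J. y j x) \<longlonglongrightarrow> ?v x"
      using AEX
    proof eventually_elim
      case (elim x)
      have "(\<Sum>j<Suc J. y j x) = u J x" for J
      proof (induction J)
        case (Suc J)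
        then show ?case using inc_eq[OF elim, of J] by (simp add: y_def)
      qed (simp add: y_def)
      moreover have "(\<lambda>J. u J x) \<longlonglongrightarrow> v x"
      proof (rule LIM_zero_cancel)
        have "(\<lambda>j. \<delta> (2 ^ j)) \<longlonglongrightarrow> 0"
        proof (rule Lim_null_comparison[OF _ summable_LIMSEQ_zero[OF dyadic]])
          have "\<delta> (2 ^ j) \<le> (2 ^ j) ^ CARD('d) * \<delta> (2 ^ j)" for j
            using mult_right_mono[of 1 "(2 ^ j) ^ CARD('d)" "\<delta> (2 ^ j)"] \<delta>0[of "2 ^ j"] by simp
          then show "eventually (\<lambda>j. norm (\<delta> (2 ^ j)) \<le> (2 ^ j) ^ CARD('d) * \<delta> (2 ^ j)) sequentially"
            using \<delta>0 by simp
        qed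
        then have "(\<lambda>j. 2 * \<delta> (2 ^ j)) \<longlonglongrightarrow> 0" by (rule tendsto_mult_right_zero)
        then show "(\<lambda>J. u J x - v x) \<longlonglongrightarrow> 0"
          by (rule Lim_null_comparison[rotated]) (use u_close[OF elim] in \<open>simp add: abs_minus_commute\<close>)
      qed
      ultimately have "(\<lambda>J. \<Sum>j<Suc J. y j x) \<longlonglongrightarrow> v x" by (simp only:)
      then show ?case using elim by (simp add: LIMSEQ_imp_Suc indicator_def del: sum.lessThan_Suc)
    qed
    have "summable (\<lambda>i. (4 * 2 ^ CARD('d)) * ((2 ^ i) ^ CARD('d) * \<delta> (2 ^ i)))" by (rule summable_mult[OF dyadic])
    then have "summable (\<lambda>i. (2 ^ Suc i) ^ CARD('d) * \<beta> (Suc i))"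
      by (simp add: \<beta>_def power_mult_distrib mult_ac)
    then show "summable (\<lambda>j. (2 ^ j) ^ CARD('d) * \<beta> j)"
      by (subst (asm) summable_Suc_iff[of "\<lambda>j. (2 ^ j) ^ CARD('d) * \<beta> j"])
  qed
  then show ?thesis by (rule that)
qed

text \<open>The preimage of a neighbourhood under the shift is a neighbourhood of \<open>x\<close>
  and, by invariance, has the same measure. So values of \<open>v\<close> along the orbit of a
  support point are all taken on the support.\<close>

lemma (in mixing_field) support_shift:
  assumes "x \<in> topological_support \<mu>"
  shows "lattice_shift i x \<in> topological_support \<mu>"
  unfolding topological_support_def
proof (intro CollectI allI impI)
  fix U :: "('d, 'a) config set" assume U: "open U" "lattice_shift i x \<in> U"
  have "open (lattice_shift i -` U)"
    by (rule open_vimage[OF U(1) continuous_lattice_shift])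
  then have "0 < emeasure \<mu> (lattice_shift i -` U)"
    using assms U(2) by (auto simp: topological_support_def)
  also have "emeasure \<mu> (lattice_shift i -` U) = emeasure (distr \<mu> \<mu> (lattice_shift i)) U"
    using U(1) sets_eq by (subst emeasure_distr) auto
  finally show "0 < emeasure \<mu> U" by (simp add: distr_shift)
qed


section \<open>The limit theorems\<close>

definition weight_path :: "nat \<Rightarrow> 'd::finite site \<Rightarrow> 'd cube_fun" where
  "weight_path n i = Bcontfun (\<lambda>t. sheet_weight n (cube_point t) i)"

lemma weight_path_apply: "apply_bcontfun (weight_path n i) t = sheet_weight n (cube_point t) i"
proof -
  have "(\<lambda>t. sheet_weight n (cube_point t) i) \<in> bcontfun"
  proof (rule bcontfun_normI)
    show "continuous_on UNIV (\<lambda>t. sheet_weight n (cube_point t) i)"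
    proof -
      have "continuous_on UNIV (\<lambda>t. cell_weight n (cube_point t $ k) (i $ k))" for k
        unfolding cell_weight_def
        by (cases "1 \<le> i $ k \<and> i $ k \<le> int n") (auto intro!: continuous_intros)
      then show ?thesis unfolding sheet_weight_def by (intro continuous_on_prod) auto
    qed
    show "norm (sheet_weight n (cube_point t) i) \<le> 1" for t
      using sheet_weight_bounds[of n "cube_point t" i] by simp
  qed
  then show ?thesis by (simp add: weight_path_def Bcontfun_inverse)
qed

lemma card_pos_box: "card (pos_box n :: 'd::finite site set) = n ^ CARD('d)"
  unfolding pos_box_def card_vec_box by simp

lemma sum_path_eq: "sum_path v n x = (\<Sum>i\<in>pos_box n. v (lattice_shift i x) *\<^sub>R weight_path n i)"
  by (rule bcontfun_eqI)
    (simp add: sum_path_apply sum_process_eq_wsum wsum_def apply_bcontfun_sum weight_path_apply mult.commute)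

context local_expansion
begin

text \<open>The path is a finite linear combination of the fixed functions
  \<open>weight_path n i\<close>, hence a continuous image of finitely many real random variables;
  this gives Borel measurability for the sup norm directly.\<close>

lemma sum_path_measurable: "sum_path v n \<in> borel_measurable \<mu>"
proof -
  let ?h = "\<lambda>p :: 'd site \<Rightarrow> real. \<Sum>i\<in>pos_box n. p i *\<^sub>R weight_path n i"
  have "continuous_on UNIV ?h"
    by (intro continuous_on_sum continuous_on_scaleR continuous_on_const continuous_on_product_coordinates)
  then have "?h \<in> borel_measurable borel" by (rule borel_measurable_continuous_onI)
  moreover have "(\<lambda>x i. v (lattice_shift i x)) \<in> borel_measurable \<mu>"
    by (rule measurable_coordinatewise_then_product)
      (rule measurable_compose[OF measurable_shift v_measurable])
  ultimately show ?thesis unfolding sum_path_eq by (rule measurable_compose[rotated])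
qed

definition scaled_path :: "nat \<Rightarrow> ('d, 'a) config \<Rightarrow> 'd cube_fun" where
  "scaled_path n x = real n powr (- real CARD('d) / 2) *\<^sub>R sum_path v n x"

lemma scaled_path_measurable [measurable]: "scaled_path n \<in> borel_measurable \<mu>"
proof -
  have "continuous_on UNIV (\<lambda>f :: 'd cube_fun. real n powr (- real CARD('d) / 2) *\<^sub>R f)"
    by (intro continuous_intros)
  then show ?thesis
    unfolding scaled_path_def
    by (intro measurable_compose[OF sum_path_measurable] borel_measurable_continuous_onI)
qed

lemma scaled_path_apply: "apply_bcontfun (scaled_path n x) t =
  wsum (\<lambda>i. real n powr (- real CARD('d) / 2) * sheet_weight n (cube_point t) i) (pos_box n) v x"
  by (simp add: scaled_path_def sum_path_apply sum_process_eq_wsum wsum_def sum_distrib_left mult_ac)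

lemma scale_bound: "(real n powr (- real CARD('d) / 2))\<^sup>2 * (real n ^ CARD('d) * D) \<le> D" if "0 \<le> D"
  using that powr_half_squared[of n "CARD('d)"] by simp

text \<open>The squared weights of an increment sum to at most the distance, so the moment of order
  \<open>8 d = 2 * (4 d)\<close> scales like its power \<open>4 d\<close>; the number of grid pairs
  consumes \<open>2 d\<close> of these.\<close>

lemma scaled_path_increment:
  "(\<integral>x. (apply_bcontfun (scaled_path n x) s - apply_bcontfun (scaled_path n x) t) ^ (8 * CARD('d)) \<partial>\<mu>)
    \<le> (moment_const (4 * CARD('d)) * (\<Sum>j. \<rho> j) ^ (8 * CARD('d))) * cube_dist s t ^ (4 * CARD('d))"
  "integrable \<mu> (\<lambda>x. (apply_bcontfun (scaled_path n x) s - apply_bcontfun (scaled_path n x) t) ^ (8 * CARD('d)))"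
proof -
  let ?c = "real n powr (- real CARD('d) / 2)"
  let ?a = "\<lambda>i. ?c * (sheet_weight n (cube_point s) i - sheet_weight n (cube_point t) i)"
  have eq: "apply_bcontfun (scaled_path n x) s - apply_bcontfun (scaled_path n x) t = wsum ?a (pos_box n) v x" for x
    unfolding scaled_path_apply wsum_def sum_subtractf[symmetric]
    by (intro sum.cong refl) (simp only: left_diff_distrib right_diff_distrib)
  have q: "8 * CARD('d) = 2 * (4 * CARD('d))" by simp
  have "(\<integral>x. wsum ?a (pos_box n) v x ^ (2 * (4 * CARD('d))) \<partial>\<mu>) \<le>
      moment_const (4 * CARD('d)) * (\<Sum>j. \<rho> j) ^ (2 * (4 * CARD('d))) * (\<Sum>i\<in>pos_box n. (?a i)\<^sup>2) ^ (4 * CARD('d))"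
    by (rule moment_wsum) auto
  also have "\<dots> \<le> moment_const (4 * CARD('d)) * (\<Sum>j. \<rho> j) ^ (2 * (4 * CARD('d))) * cube_dist s t ^ (4 * CARD('d))"
  proof (intro mult_left_mono power_mono)
    have "(\<Sum>i\<in>pos_box n. (?a i)\<^sup>2) =
        ?c\<^sup>2 * (\<Sum>i\<in>pos_box n. (sheet_weight n (cube_point s) i - sheet_weight n (cube_point t) i)\<^sup>2)"
      by (simp add: power_mult_distrib sum_distrib_left)
    also have "\<dots> \<le> ?c\<^sup>2 * (real n ^ CARD('d) * cube_dist s t)"
      by (intro mult_left_mono sum_sheet_weight_diff_squared) simp
    also have "\<dots> \<le> cube_dist s t" by (rule scale_bound[OF cube_dist_nonneg])
    finally show "(\<Sum>i\<in>pos_box n. (?a i)\<^sup>2) \<le> cube_dist s t" .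
    show "0 \<le> (\<Sum>i\<in>pos_box n. (?a i)\<^sup>2)" by (intro sum_nonneg) simp
    show "0 \<le> moment_const (4 * CARD('d)) * (\<Sum>j. \<rho> j) ^ (2 * (4 * CARD('d)))"
      using moment_const_pos[of "4 * CARD('d)"] by (intro mult_nonneg_nonneg zero_le_even_power) auto
  qed
  finally show "(\<integral>x. (apply_bcontfun (scaled_path n x) s - apply_bcontfun (scaled_path n x) t) ^ (8 * CARD('d)) \<partial>\<mu>)
    \<le> (moment_const (4 * CARD('d)) * (\<Sum>j. \<rho> j) ^ (8 * CARD('d))) * cube_dist s t ^ (4 * CARD('d))"
    unfolding eq q .
  show "integrable \<mu> (\<lambda>x. (apply_bcontfun (scaled_path n x) s - apply_bcontfun (scaled_path n x) t) ^ (8 * CARD('d)))"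
    unfolding eq by (rule integrable_wsum_power)
qed

lemma scaled_path_second_moment:
  "integrable \<mu> (\<lambda>x. (apply_bcontfun (scaled_path n x) s)\<^sup>2)"
  "(\<integral>x. (apply_bcontfun (scaled_path n x) s)\<^sup>2 \<partial>\<mu>) \<le> 2 * (\<Sum>j. \<rho> j)\<^sup>2"
proof -
  let ?c = "real n powr (- real CARD('d) / 2)"
  let ?a = "\<lambda>i. ?c * sheet_weight n (cube_point s) i"
  show "integrable \<mu> (\<lambda>x. (apply_bcontfun (scaled_path n x) s)\<^sup>2)"
    unfolding scaled_path_apply by (rule integrable_wsum_power)
  have "(\<integral>x. (wsum ?a (pos_box n) v x)\<^sup>2 \<partial>\<mu>) \<le> 2 * (\<Sum>j. \<rho> j)\<^sup>2 * (\<Sum>i\<in>pos_box n. (?a i)\<^sup>2)"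
    using moment_wsum[of "pos_box n" 1 ?a] by simp
  also have "\<dots> \<le> 2 * (\<Sum>j. \<rho> j)\<^sup>2 * 1"
  proof (rule mult_left_mono)
    have "(\<Sum>i\<in>pos_box n. (?a i)\<^sup>2) = ?c\<^sup>2 * (\<Sum>i\<in>pos_box n. (sheet_weight n (cube_point s) i)\<^sup>2)"
      by (simp add: power_mult_distrib sum_distrib_left)
    also have "\<dots> \<le> ?c\<^sup>2 * (\<Sum>i\<in>(pos_box n :: 'd site set). 1)"
      using sheet_weight_bounds[of n "cube_point s"]
      by (intro mult_left_mono sum_mono) (auto simp: power_le_one)
    also have "(\<Sum>i\<in>(pos_box n :: 'd site set). 1) = real n ^ CARD('d) * 1"
      by (simp add: card_pos_box)
    also have "?c\<^sup>2 * \<dots> \<le> 1" by (rule scale_bound) simp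
    finally show "(\<Sum>i\<in>pos_box n. (?a i)\<^sup>2) \<le> 1" .
  qed simp
  finally show "(\<integral>x. (apply_bcontfun (scaled_path n x) s)\<^sup>2 \<partial>\<mu>) \<le> 2 * (\<Sum>j. \<rho> j)\<^sup>2"
    unfolding scaled_path_apply by simp
qed

abbreviation "limit_variance \<equiv> (\<Sum>\<^sub>\<infinity>h\<in>UNIV. cov v h)"

text \<open>At the corner of the cube with all coordinates 1 the overlap limit is 1, so
  \<open>exp (- limit_variance / 2)\<close> is a limit of values of characteristic functions and
  hence at most 1.\<close>

lemma limit_variance_nonneg: "0 \<le> limit_variance"
proof -
  define t :: "nat \<Rightarrow> 'd unit_cube" where "t r = Cube 1" for r
  have t: "cube_point (t r) = 1" for r
    unfolding t_def by (rule Cube_inverse) (simp add: mem_box_cart)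
  have "weight_array (\<lambda>n i. real n powr (- real CARD('d) / 2) * (\<Sum>r<1. 1 * sheet_weight n (cube_point (t r)) i))
    pos_box (\<Sum>r<1. \<Sum>r'<1. 1 * 1 * (\<Prod>k\<in>UNIV. min (cube_point (t r) $ k) (cube_point (t r') $ k)))"
    by (rule sheet_weight_array)
  from char_sum_tendsto[OF this, of 1]
  have "norm (complex_of_real (exp (- (limit_variance / 2)))) \<le> 1"
    by (intro LIMSEQ_le_const2[OF tendsto_norm]) (auto simp: t norm_char_sum_le)
  then show ?thesis by simp
qed

lemma scaled_path_char:
  fixes s :: "nat \<Rightarrow> 'd unit_cube" and w :: "nat \<Rightarrow> real"
  shows
  "(\<lambda>n. \<integral>x. iexp (\<Sum>r<K. w r * apply_bcontfun (scaled_path n x) (s r)) \<partial>\<mu>) \<longlonglongrightarrow>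
    complex_of_real (exp (- (limit_variance * (\<Sum>r<K. \<Sum>r'<K. w r * w r' *
      (\<Prod>k\<in>UNIV. min (cube_point (s r) $ k) (cube_point (s r') $ k))) / 2)))"
proof -
  let ?c = "\<lambda>n. real n powr (- real CARD('d) / 2)"
  have "(\<Sum>r<K. w r * apply_bcontfun (scaled_path n x) (s r)) =
      wsum (\<lambda>i. ?c n * (\<Sum>r<K. w r * sheet_weight n (cube_point (s r)) i)) (pos_box n) v x" for n x
    unfolding scaled_path_apply wsum_def sum_distrib_left sum_distrib_right
    by (subst sum.swap) (simp only: mult_ac)
  then show ?thesis
    using char_sum_tendsto[OF sheet_weight_array[where t = s and \<alpha> = w and K = K], of 1]
    by (simp add: char_sum_def)
qed

theorem functional_clt:
  fixes W :: "'w \<Rightarrow> 'd cube_fun"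
  assumes W: "standard_brownian_sheet N W"
  shows "weak_conv_law (\<lambda>n. distr \<mu> borel (scaled_path n)) (distr N borel (\<lambda>\<omega>. sqrt limit_variance *\<^sub>R W \<omega>))"
proof -
  let ?\<sigma> = "limit_variance"
  let ?C = "moment_const (4 * CARD('d)) * (\<Sum>j. \<rho> j) ^ (8 * CARD('d))"
  let ?C' = "1 + ?C * (17 * real CARD('d)) ^ (4 * CARD('d)) * 4 ^ CARD('d)"
  have N: "prob_space N" and Wm: "W \<in> borel_measurable N" and gf: "gaussian_field N (\<lambda>t \<omega>. apply_bcontfun (W \<omega>) t)"
    and cov: "\<And>s t. (\<integral>x. apply_bcontfun (W x) s * apply_bcontfun (W x) t \<partial>N) =
        (\<Prod>k\<in>UNIV. min (cube_point s $ k) (cube_point t $ k))"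
    using W by (auto simp: standard_brownian_sheet_def)
  have C0: "0 \<le> ?C"
    using moment_const_pos[of "4 * CARD('d)"] by (intro mult_nonneg_nonneg zero_le_even_power) auto
  have Z2: "integrable N (\<lambda>x. (apply_bcontfun (sqrt ?\<sigma> *\<^sub>R W x) s)\<^sup>2)"
    "(\<integral>x. (apply_bcontfun (sqrt ?\<sigma> *\<^sub>R W x) s)\<^sup>2 \<partial>N) \<le> ?\<sigma>" for s
  proof -
    have g: "gaussian_rv N (\<lambda>x. apply_bcontfun (W x) s)"
      using gf[unfolded gaussian_field_def, rule_format, of "{s}" "\<lambda>_. 1"] by simp
    have eq: "(apply_bcontfun (sqrt ?\<sigma> *\<^sub>R W x) s)\<^sup>2 = ?\<sigma> * (apply_bcontfun (W x) s)\<^sup>2" for x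
      using limit_variance_nonneg by (simp add: power_mult_distrib)
    show "integrable N (\<lambda>x. (apply_bcontfun (sqrt ?\<sigma> *\<^sub>R W x) s)\<^sup>2)"
      unfolding eq by (intro integrable_mult_right gaussian_rv_integrable(2)[OF N g])
    have "(\<integral>x. (apply_bcontfun (W x) s)\<^sup>2 \<partial>N) \<le> 1"
      using cov[of s s] cube_coord[of s] by (auto simp: power2_eq_square intro!: prod_le_1)
    then show "(\<integral>x. (apply_bcontfun (sqrt ?\<sigma> *\<^sub>R W x) s)\<^sup>2 \<partial>N) \<le> ?\<sigma>"
      unfolding eq using limit_variance_nonneg by (simp add: mult_left_le)
  qed
  show ?thesis
  proof (rule weak_conv_law_bcontfun[where K = "\<lambda>m. card (grid m :: 'd unit_cube set)" and t = grid_enum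
        and \<rho> = partition_fun and \<eta> = "\<lambda>m. 2 * ?C' * (1 / 2) ^ m" and D = "2 * (\<Sum>j. \<rho> j)\<^sup>2 + ?\<sigma>"])
    show "prob_space \<mu>" by (rule prob_space_axioms)
    show "prob_space N" by (rule N)
    show "scaled_path n \<in> borel_measurable \<mu>" for n by (rule scaled_path_measurable)
    have "continuous_on UNIV (\<lambda>f :: 'd cube_fun. sqrt ?\<sigma> *\<^sub>R f)" by (intro continuous_intros)
    then show "(\<lambda>\<omega>. sqrt ?\<sigma> *\<^sub>R W \<omega>) \<in> borel_measurable N"
      by (intro measurable_compose[OF Wm] borel_measurable_continuous_onI)
    show "norm (partition_fun m i :: 'd cube_fun) \<le> 1" if "i < card (grid m :: 'd unit_cube set)" for m i
      using that by (rule norm_partition_fun)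
    show "(\<lambda>m. grid_interpolate m f) \<longlonglongrightarrow> f" for f :: "'d cube_fun" by (rule grid_interpolate_tendsto)
    show "(\<integral>x. norm (scaled_path n x - grid_interpolate m (scaled_path n x)) \<partial>\<mu>) \<le> 2 * ?C' * (1 / 2) ^ m" for n m
      by (rule chaining_bound(2)[OF prob_space_axioms scaled_path_measurable C0 scaled_path_increment(2,1)])
    show "integrable \<mu> (\<lambda>x. norm (scaled_path n x - grid_interpolate m (scaled_path n x)))" for n m
      by (rule chaining_bound(1)[OF prob_space_axioms scaled_path_measurable C0 scaled_path_increment(2,1)])
    show "(\<lambda>m. 2 * ?C' * (1 / 2) ^ m) \<longlonglongrightarrow> 0"
      by (intro tendsto_mult_right_zero LIMSEQ_power_zero) simp
    show "(\<lambda>n. \<integral>x. iexp (\<Sum>i<k. w i * apply_bcontfun (scaled_path n x) (s i)) \<partial>\<mu>) \<longlonglongrightarrow>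
        (\<integral>x. iexp (\<Sum>i<k. w i * apply_bcontfun (sqrt ?\<sigma> *\<^sub>R W x) (s i)) \<partial>N)" for k w and s :: "nat \<Rightarrow> 'd unit_cube"
    proof -
      have "(\<Sum>i<k. w i * apply_bcontfun (sqrt ?\<sigma> *\<^sub>R W x) (s i)) =
          sqrt ?\<sigma> * (\<Sum>i<k. w i * apply_bcontfun (W x) (s i))" for x
        by (simp add: sum_distrib_left mult_ac)
      then have "(\<integral>x. iexp (\<Sum>i<k. w i * apply_bcontfun (sqrt ?\<sigma> *\<^sub>R W x) (s i)) \<partial>N) =
          complex_of_real (exp (- (?\<sigma> * (\<Sum>r<k. \<Sum>r'<k. w r * w r' *
            (\<Prod>k\<in>UNIV. min (cube_point (s r) $ k) (cube_point (s r') $ k))) / 2)))"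
        using brownian_sheet_char[OF W, of "sqrt ?\<sigma>" w s k] limit_variance_nonneg
        by (simp add: mult.commute)
      then show ?thesis using scaled_path_char[of w s k] by (simp only:)
    qed
    show "integrable \<mu> (\<lambda>x. (apply_bcontfun (scaled_path n x) s)\<^sup>2)" for n s
      by (rule scaled_path_second_moment)
    show "(\<integral>x. (apply_bcontfun (scaled_path n x) s)\<^sup>2 \<partial>\<mu>) \<le> 2 * (\<Sum>j. \<rho> j)\<^sup>2 + ?\<sigma>" for n s
      using scaled_path_second_moment(2)[of n s] limit_variance_nonneg by linarith
    show "integrable N (\<lambda>x. (apply_bcontfun (sqrt ?\<sigma> *\<^sub>R W x) s)\<^sup>2)" for s by (rule Z2)
    show "(\<integral>x. (apply_bcontfun (sqrt ?\<sigma> *\<^sub>R W x) s)\<^sup>2 \<partial>N) \<le> 2 * (\<Sum>j. \<rho> j)\<^sup>2 + ?\<sigma>" for s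
      using Z2(2)[of s] zero_le_power2[of "\<Sum>j. \<rho> j"] by linarith
  qed
qed

end

theorem corollary2p9:
  fixes \<mu> :: "('d::finite, 'a::finite) config measure"
    and X :: "('d, 'a) config set"
    and v :: "('d, 'a) config \<Rightarrow> real"
    and \<sigma>2 :: real
    and N :: "'w measure"
    and W :: "'w \<Rightarrow> 'd cube_fun"
  assumes "prob_space \<mu>" and "sets \<mu> = sets borel"
    and "shift_invariant \<mu>"
    and "markov_random_field \<mu>"
    and "X = topological_support \<mu>"
    and "exp_strong_spatial_mixing \<mu>"
    and "regular_on X (real CARD('d) - 1) v"
    and "(LINT x|support_space \<mu>. v x) = 0"
    and "\<sigma>2 = (\<Sum>\<^sub>\<infinity>i\<in>UNIV. autocovariance \<mu> v i)"
  shows "autocovariance \<mu> v summable_on UNIV \<and> 0 \<le> \<sigma>2 \<and>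
    (0 < \<sigma>2 \<longrightarrow>
      (\<forall>\<Gamma>. folner \<Gamma> \<longrightarrow>
        weak_conv_m
          (\<lambda>n. distr (support_space \<mu>) borel
                 (\<lambda>x. real (card (\<Gamma> n)) powr (- 1 / 2) * (\<Sum>i\<in>\<Gamma> n. v (lattice_shift i x))))
          (density lborel (\<lambda>y. ennreal (normal_density 0 (sqrt \<sigma>2) y)))) \<and>
      (standard_brownian_sheet N W \<longrightarrow>
        weak_conv_law
          (\<lambda>n. distr (support_space \<mu>) borel
                 (\<lambda>x. real n powr (- real CARD('d) / 2) *\<^sub>R sum_path v n x))
          (distr N borel (\<lambda>\<omega>. sqrt \<sigma>2 *\<^sub>R W \<omega>))))"
proof -
  obtain C c where "mixing_field \<mu> C c"
    using mixing_field_of_strong_spatial_mixing[OF assms(1-4,6)] by blast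
  then interpret mixing_field \<mu> C c .
  let ?\<nu> = "support_space \<mu>"
  let ?X = "topological_support \<mu>"
  \<comment> \<open>The observable is arbitrary off the support. Its extension by 0 is Borel
    measurable, the support being closed, and agrees with \<open>v\<close> along all shifts of
    support points; integrals over \<open>support_space \<mu>\<close> thus become integrals over
    \<mu>.\<close>
  define v' where "v' x = indicator ?X x * v x" for x
  have reg: "regular_on ?X (real CARD('d) - 1) v" using assms(5,7) by simp
  have vc: "continuous_on ?X v" using reg by (simp add: regular_on_def)
  have v'm: "v' \<in> borel_measurable \<mu>"
  proof -
    have "(\<lambda>x. indicator ?X x *\<^sub>R v x) \<in> borel_measurable borel"
      by (intro borel_measurable_continuous_on_indicator vc borel_closed[OF closed_topological_support])
    then show ?thesis using sets_eq unfolding v'_def by (simp cong: measurable_cong_sets)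
  qed
  have v'_eq: "v (lattice_shift i x) = v' (lattice_shift i x)" if "x \<in> ?X" for i x
    using support_shift[OF that] by (simp add: v'_def)
  have "(\<integral>x. v' x \<partial>\<mu>) = 0"
    using integral_support_space[OF sets_eq v'm, of v] assms(8) by (simp add: v'_def[abs_def])
  then obtain y \<beta> where "local_expansion \<mu> C c v' y \<beta>"
    using local_expansion_of_regular[OF reg] unfolding v'_def[abs_def] by blast
  then interpret E: local_expansion \<mu> C c v' y \<beta> .
  interpret \<nu>: prob_space ?\<nu> by (rule prob_space_support_space[OF sets_eq prob_space_axioms])
  have cov: "autocovariance \<mu> v i = cov v' i" for i
  proof -
    have "(\<lambda>x. v' x * v' (lattice_shift i x)) \<in> borel_measurable \<mu>"
      by (intro borel_measurable_times v'm measurable_compose[OF measurable_shift])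
    then show ?thesis
      unfolding autocovariance_def cov_def using v'_eq[of _ 0] v'_eq[of _ i]
      by (intro integral_support_space[OF sets_eq]) auto
  qed
  have \<sigma>2: "\<sigma>2 = (\<Sum>\<^sub>\<infinity>h\<in>UNIV. cov v' h)" unfolding assms(9) by (rule infsum_cong) (rule cov)
  have meas_\<nu>: "f \<in> measurable ?\<nu> R" if "g \<in> measurable \<mu> R" "\<And>x. x \<in> ?X \<Longrightarrow> f x = g x" for f g and R :: "'z measure"
  proof -
    have "g \<in> measurable ?\<nu> R"
      unfolding support_space_def by (rule measurable_restrict_space1[OF that(1)])
    then show ?thesis
      using that(2) by (subst measurable_cong[of _ _ g]) (auto simp: support_space_def space_restrict_space)
  qed
  have summ: "autocovariance \<mu> v summable_on UNIV"
    using E.cov_v_summable by (simp add: cov[abs_def])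
  have nonneg: "0 \<le> \<sigma>2" unfolding \<sigma>2 by (rule E.limit_variance_nonneg)
  have clt: "weak_conv_m
      (\<lambda>n. distr ?\<nu> borel (\<lambda>x. real (card (\<Gamma> n)) powr (- 1 / 2) * (\<Sum>i\<in>\<Gamma> n. v (lattice_shift i x))))
      (density lborel (\<lambda>y. ennreal (normal_density 0 (sqrt \<sigma>2) y)))"
    if pos: "0 < \<sigma>2" and \<Gamma>: "folner \<Gamma>" for \<Gamma>
  proof (rule levy_continuity)
    let ?a = "\<lambda>n i. if i \<in> \<Gamma> n then real (card (\<Gamma> n)) powr (- 1 / 2) else 0"
    let ?f = "\<lambda>n x. real (card (\<Gamma> n)) powr (- 1 / 2) * (\<Sum>i\<in>\<Gamma> n. v (lattice_shift i x))"
    let ?Q = "density lborel (\<lambda>y. ennreal (normal_density 0 (sqrt \<sigma>2) y))"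
    \<comment> \<open>A positive variance is what gives the limit law a density.\<close>
    have s: "0 < sqrt \<sigma>2" using pos by simp
    have f_eq: "?f n x = wsum (?a n) (\<Gamma> n) v' x" if "x \<in> ?X" for n x
      using v'_eq[OF that] by (simp add: wsum_def sum_distrib_left)
    have fm: "?f n \<in> borel_measurable ?\<nu>" for n
      by (rule meas_\<nu>[OF E.wsum_measurable[OF v'm]]) (rule f_eq)
    show "real_distribution (distr ?\<nu> borel (?f n))" for n
      by (rule \<nu>.real_distribution_distr) (rule fm)
    have Q: "prob_space ?Q" by (rule prob_space_normal_density[OF s])
    show "real_distribution ?Q"
      by (intro real_distribution.intro real_distribution_axioms.intro Q) auto
    \<comment> \<open>The identity is a Gaussian variable under \<open>?Q\<close>, so the general
      formula yields the characteristic function of the limit law.\<close>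
    have D: "distributed ?Q lborel (\<lambda>x. x) (\<lambda>y. ennreal (normal_density 0 (sqrt \<sigma>2) y))"
      unfolding distributed_def by (auto simp: distr_id2)
    show "(\<lambda>n. char (distr ?\<nu> borel (?f n)) t) \<longlonglongrightarrow> char ?Q t" for t
    proof -
      have "char (distr ?\<nu> borel (?f n)) t = char_sum (?a n) (\<Gamma> n) v' t" for n
      proof -
        have "char (distr ?\<nu> borel (?f n)) t = (\<integral>x. iexp (t * ?f n x) \<partial>?\<nu>)"
          unfolding char_def by (rule integral_distr[OF fm]) simp
        also have "\<dots> = char_sum (?a n) (\<Gamma> n) v' t"
          unfolding char_sum_def
        proof (rule integral_support_space[OF sets_eq])
          have [measurable]: "wsum (?a n) (\<Gamma> n) v' \<in> borel_measurable \<mu>" by (rule E.wsum_measurable[OF v'm])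
          show "(\<lambda>x. iexp (t * wsum (?a n) (\<Gamma> n) v' x)) \<in> borel_measurable \<mu>" by measurable
        qed (simp only: f_eq)
        finally show ?thesis .
      qed
      moreover have "char ?Q t = complex_of_real (exp (- (\<sigma>2 * t\<^sup>2 / 2)))"
        using normal_moments_char(5)[OF Q D s, of t] pos by (simp add: char_def)
      ultimately show ?thesis
        using E.char_sum_tendsto[OF folner_weight_array[OF \<Gamma>], of t] by (simp add: \<sigma>2)
    qed
  qed
  have fclt: "weak_conv_law
      (\<lambda>n. distr ?\<nu> borel (\<lambda>x. real n powr (- real CARD('d) / 2) *\<^sub>R sum_path v n x))
      (distr N borel (\<lambda>\<omega>. sqrt \<sigma>2 *\<^sub>R W \<omega>))" if W: "standard_brownian_sheet N W"
  proof -
    let ?Y = "\<lambda>n x. real n powr (- real CARD('d) / 2) *\<^sub>R sum_path v n x"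
    have eq: "?Y n x = E.scaled_path n x" if "x \<in> ?X" for n x
      unfolding E.scaled_path_def sum_path_eq using v'_eq[OF that] by simp
    have Ym: "?Y n \<in> borel_measurable ?\<nu>" for n
      by (rule meas_\<nu>[OF E.scaled_path_measurable]) (rule eq)
    \<comment> \<open>The laws taken from the two base spaces have the same integrals of continuous
      functions, which is all that \<open>weak_conv_law\<close> sees.\<close>
    have "integral\<^sup>L (distr ?\<nu> borel (?Y n)) f = integral\<^sup>L (distr \<mu> borel (E.scaled_path n)) f"
      if f: "continuous_on UNIV f" for n and f :: "'d cube_fun \<Rightarrow> real"
    proof -
      have fm: "f \<in> borel_measurable borel" by (rule borel_measurable_continuous_onI[OF f])
      have "integral\<^sup>L (distr ?\<nu> borel (?Y n)) f = (\<integral>x. f (?Y n x) \<partial>?\<nu>)"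
        by (rule integral_distr[OF Ym fm])
      also have "\<dots> = (\<integral>x. f (E.scaled_path n x) \<partial>\<mu>)"
        by (rule integral_support_space[OF sets_eq measurable_compose[OF E.scaled_path_measurable fm]])
          (simp only: eq)
      also have "\<dots> = integral\<^sup>L (distr \<mu> borel (E.scaled_path n)) f"
        by (rule integral_distr[OF E.scaled_path_measurable fm, symmetric])
      finally show ?thesis .
    qed
    then show ?thesis
      using E.functional_clt[OF W] unfolding weak_conv_law_def \<sigma>2 by simp
  qed
  show ?thesis using summ nonneg clt fclt by blast
qed

end
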